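(* Let $v$ be the explicit function on $[0,\infty)^4$ defined in the context, and let $$A=\{q\in[0,\infty)^4:\ q_4\ge q_2,\ 2q_1\ge q_4-q_2\},\qquad B=\{q\in[0,\infty)^4:\ q_2\ge q_4\}.$$ For every binary control $w\in\{0,1\}^5$, with $d(w)=(w_2-w_1,w_3-w_2,w_4-w_3,w_5-w_4)$, $$v(q)-\tfrac12\bigl(d(w)\cdot\nabla_q\bigr)^2v(q)\ge0\qquad (q\in A\cup B).$$ The controls $w=01001$ and $w=00101$ are equality cases in $A$ (the left-hand side vanishes identically on $A$); the controls $w=00110$ and $w=00101$ are equality cases in $B$ (the left-hand side vanishes identically on $B$).
   Context: Controls are written as bit strings $w_1w_2w_3w_4w_5$. On regional interfaces and boundary faces, derivatives of $v$ up to order two are understood as the (existing) continuous extensions to the closed orthant. **The explicit candidate $v$ on $[0,\infty)^4$.** Values at vanishing denominators / zero arguments are understood by continuous extension. (i) For $t>0$, $$H(t)=\frac{3}{\sqrt2\sinh^5t\cosh^2t}\left(\frac t{16}-\frac{\sinh 2t}{64}-\frac{\sinh 4t}{64}+\frac{\sinh 6t}{192}\right),\qquad U(t)=\cosh t\int_t^\infty H(r)\,dr .$$ (ii) For $r>1$, $$g(r)=\frac{8-25r^2+15r^4-15r(r^2-1)^2\operatorname{arccoth}r}{16\sqrt2\,r\sqrt{r^2-1}},\qquad \operatorname{arccoth}r=\tfrac12\log\tfrac{r+1}{r-1}.$$ For $s>0,w\ge0$, $$\widetilde L(s,w)=\tfrac1{\sqrt2}\arctan(e^{-s})\cosh s+\int_1^{\coth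 s}(r\sinh s-\cosh s)e^{-2wr}g(r)\,dr .$$ For $y>0,z\ge0$, with $\alpha=z/3$, $\rho=y+\alpha$, $$\begin{aligned}P(y,z)={}&\frac{\sinh^3y}{\sinh^3\rho}U(\rho)+\frac34e^{-y-4\alpha}(e^{2\alpha}-1)^2\int_\rho^\infty\frac{e^{-2r}(e^{2\alpha}-e^{2r})^2U(r)}{\sinh^5r}\,dr\\&+\frac32\sinh y\,e^{-2\alpha}(e^{2\alpha}-1)\int_\rho^\infty\frac{e^{-2r}(e^{2\alpha}-e^{2r})\bigl(e^{2\alpha}-(e^{2r}+1)/2\bigr)U(r)}{\sinh^5r}\,dr.\end{aligned}$$ (iii) For bounded smooth $\phi$ on $(0,\infty)$, $y>0$, $p\ge0$, with $d=p/2$, $t=y+d$, $J_\phi(t)=\int_t^\infty\frac{\phi(r)}{\sinh^3r}dr$, $M_\phi(t)=\int_t^\infty\frac{\cosh r\,\phi(r)}{\sinh^4r}dr$, define $$(\mathcal K_p\phi)(y)=\frac{\sinh^2y}{\sinh^2t}\phi(t)+4\sinh y\sinh d\,J_\phi(t)+6\sinh^2d\,\bigl(\cosh t\,J_\phi(t)-\sinh t\,M_\phi(t)\bigr),$$ $$(\mathcal T\phi)(y)=2\sinh^2y\int_y^\infty\frac{\phi(r)}{\sinh^3r}\,dr .$$ (iv) For $x,z\ge0$, $y>0$, put $w=x-z/2$ (here a real parameter, not a control), $p=\min\{z,2x\}$, $\phi_w(s)=\widetilde L(s,w)$ if $w\ge0$ and $\phi_w(s)=P(s,-2w)$ if $w<0$,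 and $$F(x,y,z)=(\mathcal K_p\phi_w)(y),\qquad R(x,y,z)=(\mathcal T\mathcal K_p\phi_w)(y).$$ Also put $b_0(s)=\frac1{2\sqrt2}(1+\frac{e^{-2s}}3)$, $b_1(s)=\frac2{3\sqrt2}e^{-s}$, $\psi_x(s)=\widetilde L(s,x)-b_0(s)$, and $$H_B(x,y,z)=(\mathcal K_z\psi_x)(y),\qquad R_B(x,y,z)=(\mathcal T\mathcal K_z\psi_x)(y).$$ (v) If $q_4\ge q_2$, set $x=\sqrt2q_1$, $y=\sqrt2(q_2+q_3)$, $z=\sqrt2(q_4-q_2)$ and $$v(q)=F(x,y,z)\frac{\sinh(\sqrt2q_3)}{\sinh y}+R(x,y,z)\frac{\sinh(\sqrt2q_2)}{\sinh y}.$$ If $q_4\le q_2$, set $x=\sqrt2q_1$, $y=\sqrt2(q_3+q_4)$, $z=\sqrt2(q_2-q_4)$ and $$v(q)=\bigl(H_B(x,y,z)+b_0(y)\bigr)\frac{\sinh(\sqrt2q_3)}{\sinh y}+\bigl(R_B(x,y,z)+b_1(y)\bigr)\frac{\sinh(\sqrt2q_4)}{\sinh y}.$$ The two formulas agree on $q_2=q_4$. *)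

theory Defs
  imports "HOL-Analysis.Analysis"
begin

section \<open>The explicit candidate\<close>

text \<open>
  All improper integrals below converge absolutely. At points where a formula is not
  meaningful in the paper (for instance $r = 1$ in \<open>g_fun\<close>) the usual HOL totalisations
  apply; inside the integrals this concerns null sets only.
\<close>

definition H_fun :: "real \<Rightarrow> real" where
  "H_fun t = 3 / (sqrt 2 * sinh t ^ 5 * cosh t ^ 2) *
     (t / 16 - sinh (2 * t) / 64 - sinh (4 * t) / 64 + sinh (6 * t) / 192)"

definition U_fun :: "real \<Rightarrow> real" where
  "U_fun t = cosh t * integral {t..} H_fun"

definition arccoth :: "real \<Rightarrow> real" where
  "arccoth r = 1 / 2 * ln ((r + 1) / (r - 1))"

definition g_fun :: "real \<Rightarrow> real" where
  "g_fun r = (8 - 25 * r ^ 2 + 15 * r ^ 4 - 15 * r * (r ^ 2 - 1) ^ 2 * arccoth r) /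
     (16 * sqrt 2 * r * sqrt (r ^ 2 - 1))"

definition L_fun :: "real \<Rightarrow> real \<Rightarrow> real" where
  "L_fun s w = 1 / sqrt 2 * arctan (exp (- s)) * cosh s +
     integral {1..cosh s / sinh s}
       (\<lambda>r. (r * sinh s - cosh s) * exp (- 2 * w * r) * g_fun r)"

definition P_fun :: "real \<Rightarrow> real \<Rightarrow> real" where
  "P_fun y z = (let \<alpha> = z / 3; \<rho> = y + \<alpha> in
     sinh y ^ 3 / sinh \<rho> ^ 3 * U_fun \<rho>
     + 3 / 4 * exp (- y - 4 * \<alpha>) * (exp (2 * \<alpha>) - 1) ^ 2 *
       integral {\<rho>..} (\<lambda>r. exp (- 2 * r) * (exp (2 * \<alpha>) - exp (2 * r)) ^ 2 * U_fun r
         / sinh r ^ 5)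
     + 3 / 2 * sinh y * exp (- 2 * \<alpha>) * (exp (2 * \<alpha>) - 1) *
       integral {\<rho>..} (\<lambda>r. exp (- 2 * r) * (exp (2 * \<alpha>) - exp (2 * r)) *
         (exp (2 * \<alpha>) - (exp (2 * r) + 1) / 2) * U_fun r / sinh r ^ 5))"

definition J_int :: "(real \<Rightarrow> real) \<Rightarrow> real \<Rightarrow> real" where
  "J_int \<phi> t = integral {t..} (\<lambda>r. \<phi> r / sinh r ^ 3)"

definition M_int :: "(real \<Rightarrow> real) \<Rightarrow> real \<Rightarrow> real" where
  "M_int \<phi> t = integral {t..} (\<lambda>r. cosh r * \<phi> r / sinh r ^ 4)"

definition K_op :: "real \<Rightarrow> (real \<Rightarrow> real) \<Rightarrow> real \<Rightarrow> real" where
  "K_op p \<phi> y = (let d = p / 2; t = y + d in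
     sinh y ^ 2 / sinh t ^ 2 * \<phi> t
     + 4 * sinh y * sinh d * J_int \<phi> t
     + 6 * sinh d ^ 2 * (cosh t * J_int \<phi> t - sinh t * M_int \<phi> t))"

definition T_op :: "(real \<Rightarrow> real) \<Rightarrow> real \<Rightarrow> real" where
  "T_op \<phi> y = 2 * sinh y ^ 2 * integral {y..} (\<lambda>r. \<phi> r / sinh r ^ 3)"

definition phi_fun :: "real \<Rightarrow> real \<Rightarrow> real" where
  "phi_fun w s = (if w \<ge> 0 then L_fun s w else P_fun s (- 2 * w))"

definition F_fun :: "real \<Rightarrow> real \<Rightarrow> real \<Rightarrow> real" where
  "F_fun x y z = K_op (min z (2 * x)) (phi_fun (x - z / 2)) y"

definition R_fun :: "real \<Rightarrow> real \<Rightarrow> real \<Rightarrow> real" where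
  "R_fun x y z = T_op (K_op (min z (2 * x)) (phi_fun (x - z / 2))) y"

definition b0 :: "real \<Rightarrow> real" where
  "b0 s = 1 / (2 * sqrt 2) * (1 + exp (- 2 * s) / 3)"

definition b1 :: "real \<Rightarrow> real" where
  "b1 s = 2 / (3 * sqrt 2) * exp (- s)"

definition psi_fun :: "real \<Rightarrow> real \<Rightarrow> real" where
  "psi_fun x s = L_fun s x - b0 s"

definition HB_fun :: "real \<Rightarrow> real \<Rightarrow> real \<Rightarrow> real" where
  "HB_fun x y z = K_op z (psi_fun x) y"

definition RB_fun :: "real \<Rightarrow> real \<Rightarrow> real \<Rightarrow> real" where
  "RB_fun x y z = T_op (K_op z (psi_fun x)) y"

definition v_upper :: "real ^ 4 \<Rightarrow> real" where
  "v_upper q = (let x = sqrt 2 * q $ 1; y = sqrt 2 * (q $ 2 + q $ 3);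
       z = sqrt 2 * (q $ 4 - q $ 2) in
     F_fun x y z * (sinh (sqrt 2 * q $ 3) / sinh y)
     + R_fun x y z * (sinh (sqrt 2 * q $ 2) / sinh y))"

definition v_lower :: "real ^ 4 \<Rightarrow> real" where
  "v_lower q = (let x = sqrt 2 * q $ 1; y = sqrt 2 * (q $ 3 + q $ 4);
       z = sqrt 2 * (q $ 2 - q $ 4) in
     (HB_fun x y z + b0 y) * (sinh (sqrt 2 * q $ 3) / sinh y)
     + (RB_fun x y z + b1 y) * (sinh (sqrt 2 * q $ 4) / sinh y))"

definition v_formula :: "real ^ 4 \<Rightarrow> real" where
  "v_formula q = (if q $ 4 \<ge> q $ 2 then v_upper q else v_lower q)"

definition open_orthant :: "(real ^ 4) set" where
  "open_orthant = {q. \<forall>i. 0 < q $ i}"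

definition closed_orthant :: "(real ^ 4) set" where
  "closed_orthant = {q. \<forall>i. 0 \<le> q $ i}"

text \<open>
  In both branches the argument $y$ equals $\sqrt 2\,(q_3 + \min\{q_2,q_4\})$. On the closed
  orthant its vanishing is the only degeneracy of the formulas (all denominators are positive
  when $y > 0$), and there \<open>v\<close> is the continuous extension.
\<close>

definition v_cand :: "real ^ 4 \<Rightarrow> real" where
  "v_cand q = (if q $ 3 + min (q $ 2) (q $ 4) = 0
     then Lim (at q within open_orthant) v_formula
     else v_formula q)"


section \<open>Derivatives up to the boundary and the regional interfaces\<close>

definition grad :: "(real ^ 4 \<Rightarrow> real) \<Rightarrow> real ^ 4 \<Rightarrow> real ^ 4" where
  "grad f q = (\<chi> i. deriv (\<lambda>t. f (q + t *\<^sub>R axis i 1)) 0)"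

definition dir_deriv :: "real ^ 4 \<Rightarrow> (real ^ 4 \<Rightarrow> real) \<Rightarrow> real ^ 4 \<Rightarrow> real" where
  "dir_deriv d f q = d \<bullet> grad f q"

text \<open>
  The interfaces are $q_4 = q_2$ (change of branch) and $2q_1 = q_4 - q_2$ (change of sign of
  $x - z/2$). Off them, in the open orthant, derivatives are the ordinary ones.
\<close>

definition regular_points :: "(real ^ 4) set" where
  "regular_points = {q \<in> open_orthant. q $ 4 \<noteq> q $ 2 \<and> 2 * q $ 1 \<noteq> q $ 4 - q $ 2}"

definition cont_ext :: "(real ^ 4 \<Rightarrow> real) \<Rightarrow> real ^ 4 \<Rightarrow> real" where
  "cont_ext f q = (if q \<in> regular_points then f q else Lim (at q within regular_points) f)"

text \<open>$(d\cdot\nabla_q)^2 f$ on the closed orthant\<close>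

definition dir_deriv2 :: "real ^ 4 \<Rightarrow> (real ^ 4 \<Rightarrow> real) \<Rightarrow> real ^ 4 \<Rightarrow> real" where
  "dir_deriv2 d f = cont_ext (dir_deriv d (dir_deriv d f))"


section \<open>Controls and regions\<close>

definition controls :: "(real ^ 5) set" where
  "controls = {w. \<forall>i. w $ i \<in> {0, 1}}"

definition d_vec :: "real ^ 5 \<Rightarrow> real ^ 4" where
  "d_vec w = vector [w $ 2 - w $ 1, w $ 3 - w $ 2, w $ 4 - w $ 3, w $ 5 - w $ 4]"

definition region_A :: "(real ^ 4) set" where
  "region_A = {q \<in> closed_orthant. q $ 4 \<ge> q $ 2 \<and> 2 * q $ 1 \<ge> q $ 4 - q $ 2}"

definition region_B :: "(real ^ 4) set" where
  "region_B = {q \<in> closed_orthant. q $ 2 \<ge> q $ 4}"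

definition defect :: "real ^ 5 \<Rightarrow> real ^ 4 \<Rightarrow> real" where
  "defect w q = v_cand q - 1 / 2 * dir_deriv2 (d_vec w) v_cand q"

end

theory Submission
  imports Defs "HOL-Real_Asymp.Real_Asymp"
begin

text \<open>
  Every ingredient of \<open>v\<close> is a superposition of the modes \<open>cosh s - r sinh s\<close> for \<open>1 \<le> r \<le> coth s\<close>,
  with weight \<open>- g(r) exp(-2wr)\<close>, plus a few elementary terms; multiplication
  of a mode by \<open>r\<close> is a first order operation under which the integral operators \<open>K\<close> and \<open>T\<close> become
  algebraic. So on each of the three regions \<open>v\<close> is bilinear in \<open>cosh, sinh\<close> of two linear forms
  \<open>s0, s1\<close> with coefficients depending on two further linear forms \<open>s, w\<close>. The defect in a direction
  then satisfies \<open>f'' - f = W\<close> in \<open>s\<close> with explicit \<open>W\<close> and \<open>exp s * f s \<longlonglongrightarrow> 0\<close>, so \<open>W \<ge> 0\<close> gives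
  \<open>f \<ge> 0\<close>; this settles two reference directions per region, and every other direction differs from
  a reference direction by terms of evident sign. On the boundary the second derivatives of
  neighbouring regions agree because of three moment identities at \<open>w = 0\<close>, and at the points
  \<open>(x,0,0,0)\<close> each coefficient that blows up is multiplied by a sufficient power of \<open>sinh s\<close>, so the
  inequalities and equalities pass to the limit.
\<close>

section \<open>The density in hyperbolic coordinates\<close>

text \<open>In regions A and B, apart from an elementary part, \<open>v\<close> is the integral of
  \<open>dens r * exp (- 2 * w * r)\<close> over \<open>1 \<le> r \<le> coth s\<close> against three
  modes, taken at \<open>s\<close>, \<open>s0\<close> and \<open>s1\<close>. The mode at
  \<open>s\<close> vanishes at the endpoint, so two derivatives in \<open>s\<close> reproduce the
  integral up to one explicit endpoint term: the origin of \<open>W\<close>. Derivatives in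
  \<open>s0\<close> or \<open>s1\<close> only exchange \<open>cosh\<close> and \<open>sinh\<close>,
  so controls moving one of these alone are the equality cases. The reference directions belong to
  the controls 01110 and 00001 in both regions. The obstacles lie on the boundary. Limits of
  derivatives run over all regular points, so points with \<open>2 q1 = q4 - q2\<close> also see the
  region \<open>2 q1 < q4 - q2\<close>. No inequality is claimed there, but its second derivatives
  must be known; a fourth mode replaces the exponential weight. The density is of order
  \<open>(r - 1) powr (- 1/2)\<close> at 1 and \<open>1 / r^4\<close> at infinity, so the second
  moment converges and the third grows logarithmically. This fixes which coefficients blow up at
  \<open>(x,0,0,0)\<close>, and how fast.\<close>

definition kk :: real where "kk = 1 / (2 * sqrt 2)"

lemma kk_pos: "kk > 0" by (simp add: kk_def)

definition dens :: "real \<Rightarrow> real" where "dens r = - g_fun r"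

text \<open>Normalised by \<open>dens (coth s) = sinh s ^ 3 * Gam s\<close>. The cube is what the
  moving endpoint produces: the derivative of \<open>coth\<close> and that of the mode at its zero
  contribute \<open>1 / sinh s ^ 3\<close> together, so \<open>Gam\<close> alone is left as endpoint
  term.\<close>

definition Gam :: "real \<Rightarrow> real" where
  "Gam s = kk * (15 * s * cosh s / sinh s - 15 - 5 * sinh s ^ 2 + 2 * sinh s ^ 4) / (8 * cosh s * sinh s ^ 5)"

lemma cosh_sq: "cosh (s::real) ^ 2 = sinh s ^ 2 + 1"
  using hyperbolic_pythagoras[of s] by simp

lemma coth_gt_1: "s > 0 \<Longrightarrow> cosh s / sinh s > (1::real)"
proof -
  assume s: "s > 0"
  have "sinh s < cosh s" by (simp add: sinh_def cosh_def)
  thus ?thesis using s by (simp add: field_simps)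
qed

lemma coth_surj:
  assumes "r > (1::real)" obtains s where "s > 0" "r = cosh s / sinh s"
proof
  let ?s = "1/2 * ln ((r+1)/(r-1))"
  have a: "(r+1)/(r-1) > 1" using assms by (simp add: field_simps)
  show s: "?s > 0" using a by simp
  have e: "exp ?s ^ 2 = (r+1)/(r-1)" using a by (simp add: exp_double[symmetric])
  have "cosh ?s = (exp ?s ^ 2 + 1) / (2 * exp ?s)" "sinh ?s = (exp ?s ^ 2 - 1) / (2 * exp ?s)"
    unfolding cosh_def sinh_def exp_minus by (simp_all add: field_simps power2_eq_square)
  hence "cosh ?s / sinh ?s = (exp ?s ^ 2 + 1) / (exp ?s ^ 2 - 1)" by simp
  also have "\<dots> = r" unfolding e using assms by (simp add: field_simps)
  finally show "r = cosh ?s / sinh ?s" by simp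
qed

lemma arccoth_coth: assumes "s > 0" shows "arccoth (cosh s / sinh s) = s"
proof -
  have "cosh s / sinh s + 1 = (cosh s + sinh s) / sinh s" "cosh s / sinh s - 1 = (cosh s - sinh s) / sinh s"
    using assms by (simp_all add: field_simps)
  hence "(cosh s / sinh s + 1) / (cosh s / sinh s - 1) = (cosh s + sinh s) / (cosh s - sinh s)"
    using assms by simp
  also have "\<dots> = exp s / exp (-s)" by (simp add: cosh_plus_sinh cosh_minus_sinh)
  also have "\<dots> = exp (2 * s)" by (simp add: exp_minus field_simps exp_add[symmetric])
  finally show ?thesis by (simp add: arccoth_def)
qed

lemma coth_sq_minus_1: assumes "s > (0::real)" shows "(cosh s / sinh s)^2 - 1 = 1 / sinh s ^ 2"
  using assms cosh_sq[of s] by (simp add: power_divide field_simps)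

lemma dens_coth: assumes s: "s > 0" shows "dens (cosh s / sinh s) = sinh s ^ 3 * Gam s"
proof -
  let ?S = "sinh s" and ?C = "cosh s"
  have S: "?S > 0" "?C > 0" using s by (auto simp: cosh_real_pos)
  have q: "sqrt ((?C/?S)^2 - 1) = 1 / ?S"
    unfolding coth_sq_minus_1[OF s] using S by (simp add: real_sqrt_divide)
  have r4: "(?C/?S)^4 = ((?C/?S)^2)^2" by (simp only: power_mult[symmetric]) simp
  have "dens (?C/?S) = - (8 - 25 * (?C/?S)^2 + 15 * ((?C/?S)^2)^2 - 15 * (?C/?S) * ((?C/?S)^2 - 1)^2 * s) / (16 * sqrt 2 * (?C/?S) * (1/?S))"
    unfolding dens_def g_fun_def arccoth_coth[OF s] q r4 by (simp only: minus_divide_left)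
  also have "\<dots> = - (8 - 25 * ((?S^2+1)/?S^2) + 15 * ((?S^2+1)/?S^2)^2 - 15 * (?C/?S) * (1/?S^2)^2 * s) / (16 * sqrt 2 * (?C/?S) * (1/?S))"
    unfolding coth_sq_minus_1[OF s] unfolding power_divide cosh_sq ..
  also have "\<dots> = sinh s ^ 3 * Gam s"
    unfolding Gam_def kk_def using S by (simp add: field_simps) algebra
  finally show ?thesis .
qed

text \<open>Equivalent to \<open>(sinh^6 * Gam)' = kk * sinh^6 / cosh^2\<close>. Through this first
  order equation all higher derivatives of \<open>Gam\<close> are expressed by \<open>Gam\<close>
  and elementary functions.\<close>

lemma Gam_deriv: assumes s: "s > 0"
  shows "(Gam has_real_derivative (- 6 * cosh s / sinh s * Gam s + kk / cosh s ^ 2)) (at s)"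
proof -
  let ?S = "sinh s" and ?C = "cosh s"
  have S: "?S \<noteq> 0" "?C \<noteq> 0" using s by (auto simp: cosh_real_pos)
  have C2: "?C^2 = ?S^2 + 1" by (rule cosh_sq)
  have *: "(Gam has_real_derivative (kk * ((15 * ?C/?S + 15 * s * (?S*?S - ?C*?C)/(?S*?S) - 10*?S*?C + 8*?S^3*?C) * (8*?C*?S^5) - (15 * s * ?C / ?S - 15 - 5 * ?S^2 + 2*?S^4)*(8*?S^6+40*?C^2*?S^4)) / (8*?C*?S^5)^2)) (at s)"
    unfolding Gam_def using S
    by (auto intro!: derivative_eq_intros simp: field_simps power2_eq_square eval_nat_numeral)
  have "(kk * ((15 * ?C/?S + 15 * s * (?S*?S - ?C*?C)/(?S*?S) - 10*?S*?C + 8*?S^3*?C) * (8*?C*?S^5) - (15 * s * ?C / ?S - 15 - 5 * ?S^2 + 2*?S^4)*(8*?S^6+40*?C^2*?S^4)) / (8*?C*?S^5)^2) = - 6 * ?C / ?S * Gam s + kk / ?C ^ 2"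
    unfolding Gam_def using S apply (simp add: field_simps) using C2 by algebra
  with * show ?thesis by simp
qed

text \<open>\<open>F = sinh^6 * Gam\<close> vanishes at 0 and has a nonnegative derivative, and
  \<open>B\<close> vanishes at 0 and grows faster. The factor \<open>4 * sinh s ^ 2 + 5\<close> is
  chosen for later use: with \<open>P = 1 / sinh^2\<close> and \<open>q = tanh\<close> the upper
  bound reads \<open>Gam * (4 + 5 * P) \<le> kk * P * q\<close>, which is what the weight
  \<open>Ap\<close> requires.\<close>

lemma Gam_bounds: assumes s: "s > 0"
  shows "Gam s \<ge> 0" and "Gam s \<le> kk * sinh s / (cosh s * (4 * sinh s ^ 2 + 5))"
proof -
  define F where "F = (\<lambda>u. kk / 8 * (15*u - 15 * tanh u - 5 * sinh u ^ 2 * tanh u + 2 * sinh u ^ 4 * tanh u))"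
  define B where "B = (\<lambda>u. kk * sinh u ^ 7 / (cosh u * (4 * sinh u ^ 2 + 5)))"
  have S: "sinh s > 0" "cosh s > 0" using s by (auto simp: cosh_real_pos)
  have FG: "Gam s = F s / sinh s ^ 6"
    unfolding Gam_def F_def tanh_def using S by (simp add: field_simps eval_nat_numeral)
  have dF: "(F has_real_derivative kk * sinh u ^ 6 / cosh u ^ 2) (at u)" for u
  proof -
    have C: "cosh u \<noteq> 0" by (simp add: cosh_real_pos less_imp_neq[symmetric])
    have C2: "cosh u ^ 2 = sinh u ^ 2 + 1" by (rule cosh_sq)
    have "(F has_real_derivative (kk/8 * (15 - 15 * (1 - tanh u ^ 2) - (10 * sinh u * cosh u * tanh u + 5 * sinh u ^ 2 * (1 - tanh u ^ 2)) + (8 * sinh u ^ 3 * cosh u * tanh u + 2 * sinh u ^ 4 * (1 - tanh u ^ 2))))) (at u)"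
      unfolding F_def using C by (auto intro!: derivative_eq_intros)
    also have "(kk/8 * (15 - 15 * (1 - tanh u ^ 2) - (10 * sinh u * cosh u * tanh u + 5 * sinh u ^ 2 * (1 - tanh u ^ 2)) + (8 * sinh u ^ 3 * cosh u * tanh u + 2 * sinh u ^ 4 * (1 - tanh u ^ 2)))) = kk * sinh u ^ 6 / cosh u ^ 2"
      unfolding tanh_def using C apply (simp add: field_simps) using C2 by algebra
    finally show ?thesis .
  qed
  have dB: "(B has_real_derivative kk * sinh u ^ 6 * (63 + 35 + 50 * sinh u ^ 2 - 63 + 16 * sinh u ^ 4) / (cosh u ^ 2 * (4 * sinh u ^ 2 + 5)^2)) (at u)" for u
  proof -
    have C: "cosh u \<noteq> 0" by (simp add: cosh_real_pos less_imp_neq[symmetric])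
    have C2: "cosh u ^ 2 = sinh u ^ 2 + 1" by (rule cosh_sq)
    have P: "4 * sinh u ^ 2 + 5 \<noteq> 0"
      using zero_le_power2[of "sinh u"] by linarith
    have "(B has_real_derivative ((kk * (7 * sinh u ^ 6 * cosh u) * (cosh u * (4 * sinh u ^ 2 + 5)) - kk * sinh u ^ 7 * (sinh u * (4 * sinh u ^ 2 + 5) + cosh u * (8 * sinh u * cosh u))) / (cosh u * (4 * sinh u ^ 2 + 5))^2)) (at u)"
      unfolding B_def using C P by (auto intro!: derivative_eq_intros simp: power2_eq_square)
    also have "((kk * (7 * sinh u ^ 6 * cosh u) * (cosh u * (4 * sinh u ^ 2 + 5)) - kk * sinh u ^ 7 * (sinh u * (4 * sinh u ^ 2 + 5) + cosh u * (8 * sinh u * cosh u))) / (cosh u * (4 * sinh u ^ 2 + 5))^2) = kk * sinh u ^ 6 * (63 + 35 + 50 * sinh u ^ 2 - 63 + 16 * sinh u ^ 4) / (cosh u ^ 2 * (4 * sinh u ^ 2 + 5)^2)"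
      unfolding power_mult_distrib
      apply (rule arg_cong2[where f="(/)"]) using C2 apply algebra by simp
    finally show ?thesis .
  qed
  have "F 0 \<le> F s"
  proof (rule DERIV_nonneg_imp_nondecreasing[where f=F and a=0 and b=s])
    fix u assume "0 \<le> u" "u \<le> s"
    show "\<exists>d. (F has_real_derivative d) (at u) \<and> 0 \<le> d"
      using dF[of u] kk_pos by (intro exI[of _ "kk * sinh u ^ 6 / cosh u ^ 2"]) auto
  qed (use s in auto)
  hence F: "F s \<ge> 0" by (simp add: F_def)
  show "Gam s \<ge> 0" unfolding FG using F S by simp
  have "(\<lambda>u. B u - F u) 0 \<le> (\<lambda>u. B u - F u) s"
  proof (rule DERIV_nonneg_imp_nondecreasing[where f="\<lambda>u. B u - F u" and a=0 and b=s])
    fix u assume u: "0 \<le> u" "u \<le> s"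
    have C: "cosh u > 0" by (simp add: cosh_real_pos)
    have P: "4 * sinh u ^ 2 + 5 > 0"
      using zero_le_power2[of "sinh u"] by linarith
    \<comment> \<open>With \<open>S = sinh u\<close> the numerators differ by
      \<open>16 S^4 + 50 S^2 + 35 - (4 S^2 + 5)^2 = 10 + 10 S^2\<close>.\<close>
    have "kk * sinh u ^ 6 * (63 + 35 + 50 * sinh u ^ 2 - 63 + 16 * sinh u ^ 4) / (cosh u ^ 2 * (4 * sinh u ^ 2 + 5)^2) - kk * sinh u ^ 6 / cosh u ^ 2 = kk * sinh u ^ 6 * (10 + 10 * sinh u ^ 2) / (cosh u ^ 2 * (4 * sinh u ^ 2 + 5)^2)"
      using C P by (simp add: field_simps) algebra
    also have "\<dots> \<ge> 0" using kk_pos by (intro divide_nonneg_nonneg mult_nonneg_nonneg) auto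
    finally show "\<exists>y. ((\<lambda>u. B u - F u) has_real_derivative y) (at u) \<and> 0 \<le> y"
      using DERIV_diff[OF dB dF] by blast
  qed (use s in auto)
  hence "F s \<le> B s" by (simp add: F_def B_def)
  have s7: "sinh s ^ 7 = sinh s * sinh s ^ 6" by (simp add: eval_nat_numeral)
  from \<open>F s \<le> B s\<close> have "Gam s \<le> B s / sinh s ^ 6" unfolding FG using S by (simp add: divide_right_mono)
  also have "\<dots> = kk * sinh s / (cosh s * (4 * sinh s ^ 2 + 5))"
    unfolding B_def s7 using S by simp
  finally show "Gam s \<le> kk * sinh s / (cosh s * (4 * sinh s ^ 2 + 5))" .
qed

section \<open>Comparison principles on a half-line\<close>

lemma ode_nonneg:
  fixes f f1 f2 :: "real \<Rightarrow> real"
  assumes d1: "\<And>s. s > a \<Longrightarrow> (f has_real_derivative f1 s) (at s)"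
    and d2: "\<And>s. s > a \<Longrightarrow> (f1 has_real_derivative f2 s) (at s)"
    and ge: "\<And>s. s > a \<Longrightarrow> f2 s \<ge> f s"
    and lim: "((\<lambda>s. exp s * f s) \<longlongrightarrow> 0) at_top"
    and s: "s > a"
  shows "f s \<ge> 0"
proof -
  \<comment> \<open>The operator \<open>f'' - f\<close> factors: \<open>p\<close> is nondecreasing
    and \<open>u' = exp (2 * s) * p\<close>. If \<open>u'\<close> were positive once, it would stay
    above a positive constant and \<open>u\<close> would grow at least linearly, against
    \<open>u \<longlonglongrightarrow> 0\<close>. Hence \<open>u\<close> decreases to 0.\<close>
  define u where "u = (\<lambda>s. exp s * f s)"
  define u1 where "u1 = (\<lambda>s. exp s * (f s + f1 s))"
  define p where "p = (\<lambda>s. exp (-s) * (f s + f1 s))"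
  have du: "(u has_real_derivative u1 x) (at x)" if "x > a" for x
    unfolding u_def u1_def using d1[OF that] by (auto intro!: derivative_eq_intros simp: algebra_simps)
  have dp: "(p has_real_derivative exp (-x) * (f2 x - f x)) (at x)" if "x > a" for x
    unfolding p_def using d1[OF that] d2[OF that]
    by (auto intro!: derivative_eq_intros simp: algebra_simps)
  have mono: "p x \<le> p y" if "a < x" "x \<le> y" for x y
  proof (rule DERIV_nonneg_imp_nondecreasing[OF that(2)])
    fix z assume "x \<le> z" "z \<le> y"
    hence z: "z > a" using that by simp
    show "\<exists>d. (p has_real_derivative d) (at z) \<and> 0 \<le> d"
      using dp[OF z] ge[OF z] by (intro exI[of _ "exp (-z) * (f2 z - f z)"]) auto
  qed
  have u1p: "u1 x = exp (2*x) * p x" for x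
    by (simp add: u1_def p_def algebra_simps exp_add[symmetric])
  have le: "u1 x \<le> 0" if x: "x > a" for x
  proof (rule ccontr)
    assume "\<not> u1 x \<le> 0"
    hence px: "p x > 0" by (simp add: u1p mult_le_0_iff not_le)
    define c where "c = exp (2*x) * p x"
    have c: "c > 0" using px by (simp add: c_def)
    have gec: "u1 y \<ge> c" if "y \<ge> x" for y
      unfolding u1p c_def using mono[OF x that] px that by (intro mult_mono) auto
    have lin: "u y \<ge> u x + c * (y - x)" if "y \<ge> x" for y
    proof -
      have "(\<lambda>y. u y - c * y) x \<le> (\<lambda>y. u y - c * y) y"
      proof (rule DERIV_nonneg_imp_nondecreasing[OF that])
        fix z assume z: "x \<le> z" "z \<le> y"
        have "((\<lambda>y. u y - c * y) has_real_derivative u1 z - c) (at z)"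
          using du[of z] z x by (auto intro!: derivative_eq_intros)
        thus "\<exists>d. ((\<lambda>y. u y - c * y) has_real_derivative d) (at z) \<and> 0 \<le> d"
          using gec[of z] z by (intro exI[of _ "u1 z - c"]) auto
      qed
      thus ?thesis by (simp add: algebra_simps)
    qed
    have "eventually (\<lambda>y. u y < 1) at_top"
      using order_tendstoD(2)[OF lim, of 1] by (simp add: u_def)
    moreover have "eventually (\<lambda>y. y \<ge> max x (x + (1 - u x)/c)) at_top" by (rule eventually_ge_at_top)
    ultimately have "eventually (\<lambda>y. u y < 1 \<and> y \<ge> max x (x + (1 - u x)/c)) at_top"
      by (rule eventually_conj)
    then obtain y where y: "u y < 1" "y \<ge> x" "y \<ge> x + (1 - u x)/c"
      by (auto simp: eventually_at_top_linorder)
    have "c * (y - x) \<ge> 1 - u x" using y c by (simp add: field_simps)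
    with lin[of y] y show False by auto
  qed
  have anti: "u y \<le> u s" if "y \<ge> s" for y
  proof (rule DERIV_nonpos_imp_nonincreasing[OF that])
    fix x assume "s \<le> x" "x \<le> y"
    thus "\<exists>d. (u has_real_derivative d) (at x) \<and> d \<le> 0"
      using s du[of x] le[of x] by (intro exI[of _ "u1 x"]) auto
  qed
  have "u s \<ge> 0"
    by (rule tendsto_upperbound[OF lim[folded u_def]])
      (use anti in \<open>auto intro!: eventually_mono[OF eventually_ge_at_top[of s]]\<close>)
  thus ?thesis by (simp add: u_def zero_le_mult_iff)
qed

lemma ode_zero:
  fixes f f1 f2 :: "real \<Rightarrow> real"
  assumes d1: "\<And>s. s > a \<Longrightarrow> (f has_real_derivative f1 s) (at s)"
    and d2: "\<And>s. s > a \<Longrightarrow> (f1 has_real_derivative f2 s) (at s)"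
    and eq: "\<And>s. s > a \<Longrightarrow> f2 s = f s"
    and lim: "((\<lambda>s. exp s * f s) \<longlongrightarrow> 0) at_top"
    and s: "s > a"
  shows "f s = 0"
proof -
  have "f s \<ge> 0" by (rule ode_nonneg[OF d1 d2 _ lim s]) (use eq in auto)
  moreover have "- f s \<ge> 0"
    by (rule ode_nonneg[where f="\<lambda>s. - f s" and ?f1.0="\<lambda>s. - f1 s" and ?f2.0="\<lambda>s. - f2 s" and a=a])
      (use d1 d2 eq s tendsto_minus[OF lim] in \<open>auto intro!: derivative_eq_intros\<close>)
  ultimately show ?thesis by simp
qed

lemma antimono_nonneg:
  fixes f f1 :: "real \<Rightarrow> real"
  assumes d1: "\<And>s. s > a \<Longrightarrow> (f has_real_derivative f1 s) (at s)"
    and le: "\<And>s. s > a \<Longrightarrow> f1 s \<le> 0"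
    and lim: "(f \<longlongrightarrow> 0) at_top" and s: "s > a"
  shows "f s \<ge> 0"
proof -
  have anti: "f y \<le> f s" if "y \<ge> s" for y
  proof (rule DERIV_nonpos_imp_nonincreasing[OF that])
    fix x assume "s \<le> x" "x \<le> y"
    thus "\<exists>d. (f has_real_derivative d) (at x) \<and> d \<le> 0"
      using s d1[of x] le[of x] by (intro exI[of _ "f1 x"]) auto
  qed
  show ?thesis
    by (rule tendsto_upperbound[OF lim])
      (use anti in \<open>auto intro!: eventually_mono[OF eventually_ge_at_top[of s]]\<close>)
qed

lemma zero_of_deriv_zero:
  fixes f :: "real \<Rightarrow> real"
  assumes d1: "\<And>s. s > a \<Longrightarrow> (f has_real_derivative 0) (at s)"
    and lim: "(f \<longlongrightarrow> 0) at_top" and s: "s > a"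
  shows "f s = 0"
proof -
  have "f s \<ge> 0" by (rule antimono_nonneg[OF d1 _ lim s]) auto
  moreover have "- f s \<ge> 0"
    by (rule antimono_nonneg[where f="\<lambda>s. - f s" and ?f1.0="\<lambda>s. 0" and a=a])
      (use d1 s tendsto_minus[OF lim] in \<open>auto intro!: derivative_eq_intros\<close>)
  ultimately show ?thesis by simp
qed

section \<open>Moments of the density\<close>

definition wgt :: "nat \<Rightarrow> real \<Rightarrow> real \<Rightarrow> real" where
  "wgt n w r = r ^ n * (exp (- 2 * w * r) * dens r)"

definition mom :: "nat \<Rightarrow> real \<Rightarrow> real \<Rightarrow> real" where
  "mom n x w = integral {1..x} (wgt n w)"

text \<open>The derivative of \<open>2 * sqrt (1 - 1 / r)\<close>. It combines the inverse square
  root singularity of the density at 1 with the quadratic decay that remains after multiplication by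
  \<open>r^2\<close>.\<close>

definition dmaj :: "real \<Rightarrow> real" where
  "dmaj r = 1 / (r ^ 2 * sqrt (1 - 1 / r))"

text \<open>With \<open>r = coth s\<close> one has \<open>1 - 1 / r \<le> 1 / cosh s ^ 2\<close>,
  and the bound on \<open>Gam\<close> turns \<open>r^4 * dens r / cosh s\<close> into at most
  \<open>kk * cosh s ^ 2 / (4 * sinh s ^ 2 + 5)\<close>, which is below
  \<open>kk / 4\<close>.\<close>

lemma dens_bounds: assumes r: "r > 1"
  shows "0 \<le> dens r" and "r ^ 2 * dens r \<le> kk / 4 * dmaj r"
proof -
  obtain s where s: "s > 0" and rs: "r = cosh s / sinh s" using coth_surj[OF r] .
  let ?S = "sinh s" and ?C = "cosh s"
  have S: "?S > 0" "?C > 0" using s by (auto simp: cosh_real_pos)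
  have P: "4 * ?S ^ 2 + 5 > 0" using zero_le_power2[of ?S] by linarith
  have d: "dens r = ?S ^ 3 * Gam s" unfolding rs by (rule dens_coth[OF s])
  show "0 \<le> dens r" unfolding d using Gam_bounds(1)[OF s] S by simp
  have "0 < 1 - 1 / r" using r by simp
  have "1 - 1 / r \<le> (1 / ?C) ^ 2"
  proof -
    have "1 - 1 / r = 1 - ?S / ?C" by (simp add: rs)
    also have "\<dots> \<le> (1 - ?S / ?C) * (1 + ?S / ?C)"
    proof -
      have "1 - ?S/?C \<ge> 0" using S \<open>0 < 1 - 1 / r\<close> by (simp add: rs)
      thus ?thesis using S by (simp add: mult_le_cancel_left1)
    qed
    also have "\<dots> = (1 / ?C)^2" using S cosh_sq[of s] by (simp add: field_simps power2_eq_square)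
    finally show ?thesis .
  qed
  hence "sqrt (1 - 1 / r) \<le> 1 / ?C"
    using S real_le_lsqrt by (simp add: real_sqrt_le_iff' real_le_lsqrt)
  have "r ^ 4 * dens r * sqrt (1 - 1/r) \<le> r ^ 4 * dens r * (1 / ?C)"
    using \<open>0 \<le> dens r\<close> \<open>sqrt (1 - 1 / r) \<le> 1 / ?C\<close> by (intro mult_left_mono) auto
  also have "\<dots> \<le> r ^ 4 * (?S ^ 3 * (kk * ?S / (?C * (4 * ?S ^ 2 + 5)))) * (1 / ?C)"
    unfolding d using Gam_bounds(2)[OF s] S r by (intro mult_right_mono mult_left_mono) auto
  also have "\<dots> = kk * (?C ^ 2 / (4 * ?S ^ 2 + 5))"
    unfolding rs power_divide using S P apply (simp add: divide_simps) by algebra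
  also have "\<dots> \<le> kk * (1 / 4)"
    using P kk_pos cosh_sq[of s] by (intro mult_left_mono) (auto simp: field_simps)
  finally have "r ^ 4 * dens r * sqrt (1 - 1/r) \<le> kk / 4" by simp
  moreover have "r ^ 4 * dens r * sqrt (1 - 1/r) = (r ^ 2 * dens r) * (r ^ 2 * sqrt (1 - 1/r))"
    by (simp add: eval_nat_numeral)
  moreover have "r ^ 2 * sqrt (1 - 1/r) > 0" using r by simp
  ultimately show "r ^ 2 * dens r \<le> kk / 4 * dmaj r"
    unfolding dmaj_def by (simp add: field_simps)
qed

text \<open>A totalised value: the denominator contains \<open>sqrt 0\<close>, so the quotient is 0,
  although the density is unbounded near 1.\<close>

lemma dens_1: "dens 1 = 0" by (simp add: dens_def g_fun_def)

lemma dens_nonneg: "r \<ge> 1 \<Longrightarrow> dens r \<ge> 0"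
  using dens_bounds(1)[of r] dens_1 by (cases "r = 1") auto

lemma dmaj_nonneg: "r \<ge> 1 \<Longrightarrow> dmaj r \<ge> 0" by (simp add: dmaj_def)

lemma dmaj_integrable: "set_integrable lborel {1<..} dmaj"
proof -
  have "set_integrable lborel (einterval 1 \<infinity>) dmaj"
  proof (rule interval_integral_FTC_nonneg(1)[where F="\<lambda>r. 2 * sqrt (1 - 1 / r)" and A=0 and B=2])
    fix x :: real assume "1 < ereal x" "ereal x < \<infinity>"
    hence x: "x > 1" by (simp add: one_ereal_def)
    hence p: "1 - 1 / x > 0" by simp
    show "((\<lambda>r. 2 * sqrt (1 - 1 / r)) has_real_derivative dmaj x) (at x)"
      using p x by (auto intro!: derivative_eq_intros simp: dmaj_def field_simps power2_eq_square)
    show "isCont dmaj x" unfolding dmaj_def using x p by (auto intro!: continuous_intros)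
  next
    show "AE x in lborel. 1 < ereal x \<longrightarrow> ereal x < \<infinity> \<longrightarrow> 0 \<le> dmaj x"
      by (auto simp: dmaj_nonneg one_ereal_def)
    have "((\<lambda>r::real. 2 * sqrt (1 - 1 / r)) \<longlongrightarrow> 2 * sqrt (1 - 1/1)) (at_right 1)"
      by (intro tendsto_intros) auto
    thus "(((\<lambda>r::real. 2 * sqrt (1 - 1 / r)) \<circ> real_of_ereal) \<longlongrightarrow> 0) (at_right 1)"
      unfolding one_ereal_def ereal_tendsto_simps1 by simp
    have "((\<lambda>r::real. 2 * sqrt (1 - 1 / r)) \<longlongrightarrow> 2) at_top" by real_asymp
    thus "(((\<lambda>r::real. 2 * sqrt (1 - 1 / r)) \<circ> real_of_ereal) \<longlongrightarrow> 2) (at_left \<infinity>)"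
      unfolding ereal_tendsto_simps1 by simp
  qed simp
  moreover have "einterval 1 \<infinity> = {1<..}" by (auto simp: einterval_def one_ereal_def)
  ultimately show ?thesis by simp
qed

lemma wgt_measurable [measurable]: "wgt n w \<in> borel_measurable borel"
  unfolding wgt_def dens_def g_fun_def arccoth_def by measurable

text \<open>Since the density is unbounded at the left end, integrability comes from the Lebesgue
  majorant \<open>dmaj\<close>; on a bounded interval the powers and the exponential are
  bounded.\<close>

lemma wgt_set_integrable: "set_integrable lborel {1..x} (wgt n w)"
proof (cases "x \<ge> 1")
  case True
  let ?K = "x ^ n * (exp (2 * \<bar>w\<bar> * x) * (kk / 4))"
  have A: "integrable lborel (\<lambda>r. ?K * (indicator {1<..} r * dmaj r))"
    using dmaj_integrable unfolding set_integrable_def by (intro integrable_mult_right) simp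
  have B: "norm (indicator {1..x} r *\<^sub>R wgt n w r) \<le> norm (?K * (indicator {1<..} r * dmaj r))" for r
  proof (cases "1 < r \<and> r \<le> x")
    case True
    have r: "1 < r" "r \<le> x" using True by auto
    have "- (w * r) \<le> \<bar>w\<bar> * x"
    proof -
      have "- (w * r) \<le> \<bar>w\<bar> * r" using abs_ge_minus_self[of "w * r"] r by (simp add: abs_mult)
      also have "\<dots> \<le> \<bar>w\<bar> * x" using r by (intro mult_left_mono) auto
      finally show ?thesis .
    qed
    hence e: "exp (- 2 * w * r) \<le> exp (2 * \<bar>w\<bar> * x)" by (simp add: algebra_simps)
    have "dens r \<le> r ^ 2 * dens r" using r dens_nonneg[of r] by (simp add: mult_le_cancel_right1)
    also have "\<dots> \<le> kk / 4 * dmaj r" using dens_bounds(2)[of r] r by simp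
    finally have "wgt n w r \<le> x ^ n * (exp (2 * \<bar>w\<bar> * x) * (kk / 4 * dmaj r))"
      unfolding wgt_def using r e dens_nonneg[of r]
      by (intro mult_mono power_mono) auto
    moreover have "wgt n w r \<ge> 0" unfolding wgt_def using r dens_nonneg[of r] by simp
    ultimately show ?thesis using r dmaj_nonneg[of r] by (simp add: algebra_simps)
  next
    case False
    hence "indicator {1..x} r *\<^sub>R wgt n w r = 0"
      by (cases "r = 1") (auto simp: wgt_def dens_1 indicator_def)
    thus ?thesis by (simp only: norm_zero norm_ge_zero)
  qed
  show ?thesis unfolding set_integrable_def
    by (rule Bochner_Integration.integrable_bound[OF A _ AE_I2[OF B]]) measurable
qed (simp add: set_integrable_def)

lemma wgt_integrable: "wgt n w integrable_on {1..x}"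
  using set_borel_integral_eq_integral(1)[OF wgt_set_integrable] .

lemma mom_eq_LINT: "mom n x w = (LINT r:{1..x}|lborel. wgt n w r)"
  unfolding mom_def using set_borel_integral_eq_integral(2)[OF wgt_set_integrable] by simp

lemma dens_isCont: assumes r: "r > 1" shows "isCont dens r"
proof -
  have p: "(r + 1) / (r - 1) > 0" "r - 1 \<noteq> 0" using r by auto
  have "r ^ 2 > 1" using r by simp
  hence q: "16 * sqrt 2 * r * sqrt (r ^ 2 - 1) \<noteq> 0" using r by (simp del: one_less_power)
  have l: "isCont (\<lambda>r. ln ((r + 1) / (r - 1))) r"
    by (rule isCont_ln') (use p in \<open>auto intro!: continuous_intros\<close>)
  show ?thesis
    unfolding dens_def g_fun_def arccoth_def
    using q by (intro continuous_minus continuous_divide continuous_mult continuous_diff continuous_add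
      continuous_power continuous_const continuous_ident l continuous_real_sqrt) auto
qed

lemma wgt_isCont: "r > 1 \<Longrightarrow> isCont (wgt n w) r"
  unfolding wgt_def by (intro continuous_intros dens_isCont)

lemma wgt_shift: "wgt (n + j) w r = r ^ j * wgt n w r"
  by (simp add: wgt_def power_add)

text \<open>Turns a pointwise factorisation of a polynomial on \<open>[1, x]\<close> into an
  inequality between moments. Degree five covers every product of modes and powers compared
  later.\<close>

lemma mom_poly_nonneg:
  assumes "\<And>r. 1 \<le> r \<Longrightarrow> r \<le> x \<Longrightarrow> 0 \<le> c0 + c1 * r + c2 * r^2 + c3 * r^3 + c4 * r^4 + c5 * r^5"
  shows "0 \<le> c0 * mom 0 x w + c1 * mom 1 x w + c2 * mom 2 x w + c3 * mom 3 x w + c4 * mom 4 x w + c5 * mom 5 x w"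
proof -
  have "((\<lambda>r. c0 * wgt 0 w r + c1 * wgt 1 w r + c2 * wgt 2 w r + c3 * wgt 3 w r + c4 * wgt 4 w r + c5 * wgt 5 w r) has_integral
     (c0 * mom 0 x w + c1 * mom 1 x w + c2 * mom 2 x w + c3 * mom 3 x w + c4 * mom 4 x w + c5 * mom 5 x w)) {1..x}"
    unfolding mom_def by (intro has_integral_add has_integral_mult_right integrable_integral wgt_integrable)
  thus ?thesis
  proof (rule has_integral_nonneg)
    fix r assume r: "r \<in> {1..x}"
    have "c0 * wgt 0 w r + c1 * wgt 1 w r + c2 * wgt 2 w r + c3 * wgt 3 w r + c4 * wgt 4 w r + c5 * wgt 5 w r
      = (c0 + c1 * r + c2 * r^2 + c3 * r^3 + c4 * r^4 + c5 * r^5) * (exp (-2 * w * r) * dens r)"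
      by (simp add: wgt_def algebra_simps)
    also have "\<dots> \<ge> 0" using assms[of r] r dens_nonneg[of r] by simp
    finally show "0 \<le> c0 * wgt 0 w r + c1 * wgt 1 w r + c2 * wgt 2 w r + c3 * wgt 3 w r + c4 * wgt 4 w r + c5 * wgt 5 w r" .
  qed
qed

lemma mom_nonneg: "mom n x w \<ge> 0"
  unfolding mom_def
  by (rule integral_nonneg[OF wgt_integrable]) (auto simp: wgt_def intro!: mult_nonneg_nonneg dens_nonneg)

lemma mom_mono_w:
  assumes "0 \<le> w" shows "mom n x w \<le> mom n x 0"
  unfolding mom_def
proof (rule integral_le[OF wgt_integrable wgt_integrable])
  fix r assume r: "r \<in> {1..x}"
  show "wgt n w r \<le> wgt n 0 r"
    unfolding wgt_def using r assms dens_nonneg[of r]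
    by (intro mult_left_mono mult_right_mono) auto
qed

section \<open>Derivatives of the moments in the endpoint and in the exponent\<close>

lemma mom_deriv_x: assumes x: "x > 1"
  shows "((\<lambda>x. mom n x w) has_real_derivative wgt n w x) (at x)"
proof -
  have "((\<lambda>u. integral {1..u} (wgt n w)) has_vector_derivative wgt n w x) (at x within {1..x+1} - {})"
  proof (rule integral_has_vector_derivative_continuous_at)
    show "wgt n w integrable_on {1..x+1}" by (rule wgt_integrable)
    show "x \<in> {1..x+1} - {}" using x by simp
    show "continuous (at x within {1..x+1} - {}) (wgt n w)"
      using wgt_isCont[OF x] by (rule continuous_at_imp_continuous_at_within)
  qed simp
  moreover have "at x within {1..x+1} - {} = at x"
    using x by (auto intro!: at_within_interior)
  ultimately show ?thesis
    unfolding mom_def has_real_derivative_iff_has_vector_derivative by simp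
qed

lemma exp_quadratic_bound: assumes "\<bar>y::real\<bar> \<le> 1" shows "\<bar>exp y - 1 - y\<bar> \<le> y ^ 2"
proof -
  have l: "exp y \<ge> 1 + y" by (rule exp_ge_add_one_self)
  have u: "exp y \<le> 1 + y + y ^ 2"
  proof (cases "y \<ge> 0")
    case True thus ?thesis using exp_bound[of y] assms by simp
  next
    case False
    define z where "z = - y"
    have z: "z \<ge> 0" using False by (simp add: z_def)
    have q: "1 + z + z^2/2 > 0" using z by (simp add: add_pos_nonneg)
    have "exp y = 1 / exp z" by (simp add: z_def exp_minus field_simps)
    also have "\<dots> \<le> 1 / (1 + z + z^2/2)"
      using exp_lower_Taylor_quadratic[OF z] q by (intro divide_left_mono) auto
    also have "\<dots> \<le> 1 - z + z^2"
    proof -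
      have "(1 - z + z^2) * (1 + z + z^2/2) = 1 + z^2/2 + z^3/2 + z^4/2" by (simp add: field_simps eval_nat_numeral)
      also have "\<dots> \<ge> 1" using z by simp
      finally show ?thesis using q by (simp add: divide_le_eq)
    qed
    finally show ?thesis by (simp add: z_def)
  qed
  have "0 \<le> y ^ 2" by simp
  thus ?thesis using l u by linarith
qed

text \<open>Differentiation under the integral sign with an explicit remainder: the second order
  error of the exponential is dominated by the moment two degrees higher.\<close>

lemma mom_deriv_w: assumes x: "x > 1"
  shows "((\<lambda>w. mom n x w) has_real_derivative (- 2 * mom (n + 1) x w)) (at w)"
proof -
  \<comment> \<open>The restriction on \<open>h\<close> keeps the exponent \<open>2 * h * r\<close>
    within size 1 on all of \<open>[1, x]\<close>, where the quadratic bound for \<open>exp\<close>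
    holds.\<close>
  have bd: "\<bar>mom n x (w + h) - mom n x w + 2 * h * mom (n + 1) x w\<bar> \<le> 4 * h ^ 2 * mom (n + 2) x w"
    if h: "\<bar>h\<bar> \<le> 1 / (2 * x)" for h
  proof -
    let ?f = "\<lambda>r. wgt n (w+h) r - wgt n w r + 2 * h * wgt (n + 1) w r"
    have "(?f has_integral (mom n x (w + h) - mom n x w + 2 * h * mom (n + 1) x w)) {1..x}"
      unfolding mom_def by (intro has_integral_add has_integral_diff has_integral_mult_right integrable_integral wgt_integrable)
    hence "mom n x (w + h) - mom n x w + 2 * h * mom (n + 1) x w = integral {1..x} ?f"
      by (simp add: integral_unique)
    also have "norm \<dots> \<le> integral {1..x} (\<lambda>r. 4 * h^2 * wgt (n+2) w r)"
    proof (rule integral_norm_bound_integral)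
      show "?f integrable_on {1..x}"
        by (intro integrable_add integrable_diff integrable_on_mult_right wgt_integrable)
      show "(\<lambda>r. 4 * h^2 * wgt (n+2) w r) integrable_on {1..x}"
        by (intro integrable_on_mult_right wgt_integrable)
      fix r assume r: "r \<in> {1..x}"
      have "\<bar>-2 * h * r\<bar> \<le> 2 * (1/(2 * x)) * x"
        unfolding abs_mult using r h x by (intro mult_mono) auto
      hence y: "\<bar>-2 * h * r\<bar> \<le> 1" using x by simp
      have ee: "exp (- 2 * (w + h) * r) = exp (- 2 * w * r) * exp (-2 * h * r)"
        by (simp add: exp_add[symmetric] algebra_simps)
      have "?f r = r ^ n * exp (-2 * w * r) * dens r * (exp (-2 * h * r) - 1 - (-2 * h * r))"
        unfolding wgt_def ee by (simp add: algebra_simps)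
      also have "\<bar>\<dots>\<bar> = r ^ n * exp (-2 * w * r) * dens r * \<bar>exp (-2 * h * r) - 1 - (-2 * h * r)\<bar>"
        using r dens_nonneg[of r] by (simp add: abs_mult)
      also have "\<dots> \<le> r ^ n * exp (-2 * w * r) * dens r * (-2 * h * r)^2"
        using r dens_nonneg[of r] exp_quadratic_bound[OF y] by (intro mult_left_mono) auto
      also have "\<dots> = 4 * h^2 * wgt (n+2) w r"
        by (simp add: wgt_def power_add power_mult_distrib power2_eq_square)
      finally show "norm (?f r) \<le> 4 * h^2 * wgt (n+2) w r" by simp
    qed
    finally show ?thesis
      unfolding mom_def using integral_mult_right[of "{1..x}" "4 * h^2" "wgt (n+2) w"] by simp
  qed
  have "((\<lambda>h. (mom n x (w + h) - mom n x w) / h - (- 2 * mom (n + 1) x w)) \<longlongrightarrow> 0) (at 0)"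
  proof (rule Lim_null_comparison)
    have "eventually (\<lambda>h. \<bar>h\<bar> < 1/(2 * x)) (at (0::real))"
      using x by (auto simp: eventually_at intro!: exI[of _ "1/(2 * x)"])
    moreover have "eventually (\<lambda>h. h \<noteq> 0) (at (0::real))" by (simp add: eventually_at_filter)
    ultimately show "eventually (\<lambda>h. norm ((mom n x (w + h) - mom n x w) / h - (- 2 * mom (n + 1) x w)) \<le> 4 * \<bar>h\<bar> * mom (n + 2) x w) (at 0)"
    proof eventually_elim
      case (elim h)
      have "(mom n x (w + h) - mom n x w) / h - (- 2 * mom (n + 1) x w) = (mom n x (w + h) - mom n x w + 2 * h * mom (n + 1) x w) / h"
        using elim by (simp add: field_simps)
      also have "\<bar>\<dots>\<bar> \<le> 4 * h ^ 2 * mom (n + 2) x w / \<bar>h\<bar>"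
        unfolding abs_divide using bd[of h] elim by (intro divide_right_mono) auto
      also have "\<dots> = 4 * \<bar>h\<bar> * mom (n + 2) x w"
      proof -
        have "4 * a ^ 2 * m / a = 4 * a * m" if "a \<noteq> 0" for a m :: real
          using that by (simp add: power2_eq_square)
        from this[of "\<bar>h\<bar>"] show ?thesis using elim by simp
      qed
      finally show ?case by simp
    qed
    show "((\<lambda>h. 4 * \<bar>h\<bar> * mom (n + 2) x w) \<longlongrightarrow> 0) (at 0)"
      by (auto intro!: tendsto_eq_intros)
  qed
  hence "((\<lambda>h. (mom n x (w + h) - mom n x w) / h) \<longlongrightarrow> - 2 * mom (n + 1) x w) (at 0)"
    by (rule LIM_zero_cancel)
  thus ?thesis by (simp add: DERIV_def)
qed

text \<open>Joint differentiability needs continuity of only one partial derivative. The endpoint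
  partial is taken, because it is the explicit function \<open>wgt\<close>.\<close>

lemma mom_has_derivative_pair: assumes x: "x > 1"
  shows "((\<lambda>(w, x). mom n x w) has_derivative (\<lambda>(h, k). - 2 * mom (n+1) x w * h + wgt n w x * k)) (at (w, x))"
proof -
  have "((\<lambda>(w, x). mom n x w) has_derivative (\<lambda>(h, k). - 2 * mom (n+1) x w * h + blinfun_scaleR_left (wgt n w x) k)) (at (w, x) within UNIV \<times> {1<..})"
  proof (rule has_derivative_partialsI)
    show "((\<lambda>w. mom n x w) has_derivative (\<lambda>h. - 2 * mom (n+1) x w * h)) (at w within UNIV)"
      using mom_deriv_w[OF x, of n w] by (simp only: has_field_derivative_def)
    show "((\<lambda>x. mom n x w) has_derivative blinfun_apply (blinfun_scaleR_left (wgt n w x))) (at x within {1<..})"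
      if "x \<in> {1<..}" for w x
    proof -
      have "blinfun_apply (blinfun_scaleR_left (wgt n w x)) = (*) (wgt n w x)"
        by (auto simp: fun_eq_iff)
      thus ?thesis using mom_deriv_x[of x n w] that
        by (auto simp: has_field_derivative_def intro: has_derivative_at_withinI)
    qed
    have "isCont (\<lambda>p. blinfun_scaleR_left (snd p ^ n * (exp (- 2 * fst p * snd p) * dens (snd p)))) (w, x)"
      using dens_isCont[OF x]
      by (intro continuous_intros bounded_linear.isCont[OF bounded_linear_blinfun_scaleR_left]
          isCont_o2[where g=dens and f=snd]) auto
    thus "continuous (at (w, x) within UNIV \<times> {1<..}) (\<lambda>(w, x). blinfun_scaleR_left (wgt n w x))"
      unfolding wgt_def case_prod_beta by (rule continuous_at_imp_continuous_at_within)
  qed (use x in auto)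
  moreover have "at (w, x) within UNIV \<times> {1<..} = at (w, x)"
    using x by (intro at_within_open open_Times) auto
  ultimately show ?thesis by (simp add: mult.commute)
qed

lemma mom_has_derivative:
  assumes "(f has_derivative f') (at q)" "(g has_derivative g') (at q)" "f q > 1"
  shows "((\<lambda>q. mom n (f q) (g q)) has_derivative (\<lambda>h. - 2 * mom (n+1) (f q) (g q) * g' h + wgt n (g q) (f q) * f' h)) (at q)"
  using has_derivative_compose[OF has_derivative_Pair[OF assms(2,1)] mom_has_derivative_pair[OF assms(3), of n "g q"]]
  by simp

lemma mom_tendsto_0: "((\<lambda>s. mom n (cosh s / sinh s) w) \<longlongrightarrow> 0) at_top"
proof -
  have c: "continuous_on {1..2} (\<lambda>x. mom n x w)"
    unfolding mom_def by (rule indefinite_integral_continuous_1[OF wgt_integrable])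
  have "((\<lambda>x. mom n x w) \<longlongrightarrow> mom n 1 w) (at 1 within {1..2})"
    using c by (auto simp: continuous_on_def)
  moreover have "mom n 1 w = 0" by (simp add: mom_def)
  moreover have "filterlim (\<lambda>s::real. cosh s / sinh s) (at 1 within {1..2}) at_top"
  proof (subst filterlim_at, intro conjI)
    show l: "((\<lambda>s::real. cosh s / sinh s) \<longlongrightarrow> 1) at_top" by real_asymp
    have "eventually (\<lambda>s::real. cosh s / sinh s < 2) at_top"
      by (rule order_tendstoD(2)[OF l]) simp
    thus "eventually (\<lambda>s::real. cosh s / sinh s \<in> {1..2} \<and> cosh s / sinh s \<noteq> 1) at_top"
      using eventually_gt_at_top[of "0::real"]
    proof eventually_elim
      case (elim s) thus ?case using coth_gt_1[of s] by auto
    qed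
  qed
  ultimately show ?thesis using filterlim_compose by fastforce
qed

section \<open>Coefficient functions and their derivatives\<close>

definition coth :: "real \<Rightarrow> real" where "coth s = cosh s / sinh s"

text \<open>The integral of \<open>r^n\<close> times the mode \<open>cosh s - r sinh s\<close>. This
  mode vanishes at the moving endpoint \<open>coth s\<close>, so \<open>M1\<close> is the exact
  \<open>s\<close>-derivative; the endpoint contributes for the first time in \<open>M2\<close>, the
  derivative of \<open>M1\<close>.\<close>

definition M0 :: "nat \<Rightarrow> real \<Rightarrow> real \<Rightarrow> real" where
  "M0 n s w = cosh s * mom n (coth s) w - sinh s * mom (n + 1) (coth s) w"

definition M1 :: "nat \<Rightarrow> real \<Rightarrow> real \<Rightarrow> real" where
  "M1 n s w = sinh s * mom n (coth s) w - cosh s * mom (n + 1) (coth s) w"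

definition M2 :: "nat \<Rightarrow> real \<Rightarrow> real \<Rightarrow> real" where
  "M2 n s w = M0 n s w + coth s ^ n * exp (- 2 * w * coth s) * Gam s"

lemma coth_gt1: "s > 0 \<Longrightarrow> coth s > 1"
  using coth_gt_1 by (simp add: coth_def)

lemma coth_deriv: "s > 0 \<Longrightarrow> (coth has_real_derivative - 1 / sinh s ^ 2) (at s)"
proof -
  assume s: "s > 0"
  have "(coth has_real_derivative (sinh s * sinh s - cosh s * cosh s) / (sinh s * sinh s)) (at s)"
    unfolding coth_def[abs_def] using s by (auto intro!: derivative_eq_intros)
  also have "(sinh s * sinh s - cosh s * cosh s) / (sinh s * sinh s) = - 1 / sinh s ^ 2"
    using cosh_sq[of s] by (simp add: power2_eq_square)
  finally show ?thesis .
qed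

lemma wgt_coth: assumes "s > 0"
  shows "wgt n w (coth s) = coth s ^ n * exp (- 2 * w * coth s) * Gam s * sinh s ^ 3"
  using dens_coth[OF assms] by (simp add: wgt_def coth_def)

lemma mom_coth_has_derivative:
  assumes "(f has_derivative f') (at q)" "(g has_derivative g') (at q)" "f q > 0"
  shows "((\<lambda>q. mom n (coth (f q)) (g q)) has_derivative
    (\<lambda>h. - 2 * mom (n+1) (coth (f q)) (g q) * g' h - coth (f q) ^ n * exp (- 2 * g q * coth (f q)) * Gam (f q) * sinh (f q) * f' h)) (at q)"
proof -
  have "((\<lambda>q. coth (f q)) has_derivative (\<lambda>h. f' h * (- 1 / sinh (f q) ^ 2))) (at q)"
  proof -
    have "(*) (- 1 / sinh (f q) ^ 2) = (\<lambda>h. h * (- 1 / sinh (f q) ^ 2))" by (rule ext) (rule mult.commute)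
    thus ?thesis
      using has_derivative_compose[OF assms(1) coth_deriv[OF assms(3), unfolded has_field_derivative_def]] by simp
  qed
  from mom_has_derivative[OF this assms(2) coth_gt1[OF assms(3)], of n]
  show ?thesis
    unfolding wgt_coth[OF assms(3)]
  proof (rule has_derivative_eq_rhs)
    have S: "sinh (f q) \<noteq> 0" using assms(3) by simp
    have eq: "x * S ^ 3 * (h * (- 1 / S ^ 2)) = - (x * S * h)" if "S \<noteq> 0" for x S h :: real
      using that by (simp add: field_simps eval_nat_numeral)
    show "(\<lambda>h. - 2 * mom (n+1) (coth (f q)) (g q) * g' h + coth (f q) ^ n * exp (- 2 * g q * coth (f q)) * Gam (f q) * sinh (f q) ^ 3 * (f' h * (- 1 / sinh (f q) ^ 2)))
      = (\<lambda>h. - 2 * mom (n+1) (coth (f q)) (g q) * g' h - coth (f q) ^ n * exp (- 2 * g q * coth (f q)) * Gam (f q) * sinh (f q) * f' h)"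
      by (intro ext) (simp only: eq[OF S] add_uminus_conv_diff)
  qed
qed

lemma dcosh: "(cosh has_real_derivative sinh s) (at s)"
  by (auto intro!: derivative_eq_intros)

lemma dsinh: "(sinh has_real_derivative cosh s) (at s)"
  by (auto intro!: derivative_eq_intros)

lemma cosh_has_derivative:
  "(f has_derivative f') (at q) \<Longrightarrow> ((\<lambda>q. cosh (f q :: real)) has_derivative (\<lambda>h. sinh (f q) * f' h)) (at q)"
  using has_derivative_compose[of f f' q UNIV cosh "\<lambda>h. sinh (f q) * h"] dcosh[of "f q"]
  by (simp add: has_field_derivative_def)

lemma sinh_has_derivative:
  "(f has_derivative f') (at q) \<Longrightarrow> ((\<lambda>q. sinh (f q :: real)) has_derivative (\<lambda>h. cosh (f q) * f' h)) (at q)"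
  using has_derivative_compose[of f f' q UNIV sinh "\<lambda>h. cosh (f q) * h"] dsinh[of "f q"]
  by (simp add: has_field_derivative_def)

lemma M0_has_derivative:
  assumes "(f has_derivative f') (at q)" "(g has_derivative g') (at q)" "f q > 0"
  shows "((\<lambda>q. M0 n (f q) (g q)) has_derivative (\<lambda>h. M1 n (f q) (g q) * f' h - 2 * M0 (n+1) (f q) (g q) * g' h)) (at q)"
proof -
  have S: "sinh (f q) * coth (f q) = cosh (f q)" using assms(3) by (simp add: coth_def)
  \<comment> \<open>The endpoint contributions cancel by \<open>S * c = C\<close>, which says that
    the mode vanishes at \<open>r = coth\<close>.\<close>
  have id: "C * (- 2 * a * g - p * ex * G * S * f) + S * f * b - (S * (- 2 * d * g - p * c * ex * G * S * f) + C * f * a)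
    = (S * b - C * a) * f - 2 * (C * a - S * d) * g" if "S * c = C" for C S a b c d g p ex G f :: real
    unfolding that[symmetric] by (simp add: algebra_simps)
  show ?thesis unfolding M0_def M1_def
    apply (rule has_derivative_eq_rhs)
     apply (rule has_derivative_diff has_derivative_mult cosh_has_derivative sinh_has_derivative mom_coth_has_derivative assms)+
    apply (simp only: fun_eq_iff power_add power_one_right, rule allI)
    by (rule id[OF S])
qed

lemma M1_has_derivative:
  assumes "(f has_derivative f') (at q)" "(g has_derivative g') (at q)" "f q > 0"
  shows "((\<lambda>q. M1 n (f q) (g q)) has_derivative (\<lambda>h. M2 n (f q) (g q) * f' h - 2 * M1 (n+1) (f q) (g q) * g' h)) (at q)"
proof -
  have S: "sinh (f q) * coth (f q) = cosh (f q)" using assms(3) by (simp add: coth_def)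
  have C: "cosh (f q) ^ 2 = sinh (f q) ^ 2 + 1" by (rule cosh_sq)
  have id: "S * (- 2 * a * g - p * ex * G * S * f) + C * f * b - (C * (- 2 * d * g - p * c * ex * G * S * f) + S * f * a)
    = (C * b - S * a + p * ex * G) * f - 2 * (S * a - C * d) * g" if "S * c = C" "C ^ 2 = S ^ 2 + 1" for C S a b c d g p ex G f :: real
  proof -
    have "S * (- 2 * a * g - p * ex * G * S * f) + C * f * b - (C * (- 2 * d * g - p * c * ex * G * S * f) + S * f * a)
      - ((C * b - S * a + p * ex * G) * f - 2 * (S * a - C * d) * g) = p * ex * G * f * (C * (S * c) - S ^ 2 - 1)"
      by (simp add: algebra_simps power2_eq_square)
    also have "\<dots> = 0" using that by (simp add: power2_eq_square)
    finally show ?thesis by simp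
  qed
  show ?thesis unfolding M1_def M2_def M0_def
    apply (rule has_derivative_eq_rhs)
     apply (rule has_derivative_diff has_derivative_mult cosh_has_derivative sinh_has_derivative mom_coth_has_derivative assms)+
    apply (simp only: fun_eq_iff power_add power_one_right, rule allI)
    by (rule id[OF S C])
qed

lemma M0_deriv: "s > 0 \<Longrightarrow> ((\<lambda>s. M0 n s w) has_real_derivative M1 n s w) (at s)"
  using M0_has_derivative[of "\<lambda>s. s" "\<lambda>s. s" s "\<lambda>s. w" "\<lambda>s. 0" n]
  by (simp add: has_field_derivative_def)

lemma M1_deriv: "s > 0 \<Longrightarrow> ((\<lambda>s. M1 n s w) has_real_derivative M2 n s w) (at s)"
  using M1_has_derivative[of "\<lambda>s. s" "\<lambda>s. s" s "\<lambda>s. w" "\<lambda>s. 0" n]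
  by (simp add: has_field_derivative_def)

section \<open>Elementary parts and endpoint terms\<close>

definition At :: "real \<Rightarrow> real" where "At s = arctan (exp (- s))"
text \<open>Equal to \<open>ln (coth (s / 2))\<close>, the primitive of \<open>- 1 / sinh\<close>
  that vanishes at infinity.\<close>

definition lam :: "real \<Rightarrow> real" where "lam s = ln ((exp s + 1) / (exp s - 1))"

lemma At_deriv: "(At has_real_derivative - 1 / (2 * cosh s)) (at s)"
proof -
  have "(At has_real_derivative - exp (-s) / (1 + exp (-s) ^ 2)) (at s)"
    unfolding At_def[abs_def] by (auto intro!: derivative_eq_intros simp: field_simps)
  also have "- exp (-s) / (1 + exp (-s) ^ 2) = - 1 / (2 * cosh s)"
  proof -
    have "2 * cosh s * exp (-s) = 1 + exp (-s) ^ 2"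
      by (simp add: cosh_def field_simps power2_eq_square exp_add[symmetric])
    thus ?thesis using cosh_real_pos[of s] by (simp add: field_simps) (smt (verit) exp_gt_zero zero_less_power)
  qed
  finally show ?thesis .
qed

lemma lam_deriv: assumes "s > 0" shows "(lam has_real_derivative - 1 / sinh s) (at s)"
proof -
  have e: "exp s > 1" using assms by simp
  have "(lam has_real_derivative (exp s * (exp s - 1) - (exp s + 1) * exp s) / ((exp s - 1) * (exp s - 1)) / ((exp s + 1) / (exp s - 1))) (at s)"
    unfolding lam_def[abs_def] using e
    by (auto intro!: derivative_eq_intros simp: divide_pos_pos add_pos_pos)
  also have "(exp s * (exp s - 1) - (exp s + 1) * exp s) / ((exp s - 1) * (exp s - 1)) / ((exp s + 1) / (exp s - 1)) = - 1 / sinh s"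
  proof -
    have "sinh s = (exp s * exp s - 1) / (2 * exp s)"
      by (simp add: sinh_def exp_minus field_simps)
    moreover have "exp s * exp s - 1 = (exp s - 1) * (exp s + 1)" by (simp add: algebra_simps)
    ultimately have "sinh s = (exp s - 1) * (exp s + 1) / (2 * exp s)" by simp
    moreover have "exp s + 1 \<noteq> 0" "exp s - 1 \<noteq> 0" using e by linarith+
    moreover have "(E * (E - 1) - (E + 1) * E) / ((E - 1) * (E - 1)) / ((E + 1) / (E - 1)) = - 1 / ((E - 1) * (E + 1) / (2 * E))"
      if "E + 1 \<noteq> 0" "E - 1 \<noteq> 0" "E \<noteq> 0" for E :: real
      using that by (simp add: divide_simps) (simp add: algebra_simps)
    ultimately show ?thesis by simp
  qed
  finally show ?thesis .
qed

text \<open>The \<open>i\<close>-th \<open>s\<close>-derivative, for \<open>i \<le> 2\<close>, of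
  the endpoint term \<open>coth s ^ n * exp (- 2 * w * coth s) * Gam s\<close>, with derivatives of
  \<open>Gam\<close> eliminated. \<open>g1\<close> and \<open>g2\<close> belong to the factor
  without the power of \<open>coth\<close>.\<close>

definition KG :: "nat \<Rightarrow> nat \<Rightarrow> real \<Rightarrow> real \<Rightarrow> real" where
  "KG i n s w = exp (- 2 * w * coth s) * (let c = coth s; S = sinh s; G = Gam s;
     G1 = - 6 * c * G + kk / cosh s ^ 2; g1 = 2 * w * G / S ^ 2 + G1;
     g2 = 2 * w * G1 / S ^ 2 - 4 * w * c * G / S ^ 2 + 6 * G / S ^ 2 - 6 * c * G1 - 2 * kk * S / cosh s ^ 3 in
     if i = 0 then c ^ n * G
     else if i = 1 then - real n * c ^ (n - 1) / S ^ 2 * G + c ^ n * g1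
     else real n * real (n - 1) * c ^ (n - 2) / S ^ 4 * G + 2 * real n * c ^ n / S ^ 2 * G
       - 2 * real n * c ^ (n - 1) / S ^ 2 * g1 + c ^ n * (2 * w * g1 / S ^ 2 + g2))"

text \<open>Derivatives of the difference between the second derivative of the elementary part and
  the part itself. The last branch is the value for \<open>n = 3\<close> and \<open>i = 0\<close>
  only, hence the condition \<open>n < 3\<close> wherever this difference is differentiated.\<close>

definition hW :: "nat \<Rightarrow> nat \<Rightarrow> real \<Rightarrow> real" where
  "hW i n s = - kk *
     (if n = 0 then (if i = 0 then sinh s / cosh s else if i = 1 then 1 / cosh s ^ 2 else - 2 * sinh s / cosh s ^ 3)
      else if n = 1 then (if i = 0 then 1 else 0)
      else if n = 2 then (if i = 0 then coth s else if i = 1 then - 1 / sinh s ^ 2 else 2 * coth s / sinh s ^ 2)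
      else coth s ^ 2)"

text \<open>\<open>hU 0 n\<close> is \<open>N\<^sup>n\<close> applied to the \<open>w\<close>-independent part of \<open>L\<close>, where \<open>N\<close> is the operator
  with \<open>N (cosh - r sinh) = r (cosh - r sinh)\<close>; the first index counts derivatives.
  Both \<open>hU\<close> and \<open>MM\<close> use that the difference of second derivative and function is elementary.\<close>

fun hU :: "nat \<Rightarrow> nat \<Rightarrow> real \<Rightarrow> real" where
  "hU 0 n s = kk * (if n = 0 then 2 * At s * cosh s else if n = 1 then 1
     else if n = 2 then lam s * sinh s else 2 - lam s * cosh s)"
| "hU (Suc 0) n s = kk * (if n = 0 then 2 * At s * sinh s - 1 else if n = 1 then 0
     else if n = 2 then lam s * cosh s - 1 else coth s - lam s * sinh s)"
| "hU (Suc (Suc i)) n s = hU i n s + hW i n s"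

fun MM :: "nat \<Rightarrow> nat \<Rightarrow> real \<Rightarrow> real \<Rightarrow> real" where
  "MM 0 n s w = M0 n s w"
| "MM (Suc 0) n s w = M1 n s w"
| "MM (Suc (Suc i)) n s w = MM i n s w + KG i n s w"

lemma M2_eq: "M2 n s w = M0 n s w + KG 0 n s w"
  by (simp add: M2_def KG_def Let_def)

lemma DERIV_power_const: "(f has_real_derivative D) (at s) \<Longrightarrow> ((\<lambda>s. f s ^ n) has_real_derivative real n * f s ^ (n - 1) * D) (at s)"
  by (auto intro!: derivative_eq_intros)

lemma inv_sinh_sq_deriv: assumes "s > 0" shows "((\<lambda>s. 1 / sinh s ^ 2) has_real_derivative - 2 * coth s / sinh s ^ 2) (at s)"
proof -
  have "((\<lambda>s. 1 / sinh s ^ 2) has_real_derivative - (2 * sinh s * cosh s) / (sinh s ^ 2 * sinh s ^ 2)) (at s)"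
    using assms by (auto intro!: derivative_eq_intros simp: power2_eq_square)
  also have "- (2 * sinh s * cosh s) / (sinh s ^ 2 * sinh s ^ 2) = - 2 * coth s / sinh s ^ 2"
    using assms by (simp add: coth_def power2_eq_square)
  finally show ?thesis .
qed

lemma inv_cosh_sq_deriv: "((\<lambda>s::real. 1 / cosh s ^ 2) has_real_derivative - 2 * sinh s / cosh s ^ 3) (at s)"
proof -
  have C: "cosh s \<noteq> 0" by (simp add: cosh_real_pos less_imp_neq[symmetric])
  have "((\<lambda>s::real. 1 / cosh s ^ 2) has_real_derivative - (2 * cosh s * sinh s) / (cosh s ^ 2 * cosh s ^ 2)) (at s)"
    using C by (auto intro!: derivative_eq_intros simp: power2_eq_square)
  also have "- (2 * cosh s * sinh s) / (cosh s ^ 2 * cosh s ^ 2) = - 2 * sinh s / cosh s ^ 3"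
    using C by (simp add: eval_nat_numeral)
  finally show ?thesis .
qed

lemma hW_deriv: assumes s: "s > 0" and i: "i < 2" and n: "n < 3"
  shows "(hW i n has_real_derivative hW (Suc i) n s) (at s)"
proof -
  have C: "cosh s \<noteq> 0" by (simp add: cosh_real_pos less_imp_neq[symmetric])
  have C2: "cosh s ^ 2 = sinh s ^ 2 + 1" by (rule cosh_sq)
  have t: "((\<lambda>s. sinh s / cosh s) has_real_derivative 1 / cosh s ^ 2) (at s)"
  proof -
    have "((\<lambda>s. sinh s / cosh s) has_real_derivative (cosh s * cosh s - sinh s * sinh s) / (cosh s * cosh s)) (at s)"
      using C by (auto intro!: derivative_eq_intros)
    thus ?thesis using C2 by (simp add: power2_eq_square)
  qed
  have i2: "((\<lambda>s. - 1 / sinh s ^ 2) has_real_derivative 2 * coth s / sinh s ^ 2) (at s)"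
    using DERIV_minus[OF inv_sinh_sq_deriv[OF s]] by simp
  have "i = 0 \<or> i = 1" "n = 0 \<or> n = 1 \<or> n = 2" using i n by auto
  thus ?thesis
    using DERIV_cmult[OF t, of "- kk"] DERIV_cmult[OF inv_cosh_sq_deriv[of s], of "- kk"]
      DERIV_cmult[OF coth_deriv[OF s], of "- kk"] DERIV_cmult[OF i2, of "- kk"]
    by (elim disjE) (simp_all add: hW_def[abs_def])
qed

lemma KG_deriv: assumes s: "s > 0" and i: "i < 2"
  shows "((\<lambda>s. KG i n s w) has_real_derivative KG (Suc i) n s w) (at s)"
proof -
  define E where "E = (\<lambda>s. exp (- 2 * w * coth s))"
  define g1 where "g1 = (\<lambda>s. 2 * w * Gam s * (1 / sinh s ^ 2) + (- 6 * coth s * Gam s + kk * (1 / cosh s ^ 2)))"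
  have dE: "(E has_real_derivative E s * (2 * w * (1 / sinh s ^ 2))) (at s)"
    unfolding E_def by (rule derivative_eq_intros coth_deriv[OF s] refl)+ simp
  have dG: "(Gam has_real_derivative - 6 * coth s * Gam s + kk * (1 / cosh s ^ 2)) (at s)"
    using Gam_deriv[OF s] by (simp add: coth_def)
  have dg1: "(g1 has_real_derivative (2 * w * (- 6 * coth s * Gam s + kk * (1 / cosh s ^ 2))) * (1 / sinh s ^ 2) + - 2 * coth s / sinh s ^ 2 * (2 * w * Gam s)
     + ((- 6 * (- 1 / sinh s ^ 2)) * Gam s + (- 6 * coth s * Gam s + kk * (1 / cosh s ^ 2)) * (- 6 * coth s) + kk * (- 2 * sinh s / cosh s ^ 3))) (at s)"
    unfolding g1_def by (intro DERIV_add DERIV_mult DERIV_cmult dG inv_sinh_sq_deriv[OF s] inv_cosh_sq_deriv coth_deriv[OF s])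
  have dc: "((\<lambda>s. coth s ^ m) has_real_derivative real m * coth s ^ (m - 1) * (- 1 / sinh s ^ 2)) (at s)" for m
    by (rule DERIV_power_const[OF coth_deriv[OF s]])
  consider "i = 0" | "i = 1" using i by linarith
  thus ?thesis
  proof cases
    case 1
    have "((\<lambda>s. E s * (coth s ^ n * Gam s)) has_real_derivative KG 1 n s w) (at s)"
      by (rule DERIV_cong[OF DERIV_mult[OF dE DERIV_mult[OF dc dG]]])
        (simp add: KG_def Let_def E_def algebra_simps)
    thus ?thesis using 1 by (simp add: KG_def[abs_def] Let_def E_def)
  next
    case 2
    have "((\<lambda>s. E s * (- real n * (coth s ^ (n - 1) * (1 / sinh s ^ 2) * Gam s) + coth s ^ n * g1 s)) has_real_derivative KG 2 n s w) (at s)"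
    proof (rule DERIV_cong[OF DERIV_mult[OF dE DERIV_add[OF DERIV_cmult[OF DERIV_mult[OF DERIV_mult[OF dc inv_sinh_sq_deriv[OF s]] dG]] DERIV_mult[OF dc dg1]]]])
      define a where "a = 1 / sinh s ^ 2"
      define b where "b = 1 / cosh s ^ 2"
      define t where "t = sinh s / cosh s ^ 3"
      have sub: "x / sinh s ^ 2 = x * a" "x / sinh s ^ 4 = x * a ^ 2" "x / cosh s ^ 2 = x * b" "2 * x * sinh s / cosh s ^ 3 = 2 * x * t" "(- 2 * sinh s / cosh s ^ 3) = - 2 * t" for x
        by (simp_all add: a_def b_def t_def power_divide power_mult[symmetric])
      consider "n = 0" | "n = 1" | l where "n = Suc (Suc l)" by (cases n; cases "n - 1") auto
      thus "E s * (2 * w * (1 / sinh s ^ 2)) * (- real n * (coth s ^ (n - 1) * (1 / sinh s ^ 2) * Gam s) + coth s ^ n * g1 s)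
       + (- real n * ((real (n - 1) * coth s ^ (n - 1 - 1) * (- 1 / sinh s ^ 2) * (1 / sinh s ^ 2) + - 2 * coth s / sinh s ^ 2 * coth s ^ (n - 1)) * Gam s
          + (- 6 * coth s * Gam s + kk * (1 / cosh s ^ 2)) * (coth s ^ (n - 1) * (1 / sinh s ^ 2)))
        + (real n * coth s ^ (n - 1) * (- 1 / sinh s ^ 2) * g1 s + (2 * w * (- 6 * coth s * Gam s + kk * (1 / cosh s ^ 2)) * (1 / sinh s ^ 2) + - 2 * coth s / sinh s ^ 2 * (2 * w * Gam s)
     + (- 6 * (- 1 / sinh s ^ 2) * Gam s + (- 6 * coth s * Gam s + kk * (1 / cosh s ^ 2)) * (- 6 * coth s) + kk * (- 2 * sinh s / cosh s ^ 3))) * coth s ^ n)) * E s = KG 2 n s w"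
        unfolding KG_def Let_def g1_def E_def sub
        by cases (simp_all add: algebra_simps power2_eq_square)
    qed
    moreover have "(\<lambda>s. KG 1 n s w) = (\<lambda>s. E s * (- real n * (coth s ^ (n - 1) * (1 / sinh s ^ 2) * Gam s) + coth s ^ n * g1 s))"
      by (auto simp: fun_eq_iff KG_def Let_def E_def g1_def)
    ultimately show ?thesis using 2 by (simp add: numeral_2_eq_2)
  qed
qed

lemma hU_deriv:
  assumes s: "s > 0" and i: "i < 2 \<or> (i < 4 \<and> n < 3)"
  shows "(hU i n has_real_derivative hU (Suc i) n s) (at s)"
proof -
  have S: "sinh s \<noteq> 0" "cosh s \<noteq> 0" using s by (auto simp: cosh_real_pos)
  have C2: "cosh s ^ 2 = sinh s ^ 2 + 1" by (rule cosh_sq)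
  note d = At_deriv[of s] lam_deriv[OF s] coth_deriv[OF s]
  have h0: "(hU 0 m has_real_derivative hU 1 m s) (at s)" for m
  proof -
    have 1: "((\<lambda>s. kk * (2 * At s * cosh s)) has_real_derivative kk * (2 * At s * sinh s - 1)) (at s)"
      by (rule DERIV_cong, (rule DERIV_cmult DERIV_mult DERIV_diff DERIV_const d dcosh dsinh)+) (use S in \<open>simp add: field_simps\<close>)
    have 2: "((\<lambda>s. kk * (lam s * sinh s)) has_real_derivative kk * (lam s * cosh s - 1)) (at s)"
      by (rule DERIV_cong, (rule DERIV_cmult DERIV_mult DERIV_diff DERIV_const d dcosh dsinh)+) (use S in \<open>simp add: field_simps\<close>)
    have 3: "((\<lambda>s. kk * (2 - lam s * cosh s)) has_real_derivative kk * (coth s - lam s * sinh s)) (at s)"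
      by (rule DERIV_cong, (rule DERIV_cmult DERIV_mult DERIV_diff DERIV_const d dcosh dsinh)+) (use S in \<open>simp add: field_simps coth_def\<close>)
    show ?thesis using 1 2 3 by (cases "m = 0"; cases "m = 1"; cases "m = 2") (simp_all add: hU.simps[abs_def])
  qed
  have h1: "(hU 1 m has_real_derivative hU 2 m s) (at s)" for m
  proof -
    have 1: "((\<lambda>s. kk * (2 * At s * sinh s - 1)) has_real_derivative kk * (2 * At s * cosh s) + - kk * (sinh s / cosh s)) (at s)"
      by (rule DERIV_cong, (rule DERIV_cmult DERIV_mult DERIV_diff DERIV_const d dcosh dsinh)+) (use S in \<open>simp add: field_simps\<close>)
    have 2: "((\<lambda>s. kk * (lam s * cosh s - 1)) has_real_derivative kk * (lam s * sinh s) + - kk * coth s) (at s)"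
      by (rule DERIV_cong, (rule DERIV_cmult DERIV_mult DERIV_diff DERIV_const d dcosh dsinh)+) (use S in \<open>simp add: field_simps coth_def\<close>)
    have "coth s ^ 2 = 1 + 1 / sinh s ^ 2"
      using S C2 by (simp add: coth_def power_divide field_simps)
    hence 3: "((\<lambda>s. kk * (coth s - lam s * sinh s)) has_real_derivative kk * (2 - lam s * cosh s) + - kk * coth s ^ 2) (at s)"
      by (rule_tac DERIV_cong, (rule_tac DERIV_cmult DERIV_mult DERIV_diff DERIV_const d dcosh dsinh)+) (use S in \<open>simp add: field_simps coth_def\<close>)
    show ?thesis using 1 2 3
      by (cases "m = 0"; cases "m = 1"; cases "m = 2") (simp_all add: hU.simps[abs_def] numeral_2_eq_2 hW_def)
  qed
  show ?thesis
  proof (cases "i < 2")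
    case True
    hence "i = 0 \<or> i = 1" by auto
    thus ?thesis using h0 h1 by (auto simp: numeral_2_eq_2)
  next
    case False
    hence n: "n < 3" and "i = 2 \<or> i = 3" using i by auto
    thus ?thesis
    proof (elim disjE)
      assume "i = 2"
      thus ?thesis using DERIV_add[OF h0[of n] hW_deriv[OF s _ n, of 0]]
        by (simp add: eval_nat_numeral hU.simps(3)[abs_def])
    next
      assume "i = 3"
      thus ?thesis using DERIV_add[OF h1[of n] hW_deriv[OF s _ n, of 1]]
        by (simp add: eval_nat_numeral hU.simps(3)[abs_def])
    qed
  qed
qed

lemma MM_deriv: assumes s: "s > 0" and i: "i < 4"
  shows "((\<lambda>s. MM i n s w) has_real_derivative MM (Suc i) n s w) (at s)"
proof -
  have 0: "((\<lambda>s. M0 n s w) has_real_derivative M1 n s w) (at s)" by (rule M0_deriv[OF s])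
  have 1: "((\<lambda>s. M1 n s w) has_real_derivative M0 n s w + KG 0 n s w) (at s)"
    using M1_deriv[OF s, of n w] by (simp add: M2_eq)
  consider "i = 0" | "i = 1" | "i = 2" | "i = 3" using i by linarith
  thus ?thesis
    using 0 1 DERIV_add[OF 0 KG_deriv[OF s, of 0 n w]] DERIV_add[OF 1 KG_deriv[OF s, of 1 n w]]
    by cases (simp_all add: eval_nat_numeral)
qed

lemma MM_has_derivative:
  assumes "(f has_derivative f') (at q)" "(g has_derivative g') (at q)" "f q > 0" "i < 2"
  shows "((\<lambda>q. MM i n (f q) (g q)) has_derivative (\<lambda>h. MM (Suc i) n (f q) (g q) * f' h - 2 * MM i (n+1) (f q) (g q) * g' h)) (at q)"
proof (cases "i = 0")
  case True thus ?thesis using M0_has_derivative[OF assms(1-3)] by simp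
next
  case False hence "i = 1" using assms by simp
  thus ?thesis using M1_has_derivative[OF assms(1-3)] by (simp add: M2_eq)
qed

lemma hU_has_derivative:
  assumes "(f has_derivative f') (at q)" "f q > 0" "i < 2"
  shows "((\<lambda>q. hU i n (f q)) has_derivative (\<lambda>h. hU (Suc i) n (f q) * f' h)) (at q)"
  using has_derivative_compose[OF assms(1) hU_deriv[OF assms(2) disjI1[OF assms(3)], unfolded has_field_derivative_def], of n] .

lemma Gam_isCont: "s > 0 \<Longrightarrow> isCont Gam s"
  using Gam_deriv[THEN DERIV_isCont] .

lemma M0_isCont: assumes "s > 0" shows "isCont (\<lambda>p. M0 n (fst p) (snd p)) (s, w)"
  using has_derivative_continuous[OF M0_has_derivative[OF has_derivative_fst[OF has_derivative_ident] has_derivative_snd[OF has_derivative_ident], of "(s, w)" n]] assms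
  by simp

lemma M1_isCont: assumes "s > 0" shows "isCont (\<lambda>p. M1 n (fst p) (snd p)) (s, w)"
  using has_derivative_continuous[OF M1_has_derivative[OF has_derivative_fst[OF has_derivative_ident] has_derivative_snd[OF has_derivative_ident], of "(s, w)" n]] assms
  by simp

lemma coth_isCont: "s > 0 \<Longrightarrow> isCont coth s"
  using coth_deriv[THEN DERIV_isCont] .

lemma M2_isCont: assumes "s > 0" shows "isCont (\<lambda>p. M2 n (fst p) (snd p)) (s, w)"
  unfolding M2_def
  by (intro continuous_intros M0_isCont assms isCont_o2[where f=fst and g=coth] isCont_o2[where f=fst and g=Gam])
    (use assms coth_isCont Gam_isCont in auto)

lemma MM_isCont: assumes "s > 0" "i \<le> 2" shows "isCont (\<lambda>p. MM i n (fst p) (snd p)) (s, w)"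
proof -
  have "i = 0 \<or> i = 1 \<or> i = 2" using assms by auto
  thus ?thesis using M0_isCont[OF assms(1)] M1_isCont[OF assms(1)] M2_isCont[OF assms(1)]
    by (elim disjE) (simp_all add: numeral_2_eq_2 M2_eq)
qed

lemma hU_isCont: assumes s: "s > 0" "i \<le> 2" shows "isCont (hU i n) s"
proof (cases "i < 2")
  case True thus ?thesis using hU_deriv[OF s(1) disjI1[OF True], THEN DERIV_isCont] by simp
next
  case False
  hence i: "i = Suc (Suc 0)" using s by simp
  have S: "sinh s \<noteq> 0" "cosh s \<noteq> 0" using s by (auto simp: cosh_real_pos)
  have "isCont (hU 0 n) s" using hU_deriv[OF s(1) disjI1, of 0, THEN DERIV_isCont] by simp
  moreover have "isCont (hW 0 n) s"
    unfolding hW_def[abs_def] using S coth_isCont[OF s(1)]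
    by (cases "n = 0"; cases "n = 1"; cases "n = 2") (auto intro!: continuous_intros)
  ultimately show ?thesis unfolding i hU.simps(3)[abs_def] by (rule continuous_add)
qed

section \<open>Decay of the moment terms at infinity\<close>

lemma mom_lin_has_integral:
  "((\<lambda>r. (a + b * r) * wgt n w r) has_integral (a * mom n x w + b * mom (n + 1) x w)) {1..x}"
proof -
  have "((\<lambda>r. a * wgt n w r + b * wgt (n + 1) w r) has_integral (a * mom n x w + b * mom (n + 1) x w)) {1..x}"
    unfolding mom_def by (intro has_integral_add has_integral_mult_right integrable_integral wgt_integrable)
  moreover have "(\<lambda>r. a * wgt n w r + b * wgt (n + 1) w r) = (\<lambda>r. (a + b * r) * wgt n w r)"
    by (auto simp: fun_eq_iff wgt_def algebra_simps)
  ultimately show ?thesis by simp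
qed

lemma mom_lin_bounds:
  assumes "\<And>r. 1 \<le> r \<Longrightarrow> r \<le> x \<Longrightarrow> 0 \<le> a + b * r \<and> a + b * r \<le> B"
  shows "0 \<le> a * mom n x w + b * mom (n + 1) x w" "a * mom n x w + b * mom (n + 1) x w \<le> B * mom n x w"
proof -
  have w: "wgt n w r \<ge> 0" if "r \<ge> 1" for r
    unfolding wgt_def using that dens_nonneg[OF that] by simp
  show "0 \<le> a * mom n x w + b * mom (n + 1) x w"
    by (rule has_integral_nonneg[OF mom_lin_has_integral]) (use w assms in auto)
  have "((\<lambda>r. B * wgt n w r) has_integral B * mom n x w) {1..x}"
    unfolding mom_def by (intro has_integral_mult_right integrable_integral wgt_integrable)
  thus "a * mom n x w + b * mom (n + 1) x w \<le> B * mom n x w"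
    by (rule has_integral_le[OF mom_lin_has_integral]) (use w assms in \<open>auto intro!: mult_right_mono\<close>)
qed

text \<open>On \<open>[1, coth s]\<close> the mode decreases in \<open>r\<close> from
  \<open>exp (- s)\<close> to 0. Since the interval also shrinks to a point,
  \<open>exp s * M0\<close> tends to 0, which is exactly the decay that \<open>ode_nonneg\<close>
  demands.\<close>

lemma M0_bounds: assumes s: "s > 0"
  shows "0 \<le> M0 n s w" "exp s * M0 n s w \<le> mom n (coth s) w"
proof -
  have S: "sinh s > 0" using s by simp
  have b: "0 \<le> cosh s + (- sinh s) * r \<and> cosh s + (- sinh s) * r \<le> exp (- s)" if "1 \<le> r" "r \<le> coth s" for r
  proof -
    have "sinh s * 1 \<le> sinh s * r" using that S by (intro mult_left_mono) auto
    moreover have "sinh s * r \<le> sinh s * coth s" using that S by (intro mult_left_mono) auto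
    moreover have "sinh s * coth s = cosh s" using S by (simp add: coth_def)
    ultimately show ?thesis using cosh_minus_sinh[of s] by (intro conjI) linarith+
  qed
  show "0 \<le> M0 n s w" using mom_lin_bounds(1)[of "coth s", OF b] by (simp add: M0_def)
  have "M0 n s w \<le> exp (- s) * mom n (coth s) w" using mom_lin_bounds(2)[of "coth s", OF b] by (simp add: M0_def)
  hence "exp s * M0 n s w \<le> exp s * (exp (- s) * mom n (coth s) w)" by (intro mult_left_mono) auto
  thus "exp s * M0 n s w \<le> mom n (coth s) w" by (simp add: mult.assoc[symmetric] exp_add[symmetric])
qed

lemma M1_bounds: assumes s: "s > 0"
  shows "0 \<le> - M1 n s w" "- M1 n s w \<le> 1 / sinh s * mom n (coth s) w"
proof -
  have S: "sinh s > 0" using s by simp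
  have b: "0 \<le> - sinh s + cosh s * r \<and> - sinh s + cosh s * r \<le> 1 / sinh s" if "1 \<le> r" "r \<le> coth s" for r
  proof -
    have "cosh s * 1 \<le> cosh s * r" using that by (intro mult_left_mono) auto
    moreover have "cosh s * r \<le> cosh s * coth s" using that by (intro mult_left_mono) auto
    moreover have "cosh s * coth s - sinh s = 1 / sinh s"
      using S cosh_sq[of s] by (simp add: coth_def field_simps power2_eq_square)
    moreover have "sinh s < cosh s" by (simp add: sinh_def cosh_def)
    ultimately show ?thesis by (intro conjI) linarith+
  qed
  show "0 \<le> - M1 n s w" using mom_lin_bounds(1)[of "coth s", OF b] by (simp add: M1_def)
  show "- M1 n s w \<le> 1 / sinh s * mom n (coth s) w" using mom_lin_bounds(2)[of "coth s", OF b] by (simp add: M1_def)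
qed

lemma M0_lim: "((\<lambda>s. exp s * M0 n s w) \<longlongrightarrow> 0) at_top"
proof (rule tendsto_sandwich[OF _ _ tendsto_const mom_tendsto_0[of n w]])
  show "eventually (\<lambda>s. 0 \<le> exp s * M0 n s w) at_top"
    using eventually_gt_at_top[of 0] by eventually_elim (simp add: M0_bounds)
  show "eventually (\<lambda>s. exp s * M0 n s w \<le> mom n (cosh s / sinh s) w) at_top"
    using eventually_gt_at_top[of 0] by eventually_elim (use M0_bounds(2) in \<open>simp add: coth_def\<close>)
qed

lemma M1_lim: "((\<lambda>s. exp s * M1 n s w) \<longlongrightarrow> 0) at_top"
proof -
  have "((\<lambda>s::real. exp s / sinh s) \<longlongrightarrow> 2) at_top" by real_asymp
  from tendsto_mult[OF this mom_tendsto_0[of n w]]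
  have l: "((\<lambda>s. exp s / sinh s * mom n (cosh s / sinh s) w) \<longlongrightarrow> 0) at_top" by simp
  have "((\<lambda>s. exp s * - M1 n s w) \<longlongrightarrow> 0) at_top"
  proof (rule tendsto_sandwich[OF _ _ tendsto_const l])
    show "eventually (\<lambda>s. 0 \<le> exp s * - M1 n s w) at_top"
      using eventually_gt_at_top[of 0]
      by eventually_elim (intro mult_nonneg_nonneg M1_bounds(1), auto)
    show "eventually (\<lambda>s. exp s * - M1 n s w \<le> exp s / sinh s * mom n (cosh s / sinh s) w) at_top"
      using eventually_gt_at_top[of 0]
    proof eventually_elim
      case (elim s)
      have "exp s * - M1 n s w \<le> exp s * (1 / sinh s * mom n (coth s) w)"
        by (intro mult_left_mono M1_bounds(2) elim) auto
      thus ?case by (simp add: coth_def)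
    qed
  qed
  from tendsto_minus[OF this] show ?thesis by simp
qed

section \<open>The defect as a bilinear hyperbolic form\<close>

text \<open>A pair of booleans indexes the products of \<open>cosh\<close> (False) and \<open>sinh\<close> (True) of \<open>s0\<close> and \<open>s1\<close>;
  \<open>nb a b\<close> is the power of \<open>r\<close> occurring in the coefficient of such a product. In \<open>Xgen\<close> the indices
  \<open>i\<close> and \<open>j\<close> count derivatives in \<open>s\<close> and \<open>w\<close>, and \<open>\<tau>\<close> is \<open>1\<close> for \<open>q\<^sub>4 \<ge> q\<^sub>2\<close> and \<open>- 1\<close> for \<open>q\<^sub>4 \<le> q\<^sub>2\<close>.\<close>

definition nb :: "bool \<Rightarrow> bool \<Rightarrow> nat" where "nb a b = of_bool a + of_bool b"
definition sg :: "bool \<Rightarrow> real" where "sg a = (if a then -1 else 1)"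

definition Xgen :: "real \<Rightarrow> (nat \<Rightarrow> nat \<Rightarrow> real \<Rightarrow> real) \<Rightarrow> (nat \<Rightarrow> nat \<Rightarrow> real \<Rightarrow> real \<Rightarrow> real) \<Rightarrow>
    nat \<Rightarrow> nat \<Rightarrow> bool \<Rightarrow> bool \<Rightarrow> real \<Rightarrow> real \<Rightarrow> real" where
  "Xgen \<tau> H M i j a b s w = sg a * sg b *
     ((if j = 0 then (if a then \<tau> else 1) * H i (nb a b) s else 0) + (- 2) ^ j * M i (nb a b + j) s w)"

definition val :: "(bool \<Rightarrow> bool \<Rightarrow> real) \<Rightarrow> real \<Rightarrow> real \<Rightarrow> real" where
  "val Y s0 s1 = (Y False False * cosh s1 + Y False True * sinh s1) * cosh s0
     + (Y True False * cosh s1 + Y True True * sinh s1) * sinh s0"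

text \<open>Coefficients of \<open>f\<close> minus its second derivative in a direction with
  components \<open>ew, e0, e1, e2\<close> along \<open>w, s0, s1, s\<close>. Differentiating in
  \<open>s0\<close> or \<open>s1\<close> exchanges \<open>cosh\<close> and \<open>sinh\<close>,
  which negates the corresponding boolean; doing so twice restores it, hence
  \<open>1 - e0^2 - e1^2\<close>.\<close>

definition dfc :: "real \<times> real \<times> real \<times> real \<Rightarrow> (nat \<Rightarrow> nat \<Rightarrow> bool \<Rightarrow> bool \<Rightarrow> real \<Rightarrow> real \<Rightarrow> real) \<Rightarrow>
    nat \<Rightarrow> bool \<Rightarrow> bool \<Rightarrow> real \<Rightarrow> real \<Rightarrow> real" where
  "dfc e X i a b s w = (case e of (ew, e0, e1, e2) \<Rightarrow>
     (1 - e0^2 - e1^2) * X i 0 a b s w - e2^2 * X (Suc (Suc i)) 0 a b s w - 2 * e2 * ew * X (Suc i) 1 a b s w - ew^2 * X i 2 a b s w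
     - 2 * e0 * (e2 * X (Suc i) 0 (\<not> a) b s w + ew * X i 1 (\<not> a) b s w)
     - 2 * e1 * (e2 * X (Suc i) 0 a (\<not> b) s w + ew * X i 1 a (\<not> b) s w)
     - 2 * e0 * e1 * X i 0 (\<not> a) (\<not> b) s w)"

definition dfv :: "real \<times> real \<times> real \<times> real \<Rightarrow> real \<Rightarrow> nat \<Rightarrow> real \<Rightarrow> real \<Rightarrow> real \<Rightarrow> real \<Rightarrow> real" where
  "dfv e \<tau> i s0 s1 s w = val (\<lambda>a b. dfc e (Xgen \<tau> hU MM) i a b s w) s0 s1"

section \<open>The inhomogeneity in algebraic variables\<close>

lemma bool_pair_cases: "P False False \<Longrightarrow> P False True \<Longrightarrow> P True False \<Longrightarrow> P True True \<Longrightarrow> P a b"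
  by (cases a; cases b) auto

text \<open>The endpoint terms with \<open>coth\<close>, \<open>1 / sinh^2\<close>,
  \<open>tanh\<close>, the exponential and \<open>Gam\<close> as independent letters. Only
  \<open>P = c^2 - 1\<close> and \<open>q * c = 1\<close> relate them, so identities for
  \<open>W\<close> become polynomial.\<close>

definition KGp :: "nat \<Rightarrow> nat \<Rightarrow> real \<Rightarrow> real \<Rightarrow> real \<Rightarrow> real \<Rightarrow> real \<Rightarrow> real \<Rightarrow> real" where
  "KGp i n c P q w E G = E * (let
     G1 = - 6 * c * G + kk * P * q ^ 2; g1 = 2 * w * G * P + G1;
     g2 = 2 * w * G1 * P - 4 * w * c * G * P + 6 * G * P - 6 * c * G1 - 2 * kk * P * q ^ 3 in
     if i = 0 then c ^ n * G
     else if i = 1 then - real n * c ^ (n - 1) * P * G + c ^ n * g1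
     else real n * real (n - 1) * c ^ (n - 2) * P ^ 2 * G + 2 * real n * c ^ n * P * G
       - 2 * real n * c ^ (n - 1) * P * g1 + c ^ n * (2 * w * g1 * P + g2))"

definition hWp :: "nat \<Rightarrow> nat \<Rightarrow> real \<Rightarrow> real \<Rightarrow> real \<Rightarrow> real" where
  "hWp i n c P q = - kk *
     (if n = 0 then (if i = 0 then q else if i = 1 then P * q ^ 2 else - 2 * P * q ^ 3)
      else if n = 1 then (if i = 0 then 1 else 0)
      else if n = 2 then (if i = 0 then c else if i = 1 then - P else 2 * c * P)
      else c ^ 2)"

lemma KG_p:
  fixes s w :: real
  assumes s: "s > 0"
  defines "c \<equiv> coth s" and "P \<equiv> 1 / sinh s ^ 2" and "q \<equiv> sinh s / cosh s" and "E \<equiv> exp (- 2 * w * coth s)" and "G \<equiv> Gam s"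
  shows "KG i n s w = KGp i n c P q w E G" "hW i n s = hWp i n c P q" "P = c^2 - 1" "q * c = 1"
proof -
  have z: "sinh s \<noteq> 0" "cosh s \<noteq> 0" using s by (auto simp: cosh_real_pos)
  have e: "x / sinh s ^ 2 = x * P" "x / sinh s ^ 4 = x * P ^ 2" "x / cosh s ^ 2 = x * P * q ^ 2" "2 * x * sinh s / cosh s ^ 3 = 2 * x * P * q ^ 3"
    "- 2 * sinh s / cosh s ^ 3 = - 2 * P * q ^ 3" for x
    using z by (simp_all add: P_def q_def power_divide field_simps eval_nat_numeral)
  show "KG i n s w = KGp i n c P q w E G"
    unfolding KG_def KGp_def Let_def e unfolding E_def c_def G_def ..
  show "hW i n s = hWp i n c P q"
    unfolding hW_def hWp_def e c_def[symmetric] q_def[symmetric] by simp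
  show "P = c^2 - 1" using z cosh_sq[of s] by (simp add: P_def c_def coth_def power_divide field_simps)
  show "q * c = 1" using z by (simp add: q_def c_def coth_def)
qed

lemma dfc_W:
  fixes s w :: real
  assumes s: "s > 0"
  defines "c \<equiv> coth s" and "P \<equiv> 1 / sinh s ^ 2" and "q \<equiv> sinh s / cosh s" and "E \<equiv> exp (- 2 * w * coth s)" and "G \<equiv> Gam s"
  shows "dfc e (Xgen \<tau> hW KG) i a b s w = dfc e (Xgen \<tau> (\<lambda>i n s. hWp i n c P q) (\<lambda>i n s w. KGp i n c P q w E G)) i a b s w"
  unfolding dfc_def Xgen_def KG_p[OF s] c_def P_def q_def E_def G_def ..

text \<open>The inhomogeneity \<open>W\<close> for the two reference directions: the suffix h stands
  for control 01110, the suffix p for 00001. The letter A is the coefficient of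
  \<open>cosh s0 * cosh s1\<close>, the letter B that of \<open>sinh s0 * cosh s1\<close> in the
  second region.\<close>

definition Ah :: "real \<Rightarrow> real \<Rightarrow> real \<Rightarrow> real \<Rightarrow> real \<Rightarrow> real \<Rightarrow> real" where
  "Ah c P q w E G = (1 - E) * kk * P^2 * q^3 / 2 + E * (G * (3*w*c*P - w^2*P^2) - kk*w*P^2*q^2)"
definition Bh :: "real \<Rightarrow> real \<Rightarrow> real \<Rightarrow> real \<Rightarrow> real \<Rightarrow> real \<Rightarrow> real" where
  "Bh c P q w E G = (1 - E) * kk * P^2 * q^2 / 2 + E * (G * (4*c*P - w*(3*P + 5*P^2) + w^2*c*P^2) + kk*w*P^2*q)"
definition Ap :: "real \<Rightarrow> real \<Rightarrow> real \<Rightarrow> real \<Rightarrow> real \<Rightarrow> real \<Rightarrow> real" where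
  "Ap c P q w E G = (1 - E) * kk * P^2 * q^3 / 2 + E * (2*kk*P*q - G*(8 + 10*P) + 7*w*c*P*G - kk*w*P^2*q^2 - w^2*G*P^2)"
definition Bp :: "real \<Rightarrow> real \<Rightarrow> real \<Rightarrow> real \<Rightarrow> real \<Rightarrow> real \<Rightarrow> real" where
  "Bp c P q w E G = (1 - E) * kk * P^2 * q^2 / 2 + E * (G*(8*c + 18*c*P) - 2*kk*P + w*(- 7*G*P - 9*G*P^2 + kk*P^2*q) + w^2*G*c*P^2)"

text \<open>The pattern of the values is a factorisation: \<open>W\<close> is
  \<open>cosh s1 - c * sinh s1\<close> times a form in \<open>s0\<close>, and for
  \<open>\<tau> = 1\<close> this form is again a multiple of \<open>cosh s0 - c * sinh s0\<close>.
  All sign questions thereby reduce to \<open>Ah\<close>, \<open>Bh\<close>, \<open>Ap\<close> and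
  \<open>Bp\<close>.\<close>

lemma dfc_p:
  fixes c P q w E G s :: real
  assumes "P = c^2 - 1" "q * c = 1"
  defines "D \<equiv> \<lambda>e \<tau> a b. dfc e (Xgen \<tau> (\<lambda>i n s. hWp i n c P q) (\<lambda>i n s w. KGp i n c P q w E G)) 0 a b s w"
  shows "D (3/2, -1/2, -1/2, -1/2) 1 False False = Ah c P q w E G"
   "D (3/2, -1/2, -1/2, -1/2) 1 False True = - c * Ah c P q w E G"
   "D (3/2, -1/2, -1/2, -1/2) 1 True False = - c * Ah c P q w E G"
   "D (3/2, -1/2, -1/2, -1/2) 1 True True = c^2 * Ah c P q w E G"
   "D (-1/2, 1/2, 1/2, 1/2) 1 False False = Ap c P q w E G"
   "D (-1/2, 1/2, 1/2, 1/2) 1 False True = - c * Ap c P q w E G"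
   "D (-1/2, 1/2, 1/2, 1/2) 1 True False = - c * Ap c P q w E G"
   "D (-1/2, 1/2, 1/2, 1/2) 1 True True = c^2 * Ap c P q w E G"
   "D (1, 1/2, -1/2, -1/2) (-1) False False = Ah c P q w E G"
   "D (1, 1/2, -1/2, -1/2) (-1) False True = - c * Ah c P q w E G"
   "D (1, 1/2, -1/2, -1/2) (-1) True False = Bh c P q w E G"
   "D (1, 1/2, -1/2, -1/2) (-1) True True = - c * Bh c P q w E G"
   "D (0, -1/2, 1/2, 1/2) (-1) False False = Ap c P q w E G"
   "D (0, -1/2, 1/2, 1/2) (-1) False True = - c * Ap c P q w E G"
   "D (0, -1/2, 1/2, 1/2) (-1) True False = Bp c P q w E G"
   "D (0, -1/2, 1/2, 1/2) (-1) True True = - c * Bp c P q w E G"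
proof -
  have R: "c * q = 1" "c * (q * x) = x" for x
    using assms(2) by (simp_all add: mult.commute mult.assoc[symmetric])
  note defs = D_def dfc_def Xgen_def sg_def nb_def hWp_def KGp_def Let_def Ah_def Ap_def Bh_def Bp_def
  note sm = assms(1) algebra_simps power2_eq_square power3_eq_cube power4_eq_xxxx R
  show "D (3/2, -1/2, -1/2, -1/2) 1 False False = Ah c P q w E G" unfolding defs by (simp add: sm; simp add: field_simps)
  show "D (3/2, -1/2, -1/2, -1/2) 1 False True = - c * Ah c P q w E G" unfolding defs by (simp add: sm; simp add: field_simps)
  show "D (3/2, -1/2, -1/2, -1/2) 1 True False = - c * Ah c P q w E G" unfolding defs by (simp add: sm; simp add: field_simps)
  show "D (3/2, -1/2, -1/2, -1/2) 1 True True = c^2 * Ah c P q w E G" unfolding defs by (simp add: sm; simp add: field_simps)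
  show "D (-1/2, 1/2, 1/2, 1/2) 1 False False = Ap c P q w E G" unfolding defs by (simp add: sm; simp add: field_simps)
  show "D (-1/2, 1/2, 1/2, 1/2) 1 False True = - c * Ap c P q w E G" unfolding defs by (simp add: sm; simp add: field_simps)
  show "D (-1/2, 1/2, 1/2, 1/2) 1 True False = - c * Ap c P q w E G" unfolding defs by (simp add: sm; simp add: field_simps)
  show "D (-1/2, 1/2, 1/2, 1/2) 1 True True = c^2 * Ap c P q w E G" unfolding defs by (simp add: sm; simp add: field_simps)
  show "D (1, 1/2, -1/2, -1/2) (-1) False False = Ah c P q w E G" unfolding defs by (simp add: sm; simp add: field_simps)
  show "D (1, 1/2, -1/2, -1/2) (-1) False True = - c * Ah c P q w E G" unfolding defs by (simp add: sm; simp add: field_simps)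
  show "D (1, 1/2, -1/2, -1/2) (-1) True False = Bh c P q w E G" unfolding defs by (simp add: sm; simp add: field_simps)
  show "D (1, 1/2, -1/2, -1/2) (-1) True True = - c * Bh c P q w E G" unfolding defs by (simp add: sm; simp add: field_simps)
  show "D (0, -1/2, 1/2, 1/2) (-1) False False = Ap c P q w E G" unfolding defs by (simp add: sm; simp add: field_simps)
  show "D (0, -1/2, 1/2, 1/2) (-1) False True = - c * Ap c P q w E G" unfolding defs by (simp add: sm; simp add: field_simps)
  show "D (0, -1/2, 1/2, 1/2) (-1) True False = Bp c P q w E G" unfolding defs by (simp add: sm; simp add: field_simps)
  show "D (0, -1/2, 1/2, 1/2) (-1) True True = - c * Bp c P q w E G" unfolding defs by (simp add: sm; simp add: field_simps)
qed

section \<open>The differential equation for the defect and its decay\<close>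

abbreviation X0 where "X0 \<tau> \<equiv> Xgen \<tau> hU MM"

lemma nb_less: "nb a b < 3" by (auto simp: nb_def)

lemma X0_deriv:
  assumes "s > 0" "i < 4"
  shows "((\<lambda>s. X0 \<tau> i j a b s w) has_real_derivative X0 \<tau> (Suc i) j a b s w) (at s)"
proof (cases "j = 0")
  case True
  show ?thesis unfolding Xgen_def if_P[OF True]
    using assms nb_less by (intro DERIV_cmult DERIV_add MM_deriv hU_deriv) auto
next
  case False
  have "((\<lambda>s. sg a * sg b * ((- 2) ^ j * MM i (nb a b + j) s w)) has_real_derivative sg a * sg b * ((- 2) ^ j * MM (Suc i) (nb a b + j) s w)) (at s)"
    by (intro DERIV_cmult MM_deriv assms)
  thus ?thesis unfolding Xgen_def if_not_P[OF False] by simp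
qed

lemma dfc_deriv:
  assumes "s > 0" "i < 2"
  shows "((\<lambda>s. dfc e (X0 \<tau>) i a b s w) has_real_derivative dfc e (X0 \<tau>) (Suc i) a b s w) (at s)"
proof -
  have i: "i < 4" "Suc i < 4" "Suc (Suc i) < 4" using assms by auto
  obtain ew e0 e1 e2 where e: "e = (ew, e0, e1, e2)" by (cases e)
  show ?thesis unfolding dfc_def e prod.case
    by (intro DERIV_diff DERIV_add DERIV_cmult X0_deriv assms i)
qed

lemma dfv_deriv:
  assumes "s > 0" "i < 2"
  shows "((\<lambda>s. dfv e \<tau> i s0 s1 s w) has_real_derivative dfv e \<tau> (Suc i) s0 s1 s w) (at s)"
  unfolding dfv_def val_def by (intro DERIV_add DERIV_cmult_right dfc_deriv assms)

lemma X0_Suc_Suc: "X0 \<tau> (Suc (Suc i)) j a b s w = X0 \<tau> i j a b s w + Xgen \<tau> hW KG i j a b s w"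
  by (simp add: Xgen_def algebra_simps)

text \<open>This is \<open>f'' - f = W\<close>: the defect is linear in the coefficients, and two
  derivatives add to each coefficient only its explicit term.\<close>

lemma dfv_2: "dfv e \<tau> (Suc (Suc 0)) s0 s1 s w = dfv e \<tau> 0 s0 s1 s w + val (\<lambda>a b. dfc e (Xgen \<tau> hW KG) 0 a b s w) s0 s1"
  by (cases e) (simp add: dfv_def val_def dfc_def X0_Suc_Suc algebra_simps)

lemma Gam_lim: "((\<lambda>s. exp s * Gam s) \<longlongrightarrow> 0) at_top"
proof (rule tendsto_sandwich[OF _ _ tendsto_const])
  show "eventually (\<lambda>s. 0 \<le> exp s * Gam s) at_top"
    using eventually_gt_at_top[of 0] by eventually_elim (simp add: Gam_bounds)
  show "eventually (\<lambda>s. exp s * Gam s \<le> exp s * (kk * sinh s / (cosh s * (4 * sinh s ^ 2 + 5)))) at_top"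
    using eventually_gt_at_top[of 0] by eventually_elim (intro mult_left_mono Gam_bounds, auto)
  show "((\<lambda>s. exp s * (kk * sinh s / (cosh s * (4 * sinh s ^ 2 + 5)))) \<longlongrightarrow> 0) at_top"
    using kk_pos by real_asymp
qed

lemma coth_lim: "(coth \<longlongrightarrow> 1) at_top"
  unfolding coth_def by real_asymp

lemma KG0_lim: "((\<lambda>s. exp s * KG 0 n s w) \<longlongrightarrow> 0) at_top"
proof -
  have "((\<lambda>s. exp (- 2 * w * coth s) * coth s ^ n * (exp s * Gam s)) \<longlongrightarrow> exp (- 2 * w * 1) * 1 ^ n * 0) at_top"
    by (intro tendsto_intros coth_lim Gam_lim)
  thus ?thesis by (simp add: KG_def mult_ac)
qed

lemma MM_lim: "i \<le> 2 \<Longrightarrow> ((\<lambda>s. exp s * MM i n s w) \<longlongrightarrow> 0) at_top"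
proof -
  assume "i \<le> 2"
  hence "i = 0 \<or> i = 1 \<or> i = Suc (Suc 0)" by auto
  thus ?thesis
    using M0_lim[of n w] M1_lim[of n w] tendsto_add[OF M0_lim[of n w] KG0_lim[of n w]]
    by (elim disjE) (simp_all add: distrib_left)
qed

lemma hU_lim: assumes "i \<le> 2" shows "((\<lambda>s. exp s * (hU i n s - (if i = 0 then kk else 0))) \<longlongrightarrow> 0) at_top"
proof -
  have *: "((\<lambda>s. kk * (exp s * g s)) \<longlongrightarrow> 0) at_top" if "((\<lambda>s. exp s * g s) \<longlongrightarrow> 0) at_top" for g :: "real \<Rightarrow> real"
    using tendsto_mult_left[OF that, of kk] by simp
  have a0: "((\<lambda>s. exp s * (2 * At s * cosh s - 1)) \<longlongrightarrow> 0) at_top" unfolding At_def by real_asymp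
  have a1: "((\<lambda>s. exp s * (2 * At s * sinh s - 1)) \<longlongrightarrow> 0) at_top" unfolding At_def by real_asymp
  have a2: "((\<lambda>s. exp s * (2 * At s * cosh s - sinh s / cosh s)) \<longlongrightarrow> 0) at_top" unfolding At_def by real_asymp
  have l0: "((\<lambda>s. exp s * (lam s * sinh s - 1)) \<longlongrightarrow> 0) at_top" unfolding lam_def by real_asymp
  have l1: "((\<lambda>s. exp s * (lam s * cosh s - 1)) \<longlongrightarrow> 0) at_top" unfolding lam_def by real_asymp
  have l2: "((\<lambda>s. exp s * (lam s * sinh s - coth s)) \<longlongrightarrow> 0) at_top" unfolding lam_def coth_def by real_asymp
  have l3: "((\<lambda>s. exp s * (2 - lam s * cosh s - 1)) \<longlongrightarrow> 0) at_top" unfolding lam_def by real_asymp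
  have l4: "((\<lambda>s. exp s * (coth s - lam s * sinh s)) \<longlongrightarrow> 0) at_top" unfolding lam_def coth_def by real_asymp
  have l5: "((\<lambda>s. exp s * (2 - lam s * cosh s - coth s ^ 2)) \<longlongrightarrow> 0) at_top" unfolding lam_def coth_def by real_asymp
  have i: "i = 0 \<or> i = 1 \<or> i = Suc (Suc 0)" using assms by auto
  consider "n = 0" | "n = 1" | "n = 2" | "n > 2" by linarith
  thus ?thesis
  proof cases
    case 1 thus ?thesis using i *[OF a0] *[OF a1] *[OF a2]
      by (elim disjE) (simp_all add: hW_def algebra_simps)
  next
    case 2 thus ?thesis using i by (elim disjE) (simp_all add: hW_def)
  next
    case 3 thus ?thesis using i *[OF l0] *[OF l1] *[OF l2]
      by (elim disjE) (simp_all add: hW_def algebra_simps)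
  next
    case 4 thus ?thesis using i *[OF l3] *[OF l4] *[OF l5]
      by (elim disjE) (simp_all add: hW_def algebra_simps)
  qed
qed

text \<open>The coefficients at \<open>s = \<infinity>\<close>: moments vanish and every
  \<open>hU 0 n\<close> tends to \<open>kk\<close>, so the function itself tends to
  \<open>kk * exp (- \<tau> * s0 - s1)\<close>.\<close>

definition X8 :: "real \<Rightarrow> nat \<Rightarrow> nat \<Rightarrow> bool \<Rightarrow> bool \<Rightarrow> real \<Rightarrow> real \<Rightarrow> real" where
  "X8 \<tau> = Xgen \<tau> (\<lambda>i n s. if i = 0 then kk else 0) (\<lambda>i n s w. 0)"

lemma X0_lim: assumes "i \<le> 2"
  shows "((\<lambda>s. exp s * (X0 \<tau> i j a b s w - X8 \<tau> i j a b s w)) \<longlongrightarrow> 0) at_top"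
proof -
  have "((\<lambda>s. sg a * sg b * ((if j = 0 then (if a then \<tau> else 1) else 0) * (exp s * (hU i (nb a b) s - (if i = 0 then kk else 0)))
     + (- 2) ^ j * (exp s * MM i (nb a b + j) s w))) \<longlongrightarrow> sg a * sg b * ((if j = 0 then (if a then \<tau> else 1) else 0) * 0 + (-2)^j * 0)) at_top"
    by (intro tendsto_intros hU_lim MM_lim assms)
  thus ?thesis by (cases "j = 0") (simp_all add: X8_def Xgen_def algebra_simps)
qed

text \<open>The limiting function \<open>kk * exp (- \<tau> * s0 - s1)\<close> has a defect with the
  factor \<open>1 - (e0 + \<tau> * e1)^2\<close>, which the hypothesis makes zero. What remains is
  \<open>o(exp (- s))\<close> coefficient by coefficient.\<close>

lemma dfv_lim:
  assumes "\<tau> = 1 \<or> \<tau> = -1" "(e0 + \<tau> * e1)^2 = 1"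
  shows "((\<lambda>s. exp s * dfv (ew, e0, e1, e2) \<tau> 0 s0 s1 s w) \<longlongrightarrow> 0) at_top"
proof -
  \<comment> \<open>The decaying differences are packed as a coefficient family that ignores its own
    last two arguments, so that the linear maps \<open>dfc\<close> and \<open>val\<close> apply to
    it.\<close>
  define D where "D = (\<lambda>s i j a b (s'::real) (w'::real). exp s * (X0 \<tau> i j a b s w - X8 \<tau> i j a b s w))"
  have "((\<lambda>s. val (\<lambda>a b. dfc (ew, e0, e1, e2) (D s) 0 a b s w) s0 s1) \<longlongrightarrow>
     val (\<lambda>a b. dfc (ew, e0, e1, e2) (\<lambda>i j a b s w. 0) 0 a b (0::real) (0::real)) s0 s1) at_top"
    unfolding val_def dfc_def prod.case D_def
    by (intro tendsto_intros X0_lim) auto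
  also have "val (\<lambda>a b. dfc (ew, e0, e1, e2) (\<lambda>i j a b s w. 0) 0 a b (0::real) (0::real)) s0 s1 = 0"
    by (simp add: val_def dfc_def)
  finally have l: "((\<lambda>s. val (\<lambda>a b. dfc (ew, e0, e1, e2) (D s) 0 a b s w) s0 s1) \<longlongrightarrow> 0) at_top" .
  have z: "val (\<lambda>a b. dfc (ew, e0, e1, e2) (X8 \<tau>) 0 a b s w) s0 s1 = 0" for s
  proof -
    have "val (\<lambda>a b. dfc (ew, e0, e1, e2) (X8 \<tau>) 0 a b s w) s0 s1 = kk * (1 - (e0 + \<tau> * e1)^2) * (cosh s0 - \<tau> * sinh s0) * (cosh s1 - sinh s1)"
      using assms(1) by (elim disjE) (simp_all add: val_def dfc_def X8_def Xgen_def sg_def algebra_simps power2_eq_square)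
    thus ?thesis using assms(2) by simp
  qed
  have "exp s * dfv (ew, e0, e1, e2) \<tau> 0 s0 s1 s w = val (\<lambda>a b. dfc (ew, e0, e1, e2) (D s) 0 a b s w) s0 s1
     + exp s * val (\<lambda>a b. dfc (ew, e0, e1, e2) (X8 \<tau>) 0 a b s w) s0 s1" for s
    unfolding dfv_def val_def dfc_def D_def prod.case by (simp add: algebra_simps)
  hence "exp s * dfv (ew, e0, e1, e2) \<tau> 0 s0 s1 s w = val (\<lambda>a b. dfc (ew, e0, e1, e2) (D s) 0 a b s w) s0 s1" for s
    by (simp add: z)
  thus ?thesis using l by simp
qed

section \<open>Sign of the inhomogeneity in the reference directions\<close>

lemma Gam_le:
  assumes "s > 0"
  defines "c \<equiv> coth s" and "P \<equiv> 1 / sinh s ^ 2" and "q \<equiv> sinh s / cosh s" and "G \<equiv> Gam s"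
  shows "G \<ge> 0" "G * (8 + 10 * P) \<le> 2 * kk * P * q" "G \<le> kk * q" "P > 0" "q > 0" "c > 1" "q < 1"
proof -
  have S: "sinh s > 0" "cosh s > 0" using assms(1) by (auto simp: cosh_real_pos)
  show P: "P > 0" and q: "q > 0" using S by (auto simp: P_def q_def)
  show c: "c > 1" unfolding c_def by (rule coth_gt1[OF assms(1)])
  have "q = 1 / c" by (simp add: q_def c_def coth_def)
  thus "q < 1" using c by simp
  show G: "G \<ge> 0" unfolding G_def by (rule Gam_bounds(1)[OF assms(1)])
  have pos: "4 * sinh s ^ 2 + 5 > 0" using zero_le_power2[of "sinh s"] by linarith
  have "G * (4 + 5 * P) \<le> kk * sinh s / (cosh s * (4 * sinh s ^ 2 + 5)) * (4 + 5 * P)"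
    unfolding G_def using P by (intro mult_right_mono Gam_bounds assms(1)) auto
  also have "4 + 5 * P = (4 * sinh s ^ 2 + 5) * P" using S by (simp add: P_def field_simps)
  also have "kk * sinh s / (cosh s * (4 * sinh s ^ 2 + 5)) * ((4 * sinh s ^ 2 + 5) * P) = kk * q * P"
  proof -
    have "x / (y * D) * (D * P) = x / y * P" if "D \<noteq> 0" for x y D :: real using that by simp
    from this[of "4 * sinh s ^ 2 + 5" "kk * sinh s" "cosh s"] show ?thesis using pos by (simp add: q_def)
  qed
  finally have m: "G * (4 + 5 * P) \<le> kk * q * P" using S by (simp add: P_def field_simps)
  thus "G * (8 + 10 * P) \<le> 2 * kk * P * q" by (simp add: algebra_simps)
  have "G * P \<le> kk * q * P"
  proof -
    have "G * P \<le> G * (4 + 5 * P)" using G P by (intro mult_left_mono) auto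
    thus ?thesis using m by simp
  qed
  thus "G \<le> kk * q" using P by simp
qed

text \<open>The negative terms carry \<open>w\<close> or \<open>w^2\<close>. They are paid for by
  \<open>1 - E \<ge> E * (2 * (w * c) + 2 * (w * c)^2)\<close>, the quadratic lower bound for
  \<open>exp (2 * w * c)\<close>; the rest is controlled by \<open>G \<le> kk * q\<close> and
  \<open>G * (8 + 10 * P) \<le> 2 * kk * P * q\<close>. The sums with weight \<open>q\<close> are
  the form in \<open>s0\<close> at the extreme ratio \<open>tanh s0 = tanh s\<close>.\<close>

lemma ref_weights_nonneg:
  assumes s: "s > 0" and w: "w \<ge> 0"
  defines "c \<equiv> coth s" and "P \<equiv> 1 / sinh s ^ 2" and "q \<equiv> sinh s / cosh s" and "E \<equiv> exp (- 2 * w * coth s)" and "G \<equiv> Gam s"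
  shows "Ah c P q w E G \<ge> 0" "Ap c P q w E G \<ge> 0" "Ah c P q w E G + q * Bh c P q w E G \<ge> 0" "Ap c P q w E G + q * Bp c P q w E G \<ge> 0"
proof -
  note f = Gam_le[OF s, folded c_def P_def q_def G_def]
  have Pc: "P = c^2 - 1" unfolding P_def c_def by (rule KG_p(3)[OF s])
  have qc: "q * c = 1" unfolding q_def c_def by (rule KG_p(4)[OF s])
  have E: "E > 0" by (simp add: E_def)
  have wc: "w * c \<ge> 0" using w f by simp
  have E1: "1 - E \<ge> E * (2 * (w * c) + 2 * (w * c)^2)"
  proof -
    have "E * (1 + 2 * (w * c) + (2 * (w * c))^2 / 2) \<le> E * exp (2 * (w * c))"
      using wc E exp_lower_Taylor_quadratic[of "2 * (w * c)"] by (intro mult_left_mono) auto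
    also have "\<dots> = 1" by (simp add: E_def c_def exp_add[symmetric])
    finally show ?thesis by (simp add: algebra_simps power2_eq_square)
  qed
  have k1: "kk * q - G \<ge> 0" and k2: "2 * kk * P * q - G * (8 + 10 * P) \<ge> 0" using f by auto
  have n1: "(1 - E) * (kk * P^2 * q^3) \<ge> E * (2 * (w * c) + 2 * (w * c)^2) * (kk * P^2 * q^3)"
    using E1 kk_pos f by (intro mult_right_mono) auto
  have qq: "(w * c) * q^3 = w * q^2" "(w * c)^2 * q^3 = w^2 * q"
    using qc by (algebra, algebra)
  have e1: "E * (2 * (w * c) + 2 * (w * c)^2) * (kk * P^2 * q^3) = E * (kk * P^2 * (2 * w * q^2 + 2 * w^2 * q))"
  proof -
    have "E * (2 * (w * c) + 2 * (w * c)^2) * (kk * P^2 * q^3) = E * (kk * P^2 * (2 * ((w * c) * q^3) + 2 * ((w * c)^2 * q^3)))"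
      by (simp add: algebra_simps)
    thus ?thesis by (simp only: qq) (simp add: algebra_simps)
  qed
  note n2 = n1[unfolded e1]
  have "Ah c P q w E G = ((1 - E) * (kk * P^2 * q^3) - E * (kk * P^2 * (2 * w * q^2 + 2 * w^2 * q))) / 2
      + E * (w^2 * P^2 * (kk * q - G) + 3 * w * c * P * G)"
    unfolding Ah_def by (simp add: field_simps)
  also have "\<dots> \<ge> 0"
    using n2 E w k1 f by (intro add_nonneg_nonneg mult_nonneg_nonneg divide_nonneg_nonneg) auto
  finally show "Ah c P q w E G \<ge> 0" .
  have "Ap c P q w E G = ((1 - E) * (kk * P^2 * q^3) - E * (kk * P^2 * (2 * w * q^2 + 2 * w^2 * q))) / 2
      + E * (w^2 * P^2 * (kk * q - G) + (2 * kk * P * q - G * (8 + 10 * P)) + 7 * w * c * P * G)"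
    unfolding Ap_def by (simp add: field_simps)
  also have "\<dots> \<ge> 0"
    using n2 E w k1 k2 f by (intro add_nonneg_nonneg mult_nonneg_nonneg divide_nonneg_nonneg) auto
  finally show "Ap c P q w E G \<ge> 0" .
  have n3: "(1 - E) * (kk * P^2 * q^3) \<ge> E * (kk * P^2 * (2 * w * q^2))"
  proof -
    have "E * (kk * P^2 * (2 * w * q^2)) \<le> E * (kk * P^2 * (2 * w * q^2 + 2 * w^2 * q))"
      using E kk_pos w f by (intro mult_left_mono) auto
    thus ?thesis using n2 by simp
  qed
  have R: "c * q = 1" "c * (q * x) = x" for x
    using qc by (simp_all add: mult.commute mult.assoc[symmetric])
  have "Ah c P q w E G + q * Bh c P q w E G = ((1 - E) * (kk * P^2 * q^3) - E * (kk * P^2 * (2 * w * q^2)))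
     + E * (2 * w * P^2 * q * (kk * q - G) + 4 * P * G)"
    unfolding Ah_def Bh_def Pc by (simp add: algebra_simps power2_eq_square power3_eq_cube power4_eq_xxxx R; simp add: field_simps)
  also have "\<dots> \<ge> 0"
    using n3 E w k1 f by (intro add_nonneg_nonneg mult_nonneg_nonneg) auto
  finally show "Ah c P q w E G + q * Bh c P q w E G \<ge> 0" .
  have "Ap c P q w E G + q * Bp c P q w E G = ((1 - E) * (kk * P^2 * q^3) - E * (kk * P^2 * (2 * w * q^2)))
     + E * (2 * w * P^2 * q * (kk * q - G) + 8 * P * G)"
    unfolding Ap_def Bp_def Pc by (simp add: algebra_simps power2_eq_square power3_eq_cube power4_eq_xxxx R; simp add: field_simps)
  also have "\<dots> \<ge> 0"
    using n3 E w k1 f by (intro add_nonneg_nonneg mult_nonneg_nonneg) auto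
  finally show "Ap c P q w E G + q * Bp c P q w E G \<ge> 0" .
qed

lemma coth_diff: assumes "s > 0" shows "sinh (s - t) = sinh s * (cosh t - coth s * sinh t)"
  using assms by (simp add: sinh_diff coth_def field_simps)

lemma tanh_mono_le: assumes "0 \<le> t" "t < s" shows "sinh t \<le> sinh s / cosh s * cosh t" "cosh t - coth s * sinh t \<ge> 0"
proof -
  have S: "sinh s > 0" "cosh s > 0" using assms by (auto simp: cosh_real_pos)
  have "sinh (s - t) \<ge> 0" using assms by simp
  hence "sinh s * cosh t - cosh s * sinh t \<ge> 0" by (simp add: sinh_diff)
  thus "sinh t \<le> sinh s / cosh s * cosh t" "cosh t - coth s * sinh t \<ge> 0"
    using S by (auto simp: field_simps coth_def)
qed

text \<open>The form factors as \<open>(cosh s1 - c * sinh s1)\<close> times a form in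
  \<open>s0\<close>. If the coefficient of \<open>sinh s0\<close> is negative,
  \<open>tanh s0 \<le> tanh s\<close> bounds the second factor by its value at the extreme ratio,
  which is the last sign hypothesis.\<close>

lemma val_W_nonneg:
  assumes "0 \<le> s0" "s0 \<le> s1" "s1 < s"
  and "Y False True = - c * Y False False" "Y True True = - c * Y True False"
  and "Y False False \<ge> 0" "Y False False + sinh s / cosh s * Y True False \<ge> 0" and c: "c = coth s"
  shows "val Y s0 s1 \<ge> 0"
proof -
  have "val Y s0 s1 = (cosh s1 - c * sinh s1) * (Y False False * cosh s0 + Y True False * sinh s0)"
    unfolding val_def assms(4,5) by (simp add: algebra_simps)
  also have "\<dots> \<ge> 0"
  proof (rule mult_nonneg_nonneg)
    show "cosh s1 - c * sinh s1 \<ge> 0" unfolding c using tanh_mono_le[of s1 s] assms by simp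
    show "0 \<le> Y False False * cosh s0 + Y True False * sinh s0"
    proof (cases "Y True False \<ge> 0")
      case True thus ?thesis using assms by (intro add_nonneg_nonneg mult_nonneg_nonneg) auto
    next
      case False
      have "sinh s0 \<le> sinh s / cosh s * cosh s0" using tanh_mono_le[of s0 s] assms by simp
      hence "Y True False * sinh s0 \<ge> Y True False * (sinh s / cosh s * cosh s0)"
        using False by (intro mult_left_mono_neg) auto
      moreover have "(Y False False + sinh s / cosh s * Y True False) * cosh s0 \<ge> 0"
        using assms by (intro mult_nonneg_nonneg) auto
      ultimately show ?thesis by (simp add: algebra_simps)
    qed
  qed
  finally show ?thesis .
qed

lemma val_W_nonneg':
  assumes "0 \<le> s0" "s0 \<le> s1" "s1 < s" "s > 0"
  and "Y False True = - coth s * Y False False" "Y True False = - coth s * Y False False" "Y True True = coth s ^ 2 * Y False False"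
  and "Y False False \<ge> 0"
  shows "val Y s0 s1 \<ge> 0"
proof (rule val_W_nonneg[where Y=Y and c="coth s", OF assms(1-3,5) _ assms(8) _ refl])
  show "Y True True = - coth s * Y True False" using assms(6,7) by (simp add: power2_eq_square)
  have "Y False False + sinh s / cosh s * Y True False = (1 - sinh s / cosh s * coth s) * Y False False"
    unfolding assms(6) by (simp add: algebra_simps)
  thus "Y False False + sinh s / cosh s * Y True False \<ge> 0" unfolding KG_p(4)[OF assms(4)] by simp
qed

text \<open>The comparison principle runs in \<open>s\<close> over the half-line beyond
  \<open>s1\<close>, with \<open>s0\<close>, \<open>s1\<close> and \<open>w\<close> frozen. Beyond
  \<open>s1\<close> the factors \<open>cosh - coth s * sinh\<close> at \<open>s0\<close> and
  \<open>s1\<close> are nonnegative, so \<open>W \<ge> 0\<close> there.\<close>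

lemma dfv_ref_nonneg:
  assumes "0 \<le> s0" "s0 \<le> s1" "s1 < s" "w \<ge> 0"
  shows "dfv (3/2, -1/2, -1/2, -1/2) 1 0 s0 s1 s w \<ge> 0" "dfv (-1/2, 1/2, 1/2, 1/2) 1 0 s0 s1 s w \<ge> 0"
    "dfv (1, 1/2, -1/2, -1/2) (-1) 0 s0 s1 s w \<ge> 0" "dfv (0, -1/2, 1/2, 1/2) (-1) 0 s0 s1 s w \<ge> 0"
proof -
  have *: "dfv (ew, e0, e1, e2) \<tau> 0 s0 s1 s w \<ge> 0"
    if "\<tau> = 1 \<or> \<tau> = -1" "(e0 + \<tau> * e1)^2 = 1"
    and W: "\<And>s. s > s1 \<Longrightarrow> val (\<lambda>a b. dfc (ew, e0, e1, e2) (Xgen \<tau> hW KG) 0 a b s w) s0 s1 \<ge> 0" for ew e0 e1 e2 \<tau>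
  proof (rule ode_nonneg[where f="\<lambda>s. dfv (ew, e0, e1, e2) \<tau> 0 s0 s1 s w" and ?f1.0="\<lambda>s. dfv (ew, e0, e1, e2) \<tau> (Suc 0) s0 s1 s w"
        and ?f2.0="\<lambda>s. dfv (ew, e0, e1, e2) \<tau> (Suc (Suc 0)) s0 s1 s w" and a=s1])
    show "((\<lambda>s. dfv (ew, e0, e1, e2) \<tau> 0 s0 s1 s w) has_real_derivative dfv (ew, e0, e1, e2) \<tau> (Suc 0) s0 s1 x w) (at x)" if "x > s1" for x
      by (rule dfv_deriv) (use that assms in auto)
    show "((\<lambda>s. dfv (ew, e0, e1, e2) \<tau> (Suc 0) s0 s1 s w) has_real_derivative dfv (ew, e0, e1, e2) \<tau> (Suc (Suc 0)) s0 s1 x w) (at x)" if "x > s1" for x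
      by (rule dfv_deriv) (use that assms in auto)
    show "dfv (ew, e0, e1, e2) \<tau> 0 s0 s1 x w \<le> dfv (ew, e0, e1, e2) \<tau> (Suc (Suc 0)) s0 s1 x w" if "x > s1" for x
      unfolding dfv_2 using W[OF that] by simp
    show "((\<lambda>s. exp s * dfv (ew, e0, e1, e2) \<tau> 0 s0 s1 s w) \<longlongrightarrow> 0) at_top"
      by (rule dfv_lim) (use that in auto)
  qed (use assms in auto)
  have pos: "x > 0" if "x > s1" for x using that assms by simp
  note dp = dfc_p[OF KG_p(3,4)]
  show "dfv (3/2, -1/2, -1/2, -1/2) 1 0 s0 s1 s w \<ge> 0"
  proof (rule *)
    fix x assume x: "x > s1"
    note W = ref_weights_nonneg[OF pos[OF x] assms(4)]
    show "val (\<lambda>a b. dfc (3/2, -1/2, -1/2, -1/2) (Xgen 1 hW KG) 0 a b x w) s0 s1 \<ge> 0"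
      by (rule val_W_nonneg'[OF assms(1,2) x pos[OF x]])
        (unfold dfc_W[OF pos[OF x]] dp[OF pos[OF x] pos[OF x]], use W(1) in simp_all)
  qed (auto simp: power2_eq_square)
  show "dfv (-1/2, 1/2, 1/2, 1/2) 1 0 s0 s1 s w \<ge> 0"
  proof (rule *)
    fix x assume x: "x > s1"
    note W = ref_weights_nonneg[OF pos[OF x] assms(4)]
    show "val (\<lambda>a b. dfc (-1/2, 1/2, 1/2, 1/2) (Xgen 1 hW KG) 0 a b x w) s0 s1 \<ge> 0"
      by (rule val_W_nonneg'[OF assms(1,2) x pos[OF x]])
        (unfold dfc_W[OF pos[OF x]] dp[OF pos[OF x] pos[OF x]], use W(2) in simp_all)
  qed (auto simp: power2_eq_square)
  show "dfv (1, 1/2, -1/2, -1/2) (-1) 0 s0 s1 s w \<ge> 0"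
  proof (rule *)
    fix x assume x: "x > s1"
    note W = ref_weights_nonneg[OF pos[OF x] assms(4)]
    show "val (\<lambda>a b. dfc (1, 1/2, -1/2, -1/2) (Xgen (-1) hW KG) 0 a b x w) s0 s1 \<ge> 0"
      by (rule val_W_nonneg[OF assms(1,2) x _ _ _ _ refl])
        (unfold dfc_W[OF pos[OF x]] dp[OF pos[OF x] pos[OF x]], use W in simp_all)
  qed (auto simp: power2_eq_square)
  show "dfv (0, -1/2, 1/2, 1/2) (-1) 0 s0 s1 s w \<ge> 0"
  proof (rule *)
    fix x assume x: "x > s1"
    note W = ref_weights_nonneg[OF pos[OF x] assms(4)]
    show "val (\<lambda>a b. dfc (0, -1/2, 1/2, 1/2) (Xgen (-1) hW KG) 0 a b x w) s0 s1 \<ge> 0"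
      by (rule val_W_nonneg[OF assms(1,2) x _ _ _ _ refl])
        (unfold dfc_W[OF pos[OF x]] dp[OF pos[OF x] pos[OF x]], use W in simp_all)
  qed (auto simp: power2_eq_square)
qed

section \<open>Signs of moment combinations\<close>

text \<open>The mode at \<open>t\<close> changes sign only at \<open>coth t\<close>, which for
  \<open>t \<le> s\<close> lies beyond the interval of integration.\<close>

lemma phi_nonneg: assumes "0 \<le> t" "t \<le> s" "s > 0" "r \<le> coth s" shows "cosh t - r * sinh t \<ge> 0"
proof -
  have "sinh (s - t) \<ge> 0" using assms by simp
  hence "0 \<le> sinh s * (cosh t - coth s * sinh t)" using coth_diff[OF assms(3), of t] by simp
  hence "cosh t - coth s * sinh t \<ge> 0" using assms by (simp add: zero_le_mult_iff)
  moreover have "r * sinh t \<le> coth s * sinh t" using assms by (intro mult_right_mono) auto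
  ultimately show ?thesis by simp
qed

lemma M0_exp:
  "M0 0 s w = cosh s * mom 0 (coth s) w - sinh s * mom 1 (coth s) w"
  "M0 1 s w = cosh s * mom 1 (coth s) w - sinh s * mom 2 (coth s) w"
  "M0 (Suc 0) s w = cosh s * mom 1 (coth s) w - sinh s * mom 2 (coth s) w"
  "M0 2 s w = cosh s * mom 2 (coth s) w - sinh s * mom 3 (coth s) w"
  "M0 3 s w = cosh s * mom 3 (coth s) w - sinh s * mom 4 (coth s) w"
  "M0 4 s w = cosh s * mom 4 (coth s) w - sinh s * mom 5 (coth s) w"
  unfolding M0_def by (simp_all add: eval_nat_numeral)

lemma M0_diff_nonneg:
  assumes s: "s > 0"
  shows "M0 3 s w - M0 1 s w \<ge> 0" "M0 4 s w - M0 2 s w \<ge> 0" "M0 2 s w \<ge> 0"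
proof -
  have p: "cosh s - r * sinh s \<ge> 0" if "r \<le> coth s" for r by (rule phi_nonneg[OF _ order_refl s that]) (use s in simp)
  have r2: "r^2 - 1 \<ge> 0" if "1 \<le> r" for r :: real using that by simp
  have "0 \<le> 0 * mom 0 (coth s) w + (- cosh s) * mom 1 (coth s) w + sinh s * mom 2 (coth s) w + cosh s * mom 3 (coth s) w + (- sinh s) * mom 4 (coth s) w + 0 * mom 5 (coth s) w"
  proof (rule mom_poly_nonneg)
    fix r assume r: "1 \<le> r" "r \<le> coth s"
    have "0 * 1 + - cosh s * r + sinh s * r^2 + cosh s * r^3 + - sinh s * r^4 + 0 * r^5 = r * (r^2 - 1) * (cosh s - r * sinh s)" by algebra
    also have "\<dots> \<ge> 0" using r p[OF r(2)] r2[OF r(1)] by (intro mult_nonneg_nonneg) auto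
    finally show "0 \<le> 0 + - cosh s * r + sinh s * r^2 + cosh s * r^3 + - sinh s * r^4 + 0 * r^5" by simp
  qed
  thus "M0 3 s w - M0 1 s w \<ge> 0" by (simp add: M0_exp algebra_simps)
  have "0 \<le> 0 * mom 0 (coth s) w + 0 * mom 1 (coth s) w + (- cosh s) * mom 2 (coth s) w + sinh s * mom 3 (coth s) w + cosh s * mom 4 (coth s) w + (- sinh s) * mom 5 (coth s) w"
  proof (rule mom_poly_nonneg)
    fix r assume r: "1 \<le> r" "r \<le> coth s"
    have "0 + 0 * r + - cosh s * r^2 + sinh s * r^3 + cosh s * r^4 + - sinh s * r^5 = r^2 * (r^2 - 1) * (cosh s - r * sinh s)" by algebra
    also have "\<dots> \<ge> 0" using r p[OF r(2)] r2[OF r(1)] by (intro mult_nonneg_nonneg) auto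
    finally show "0 \<le> 0 + 0 * r + - cosh s * r^2 + sinh s * r^3 + cosh s * r^4 + - sinh s * r^5" by simp
  qed
  thus "M0 4 s w - M0 2 s w \<ge> 0" by (simp add: M0_exp algebra_simps)
  show "M0 2 s w \<ge> 0" by (rule M0_bounds(1)[OF s])
qed

text \<open>Each expression is the moment of a polynomial times the two modes at \<open>s\<close>
  and \<open>t\<close>. The factor \<open>4 * r^2 - 1\<close> in the last two comes from the
  direction of \<open>w\<close>, where each derivative brings \<open>- 2 * r\<close>.\<close>

lemma phi2_nonneg:
  assumes s: "s > 0" and t: "0 \<le> t" "t \<le> s"
  shows "cosh t * (M0 3 s w - M0 1 s w) - sinh t * (M0 4 s w - M0 2 s w) \<ge> 0"
    "cosh t * (4 * M0 3 s w - 4 * M0 2 s w - M0 1 s w + M0 0 s w) - sinh t * (4 * M0 4 s w - 4 * M0 3 s w - M0 2 s w + M0 1 s w) \<ge> 0"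
    "cosh t * (4 * M0 3 s w - M0 1 s w) - sinh t * (4 * M0 4 s w - M0 2 s w) \<ge> 0"
proof -
  have p: "cosh t - r * sinh t \<ge> 0" "cosh s - r * sinh s \<ge> 0" if "r \<le> coth s" for r
    by (rule phi_nonneg[OF _ _ s that]; use s t in simp)+
  have r2: "r^2 - 1 \<ge> 0" "4 * r^2 - 1 \<ge> 0" if "1 \<le> r" for r :: real
  proof -
    have "r^2 \<ge> 1" using that by simp
    thus "r^2 - 1 \<ge> 0" "4 * r^2 - 1 \<ge> 0" by linarith+
  qed
  let ?S = "sinh s" and ?C = "cosh s" and ?s = "sinh t" and ?c = "cosh t"
  have "0 \<le> 0 * mom 0 (coth s) w + (- ?c*?C) * mom 1 (coth s) w + (?c*?S + ?s*?C) * mom 2 (coth s) w + (?c*?C - ?s*?S) * mom 3 (coth s) w + (- (?c*?S + ?s*?C)) * mom 4 (coth s) w + (?s*?S) * mom 5 (coth s) w"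
  proof (rule mom_poly_nonneg)
    fix r assume r: "1 \<le> r" "r \<le> coth s"
    have "0 + (- ?c*?C) * r + (?c*?S + ?s*?C) * r^2 + (?c*?C - ?s*?S) * r^3 + (- (?c*?S + ?s*?C)) * r^4 + (?s*?S) * r^5 = r * (r^2 - 1) * (?c - r * ?s) * (?C - r * ?S)" by algebra
    also have "\<dots> \<ge> 0" using r p[OF r(2)] r2[OF r(1)] by (intro mult_nonneg_nonneg) auto
    finally show "0 \<le> 0 + (- ?c*?C) * r + (?c*?S + ?s*?C) * r^2 + (?c*?C - ?s*?S) * r^3 + (- (?c*?S + ?s*?C)) * r^4 + (?s*?S) * r^5" .
  qed
  thus "cosh t * (M0 3 s w - M0 1 s w) - sinh t * (M0 4 s w - M0 2 s w) \<ge> 0" by (simp add: M0_exp algebra_simps)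
  have "0 \<le> (?c*?C) * mom 0 (coth s) w + (- ?c*?C - ?c*?S - ?s*?C) * mom 1 (coth s) w + (- 4*?c*?C + ?c*?S + ?s*?C + ?s*?S) * mom 2 (coth s) w
    + (4*?c*?C + 4*?c*?S + 4*?s*?C - ?s*?S) * mom 3 (coth s) w + (- 4*?c*?S - 4*?s*?C - 4*?s*?S) * mom 4 (coth s) w + (4*?s*?S) * mom 5 (coth s) w"
  proof (rule mom_poly_nonneg)
    fix r assume r: "1 \<le> r" "r \<le> coth s"
    have "(?c*?C) + (- ?c*?C - ?c*?S - ?s*?C) * r + (- 4*?c*?C + ?c*?S + ?s*?C + ?s*?S) * r^2
    + (4*?c*?C + 4*?c*?S + 4*?s*?C - ?s*?S) * r^3 + (- 4*?c*?S - 4*?s*?C - 4*?s*?S) * r^4 + (4*?s*?S) * r^5 = (4 * r^2 - 1) * (r - 1) * (?c - r * ?s) * (?C - r * ?S)" by algebra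
    also have "\<dots> \<ge> 0" using r p[OF r(2)] r2[OF r(1)] by (intro mult_nonneg_nonneg) auto
    finally show "0 \<le> (?c*?C) + (- ?c*?C - ?c*?S - ?s*?C) * r + (- 4*?c*?C + ?c*?S + ?s*?C + ?s*?S) * r^2
    + (4*?c*?C + 4*?c*?S + 4*?s*?C - ?s*?S) * r^3 + (- 4*?c*?S - 4*?s*?C - 4*?s*?S) * r^4 + (4*?s*?S) * r^5" .
  qed
  thus "cosh t * (4 * M0 3 s w - 4 * M0 2 s w - M0 1 s w + M0 0 s w) - sinh t * (4 * M0 4 s w - 4 * M0 3 s w - M0 2 s w + M0 1 s w) \<ge> 0"
    by (simp add: M0_exp algebra_simps)
  have "0 \<le> 0 * mom 0 (coth s) w + (- ?c*?C) * mom 1 (coth s) w + (?c*?S + ?s*?C) * mom 2 (coth s) w + (4*?c*?C - ?s*?S) * mom 3 (coth s) w + (- 4*(?c*?S + ?s*?C)) * mom 4 (coth s) w + (4*?s*?S) * mom 5 (coth s) w"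
  proof (rule mom_poly_nonneg)
    fix r assume r: "1 \<le> r" "r \<le> coth s"
    have "0 + (- ?c*?C) * r + (?c*?S + ?s*?C) * r^2 + (4*?c*?C - ?s*?S) * r^3 + (- 4*(?c*?S + ?s*?C)) * r^4 + (4*?s*?S) * r^5 = r * (4 * r^2 - 1) * (?c - r * ?s) * (?C - r * ?S)" by algebra
    also have "\<dots> \<ge> 0" using r p[OF r(2)] r2[OF r(1)] by (intro mult_nonneg_nonneg) auto
    finally show "0 \<le> 0 + (- ?c*?C) * r + (?c*?S + ?s*?C) * r^2 + (4*?c*?C - ?s*?S) * r^3 + (- 4*(?c*?S + ?s*?C)) * r^4 + (4*?s*?S) * r^5" .
  qed
  thus "cosh t * (4 * M0 3 s w - M0 1 s w) - sinh t * (4 * M0 4 s w - M0 2 s w) \<ge> 0" by (simp add: M0_exp algebra_simps)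
qed

lemma phi1_nonneg:
  assumes s: "s > 0" and t: "0 \<le> t" "t \<le> s"
  shows "cosh t * (mom 4 (coth s) w - 2 * mom 2 (coth s) w + mom 0 (coth s) w) - sinh t * (mom 5 (coth s) w - 2 * mom 3 (coth s) w + mom 1 (coth s) w) \<ge> 0"
    "cosh t * (2 * mom 4 (coth s) w - mom 2 (coth s) w - mom 0 (coth s) w) - sinh t * (2 * mom 5 (coth s) w - mom 3 (coth s) w - mom 1 (coth s) w) \<ge> 0"
    "mom 4 (coth s) w - 2 * mom 2 (coth s) w + mom 0 (coth s) w \<ge> 0"
    "4 * mom 3 (coth s) w - mom 1 (coth s) w \<ge> 0"
proof -
  have p: "cosh t - r * sinh t \<ge> 0" if "r \<le> coth s" for r
    by (rule phi_nonneg[OF t s that])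
  have r2: "r^2 - 1 \<ge> 0" "4 * r^2 - 1 \<ge> 0" if "1 \<le> r" for r :: real
  proof -
    have "r^2 \<ge> 1" using that by simp
    thus "r^2 - 1 \<ge> 0" "4 * r^2 - 1 \<ge> 0" by linarith+
  qed
  let ?s = "sinh t" and ?c = "cosh t"
  have "0 \<le> ?c * mom 0 (coth s) w + (- ?s) * mom 1 (coth s) w + (- 2 * ?c) * mom 2 (coth s) w + (2 * ?s) * mom 3 (coth s) w + ?c * mom 4 (coth s) w + (- ?s) * mom 5 (coth s) w"
  proof (rule mom_poly_nonneg)
    fix r assume r: "1 \<le> r" "r \<le> coth s"
    have "?c + (- ?s) * r + (- 2 * ?c) * r^2 + (2 * ?s) * r^3 + ?c * r^4 + (- ?s) * r^5 = (r^2 - 1)^2 * (?c - r * ?s)" by algebra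
    also have "\<dots> \<ge> 0" using r p[OF r(2)] by (intro mult_nonneg_nonneg) auto
    finally show "0 \<le> ?c + (- ?s) * r + (- 2 * ?c) * r^2 + (2 * ?s) * r^3 + ?c * r^4 + (- ?s) * r^5" .
  qed
  thus "cosh t * (mom 4 (coth s) w - 2 * mom 2 (coth s) w + mom 0 (coth s) w) - sinh t * (mom 5 (coth s) w - 2 * mom 3 (coth s) w + mom 1 (coth s) w) \<ge> 0"
    by (simp add: algebra_simps)
  have "0 \<le> (- ?c) * mom 0 (coth s) w + ?s * mom 1 (coth s) w + (- ?c) * mom 2 (coth s) w + ?s * mom 3 (coth s) w + (2 * ?c) * mom 4 (coth s) w + (- 2 * ?s) * mom 5 (coth s) w"
  proof (rule mom_poly_nonneg)
    fix r assume r: "1 \<le> r" "r \<le> coth s"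
    have "- ?c + ?s * r + (- ?c) * r^2 + ?s * r^3 + (2 * ?c) * r^4 + (- 2 * ?s) * r^5 = (2 * r^2 + 1) * (r^2 - 1) * (?c - r * ?s)" by algebra
    also have "\<dots> \<ge> 0" using r p[OF r(2)] r2[OF r(1)] by (intro mult_nonneg_nonneg) auto
    finally show "0 \<le> - ?c + ?s * r + (- ?c) * r^2 + ?s * r^3 + (2 * ?c) * r^4 + (- 2 * ?s) * r^5" .
  qed
  thus "cosh t * (2 * mom 4 (coth s) w - mom 2 (coth s) w - mom 0 (coth s) w) - sinh t * (2 * mom 5 (coth s) w - mom 3 (coth s) w - mom 1 (coth s) w) \<ge> 0"
    by (simp add: algebra_simps)
  have "0 \<le> 1 * mom 0 (coth s) w + 0 * mom 1 (coth s) w + (- 2) * mom 2 (coth s) w + 0 * mom 3 (coth s) w + 1 * mom 4 (coth s) w + 0 * mom 5 (coth s) w"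
  proof (rule mom_poly_nonneg)
    fix r :: real
    have "1 + 0 * r + (- 2) * r^2 + 0 * r^3 + 1 * r^4 + 0 * r^5 = (r^2 - 1)^2" by algebra
    thus "0 \<le> 1 + 0 * r + (- 2) * r^2 + 0 * r^3 + 1 * r^4 + 0 * r^5" by simp
  qed
  thus "mom 4 (coth s) w - 2 * mom 2 (coth s) w + mom 0 (coth s) w \<ge> 0" by simp
  have "0 \<le> 0 * mom 0 (coth s) w + (- 1) * mom 1 (coth s) w + 0 * mom 2 (coth s) w + 4 * mom 3 (coth s) w + 0 * mom 4 (coth s) w + 0 * mom 5 (coth s) w"
  proof (rule mom_poly_nonneg)
    fix r :: real assume r: "1 \<le> r"
    have "0 + (- 1) * r + 0 * r^2 + 4 * r^3 + 0 * r^4 + 0 * r^5 = r * (4 * r^2 - 1)" by algebra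
    also have "\<dots> \<ge> 0" using r r2[OF r] by (intro mult_nonneg_nonneg) auto
    finally show "0 \<le> 0 + (- 1) * r + 0 * r^2 + 4 * r^3 + 0 * r^4 + 0 * r^5" .
  qed
  thus "4 * mom 3 (coth s) w - mom 1 (coth s) w \<ge> 0" by simp
qed

lemma phi3_nonneg:
  assumes s: "s > 0" and t: "0 \<le> t" "t \<le> s" and u: "0 \<le> u" "u \<le> s"
  shows "cosh t * cosh u * (mom 3 (coth s) w - mom 1 (coth s) w) - sinh (t + u) * (mom 4 (coth s) w - mom 2 (coth s) w) + sinh t * sinh u * (mom 5 (coth s) w - mom 3 (coth s) w) \<ge> 0"
    "cosh t * cosh u * M0 2 s w - sinh (t + u) * M0 3 s w + sinh t * sinh u * M0 4 s w \<ge> 0"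
proof -
  have p: "cosh t - r * sinh t \<ge> 0" "cosh u - r * sinh u \<ge> 0" "cosh s - r * sinh s \<ge> 0" if "r \<le> coth s" for r
    by (rule phi_nonneg[OF _ _ s that]; use s t u in simp)+
  have r2: "r^2 - 1 \<ge> 0" if "1 \<le> r" for r :: real using that by simp
  let ?S = "sinh s" and ?C = "cosh s" and ?s = "sinh t" and ?c = "cosh t" and ?y = "sinh u" and ?x = "cosh u"
  have "0 \<le> 0 * mom 0 (coth s) w + (- ?c*?x) * mom 1 (coth s) w + (?c*?y + ?s*?x) * mom 2 (coth s) w + (?c*?x - ?s*?y) * mom 3 (coth s) w + (- (?c*?y + ?s*?x)) * mom 4 (coth s) w + (?s*?y) * mom 5 (coth s) w"
  proof (rule mom_poly_nonneg)
    fix r assume r: "1 \<le> r" "r \<le> coth s"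
    have "0 + (- ?c*?x) * r + (?c*?y + ?s*?x) * r^2 + (?c*?x - ?s*?y) * r^3 + (- (?c*?y + ?s*?x)) * r^4 + (?s*?y) * r^5 = r * (r^2 - 1) * (?c - r * ?s) * (?x - r * ?y)" by algebra
    also have "\<dots> \<ge> 0" using r p[OF r(2)] r2[OF r(1)] by (intro mult_nonneg_nonneg) auto
    finally show "0 \<le> 0 + (- ?c*?x) * r + (?c*?y + ?s*?x) * r^2 + (?c*?x - ?s*?y) * r^3 + (- (?c*?y + ?s*?x)) * r^4 + (?s*?y) * r^5" .
  qed
  thus "cosh t * cosh u * (mom 3 (coth s) w - mom 1 (coth s) w) - sinh (t + u) * (mom 4 (coth s) w - mom 2 (coth s) w) + sinh t * sinh u * (mom 5 (coth s) w - mom 3 (coth s) w) \<ge> 0"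
    by (simp add: sinh_add algebra_simps)
  have "0 \<le> 0 * mom 0 (coth s) w + 0 * mom 1 (coth s) w + (?c*?x*?C) * mom 2 (coth s) w + (- (?c*?y*?C + ?s*?x*?C + ?c*?x*?S)) * mom 3 (coth s) w + (?s*?y*?C + ?c*?y*?S + ?s*?x*?S) * mom 4 (coth s) w + (- ?s*?y*?S) * mom 5 (coth s) w"
  proof (rule mom_poly_nonneg)
    fix r assume r: "1 \<le> r" "r \<le> coth s"
    have "0 + 0 * r + (?c*?x*?C) * r^2 + (- (?c*?y*?C + ?s*?x*?C + ?c*?x*?S)) * r^3 + (?s*?y*?C + ?c*?y*?S + ?s*?x*?S) * r^4 + (- ?s*?y*?S) * r^5 = r^2 * (?c - r * ?s) * (?x - r * ?y) * (?C - r * ?S)" by algebra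
    also have "\<dots> \<ge> 0" using r p[OF r(2)] by (intro mult_nonneg_nonneg) auto
    finally show "0 \<le> 0 + 0 * r + (?c*?x*?C) * r^2 + (- (?c*?y*?C + ?s*?x*?C + ?c*?x*?S)) * r^3 + (?s*?y*?C + ?c*?y*?S + ?s*?x*?S) * r^4 + (- ?s*?y*?S) * r^5" .
  qed
  thus "cosh t * cosh u * M0 2 s w - sinh (t + u) * M0 3 s w + sinh t * sinh u * M0 4 s w \<ge> 0"
    by (simp add: M0_exp sinh_add algebra_simps)
qed

section \<open>Elementary parts compared with moments\<close>

lemma hU_d:
  assumes "s > 0"
  shows "(hU 0 n has_real_derivative hU 1 n s) (at s)" "(hU 1 n has_real_derivative hU 2 n s) (at s)"
    "n < 3 \<Longrightarrow> (hU 2 n has_real_derivative hU 3 n s) (at s)"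
  using hU_deriv[OF assms, of 0 n] hU_deriv[OF assms, of 1 n] hU_deriv[OF assms, of 2 n]
  unfolding One_nat_def Suc_1 by (simp_all del: hU.simps add: numeral_3_eq_3 numeral_2_eq_2)

lemma hU_2: "hU 2 n s = hU 0 n s + hW 0 n s" "hU 3 n s = hU 1 n s + hW 1 n s"
  by (simp_all add: numeral_2_eq_2 numeral_3_eq_3)

text \<open>After subtraction of the limit at infinity (0 or \<open>kk\<close>) each function, up to
  sign, satisfies \<open>f'' \<ge> f\<close>, because \<open>hW\<close> is explicit and
  \<open>tanh < 1 < coth\<close>.\<close>

lemma hU_signs: assumes s: "s > 0"
  shows "hU 1 2 s \<ge> 0" "hU 1 0 s \<le> 0" "hU 0 0 s \<ge> kk" "hU 0 2 s \<le> kk"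
proof -
  have g: "1 / sinh s ^ 2 > 0" "coth s > 1" "sinh s / cosh s < 1" if "s > 0" for s
    using Gam_le[OF that] by auto
  have l: "((\<lambda>s. exp s * (hU i n s - (if i = 0 then kk else 0))) \<longlongrightarrow> 0) at_top" if "i \<le> 2" for i n by (rule hU_lim[OF that])
  show "hU 1 2 s \<ge> 0"
  proof (rule ode_nonneg[where a=0 and f="hU 1 2" and ?f1.0="hU 2 2" and ?f2.0="hU 3 2"])
    show "hU 1 2 x \<le> hU 3 2 x" for x unfolding hU_2 using kk_pos by (simp add: hW_def del: hU.simps)
    show "((\<lambda>s. exp s * hU 1 2 s) \<longlongrightarrow> 0) at_top" using l[of 1 2] by (simp del: hU.simps)
  qed (auto intro!: hU_d s simp del: hU.simps One_nat_def)
  have "- hU 1 0 s \<ge> 0"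
  proof (rule ode_nonneg[where a=0 and f="\<lambda>s. - hU 1 0 s" and ?f1.0="\<lambda>s. - hU 2 0 s" and ?f2.0="\<lambda>s. - hU 3 0 s"])
    show "- hU 1 0 x \<le> - hU 3 0 x" for x unfolding hU_2 using kk_pos by (simp add: hW_def del: hU.simps)
    show "((\<lambda>s. exp s * - hU 1 0 s) \<longlongrightarrow> 0) at_top" using tendsto_minus[OF l[of 1 0]] by (simp del: hU.simps)
  qed (auto intro!: hU_d DERIV_minus s simp del: hU.simps One_nat_def)
  thus "hU 1 0 s \<le> 0" by simp
  have "hU 0 0 s - kk \<ge> 0"
  proof (rule ode_nonneg[where a=0 and f="\<lambda>s. hU 0 0 s - kk" and ?f1.0="hU 1 0" and ?f2.0="hU 2 0"])
    show "hU 0 0 x - kk \<le> hU 2 0 x" if "x > 0" for x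
    proof -
      have "kk * (sinh x / cosh x) \<le> kk * 1" using g(3)[OF that] kk_pos by (intro mult_left_mono) auto
      thus ?thesis unfolding hU_2 by (simp add: hW_def del: hU.simps)
    qed
    show "((\<lambda>s. hU 0 0 s - kk) has_real_derivative hU 1 0 x) (at x)" if "x > 0" for x
      using DERIV_diff[OF hU_d(1)[OF that, of 0] DERIV_const] by (simp del: hU.simps)
    show "(hU 1 0 has_real_derivative hU 2 0 x) (at x)" if "x > 0" for x by (rule hU_d(2)[OF that])
    show "((\<lambda>s. exp s * (hU 0 0 s - kk)) \<longlongrightarrow> 0) at_top" using l[of 0 0] by (simp del: hU.simps)
  qed (rule s)
  thus "hU 0 0 s \<ge> kk" by simp
  have "kk - hU 0 2 s \<ge> 0"
  proof (rule ode_nonneg[where a=0 and f="\<lambda>s. kk - hU 0 2 s" and ?f1.0="\<lambda>s. - hU 1 2 s" and ?f2.0="\<lambda>s. - hU 2 2 s"])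
    show "kk - hU 0 2 x \<le> - hU 2 2 x" if "x > 0" for x
    proof -
      have "kk * 1 \<le> kk * coth x" using g(2)[OF that] kk_pos by (intro mult_left_mono) auto
      thus ?thesis unfolding hU_2 by (simp add: hW_def del: hU.simps)
    qed
    show "((\<lambda>s. kk - hU 0 2 s) has_real_derivative - hU 1 2 x) (at x)" if "x > 0" for x
      using DERIV_diff[OF DERIV_const hU_d(1)[OF that, of 2]] by (simp del: hU.simps)
    show "((\<lambda>s. - hU 1 2 s) has_real_derivative - hU 2 2 x) (at x)" if "x > 0" for x
      by (rule DERIV_minus[OF hU_d(2)[OF that]])
    show "((\<lambda>s. exp s * (kk - hU 0 2 s)) \<longlongrightarrow> 0) at_top" using tendsto_minus[OF l[of 0 2]] by (simp add: algebra_simps del: hU.simps)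
  qed (rule s)
  thus "hU 0 2 s \<le> kk" by simp
qed

text \<open>Both follow from \<open>Gam * (4 + 5 * P) \<le> kk * P * q\<close>: the factor
  \<open>4 + 5 * P\<close> exceeds \<open>3 * c^2\<close> by \<open>1 + 2 * P\<close> and
  \<open>4 * c^2 - 1\<close> by \<open>1 + P\<close>.\<close>

lemma Gam3: assumes s: "s > 0"
  shows "3 * coth s * Gam s \<le> kk * (1 / sinh s ^ 2) * (sinh s / cosh s)^2"
    and "(4 * coth s ^ 2 - 1) * Gam s * (sinh s * cosh s) \<le> kk"
proof -
  define c where "c = coth s" define P where "P = 1 / sinh s ^ 2" define q where "q = sinh s / cosh s" define G where "G = Gam s"
  note f = Gam_le[OF s, folded c_def P_def q_def G_def]
  have Pc: "P = c^2 - 1" unfolding P_def c_def by (rule KG_p(3)[OF s])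
  have qc: "q * c = 1" unfolding q_def c_def by (rule KG_p(4)[OF s])
  have b: "G * (4 + 5 * P) \<le> kk * P * q" using f(2) by (simp add: algebra_simps)
  have cq: "c^2 * q^2 = 1" using qc by (simp add: power_mult_distrib[symmetric] mult.commute)
  have "3 * G * c^2 \<le> G * (4 + 5 * P)"
  proof -
    have "G * (4 + 5 * P) - 3 * G * c^2 = G * (1 + 2 * P)" unfolding Pc by (simp add: algebra_simps)
    also have "\<dots> \<ge> 0" using f by simp
    finally show ?thesis by simp
  qed
  hence "3 * G * c^2 * (c * q^2) \<le> kk * P * q * (c * q^2)"
    using b f qc by (intro mult_right_mono) auto
  moreover have "3 * G * c^2 * (c * q^2) = 3 * c * G" using cq by algebra
  moreover have "kk * P * q * (c * q^2) = kk * P * q^2" using qc by algebra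
  ultimately have "3 * c * G \<le> kk * P * q^2" by linarith
  thus "3 * coth s * Gam s \<le> kk * (1 / sinh s ^ 2) * (sinh s / cosh s)^2"
    unfolding c_def P_def q_def G_def .
  have SC: "P * q * (sinh s * cosh s) = 1" using s by (simp add: P_def q_def power2_eq_square cosh_real_pos less_imp_neq[symmetric])
  have "(4 * c^2 - 1) * G \<le> kk * P * q"
  proof -
    have "(4 * c^2 - 1) * G \<le> (4 + 5 * P) * G" using f(1,4) by (intro mult_right_mono) (auto simp: Pc)
    thus ?thesis using b by (simp add: mult.commute)
  qed
  hence "(4 * c^2 - 1) * G * (sinh s * cosh s) \<le> kk * P * q * (sinh s * cosh s)"
    using s by (intro mult_right_mono) auto
  also have "\<dots> = kk" using SC by (simp add: mult.assoc)
  finally show "(4 * coth s ^ 2 - 1) * Gam s * (sinh s * cosh s) \<le> kk" by (simp add: c_def G_def)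
qed

text \<open>The amount by which the elementary slopes outweigh three times the moment of
  \<open>r * (r^2 - 1)\<close>. It occurs as a coefficient when directions are compared and again as
  a corner value of the forms \<open>bet\<close> and \<open>betB\<close>.\<close>

definition kap :: "real \<Rightarrow> real \<Rightarrow> real" where
  "kap s w = hU 1 2 s + hU 1 0 s - 3 * (M0 3 s w - M0 1 s w)"

lemma exp_le_1: "w \<ge> 0 \<Longrightarrow> s > 0 \<Longrightarrow> exp (- 2 * w * coth s) \<le> 1"
  using coth_gt1[of s] by simp

text \<open>Here \<open>f'' - f\<close> equals
  \<open>kk * P - kk * P * q^2 - E * (3 * c * G * P)\<close>. Since
  \<open>P * q^2 * P = P - P * q^2\<close>, this is \<open>P\<close> times the slack in
  \<open>3 * c * G * E \<le> kk * P * q^2\<close>.\<close>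

lemma kap_nonneg: assumes s: "s > 0" and w: "w \<ge> 0" shows "kap s w \<ge> 0"
proof (rule ode_nonneg[where a=0 and f="\<lambda>s. kap s w"
      and ?f1.0="\<lambda>s. hU 2 2 s + hU 2 0 s - 3 * (M1 3 s w - M1 1 s w)" and ?f2.0="\<lambda>s. hU 3 2 s + hU 3 0 s - 3 * (M2 3 s w - M2 1 s w)"])
  fix x :: real assume x: "x > 0"
  show "((\<lambda>s. kap s w) has_real_derivative hU 2 2 x + hU 2 0 x - 3 * (M1 3 x w - M1 1 x w)) (at x)"
    unfolding kap_def by (intro DERIV_diff DERIV_add DERIV_cmult M0_deriv x hU_d)
  show "((\<lambda>s. hU 2 2 s + hU 2 0 s - 3 * (M1 3 s w - M1 1 s w)) has_real_derivative hU 3 2 x + hU 3 0 x - 3 * (M2 3 x w - M2 1 x w)) (at x)"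
    by (intro DERIV_diff DERIV_add DERIV_cmult M1_deriv x hU_d) auto
  define c where "c = coth x" define P where "P = 1 / sinh x ^ 2" define q where "q = sinh x / cosh x" define G where "G = Gam x" define E where "E = exp (- 2 * w * coth x)"
  have Pc: "P = c^2 - 1" unfolding P_def c_def by (rule KG_p(3)[OF x])
  have qc: "q * c = 1" unfolding q_def c_def by (rule KG_p(4)[OF x])
  note f = Gam_le[OF x, folded c_def P_def q_def G_def]
  have G3: "3 * c * G \<le> kk * P * q^2" using Gam3(1)[OF x] by (simp add: c_def P_def q_def G_def)
  have "E * (3 * c * G * P) \<le> 1 * (3 * c * G * P)"
    using exp_le_1[OF w x] f unfolding E_def by (intro mult_right_mono) auto
  also have "\<dots> = 3 * c * G * P" by simp
  also have "\<dots> \<le> kk * P * q^2 * P" using G3 f by (intro mult_right_mono) auto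
  also have "\<dots> = kk * P - kk * P * q^2" unfolding Pc using qc by algebra
  finally have "kk * P - kk * P * q^2 - E * (3 * c * G * P) \<ge> 0" by simp
  moreover have "hU 3 2 x + hU 3 0 x - 3 * (M2 3 x w - M2 1 x w) - kap x w = kk * P - kk * P * q^2 - E * (3 * c * G * P)"
  proof -
    have "hW 1 2 x = kk * P" "hW 1 0 x = - kk * P * q^2" unfolding KG_p(2)[OF x] by (simp_all add: hWp_def P_def q_def)
    moreover have "KG 0 3 x w = E * (c^3 * G)" "KG 0 1 x w = E * (c * G)" by (simp_all add: KG_def Let_def E_def c_def G_def)
    moreover have "E * (3 * c * G * P) = 3 * (E * (c^3 * G) - E * (c * G))" unfolding Pc by algebra
    ultimately show ?thesis unfolding kap_def M2_eq hU_2 by simp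
  qed
  ultimately show "kap x w \<le> hU 3 2 x + hU 3 0 x - 3 * (M2 3 x w - M2 1 x w)" by simp
next
  have "((\<lambda>s. exp s * (hU 1 2 s - (if (1::nat) = 0 then kk else 0)) + exp s * (hU 1 0 s - (if (1::nat) = 0 then kk else 0)) - 3 * (exp s * MM 0 3 s w - exp s * MM 0 1 s w)) \<longlongrightarrow> 0 + 0 - 3 * (0 - 0)) at_top"
    by (intro tendsto_intros hU_lim MM_lim) auto
  thus "((\<lambda>s. exp s * kap s w) \<longlongrightarrow> 0) at_top" by (simp add: kap_def algebra_simps)
qed (rule s)

lemma mom_coth_deriv: assumes "s > 0"
  shows "((\<lambda>s. mom n (coth s) w) has_real_derivative - (coth s ^ n * exp (- 2 * w * coth s) * Gam s * sinh s)) (at s)"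
  by (rule has_derivative_imp_has_field_derivative[OF mom_coth_has_derivative[of "\<lambda>s. s" "\<lambda>s. s" s "\<lambda>s. w" "\<lambda>s. 0" n]])
    (use assms in auto)

lemma mom_coth_lim: "((\<lambda>s. mom n (coth s) w) \<longlongrightarrow> 0) at_top"
  using mom_tendsto_0[of n w] by (simp add: coth_def)

text \<open>A first order comparison is enough: everything vanishes at infinity, and the derivative
  is \<open>(3 * c * G * E - kk) / sinh x\<close>, negative by the first bound of
  \<open>Gam3\<close> and \<open>P * q^2 \<le> 1\<close>.\<close>

lemma lam_moment: assumes s: "s > 0" and w: "w \<ge> 0"
  shows "kk * lam s - 3 * (mom 3 (coth s) w - mom 1 (coth s) w) \<ge> 0"
proof (rule antimono_nonneg[where a=0 and f="\<lambda>s. kk * lam s - 3 * (mom 3 (coth s) w - mom 1 (coth s) w)"])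
  fix x :: real assume x: "x > 0"
  let ?E = "exp (- 2 * w * coth x)"
  let ?D = "kk * (- 1 / sinh x) - 3 * (- (coth x ^ 3 * ?E * Gam x * sinh x) - - (coth x ^ 1 * ?E * Gam x * sinh x))"
  show "((\<lambda>s. kk * lam s - 3 * (mom 3 (coth s) w - mom 1 (coth s) w)) has_real_derivative ?D) (at x)"
    by (intro DERIV_diff DERIV_cmult lam_deriv mom_coth_deriv x)
  define c where "c = coth x" define P where "P = 1 / sinh x ^ 2" define q where "q = sinh x / cosh x" define G where "G = Gam x"
  have Pc: "P = c^2 - 1" unfolding P_def c_def by (rule KG_p(3)[OF x])
  note f = Gam_le[OF x, folded c_def P_def q_def G_def]
  have G3: "3 * c * G \<le> kk * P * q^2" using Gam3(1)[OF x] by (simp add: c_def P_def q_def G_def)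
  have S: "sinh x > 0" "cosh x > 0" using x by (auto simp: cosh_real_pos)
  have PS: "P * sinh x = 1 / sinh x" using S by (simp add: P_def power2_eq_square)
  have "1 \<le> cosh x ^ 2" using cosh_sq[of x] by simp
  hence "P * q^2 \<le> 1" using S by (simp add: P_def q_def power_divide)
  hence "kk * (P * q^2) \<le> kk * 1" using kk_pos by (intro mult_left_mono) auto
  moreover have "3 * c * G * ?E \<le> 3 * c * G * 1" using exp_le_1[OF w x] f by (intro mult_left_mono) auto
  ultimately have "(3 * c * G * ?E - kk) * (1 / sinh x) \<le> 0"
    using G3 S by (intro mult_nonpos_nonneg) auto
  moreover have "?D = (3 * c * G * ?E) * (P * sinh x) - kk * (1 / sinh x)"
    unfolding Pc by (simp add: c_def[symmetric] G_def[symmetric] algebra_simps power3_eq_cube power2_eq_square)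
  ultimately show "?D \<le> 0" unfolding PS by (simp add: algebra_simps)
next
  have "(lam \<longlongrightarrow> 0) at_top" unfolding lam_def[abs_def] by real_asymp
  hence "((\<lambda>s. kk * lam s - 3 * (mom 3 (coth s) w - mom 1 (coth s) w)) \<longlongrightarrow> kk * 0 - 3 * (0 - 0)) at_top"
    by (intro tendsto_intros mom_coth_lim)
  thus "((\<lambda>s. kk * lam s - 3 * (mom 3 (coth s) w - mom 1 (coth s) w)) \<longlongrightarrow> 0) at_top" by simp
qed (rule s)

lemma At_moment: assumes s: "s > 0" and w: "w \<ge> 0"
  shows "2 * kk * At s - (4 * mom 2 (coth s) w - mom 0 (coth s) w) \<ge> 0"
proof (rule antimono_nonneg[where a=0 and f="\<lambda>s. 2 * kk * At s - (4 * mom 2 (coth s) w - mom 0 (coth s) w)"])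
  fix x :: real assume x: "x > 0"
  let ?E = "exp (- 2 * w * coth x)"
  let ?D = "2 * kk * (- 1 / (2 * cosh x)) - (4 * (- (coth x ^ 2 * ?E * Gam x * sinh x)) - - (coth x ^ 0 * ?E * Gam x * sinh x))"
  show "((\<lambda>s. 2 * kk * At s - (4 * mom 2 (coth s) w - mom 0 (coth s) w)) has_real_derivative ?D) (at x)"
    by (intro DERIV_diff DERIV_cmult At_deriv mom_coth_deriv x)
  have S: "sinh x > 0" "cosh x > 0" using x by (auto simp: cosh_real_pos)
  have "coth x ^ 2 > 1" using coth_gt1[OF x] by simp
  hence n: "(4 * coth x ^ 2 - 1) * Gam x * sinh x \<ge> 0" using Gam_bounds(1)[OF x] S by simp
  have "?E * ((4 * coth x ^ 2 - 1) * Gam x * sinh x) \<le> 1 * ((4 * coth x ^ 2 - 1) * Gam x * sinh x)"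
    using exp_le_1[OF w x] n by (intro mult_right_mono) auto
  also have "\<dots> \<le> kk / cosh x" using Gam3(2)[OF x] S by (simp add: field_simps)
  finally show "?D \<le> 0" by (simp add: algebra_simps)
next
  have "(At \<longlongrightarrow> 0) at_top" unfolding At_def[abs_def] by real_asymp
  hence "((\<lambda>s. 2 * kk * At s - (4 * mom 2 (coth s) w - mom 0 (coth s) w)) \<longlongrightarrow> 2 * kk * 0 - (4 * 0 - 0)) at_top"
    by (intro tendsto_intros mom_coth_lim)
  thus "((\<lambda>s. 2 * kk * At s - (4 * mom 2 (coth s) w - mom 0 (coth s) w)) \<longlongrightarrow> 0) at_top" by simp
qed (rule s)

text \<open>For this combination
  \<open>f'' - f = kk * (1 - tanh s) * (cosh t - coth s * sinh t)\<close>, nonnegative as soon as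
  \<open>s > t\<close>.\<close>

lemma hU_tanh_nonneg: assumes t: "0 \<le> t" "t < s"
  shows "(hU 0 0 s - kk) * cosh t + (hU 0 2 s - kk) * sinh t \<ge> 0"
proof (rule ode_nonneg[where a=t and f="\<lambda>s. (hU 0 0 s - kk) * cosh t + (hU 0 2 s - kk) * sinh t"
      and ?f1.0="\<lambda>s. hU 1 0 s * cosh t + hU 1 2 s * sinh t" and ?f2.0="\<lambda>s. hU 2 0 s * cosh t + hU 2 2 s * sinh t"])
  fix x assume x: "x > t"
  hence x0: "x > 0" using t by simp
  show "((\<lambda>s. (hU 0 0 s - kk) * cosh t + (hU 0 2 s - kk) * sinh t) has_real_derivative hU 1 0 x * cosh t + hU 1 2 x * sinh t) (at x)"
    by (rule DERIV_cong, rule DERIV_add, (rule DERIV_cmult_right DERIV_diff hU_d x0 DERIV_const)+) simp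
  show "((\<lambda>s. hU 1 0 s * cosh t + hU 1 2 s * sinh t) has_real_derivative hU 2 0 x * cosh t + hU 2 2 x * sinh t) (at x)"
    by (intro DERIV_add DERIV_cmult_right hU_d x0)
  have t1: "sinh t \<le> sinh x / cosh x * cosh t" using tanh_mono_le[OF t(1) x] by simp
  have qc: "sinh x / cosh x * coth x = 1" by (rule KG_p(4)[OF x0])
  have "(coth x - 1) * sinh t \<le> (coth x - 1) * (sinh x / cosh x * cosh t)"
    using t1 coth_gt1[OF x0] by (intro mult_left_mono) auto
  also have "\<dots> = (sinh x / cosh x * coth x) * cosh t - sinh x / cosh x * cosh t"
  proof -
    have "(c - 1) * (q * C) = (q * c) * C - q * C" for c q C :: real by (simp add: algebra_simps)
    thus ?thesis .
  qed
  finally have "(coth x - 1) * sinh t \<le> cosh t - sinh x / cosh x * cosh t" unfolding qc by simp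
  hence "kk * ((coth x - 1) * sinh t) \<le> kk * (cosh t - sinh x / cosh x * cosh t)"
    using kk_pos by (intro mult_left_mono) auto
  thus "(hU 0 0 x - kk) * cosh t + (hU 0 2 x - kk) * sinh t \<le> hU 2 0 x * cosh t + hU 2 2 x * sinh t"
    unfolding hU_2 by (simp add: hW_def algebra_simps del: hU.simps)
next
  have "((\<lambda>s. exp s * (hU 0 0 s - (if (0::nat) = 0 then kk else 0)) * cosh t + exp s * (hU 0 2 s - (if (0::nat) = 0 then kk else 0)) * sinh t) \<longlongrightarrow> 0 * cosh t + 0 * sinh t) at_top"
    by (intro tendsto_intros hU_lim) auto
  thus "((\<lambda>s. exp s * ((hU 0 0 s - kk) * cosh t + (hU 0 2 s - kk) * sinh t)) \<longlongrightarrow> 0) at_top"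
    by (simp add: algebra_simps del: hU.simps)
qed (use t in auto)

section \<open>Comparison of directions\<close>

text \<open>\<open>a1\<close> to \<open>a5\<close> are moments of manifestly nonnegative integrands:
  \<open>r * (r^2 - 1)\<close> with two modes in \<open>a1\<close> and \<open>a3\<close>,
  \<open>(r^2 - 1)^2\<close> with one mode in \<open>a2\<close> and none in \<open>a4\<close>, and
  \<open>(2 * r^2 + 1) * (r^2 - 1)\<close> with one mode in \<open>a5\<close>.\<close>

definition a1 where "a1 t s w = cosh t * (M0 3 s w - M0 1 s w) - sinh t * (M0 4 s w - M0 2 s w)"
definition a2 where "a2 t s w = cosh t * (mom 4 (coth s) w - 2 * mom 2 (coth s) w + mom 0 (coth s) w) - sinh t * (mom 5 (coth s) w - 2 * mom 3 (coth s) w + mom 1 (coth s) w)"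
definition a3 where "a3 t u s w = cosh t * cosh u * (mom 3 (coth s) w - mom 1 (coth s) w) - (sinh t * cosh u + cosh t * sinh u) * (mom 4 (coth s) w - mom 2 (coth s) w) + sinh t * sinh u * (mom 5 (coth s) w - mom 3 (coth s) w)"
definition a4 where "a4 s w = mom 4 (coth s) w - 2 * mom 2 (coth s) w + mom 0 (coth s) w"
definition a5 where "a5 t s w = cosh t * (2 * mom 4 (coth s) w - mom 2 (coth s) w - mom 0 (coth s) w) - sinh t * (2 * mom 5 (coth s) w - mom 3 (coth s) w - mom 1 (coth s) w)"

lemma a_nonneg: assumes s: "s > 0" and t: "0 \<le> t" "t \<le> s" and u: "0 \<le> u" "u \<le> s"
  shows "a1 t s w \<ge> 0" "a2 t s w \<ge> 0" "a3 t u s w \<ge> 0" "a4 s w \<ge> 0" "a5 t s w \<ge> 0"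
  using phi2_nonneg(1)[OF s t] phi1_nonneg(1)[OF s t] phi3_nonneg(1)[OF s t u] phi1_nonneg(3)[OF s t] phi1_nonneg(2)[OF s t]
  unfolding a1_def a2_def a3_def a4_def a5_def by (simp_all add: sinh_add)

text \<open>The part of a comparison between directions whose sign is not visible term by term. It
  is bilinear in \<open>cosh, sinh\<close> of \<open>s0\<close> and of \<open>s1\<close>, so its
  sign can be read off at corners; \<open>betB\<close> plays the same part for
  \<open>\<tau> = - 1\<close>.\<close>

definition bet :: "real \<Rightarrow> real \<Rightarrow> real \<Rightarrow> real \<Rightarrow> real" where
  "bet s0 s1 s w = (hU 0 0 s * sinh s0 * sinh s1 - kk * (sinh s0 * cosh s1 + cosh s0 * sinh s1) + hU 0 2 s * cosh s0 * cosh s1)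
     + (hU 1 0 s * cosh s0 * sinh s1 + hU 1 2 s * sinh s0 * cosh s1) - 3 * (sinh s0 * a1 s1 s w + sinh s * a3 s0 s1 s w)"

definition betB :: "real \<Rightarrow> real \<Rightarrow> real \<Rightarrow> real \<Rightarrow> real" where
  "betB s0 s1 s w = (hU 1 0 s * cosh s0 * sinh s1 - hU 1 2 s * sinh s0 * cosh s1)
     - (hU 0 0 s * sinh s0 * sinh s1 + kk * sinh (s1 - s0) - hU 0 2 s * cosh s0 * cosh s1)
     - 3 * sinh (s - s0) * (cosh s1 * (mom 3 (coth s) w - mom 1 (coth s) w) - sinh s1 * (mom 4 (coth s) w - mom 2 (coth s) w))"

lemma hU_M: "hU (Suc (Suc 0)) n s = hU 0 n s + hW 0 n s" by simp

lemmas ex = dfv_def val_def dfc_def Xgen_def sg_def nb_def a1_def a2_def a3_def a4_def a5_def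
  bet_def betB_def kap_def sinh_diff sinh_add

lemma hU_01: "hU 0 1 s = kk" "hU 1 1 s = 0" "hU 0 (Suc 0) s = kk" "hU (Suc 0) (Suc 0) s = 0" by simp_all

text \<open>Expansion of both sides in moments and elementary parts. The two zero lines are the
  directions of \<open>s0\<close> and \<open>s1\<close> alone, in which \<open>v\<close> is a
  combination of \<open>cosh\<close> and \<open>sinh\<close>. The direction of \<open>s\<close>
  alone gives \<open>- W\<close>, since \<open>v'' - v = W\<close> there.\<close>

lemma dirs_A:
  fixes s0 s1 s w :: real
  defines "S0 \<equiv> sinh s0" and "S1 \<equiv> sinh s1" and "S \<equiv> sinh s"
  shows
  "dfv (1/2, -1/2, -1/2, 1/2) 1 0 s0 s1 s w = dfv (-1/2, 1/2, 1/2, 1/2) 1 0 s0 s1 s w + (sinh s0 * cosh s1 + cosh s0 * sinh s1) * (hU 1 0 s + hU 1 2 s)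
     + S0 * a1 s1 s w + S1 * a1 s0 s w + S0 * S * a2 s1 s w + S1 * S * a2 s0 s w"
  "dfv (1/2, 1/2, 1/2, -1/2) 1 0 s0 s1 s w = dfv (3/2, -1/2, -1/2, -1/2) 1 0 s0 s1 s w + (sinh s0 * cosh s1 + cosh s0 * sinh s1) * kap s w
     + 6 * S0 * S1 * (M0 4 s w - M0 2 s w) + S0 * S * a2 s1 s w + S1 * S * a2 s0 s w"
  "dfv (1/2, -1/2, 1/2, -1/2) 1 0 s0 s1 s w = dfv (-1/2, 1/2, 1/2, 1/2) 1 0 s0 s1 s w + bet s0 s1 s w
     + 4 * (S0 * a1 s1 s w + S * a3 s0 s1 s w) + S0 * S1 * a2 s s w + S1 * S * a2 s0 s w"
  "dfv (1/2, 1/2, -1/2, 1/2) 1 0 s0 s1 s w = dfv (3/2, -1/2, -1/2, -1/2) 1 0 s0 s1 s w + bet s0 s1 s w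
     + S0 * S1 * a2 s s w + S1 * S * a2 s0 s w"
  "dfv (1/2, 1/2, -1/2, -1/2) 1 0 s0 s1 s w = dfv (-1/2, 1/2, 1/2, 1/2) 1 0 s0 s1 s w + bet s1 s0 s w
     + 4 * (S1 * a1 s0 s w + S * a3 s0 s1 s w) + S0 * S1 * a2 s s w + S0 * S * a2 s1 s w"
  "dfv (1/2, -1/2, 1/2, 1/2) 1 0 s0 s1 s w = dfv (3/2, -1/2, -1/2, -1/2) 1 0 s0 s1 s w + bet s1 s0 s w
     + S0 * S1 * a2 s s w + S0 * S * a2 s1 s w"
  "dfv (1, -1, 0, 0) 1 0 s0 s1 s w = 4 * S0 * a1 s1 s w"
  "dfv (1, 0, -1, 0) 1 0 s0 s1 s w = 4 * S1 * a1 s0 s w"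
  "dfv (0, 1, 0, 0) 1 0 s0 s1 s w = 0"
  "dfv (0, 0, 1, 0) 1 0 s0 s1 s w = 0"
  "dfv (0, 0, 0, 1) 1 0 s0 s1 s w = - val (\<lambda>a b. Xgen 1 hW KG 0 0 a b s w) s0 s1"
  "dfv (1, 0, 0, -1) 1 0 s0 s1 s w = 4 * S * a3 s0 s1 s w - val (\<lambda>a b. Xgen 1 hW KG 0 0 a b s w) s0 s1"
proof -
  show "dfv (1/2, -1/2, -1/2, 1/2) 1 0 s0 s1 s w = dfv (-1/2, 1/2, 1/2, 1/2) 1 0 s0 s1 s w + (sinh s0 * cosh s1 + cosh s0 * sinh s1) * (hU 1 0 s + hU 1 2 s)
     + S0 * a1 s1 s w + S1 * a1 s0 s w + S0 * S * a2 s1 s w + S1 * S * a2 s0 s w"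
    unfolding S0_def S1_def S_def ex hU_M by (simp add: M0_def M1_def hU_01 algebra_simps eval_nat_numeral del: hU.simps; (simp add: field_simps del: hU.simps)?)
  show "dfv (1/2, 1/2, 1/2, -1/2) 1 0 s0 s1 s w = dfv (3/2, -1/2, -1/2, -1/2) 1 0 s0 s1 s w + (sinh s0 * cosh s1 + cosh s0 * sinh s1) * kap s w
     + 6 * S0 * S1 * (M0 4 s w - M0 2 s w) + S0 * S * a2 s1 s w + S1 * S * a2 s0 s w"
    unfolding S0_def S1_def S_def ex hU_M by (simp add: M0_def M1_def hU_01 algebra_simps eval_nat_numeral del: hU.simps; (simp add: field_simps del: hU.simps)?)
  show "dfv (1/2, -1/2, 1/2, -1/2) 1 0 s0 s1 s w = dfv (-1/2, 1/2, 1/2, 1/2) 1 0 s0 s1 s w + bet s0 s1 s w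
     + 4 * (S0 * a1 s1 s w + S * a3 s0 s1 s w) + S0 * S1 * a2 s s w + S1 * S * a2 s0 s w"
    unfolding S0_def S1_def S_def ex hU_M by (simp add: M0_def M1_def hU_01 algebra_simps eval_nat_numeral del: hU.simps; (simp add: field_simps del: hU.simps)?)
  show "dfv (1/2, 1/2, -1/2, 1/2) 1 0 s0 s1 s w = dfv (3/2, -1/2, -1/2, -1/2) 1 0 s0 s1 s w + bet s0 s1 s w
     + S0 * S1 * a2 s s w + S1 * S * a2 s0 s w"
    unfolding S0_def S1_def S_def ex hU_M by (simp add: M0_def M1_def hU_01 algebra_simps eval_nat_numeral del: hU.simps; (simp add: field_simps del: hU.simps)?)
  show "dfv (1/2, 1/2, -1/2, -1/2) 1 0 s0 s1 s w = dfv (-1/2, 1/2, 1/2, 1/2) 1 0 s0 s1 s w + bet s1 s0 s w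
     + 4 * (S1 * a1 s0 s w + S * a3 s0 s1 s w) + S0 * S1 * a2 s s w + S0 * S * a2 s1 s w"
    unfolding S0_def S1_def S_def ex hU_M by (simp add: M0_def M1_def hU_01 algebra_simps eval_nat_numeral del: hU.simps; (simp add: field_simps del: hU.simps)?)
  show "dfv (1/2, -1/2, 1/2, 1/2) 1 0 s0 s1 s w = dfv (3/2, -1/2, -1/2, -1/2) 1 0 s0 s1 s w + bet s1 s0 s w
     + S0 * S1 * a2 s s w + S0 * S * a2 s1 s w"
    unfolding S0_def S1_def S_def ex hU_M by (simp add: M0_def M1_def hU_01 algebra_simps eval_nat_numeral del: hU.simps; (simp add: field_simps del: hU.simps)?)
  show "dfv (1, -1, 0, 0) 1 0 s0 s1 s w = 4 * S0 * a1 s1 s w"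
    unfolding S0_def S1_def S_def ex hU_M by (simp add: M0_def M1_def hU_01 algebra_simps eval_nat_numeral del: hU.simps; (simp add: field_simps del: hU.simps)?)
  show "dfv (1, 0, -1, 0) 1 0 s0 s1 s w = 4 * S1 * a1 s0 s w"
    unfolding S0_def S1_def S_def ex hU_M by (simp add: M0_def M1_def hU_01 algebra_simps eval_nat_numeral del: hU.simps; (simp add: field_simps del: hU.simps)?)
  show "dfv (0, 1, 0, 0) 1 0 s0 s1 s w = 0"
    unfolding S0_def S1_def S_def ex hU_M by (simp add: M0_def M1_def hU_01 algebra_simps eval_nat_numeral del: hU.simps; (simp add: field_simps del: hU.simps)?)
  show "dfv (0, 0, 1, 0) 1 0 s0 s1 s w = 0"
    unfolding S0_def S1_def S_def ex hU_M by (simp add: M0_def M1_def hU_01 algebra_simps eval_nat_numeral del: hU.simps; (simp add: field_simps del: hU.simps)?)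
  show "dfv (0, 0, 0, 1) 1 0 s0 s1 s w = - val (\<lambda>a b. Xgen 1 hW KG 0 0 a b s w) s0 s1"
    unfolding S0_def S1_def S_def ex hU_M by (simp add: M0_def M1_def hU_01 algebra_simps eval_nat_numeral del: hU.simps; (simp add: field_simps del: hU.simps)?)
  show "dfv (1, 0, 0, -1) 1 0 s0 s1 s w = 4 * S * a3 s0 s1 s w - val (\<lambda>a b. Xgen 1 hW KG 0 0 a b s w) s0 s1"
    unfolding S0_def S1_def S_def ex hU_M by (simp add: M0_def M1_def hU_01 algebra_simps eval_nat_numeral del: hU.simps; (simp add: field_simps del: hU.simps)?)
qed

definition alB :: "real \<Rightarrow> real \<Rightarrow> real \<Rightarrow> real \<Rightarrow> real" where
  "alB s0 s1 s w = cosh s0 * bet s1 0 s w + sinh s0 * (kk * cosh s1 - hU 1 0 s * cosh s1 - hU 0 0 s * sinh s1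
     + sinh s1 * (2 * M0 4 s w - M0 2 s w - M0 0 s w) + sinh s * a5 s1 s w)"

lemma dirs_B:
  fixes s0 s1 s w :: real
  defines "S0 \<equiv> sinh s0" and "S1 \<equiv> sinh s1" and "S \<equiv> sinh s"
  shows
  "dfv (0, 1/2, -1/2, 1/2) (-1) 0 s0 s1 s w = dfv (0, -1/2, 1/2, 1/2) (-1) 0 s0 s1 s w
     + sinh (s1 - s0) * (hU 1 0 s + hU 1 2 s + (M0 3 s w - M0 1 s w) + S * a4 s w)"
  "dfv (1, -1/2, 1/2, -1/2) (-1) 0 s0 s1 s w = dfv (1, 1/2, -1/2, -1/2) (-1) 0 s0 s1 s w
     + sinh (s1 - s0) * (kap s w + S * a4 s w)"
  "dfv (0, 1/2, 1/2, -1/2) (-1) 0 s0 s1 s w = dfv (0, -1/2, 1/2, 1/2) (-1) 0 s0 s1 s w + betB s0 s1 s w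
     + sinh (s - s0) * (4 * (cosh s1 * (mom 3 (coth s) w - mom 1 (coth s) w) - sinh s1 * (mom 4 (coth s) w - mom 2 (coth s) w)) + S1 * a4 s w)"
  "dfv (1, -1/2, -1/2, 1/2) (-1) 0 s0 s1 s w = dfv (1, 1/2, -1/2, -1/2) (-1) 0 s0 s1 s w + betB s0 s1 s w
     + sinh (s - s0) * (S1 * a4 s w)"
  "dfv (1, -1/2, -1/2, -1/2) (-1) 0 s0 s1 s w = dfv (0, -1/2, 1/2, 1/2) (-1) 0 s0 s1 s w + alB s0 s1 s w
     + 4 * (S1 * a1 s0 s w + S * a3 s0 s1 s w)"
  "dfv (0, 1/2, 1/2, 1/2) (-1) 0 s0 s1 s w = dfv (1, 1/2, -1/2, -1/2) (-1) 0 s0 s1 s w + alB s0 s1 s w"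
  "dfv (1, -1, 0, 0) (-1) 0 s0 s1 s w = 4 * S0 * a1 s1 s w"
  "dfv (1, 0, -1, 0) (-1) 0 s0 s1 s w = 4 * S1 * a1 s0 s w"
  "dfv (0, 1, 0, 0) (-1) 0 s0 s1 s w = 0"
  "dfv (0, 0, 1, 0) (-1) 0 s0 s1 s w = 0"
  "dfv (0, 0, 0, 1) (-1) 0 s0 s1 s w = - val (\<lambda>a b. Xgen (-1) hW KG 0 0 a b s w) s0 s1"
  "dfv (1, 0, 0, -1) (-1) 0 s0 s1 s w = 4 * S * a3 s0 s1 s w - val (\<lambda>a b. Xgen (-1) hW KG 0 0 a b s w) s0 s1"
proof -
  show "dfv (0, 1/2, -1/2, 1/2) (-1) 0 s0 s1 s w = dfv (0, -1/2, 1/2, 1/2) (-1) 0 s0 s1 s w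
     + sinh (s1 - s0) * (hU 1 0 s + hU 1 2 s + (M0 3 s w - M0 1 s w) + S * a4 s w)"
    unfolding S0_def S1_def S_def ex alB_def hU_M by (simp add: M0_def M1_def hU_01 algebra_simps eval_nat_numeral del: hU.simps; (simp add: field_simps del: hU.simps)?)
  show "dfv (1, -1/2, 1/2, -1/2) (-1) 0 s0 s1 s w = dfv (1, 1/2, -1/2, -1/2) (-1) 0 s0 s1 s w
     + sinh (s1 - s0) * (kap s w + S * a4 s w)"
    unfolding S0_def S1_def S_def ex alB_def hU_M by (simp add: M0_def M1_def hU_01 algebra_simps eval_nat_numeral del: hU.simps; (simp add: field_simps del: hU.simps)?)
  show "dfv (0, 1/2, 1/2, -1/2) (-1) 0 s0 s1 s w = dfv (0, -1/2, 1/2, 1/2) (-1) 0 s0 s1 s w + betB s0 s1 s w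
     + sinh (s - s0) * (4 * (cosh s1 * (mom 3 (coth s) w - mom 1 (coth s) w) - sinh s1 * (mom 4 (coth s) w - mom 2 (coth s) w)) + S1 * a4 s w)"
    unfolding S0_def S1_def S_def ex alB_def hU_M by (simp add: M0_def M1_def hU_01 algebra_simps eval_nat_numeral del: hU.simps; (simp add: field_simps del: hU.simps)?)
  show "dfv (1, -1/2, -1/2, 1/2) (-1) 0 s0 s1 s w = dfv (1, 1/2, -1/2, -1/2) (-1) 0 s0 s1 s w + betB s0 s1 s w
     + sinh (s - s0) * (S1 * a4 s w)"
    unfolding S0_def S1_def S_def ex alB_def hU_M by (simp add: M0_def M1_def hU_01 algebra_simps eval_nat_numeral del: hU.simps; (simp add: field_simps del: hU.simps)?)
  show "dfv (1, -1/2, -1/2, -1/2) (-1) 0 s0 s1 s w = dfv (0, -1/2, 1/2, 1/2) (-1) 0 s0 s1 s w + alB s0 s1 s w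
     + 4 * (S1 * a1 s0 s w + S * a3 s0 s1 s w)"
    unfolding S0_def S1_def S_def ex alB_def hU_M by (simp add: M0_def M1_def hU_01 algebra_simps eval_nat_numeral del: hU.simps; (simp add: field_simps del: hU.simps)?)
  show "dfv (0, 1/2, 1/2, 1/2) (-1) 0 s0 s1 s w = dfv (1, 1/2, -1/2, -1/2) (-1) 0 s0 s1 s w + alB s0 s1 s w"
    unfolding S0_def S1_def S_def ex alB_def hU_M by (simp add: M0_def M1_def hU_01 algebra_simps eval_nat_numeral del: hU.simps; (simp add: field_simps del: hU.simps)?)
  show "dfv (1, -1, 0, 0) (-1) 0 s0 s1 s w = 4 * S0 * a1 s1 s w"
    unfolding S0_def S1_def S_def ex alB_def hU_M by (simp add: M0_def M1_def hU_01 algebra_simps eval_nat_numeral del: hU.simps; (simp add: field_simps del: hU.simps)?)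
  show "dfv (1, 0, -1, 0) (-1) 0 s0 s1 s w = 4 * S1 * a1 s0 s w"
    unfolding S0_def S1_def S_def ex alB_def hU_M by (simp add: M0_def M1_def hU_01 algebra_simps eval_nat_numeral del: hU.simps; (simp add: field_simps del: hU.simps)?)
  show "dfv (0, 1, 0, 0) (-1) 0 s0 s1 s w = 0"
    unfolding S0_def S1_def S_def ex alB_def hU_M by (simp add: M0_def M1_def hU_01 algebra_simps eval_nat_numeral del: hU.simps; (simp add: field_simps del: hU.simps)?)
  show "dfv (0, 0, 1, 0) (-1) 0 s0 s1 s w = 0"
    unfolding S0_def S1_def S_def ex alB_def hU_M by (simp add: M0_def M1_def hU_01 algebra_simps eval_nat_numeral del: hU.simps; (simp add: field_simps del: hU.simps)?)
  show "dfv (0, 0, 0, 1) (-1) 0 s0 s1 s w = - val (\<lambda>a b. Xgen (-1) hW KG 0 0 a b s w) s0 s1"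
    unfolding S0_def S1_def S_def ex alB_def hU_M by (simp add: M0_def M1_def hU_01 algebra_simps eval_nat_numeral del: hU.simps; (simp add: field_simps del: hU.simps)?)
  show "dfv (1, 0, 0, -1) (-1) 0 s0 s1 s w = 4 * S * a3 s0 s1 s w - val (\<lambda>a b. Xgen (-1) hW KG 0 0 a b s w) s0 s1"
    unfolding S0_def S1_def S_def ex alB_def hU_M by (simp add: M0_def M1_def hU_01 algebra_simps eval_nat_numeral del: hU.simps; (simp add: field_simps del: hU.simps)?)
qed

lemma dirs_w:
  "dfv (1, 0, 0, 0) 1 0 s0 s1 s w = ((hU 0 0 s - (4 * M0 2 s w - M0 0 s w)) * cosh s1 - (kk - (4 * M0 3 s w - M0 1 s w)) * sinh s1) * cosh s0
     + (- (kk - (4 * M0 3 s w - M0 1 s w)) * cosh s1 + (hU 0 2 s - (4 * M0 4 s w - M0 2 s w)) * sinh s1) * sinh s0"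
  "dfv (1, 0, 0, 0) (-1) 0 s0 s1 s w = ((hU 0 0 s - (4 * M0 2 s w - M0 0 s w)) * cosh s1 - (kk - (4 * M0 3 s w - M0 1 s w)) * sinh s1) * cosh s0
     + ((kk + (4 * M0 3 s w - M0 1 s w)) * cosh s1 - (hU 0 2 s + (4 * M0 4 s w - M0 2 s w)) * sinh s1) * sinh s0"
  unfolding dfv_def val_def dfc_def Xgen_def sg_def nb_def
  by (simp_all add: M0_def hU_01 algebra_simps eval_nat_numeral del: hU.simps)

text \<open>For the zero direction the defect is \<open>v\<close> itself. It is written as the
  defect in the direction of \<open>w\<close> plus the second \<open>w\<close>-derivative, a moment
  of \<open>4 * r^2\<close> with three modes.\<close>

lemma dirs_0: "dfv (0, 0, 0, 0) \<tau> 0 s0 s1 s w = dfv (1, 0, 0, 0) \<tau> 0 s0 s1 s w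
   + 4 * (cosh s0 * cosh s1 * M0 2 s w - (sinh s0 * cosh s1 + cosh s0 * sinh s1) * M0 3 s w + sinh s0 * sinh s1 * M0 4 s w)"
  unfolding dfv_def val_def dfc_def Xgen_def sg_def nb_def
  by (simp add: M0_def hU_01 algebra_simps eval_nat_numeral del: hU.simps)

section \<open>Signs of the comparison terms\<close>

lemma kap_pos: assumes "s > 0" "(w::real) \<ge> 0" shows "hU 1 0 s + hU 1 2 s \<ge> 0"
  using kap_nonneg[OF assms] M0_diff_nonneg(1)[OF assms(1), of w] by (simp add: kap_def del: hU.simps)

text \<open>Solutions of \<open>f'' = f\<close> on \<open>[0, s]\<close> are interpolated from their
  end values with the nonnegative weights \<open>sinh (s - t) / sinh s\<close> and
  \<open>sinh t / sinh s\<close>.\<close>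

lemma interp_nonneg:
  fixes a b :: real
  assumes s: "s > 0" and t: "0 \<le> t" "t \<le> s" and "a \<ge> 0" "a * cosh s + b * sinh s \<ge> 0"
  shows "a * cosh t + b * sinh t \<ge> 0"
proof -
  have S: "sinh s > 0" using s by simp
  have "sinh s * (a * cosh t + b * sinh t) = a * sinh (s - t) + (a * cosh s + b * sinh s) * sinh t"
    by (simp add: sinh_diff algebra_simps)
  also have "\<dots> \<ge> 0"
  proof -
    have "a * sinh (s - t) \<ge> 0" using assms by simp
    moreover have "(a * cosh s + b * sinh s) * sinh t \<ge> 0" using assms(5) t by (intro mult_nonneg_nonneg) simp_all
    ultimately show ?thesis by linarith
  qed
  finally show ?thesis using S by (simp add: zero_le_mult_iff)
qed

text \<open>The same interpolation with the right end at infinity: \<open>a + b\<close> is the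
  coefficient of the growing part.\<close>

lemma exp_interp_nonneg:
  fixes a b :: real
  assumes t: "0 \<le> t" and "a \<ge> 0" "a + b \<ge> 0"
  shows "a * cosh t + b * sinh t \<ge> 0"
proof -
  have "a * cosh t + b * sinh t = a * exp (- t) + (a + b) * sinh t"
    using cosh_minus_sinh[of t] by (simp add: algebra_simps)
  also have "\<dots> \<ge> 0"
  proof -
    have "(a + b) * sinh t \<ge> 0" using assms(3) t by (intro mult_nonneg_nonneg) simp_all
    moreover have "a * exp (- t) \<ge> 0" using assms(2) by simp
    ultimately show ?thesis by linarith
  qed
  finally show ?thesis .
qed

lemma bet_corners:
  "s > 0 \<Longrightarrow> bet 0 0 s w = sinh s * (kk * lam s - 3 * (mom 3 (coth s) w - mom 1 (coth s) w))"
  "s > 0 \<Longrightarrow> bet 0 s s w = sinh s * kap s w"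
  "s > 0 \<Longrightarrow> bet s 0 s w = 2 * sinh s * (kap s w - hU 1 0 s)"
  "s > 0 \<Longrightarrow> bet s s s w = 2 * sinh s * (cosh s * kap s w + 3 * sinh s * (M0 4 s w - M0 2 s w))"
proof -
  have h: "hU 0 0 s = kk * (2 * At s * cosh s)" "hU 1 0 s = kk * (2 * At s * sinh s - 1)" "hU 0 2 s = kk * (lam s * sinh s)" "hU 1 2 s = kk * (lam s * cosh s - 1)"
    by simp_all
  show "bet 0 0 s w = sinh s * (kk * lam s - 3 * (mom 3 (coth s) w - mom 1 (coth s) w))"
    unfolding bet_def a1_def a3_def h by (simp add: algebra_simps)
  show "bet 0 s s w = sinh s * kap s w"
    unfolding bet_def a1_def a3_def kap_def h M0_exp by (simp add: algebra_simps)
  show "bet s 0 s w = 2 * sinh s * (kap s w - hU 1 0 s)"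
    unfolding bet_def a1_def a3_def kap_def h M0_exp by (simp add: algebra_simps)
  show "bet s s s w = 2 * sinh s * (cosh s * kap s w + 3 * sinh s * (M0 4 s w - M0 2 s w))"
    unfolding bet_def a1_def a3_def kap_def h M0_exp by (simp add: algebra_simps)
qed

text \<open>Two interpolations, in \<open>u\<close> at the ends of the \<open>t\<close>-interval and
  then in \<open>t\<close>, reduce the claim to the four corners of the square with side
  \<open>[0, s]\<close>. The corners are settled by \<open>lam_moment\<close>, by
  \<open>kap_nonneg\<close> and by signs of single terms.\<close>

lemma bet_nonneg:
  assumes s: "s > 0" and w: "w \<ge> 0" and t: "0 \<le> t" "t \<le> s" and u: "0 \<le> u" "u \<le> s"
  shows "bet t u s w \<ge> 0"
proof -
  have S: "sinh s > 0" "cosh s > 0" using s by (auto simp: cosh_real_pos)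
  have c: "bet 0 0 s w \<ge> 0" "bet 0 s s w \<ge> 0" "bet s 0 s w \<ge> 0" "bet s s s w \<ge> 0"
    unfolding bet_corners[OF s] using S kap_nonneg[OF s w] lam_moment[OF s w] hU_signs(2)[OF s] M0_diff_nonneg(2)[OF s, of w]
    by (simp_all del: hU.simps)
  have lin1: "\<exists>a b. \<forall>u. bet t u s w = a * cosh u + b * sinh u" for t
    unfolding bet_def a1_def a3_def
    by (rule exI[of _ "- kk * sinh t + hU 0 2 s * cosh t + hU 1 2 s * sinh t - 3 * (sinh t * (M0 3 s w - M0 1 s w) + sinh s * (cosh t * (mom 3 (coth s) w - mom 1 (coth s) w) - sinh t * (mom 4 (coth s) w - mom 2 (coth s) w)))"],
        rule exI[of _ "hU 0 0 s * sinh t - kk * cosh t + hU 1 0 s * cosh t - 3 * (- sinh t * (M0 4 s w - M0 2 s w) + sinh s * (- cosh t * (mom 4 (coth s) w - mom 2 (coth s) w) + sinh t * (mom 5 (coth s) w - mom 3 (coth s) w)))"])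
      (simp add: algebra_simps del: hU.simps)
  have lin0: "\<exists>a b. \<forall>t. bet t u s w = a * cosh t + b * sinh t" for u
    unfolding bet_def a1_def a3_def
    by (rule exI[of _ "- kk * sinh u + hU 0 2 s * cosh u + hU 1 0 s * sinh u - 3 * (sinh s * (cosh u * (mom 3 (coth s) w - mom 1 (coth s) w) - sinh u * (mom 4 (coth s) w - mom 2 (coth s) w)))"],
        rule exI[of _ "hU 0 0 s * sinh u - kk * cosh u + hU 1 2 s * cosh u - 3 * ((cosh u * (M0 3 s w - M0 1 s w) - sinh u * (M0 4 s w - M0 2 s w)) + sinh s * (- cosh u * (mom 4 (coth s) w - mom 2 (coth s) w) + sinh u * (mom 5 (coth s) w - mom 3 (coth s) w)))"])
      (simp add: algebra_simps del: hU.simps)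
  have edge: "bet t u s w \<ge> 0" if "bet t 0 s w \<ge> 0" "bet t s s w \<ge> 0" "0 \<le> u" "u \<le> s" for t u
  proof -
    obtain a b where ab: "\<And>u. bet t u s w = a * cosh u + b * sinh u" using lin1[of t] by blast
    show ?thesis unfolding ab
      by (rule interp_nonneg[OF s that(3,4)]) (use that(1,2) in \<open>simp_all add: ab\<close>)
  qed
  have "bet 0 u s w \<ge> 0" "bet s u s w \<ge> 0" by (rule edge; use c u in simp)+
  moreover obtain a b where ab: "\<And>t. bet t u s w = a * cosh t + b * sinh t" using lin0[of u] by blast
  ultimately show ?thesis unfolding ab
    using interp_nonneg[OF s t, of a b] by simp
qed

lemma betB_nonneg:
  assumes s: "s > 0" and w: "w \<ge> 0" and t: "0 \<le> t" "t \<le> s" and u: "0 \<le> u" "u \<le> s"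
  shows "betB t u s w \<ge> 0"
proof -
  have S: "sinh s > 0" "cosh s > 0" "sinh (s - t) \<ge> 0" using s t by (auto simp: cosh_real_pos)
  have h: "hU 0 0 s = kk * (2 * At s * cosh s)" "hU 1 0 s = kk * (2 * At s * sinh s - 1)" "hU 0 2 s = kk * (lam s * sinh s)" "hU 1 2 s = kk * (lam s * cosh s - 1)"
    by simp_all
  have c0: "betB t 0 s w = sinh (s - t) * (kk * lam s - 3 * (mom 3 (coth s) w - mom 1 (coth s) w)) + 2 * kk * sinh t"
    unfolding betB_def h sinh_diff by (simp add: algebra_simps)
  have c1: "betB t s s w = sinh (s - t) * kap s w"
    unfolding betB_def kap_def h M0_exp sinh_diff by (simp add: algebra_simps)
  have "\<exists>a b. \<forall>u. betB t u s w = a * cosh u + b * sinh u"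
    unfolding betB_def sinh_diff
    by (rule exI[of _ "- hU 1 2 s * sinh t + kk * sinh t + hU 0 2 s * cosh t - 3 * (sinh s * cosh t - cosh s * sinh t) * (mom 3 (coth s) w - mom 1 (coth s) w)"],
        rule exI[of _ "hU 1 0 s * cosh t - hU 0 0 s * sinh t - kk * cosh t + 3 * (sinh s * cosh t - cosh s * sinh t) * (mom 4 (coth s) w - mom 2 (coth s) w)"])
      (simp add: algebra_simps del: hU.simps)
  then obtain a b where ab: "\<And>u. betB t u s w = a * cosh u + b * sinh u" by blast
  have "betB t 0 s w \<ge> 0" unfolding c0 using S t kk_pos lam_moment[OF s w] by (intro add_nonneg_nonneg mult_nonneg_nonneg) auto
  moreover have "betB t s s w \<ge> 0" unfolding c1 using S kap_nonneg[OF s w] by simp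
  ultimately show ?thesis unfolding ab using interp_nonneg[OF s u, of a b] by simp
qed

lemma alB_nonneg:
  assumes s: "s > 0" and w: "w \<ge> 0" and t: "0 \<le> t" "t \<le> s" and u: "0 \<le> u" "u \<le> s"
  shows "alB t u s w \<ge> 0"
proof -
  have S: "sinh s > 0" "cosh s > 0" "sinh t \<ge> 0" "sinh u \<ge> 0" "cosh u > 0" using s t u by (auto simp: cosh_real_pos)
  have "2 * M0 4 s w - M0 2 s w - M0 0 s w = a5 s s w"
    unfolding a5_def M0_exp by (simp add: algebra_simps)
  hence m: "2 * M0 4 s w - M0 2 s w - M0 0 s w \<ge> 0" using a_nonneg(5)[OF s _ _ _ _, of s 0 w] s by simp
  have A: "At s \<ge> 0" by (simp add: At_def)
  have q: "2 * At s * sinh s \<le> 1" using hU_signs(2)[OF s] kk_pos by (simp add: mult_le_0_iff)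
  have "2 * At s * sinh (s + u) \<le> 2 * cosh u"
  proof -
    have "sinh (s - u) \<ge> 0" using u by simp
    hence "cosh s * sinh u \<le> sinh s * cosh u" by (simp add: sinh_diff)
    hence "sinh (s + u) \<le> 2 * (sinh s * cosh u)" by (simp add: sinh_add algebra_simps)
    hence "2 * At s * sinh (s + u) \<le> 2 * At s * (2 * (sinh s * cosh u))" using A by (intro mult_left_mono) auto
    also have "\<dots> = 2 * (2 * At s * sinh s) * cosh u" by simp
    also have "\<dots> \<le> 2 * 1 * cosh u" using q S by (intro mult_right_mono mult_left_mono) auto
    finally show ?thesis by simp
  qed
  hence "kk * (2 * cosh u - 2 * At s * sinh (s + u)) \<ge> 0" using kk_pos by simp
  moreover have "kk * (2 * cosh u - 2 * At s * sinh (s + u)) = kk * cosh u - hU 1 0 s * cosh u - hU 0 0 s * sinh u"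
    by (simp add: sinh_add algebra_simps)
  ultimately have "kk * cosh u - hU 1 0 s * cosh u - hU 0 0 s * sinh u \<ge> 0" by linarith
  thus ?thesis unfolding alB_def
    using bet_nonneg[OF s w u, of 0] s m S a_nonneg(5)[OF s u t, of w]
    by (intro add_nonneg_nonneg mult_nonneg_nonneg) auto
qed

text \<open>The defect in the direction of \<open>s\<close> alone is minus this value. The sign
  rests on \<open>E * G \<le> G \<le> kk * tanh s\<close>, the endpoint term being dominated by the
  elementary one.\<close>

lemma W_sign:
  assumes s: "0 \<le> s0" "s0 \<le> s1" "s1 < s" and w: "w \<ge> 0" and \<tau>: "\<tau> = 1 \<or> \<tau> = -1"
  shows "val (\<lambda>a b. Xgen \<tau> hW KG 0 0 a b s w) s0 s1 \<le> 0"
proof -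
  have s': "s > 0" using s by simp
  define c where "c = coth s" define q where "q = sinh s / cosh s" define G where "G = Gam s" define E where "E = exp (- 2 * w * coth s)"
  have qc: "q * c = 1" unfolding q_def c_def by (rule KG_p(4)[OF s'])
  note f = Gam_le[OF s', folded c_def q_def G_def]
  have E: "0 < E" "E \<le> 1" using exp_le_1[OF w s'] by (auto simp: E_def)
  have "E * G \<le> 1 * G" using E f by (intro mult_right_mono) auto
  hence EG: "E * G \<le> kk * q" using f by simp
  have t: "cosh s1 - c * sinh s1 \<ge> 0" "cosh s0 - c * sinh s0 \<ge> 0" unfolding c_def using tanh_mono_le[of _ s] s by auto
  have hw: "hW 0 0 s = - kk * q" "hW 0 1 s = - kk" "hW 0 (Suc 0) s = - kk" "hW 0 2 s = - kk * c" "hW 0 (Suc (Suc 0)) s = - kk * c"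
    by (simp_all add: hW_def q_def c_def)
  have kg: "KG 0 n s w = E * (c ^ n * G)" for n by (simp add: KG_def E_def c_def G_def)
  from \<tau> show ?thesis
  proof
    assume \<tau>: "\<tau> = 1"
    \<comment> \<open>A polynomial identity in the letters once a multiple of
      \<open>1 - q * c\<close> is added; that multiple is zero.\<close>
    have "val (\<lambda>a b. Xgen \<tau> hW KG 0 0 a b s w) s0 s1 = (cosh s1 - c * sinh s1) * (cosh s0 - c * sinh s0) * (E * G - kk * q)
      + kk * (1 - q * c) * X" if "X = (sinh s0 * cosh s1 + cosh s0 * sinh s1) - c * sinh s0 * sinh s1" for X
      unfolding that val_def Xgen_def sg_def nb_def \<tau> by (simp add: hw kg algebra_simps power2_eq_square)
    hence "val (\<lambda>a b. Xgen \<tau> hW KG 0 0 a b s w) s0 s1 = (cosh s1 - c * sinh s1) * (cosh s0 - c * sinh s0) * (E * G - kk * q)"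
      using qc by simp
    also have "\<dots> \<le> 0" using t EG by (intro mult_nonneg_nonpos) auto
    finally show ?thesis .
  next
    assume \<tau>: "\<tau> = -1"
    have "val (\<lambda>a b. Xgen \<tau> hW KG 0 0 a b s w) s0 s1 = - ((cosh s1 - c * sinh s1) * ((kk * q - E * G) * cosh s0 + (kk + E * G * c) * sinh s0))
      + kk * (1 - q * c) * X" if "X = cosh s0 * sinh s1" for X
      unfolding that val_def Xgen_def sg_def nb_def \<tau> by (simp add: hw kg algebra_simps power2_eq_square)
    hence "val (\<lambda>a b. Xgen \<tau> hW KG 0 0 a b s w) s0 s1 = - ((cosh s1 - c * sinh s1) * ((kk * q - E * G) * cosh s0 + (kk + E * G * c) * sinh s0))"
      using qc by simp
    moreover have "(cosh s1 - c * sinh s1) * ((kk * q - E * G) * cosh s0 + (kk + E * G * c) * sinh s0) \<ge> 0"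
      using t EG E f s kk_pos by (intro mult_nonneg_nonneg add_nonneg_nonneg) auto
    ultimately show ?thesis by simp
  qed
qed

text \<open>In the direction of \<open>w\<close> the moments enter with the negative factor
  \<open>1 - 4 * r^2\<close>, so the elementary part has to dominate them. At
  \<open>s0 = s1 = 0\<close> this is \<open>At_moment\<close>; the remaining range of
  \<open>s0\<close> and \<open>s1\<close> is reached by \<open>exp_interp_nonneg\<close> or by
  termwise signs.\<close>

lemma dfv_w_nonneg:
  assumes s: "0 \<le> s0" "s0 \<le> s1" "s1 < s" and w: "w \<ge> 0" and \<tau>: "\<tau> = 1 \<or> \<tau> = -1"
  shows "dfv (1, 0, 0, 0) \<tau> 0 s0 s1 s w \<ge> 0"
proof -
  have s': "s > 0" using s by simp
  have S: "sinh s0 \<ge> 0" "sinh s1 \<ge> 0" "sinh s > 0" "cosh s > 0" using s by (auto simp: cosh_real_pos)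
  note g = hU_signs[OF s']
  have p6: "cosh t * (4 * M0 3 s w - 4 * M0 2 s w - M0 1 s w + M0 0 s w) - sinh t * (4 * M0 4 s w - 4 * M0 3 s w - M0 2 s w + M0 1 s w) \<ge> 0" if "0 \<le> t" "t \<le> s" for t
    by (rule phi2_nonneg(2)[OF s' that])
  have y00: "hU 0 0 s - (4 * M0 2 s w - M0 0 s w) \<ge> 0"
  proof -
    have "cosh s * (2 * kk * At s - (4 * mom 2 (coth s) w - mom 0 (coth s) w)) + sinh s * (4 * mom 3 (coth s) w - mom 1 (coth s) w) \<ge> 0"
      using At_moment[OF s' w] phi1_nonneg(4)[OF s' _ _, of 0 w] S s' by (intro add_nonneg_nonneg mult_nonneg_nonneg) auto
    thus ?thesis by (simp add: M0_exp algebra_simps)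
  qed
  have y0: "(hU 0 0 s - (4 * M0 2 s w - M0 0 s w)) * cosh s1 - (kk - (4 * M0 3 s w - M0 1 s w)) * sinh s1 \<ge> 0"
    using exp_interp_nonneg[of s1 "hU 0 0 s - (4 * M0 2 s w - M0 0 s w)" "- (kk - (4 * M0 3 s w - M0 1 s w))"] y00 p6[of 0] g(3) s
    by (simp add: algebra_simps del: hU.simps)
  from \<tau> show ?thesis
  proof
    assume \<tau>: "\<tau> = 1"
    show ?thesis unfolding \<tau> dirs_w
    proof (rule exp_interp_nonneg[OF s(1) y0])
      have "(hU 0 0 s - kk) * cosh s1 + (hU 0 2 s - kk) * sinh s1 \<ge> 0" by (rule hU_tanh_nonneg) (use s in auto)
      thus "(hU 0 0 s - (4 * M0 2 s w - M0 0 s w)) * cosh s1 - (kk - (4 * M0 3 s w - M0 1 s w)) * sinh s1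
        + (- (kk - (4 * M0 3 s w - M0 1 s w)) * cosh s1 + (hU 0 2 s - (4 * M0 4 s w - M0 2 s w)) * sinh s1) \<ge> 0"
        using p6[of s1] s by (simp add: algebra_simps del: hU.simps)
    qed
  next
    assume \<tau>: "\<tau> = -1"
    have "sinh s1 \<le> cosh s1" by (simp add: sinh_def cosh_def)
    have "hU 0 2 s * sinh s1 \<le> kk * sinh s1" using g S by (intro mult_right_mono) auto
    also have "\<dots> \<le> kk * cosh s1" using \<open>sinh s1 \<le> cosh s1\<close> kk_pos by simp
    finally have "kk * cosh s1 - hU 0 2 s * sinh s1 \<ge> 0" by simp
    moreover have "cosh s1 * (4 * M0 3 s w - M0 1 s w) - sinh s1 * (4 * M0 4 s w - M0 2 s w) \<ge> 0"
      by (rule phi2_nonneg(3)[OF s']) (use s in auto)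
    ultimately have "(kk + (4 * M0 3 s w - M0 1 s w)) * cosh s1 - (hU 0 2 s + (4 * M0 4 s w - M0 2 s w)) * sinh s1 \<ge> 0"
      by (simp add: algebra_simps del: hU.simps)
    thus ?thesis unfolding \<tau> dirs_w using y0 S by (intro add_nonneg_nonneg mult_nonneg_nonneg) auto
  qed
qed

text \<open>One direction for each of the sixteen pairs of complementary controls, up to sign, in
  the coordinates \<open>(w, s0, s1, s)\<close> divided by \<open>sqrt 2\<close>.\<close>

definition dsetA :: "(real \<times> real \<times> real \<times> real) set" where
  "dsetA = {(0,0,0,0), (-1/2,1/2,1/2,1/2), (1/2,-1/2,-1/2,1/2), (0,0,0,1), (1/2,-1/2,1/2,-1/2), (0,0,1,0), (1,-1,0,0), (1/2,-1/2,1/2,1/2),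
    (1/2,1/2,-1/2,-1/2), (0,1,0,0), (1,0,-1,0), (1/2,1/2,-1/2,1/2), (1,0,0,-1), (1/2,1/2,1/2,-1/2), (3/2,-1/2,-1/2,-1/2), (1,0,0,0)}"

definition dsetB :: "(real \<times> real \<times> real \<times> real) set" where
  "dsetB = {(0,0,0,0), (0,-1/2,1/2,1/2), (0,1/2,-1/2,1/2), (0,0,0,1), (0,1/2,1/2,-1/2), (0,0,1,0), (0,1,0,0), (0,1/2,1/2,1/2),
    (1,-1/2,-1/2,-1/2), (1,-1,0,0), (1,0,-1,0), (1,-1/2,-1/2,1/2), (1,0,0,-1), (1,-1/2,1/2,-1/2), (1,1/2,-1/2,-1/2), (1,0,0,0)}"

lemma dfv_nonneg:
  assumes s: "0 \<le> s0" "s0 \<le> s1" "s1 < s" and w: "w \<ge> 0"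
  shows "e \<in> dsetA \<Longrightarrow> dfv e 1 0 s0 s1 s w \<ge> 0" "e \<in> dsetB \<Longrightarrow> dfv e (-1) 0 s0 s1 s w \<ge> 0"
proof -
  have s': "s > 0" and t: "0 \<le> s0" "s0 \<le> s" and u: "0 \<le> s1" "s1 \<le> s" and ss: "0 \<le> s" "s \<le> s" using s by auto
  have S: "sinh s0 \<ge> 0" "sinh s1 \<ge> 0" "sinh s \<ge> 0" "sinh (s1 - s0) \<ge> 0" "sinh (s - s0) \<ge> 0" using s by auto
  have Sa: "sinh s0 * cosh s1 + cosh s0 * sinh s1 \<ge> 0" using S by simp
  note nn = dfv_ref_nonneg[OF s w] S Sa a_nonneg[OF s' t u, of w] a_nonneg[OF s' u t, of w] a_nonneg[OF s' ss ss, of w] M0_diff_nonneg[OF s', of w]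
    kap_nonneg[OF s' w] kap_pos[OF s' w] bet_nonneg[OF s' w t u] bet_nonneg[OF s' w u t] betB_nonneg[OF s' w t u] alB_nonneg[OF s' w t u]
  have W: "- val (\<lambda>a b. Xgen 1 hW KG 0 0 a b s w) s0 s1 \<ge> 0" "- val (\<lambda>a b. Xgen (-1) hW KG 0 0 a b s w) s0 s1 \<ge> 0"
    using W_sign[OF s w] by auto
  have vw: "dfv (1, 0, 0, 0) 1 0 s0 s1 s w \<ge> 0" "dfv (1, 0, 0, 0) (-1) 0 s0 s1 s w \<ge> 0"
    using dfv_w_nonneg[OF s w] by auto
  have V: "cosh s0 * cosh s1 * M0 2 s w - (sinh s0 * cosh s1 + cosh s0 * sinh s1) * M0 3 s w + sinh s0 * sinh s1 * M0 4 s w \<ge> 0"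
    using phi3_nonneg(2)[OF s' t u, of w] by (simp add: sinh_add algebra_simps)
  have v0: "dfv (0, 0, 0, 0) 1 0 s0 s1 s w \<ge> 0" "dfv (0, 0, 0, 0) (-1) 0 s0 s1 s w \<ge> 0"
    unfolding dirs_0 using add_nonneg_nonneg[OF vw(1) mult_nonneg_nonneg[OF _ V, of 4]] add_nonneg_nonneg[OF vw(2) mult_nonneg_nonneg[OF _ V, of 4]]
    by simp_all
  have p3: "cosh s1 * (mom 3 (coth s) w - mom 1 (coth s) w) - sinh s1 * (mom 4 (coth s) w - mom 2 (coth s) w) \<ge> 0"
    using a_nonneg(3)[OF s' u, of 0 w] s' by (simp add: a3_def algebra_simps)
  have W1: "0 \<le> 4 * sinh s * a3 s0 s1 s w - val (\<lambda>a b. Xgen 1 hW KG 0 0 a b s w) s0 s1"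
    "0 \<le> 4 * sinh s * a3 s0 s1 s w - val (\<lambda>a b. Xgen (-1) hW KG 0 0 a b s w) s0 s1"
  proof -
    have "4 * sinh s * a3 s0 s1 s w \<ge> 0" using nn by simp
    thus "0 \<le> 4 * sinh s * a3 s0 s1 s w - val (\<lambda>a b. Xgen 1 hW KG 0 0 a b s w) s0 s1"
    "0 \<le> 4 * sinh s * a3 s0 s1 s w - val (\<lambda>a b. Xgen (-1) hW KG 0 0 a b s w) s0 s1" using W by linarith+
  qed
  show "dfv e 1 0 s0 s1 s w \<ge> 0" if "e \<in> dsetA"
    using that unfolding dsetA_def
    by (elim insertE emptyE; (simp only: dirs_A))
       (use nn W W1 vw v0 in \<open>auto intro!: add_nonneg_nonneg mult_nonneg_nonneg simp del: hU.simps\<close>)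
  show "dfv e (-1) 0 s0 s1 s w \<ge> 0" if "e \<in> dsetB"
    using that unfolding dsetB_def
    by (elim insertE emptyE; (simp only: dirs_B))
       (use nn W W1 vw v0 p3 in \<open>auto intro!: add_nonneg_nonneg mult_nonneg_nonneg simp del: hU.simps\<close>)
qed

section \<open>Jets across the interfaces\<close>

text \<open>At \<open>w = 0\<close> the exponential is 1 and \<open>Ah\<close> vanishes, so the
  first reference direction becomes an equality case on the interface. Across the interface, in the
  third region, the opposite direction moves only the argument of the fourth mode, in which
  \<open>v\<close> is a combination of \<open>cosh\<close> and \<open>sinh\<close>; the two facts
  match.\<close>

lemma dfc_h_zero: assumes s: "s > 0" shows "dfc (3/2, -1/2, -1/2, -1/2) (X0 1) 0 a b s 0 = 0"
proof (rule ode_zero[where f="\<lambda>s. dfc (3/2, -1/2, -1/2, -1/2) (X0 1) 0 a b s 0" and a=0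
      and ?f1.0="\<lambda>s. dfc (3/2, -1/2, -1/2, -1/2) (X0 1) (Suc 0) a b s 0" and ?f2.0="\<lambda>s. dfc (3/2, -1/2, -1/2, -1/2) (X0 1) (Suc (Suc 0)) a b s 0"])
  fix x :: real assume x: "x > 0"
  show "((\<lambda>s. dfc (3/2, -1/2, -1/2, -1/2) (X0 1) 0 a b s 0) has_real_derivative dfc (3/2, -1/2, -1/2, -1/2) (X0 1) (Suc 0) a b x 0) (at x)"
    by (rule dfc_deriv[OF x]) simp
  show "((\<lambda>s. dfc (3/2, -1/2, -1/2, -1/2) (X0 1) (Suc 0) a b s 0) has_real_derivative dfc (3/2, -1/2, -1/2, -1/2) (X0 1) (Suc (Suc 0)) a b x 0) (at x)"
    by (rule dfc_deriv[OF x]) simp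
  have "dfc (3/2, -1/2, -1/2, -1/2) (X0 1) (Suc (Suc 0)) a b x 0 = dfc (3/2, -1/2, -1/2, -1/2) (X0 1) 0 a b x 0
     + dfc (3/2, -1/2, -1/2, -1/2) (Xgen 1 hW KG) 0 a b x 0"
    unfolding dfc_def prod.case X0_Suc_Suc by (simp add: algebra_simps)
  also have "dfc (3/2, -1/2, -1/2, -1/2) (Xgen 1 hW KG) 0 a b x 0 = 0"
    unfolding dfc_W[OF x]
    by (rule bool_pair_cases[of "\<lambda>a b. dfc (3/2, -1/2, -1/2, -1/2) (Xgen 1 (\<lambda>i n s. hWp i n (coth x) (1 / sinh x ^ 2) (sinh x / cosh x)) (\<lambda>i n s w. KGp i n (coth x) (1 / sinh x ^ 2) (sinh x / cosh x) w (exp (- 2 * 0 * coth x)) (Gam x))) 0 a b x 0 = 0"])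
      (simp_all only: dfc_p[OF KG_p(3)[OF x] KG_p(4)[OF x]], simp_all add: Ah_def)
  finally show "dfc (3/2, -1/2, -1/2, -1/2) (X0 1) (Suc (Suc 0)) a b x 0 = dfc (3/2, -1/2, -1/2, -1/2) (X0 1) 0 a b x 0" by simp
next
  define D where "D = (\<lambda>s i j a b (s'::real) (w'::real). exp s * (X0 1 i j a b s 0 - X8 1 i j a b s 0))"
  have "((\<lambda>s. dfc (3/2, -1/2, -1/2, -1/2) (D s) 0 a b s 0) \<longlongrightarrow> dfc (3/2, -1/2, -1/2, -1/2) (\<lambda>i j a b s w. 0) 0 a b (0::real) (0::real)) at_top"
    unfolding dfc_def prod.case D_def by (intro tendsto_intros X0_lim) auto
  hence l: "((\<lambda>s. dfc (3/2, -1/2, -1/2, -1/2) (D s) 0 a b s 0) \<longlongrightarrow> 0) at_top" by (simp add: dfc_def)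
  have z: "dfc (3/2, -1/2, -1/2, -1/2) (X8 1) 0 a b s 0 = 0" for s
    by (cases a; cases b) (simp_all add: dfc_def X8_def Xgen_def sg_def power2_eq_square)
  have e: "exp s * dfc (3/2, -1/2, -1/2, -1/2) (X0 1) 0 a b s 0 = dfc (3/2, -1/2, -1/2, -1/2) (D s) 0 a b s 0 + exp s * dfc (3/2, -1/2, -1/2, -1/2) (X8 1) 0 a b s 0" for s
    unfolding dfc_def D_def prod.case by (simp add: algebra_simps)
  show "((\<lambda>s. exp s * dfc (3/2, -1/2, -1/2, -1/2) (X0 1) 0 a b s 0) \<longlongrightarrow> 0) at_top"
    using l unfolding e z by simp
qed (rule s)

section \<open>Identities between moments at \<open>w = 0\<close>\<close>

lemma M1_Suc_deriv: assumes "s > 0"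
  shows "((\<lambda>s. M0 n s w) has_real_derivative M1 n s w) (at s)"
    "((\<lambda>s. M1 n s w) has_real_derivative M0 n s w + KG 0 n s w) (at s)"
    "((\<lambda>s. M0 n s w + KG 0 n s w) has_real_derivative M1 n s w + KG 1 n s w) (at s)"
  using MM_deriv[OF assms, of 0 n w] MM_deriv[OF assms, of 1 n w] MM_deriv[OF assms, of 2 n w]
  by (simp_all add: numeral_2_eq_2)

lemma M_lims: "((\<lambda>s. exp s * M0 n s w) \<longlongrightarrow> 0) at_top" "((\<lambda>s. exp s * M1 n s w) \<longlongrightarrow> 0) at_top"
  by (rule M0_lim M1_lim)+

lemma h_lims:
  "((\<lambda>s. exp s * (hU 0 n s - kk)) \<longlongrightarrow> 0) at_top" "((\<lambda>s. exp s * hU 1 n s) \<longlongrightarrow> 0) at_top"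
  using hU_lim[of 0 n] hU_lim[of 1 n] by (simp_all del: hU.simps)

lemma KG_w0: assumes x: "x > 0"
  defines "c \<equiv> coth x" and "P \<equiv> 1 / sinh x ^ 2" and "q \<equiv> sinh x / cosh x" and "G \<equiv> Gam x"
  shows "KG 0 n x 0 = c ^ n * G" "KG 1 0 x 0 = - 6 * c * G + kk * P * q^2" "KG 1 1 x 0 = - P * G + c * (- 6 * c * G + kk * P * q^2)"
    "KG 1 2 x 0 = - 2 * c * P * G + c^2 * (- 6 * c * G + kk * P * q^2)" "P = c^2 - 1" "q * c = 1"
    "hW 0 0 x = - kk * q" "hW 0 2 x = - kk * c" "hW 1 0 x = - kk * P * q^2" "hW 1 2 x = kk * P"
proof -
  note K = KG_p(1,2)[OF x, folded c_def P_def q_def G_def] KG_p(3,4)[OF x, folded c_def P_def q_def]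
  show "P = c^2 - 1" "q * c = 1" by (fact K)+
  show "KG 0 n x 0 = c ^ n * G" "KG 1 0 x 0 = - 6 * c * G + kk * P * q^2" "KG 1 1 x 0 = - P * G + c * (- 6 * c * G + kk * P * q^2)"
    "KG 1 2 x 0 = - 2 * c * P * G + c^2 * (- 6 * c * G + kk * P * q^2)"
    unfolding K(1) by (simp_all add: KGp_def)
  show "hW 0 0 x = - kk * q" "hW 0 2 x = - kk * c" "hW 1 0 x = - kk * P * q^2" "hW 1 2 x = kk * P"
    unfolding K(2) by (simp_all add: hWp_def)
qed

text \<open>The three identities at \<open>w = 0\<close> are the components of \<open>Eh_eq\<close>:
  differentiation along the reference direction acts there as multiplication of the mode by
  \<open>r\<close>. Each left-hand side solves \<open>f'' = f\<close> and is
  \<open>o(exp (- s))\<close>, hence zero.\<close>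

lemma w0_identity_1: assumes s: "s > 0" shows "hU 1 0 s + M1 0 s 0 + 6 * M0 1 s 0 = 0"
proof (rule ode_zero[where a=0 and f="\<lambda>s. hU 1 0 s + M1 0 s 0 + 6 * M0 1 s 0"
      and ?f1.0="\<lambda>s. hU 2 0 s + (M0 0 s 0 + KG 0 0 s 0) + 6 * M1 1 s 0" and ?f2.0="\<lambda>s. hU 3 0 s + (M1 0 s 0 + KG 1 0 s 0) + 6 * (M0 1 s 0 + KG 0 1 s 0)"])
  fix x :: real assume x: "x > 0"
  show "((\<lambda>s. hU 1 0 s + M1 0 s 0 + 6 * M0 1 s 0) has_real_derivative hU 2 0 x + (M0 0 x 0 + KG 0 0 x 0) + 6 * M1 1 x 0) (at x)"
    by (intro DERIV_add DERIV_cmult hU_d M1_Suc_deriv x)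
  show "((\<lambda>s. hU 2 0 s + (M0 0 s 0 + KG 0 0 s 0) + 6 * M1 1 s 0) has_real_derivative hU 3 0 x + (M1 0 x 0 + KG 1 0 x 0) + 6 * (M0 1 x 0 + KG 0 1 x 0)) (at x)"
    by (intro DERIV_add DERIV_cmult hU_d M1_Suc_deriv x) simp
  show "hU 3 0 x + (M1 0 x 0 + KG 1 0 x 0) + 6 * (M0 1 x 0 + KG 0 1 x 0) = hU 1 0 x + M1 0 x 0 + 6 * M0 1 x 0"
    unfolding hU_2 KG_w0[OF x] by (simp del: hU.simps)
next
  have "((\<lambda>s. exp s * hU 1 0 s + exp s * M1 0 s 0 + 6 * (exp s * M0 1 s 0)) \<longlongrightarrow> 0 + 0 + 6 * 0) at_top"
    by (intro tendsto_intros h_lims M_lims)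
  thus "((\<lambda>s. exp s * (hU 1 0 s + M1 0 s 0 + 6 * M0 1 s 0)) \<longlongrightarrow> 0) at_top" by (simp add: algebra_simps del: hU.simps)
qed (rule s)

lemma w0_identity_2: assumes s: "s > 0" shows "7 * M0 2 s 0 + hU 0 2 s - hU 0 0 s - M0 0 s 0 + M1 1 s 0 = 0"
proof (rule ode_zero[where a=0 and f="\<lambda>s. 7 * M0 2 s 0 + hU 0 2 s - hU 0 0 s - M0 0 s 0 + M1 1 s 0"
      and ?f1.0="\<lambda>s. 7 * M1 2 s 0 + hU 1 2 s - hU 1 0 s - M1 0 s 0 + (M0 1 s 0 + KG 0 1 s 0)"
      and ?f2.0="\<lambda>s. 7 * (M0 2 s 0 + KG 0 2 s 0) + hU 2 2 s - hU 2 0 s - (M0 0 s 0 + KG 0 0 s 0) + (M1 1 s 0 + KG 1 1 s 0)"])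
  fix x :: real assume x: "x > 0"
  show "((\<lambda>s. 7 * M0 2 s 0 + hU 0 2 s - hU 0 0 s - M0 0 s 0 + M1 1 s 0) has_real_derivative 7 * M1 2 x 0 + hU 1 2 x - hU 1 0 x - M1 0 x 0 + (M0 1 x 0 + KG 0 1 x 0)) (at x)"
    by (intro DERIV_add DERIV_diff DERIV_cmult hU_d M1_Suc_deriv x)
  show "((\<lambda>s. 7 * M1 2 s 0 + hU 1 2 s - hU 1 0 s - M1 0 s 0 + (M0 1 s 0 + KG 0 1 s 0)) has_real_derivative 7 * (M0 2 x 0 + KG 0 2 x 0) + hU 2 2 x - hU 2 0 x - (M0 0 x 0 + KG 0 0 x 0) + (M1 1 x 0 + KG 1 1 x 0)) (at x)"
    by (intro DERIV_add DERIV_diff DERIV_cmult hU_d M1_Suc_deriv x)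
  define c where "c = coth x" define P where "P = 1 / sinh x ^ 2" define q where "q = sinh x / cosh x" define G where "G = Gam x"
  note K = KG_w0[OF x, folded c_def P_def q_def G_def]
  have "7 * c^2 * G - kk * c + kk * q - c^0 * G + (- P * G + c * (- 6 * c * G + kk * P * q^2)) = 0"
    unfolding K(5) using K(6) by algebra
  thus "7 * (M0 2 x 0 + KG 0 2 x 0) + hU 2 2 x - hU 2 0 x - (M0 0 x 0 + KG 0 0 x 0) + (M1 1 x 0 + KG 1 1 x 0) = 7 * M0 2 x 0 + hU 0 2 x - hU 0 0 x - M0 0 x 0 + M1 1 x 0"
    unfolding hU_2 K by (simp del: hU.simps)
next
  have "((\<lambda>s. 7 * (exp s * M0 2 s 0) + exp s * (hU 0 2 s - kk) - exp s * (hU 0 0 s - kk) - exp s * M0 0 s 0 + exp s * M1 1 s 0) \<longlongrightarrow> 7 * 0 + 0 - 0 - 0 + 0) at_top"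
    by (intro tendsto_intros h_lims M_lims)
  thus "((\<lambda>s. exp s * (7 * M0 2 s 0 + hU 0 2 s - hU 0 0 s - M0 0 s 0 + M1 1 s 0)) \<longlongrightarrow> 0) at_top" by (simp add: algebra_simps del: hU.simps)
qed (rule s)

lemma w0_identity_3: assumes s: "s > 0" shows "- 8 * M0 3 s 0 + hU 1 2 s + 2 * M0 1 s 0 - M1 2 s 0 = 0"
proof (rule ode_zero[where a=0 and f="\<lambda>s. - 8 * M0 3 s 0 + hU 1 2 s + 2 * M0 1 s 0 - M1 2 s 0"
      and ?f1.0="\<lambda>s. - 8 * M1 3 s 0 + hU 2 2 s + 2 * M1 1 s 0 - (M0 2 s 0 + KG 0 2 s 0)"
      and ?f2.0="\<lambda>s. - 8 * (M0 3 s 0 + KG 0 3 s 0) + hU 3 2 s + 2 * (M0 1 s 0 + KG 0 1 s 0) - (M1 2 s 0 + KG 1 2 s 0)"])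
  fix x :: real assume x: "x > 0"
  show "((\<lambda>s. - 8 * M0 3 s 0 + hU 1 2 s + 2 * M0 1 s 0 - M1 2 s 0) has_real_derivative - 8 * M1 3 x 0 + hU 2 2 x + 2 * M1 1 x 0 - (M0 2 x 0 + KG 0 2 x 0)) (at x)"
    by (intro DERIV_add DERIV_diff DERIV_cmult hU_d M1_Suc_deriv x)
  show "((\<lambda>s. - 8 * M1 3 s 0 + hU 2 2 s + 2 * M1 1 s 0 - (M0 2 s 0 + KG 0 2 s 0)) has_real_derivative - 8 * (M0 3 x 0 + KG 0 3 x 0) + hU 3 2 x + 2 * (M0 1 x 0 + KG 0 1 x 0) - (M1 2 x 0 + KG 1 2 x 0)) (at x)"
    by (intro DERIV_add DERIV_diff DERIV_cmult hU_d M1_Suc_deriv x) simp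
  define c where "c = coth x" define P where "P = 1 / sinh x ^ 2" define q where "q = sinh x / cosh x" define G where "G = Gam x"
  note K = KG_w0[OF x, folded c_def P_def q_def G_def]
  have "- 8 * (c^3 * G) + kk * P + 2 * (c^1 * G) - (- 2 * c * P * G + c^2 * (- 6 * c * G + kk * P * q^2)) = 0"
    unfolding K(5) using K(6) by algebra
  thus "- 8 * (M0 3 x 0 + KG 0 3 x 0) + hU 3 2 x + 2 * (M0 1 x 0 + KG 0 1 x 0) - (M1 2 x 0 + KG 1 2 x 0) = - 8 * M0 3 x 0 + hU 1 2 x + 2 * M0 1 x 0 - M1 2 x 0"
    unfolding hU_2 K by (simp del: hU.simps)
next
  have "((\<lambda>s. - 8 * (exp s * M0 3 s 0) + exp s * hU 1 2 s + 2 * (exp s * M0 1 s 0) - exp s * M1 2 s 0) \<longlongrightarrow> - 8 * 0 + 0 + 2 * 0 - 0) at_top"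
    by (intro tendsto_intros h_lims M_lims)
  thus "((\<lambda>s. exp s * (- 8 * M0 3 s 0 + hU 1 2 s + 2 * M0 1 s 0 - M1 2 s 0)) \<longlongrightarrow> 0) at_top" by (simp add: algebra_simps del: hU.simps)
qed (rule s)

text \<open>For \<open>n \<le> 3\<close>, the \<open>i\<close>-th derivative of \<open>L\<close> at
  \<open>w = 0\<close> after \<open>n\<close> multiplications of the mode by \<open>r\<close>;
  \<open>Uj 0 0\<close> is the function \<open>U\<close>.\<close>

definition Uj :: "nat \<Rightarrow> nat \<Rightarrow> real \<Rightarrow> real" where "Uj i n s = hU i n s + MM i n s 0"

text \<open>The coefficients in the third region, where a fourth mode
  \<open>cosh \<alpha> - r sinh \<alpha>\<close> stands in place of the exponential weight.
  Derivatives in \<open>\<alpha>\<close> have period two, hence the parity of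
  \<open>j\<close>.\<close>

definition XC :: "nat \<Rightarrow> nat \<Rightarrow> bool \<Rightarrow> bool \<Rightarrow> real \<Rightarrow> real \<Rightarrow> real" where
  "XC i j a b s \<alpha> = sg a * sg b * ((if even j then cosh \<alpha> else sinh \<alpha>) * Uj i (nb a b) s
     - (if even j then sinh \<alpha> else cosh \<alpha>) * Uj i (Suc (nb a b)) s)"

definition jets :: "(nat \<Rightarrow> nat \<Rightarrow> bool \<Rightarrow> bool \<Rightarrow> real \<Rightarrow> real \<Rightarrow> real) \<Rightarrow> bool" where
  "jets X \<longleftrightarrow> (\<forall>i j a b s w. s > 0 \<longrightarrow> i + j < 2 \<longrightarrow>
       ((\<lambda>p. X i j a b (fst p) (snd p)) has_derivative (\<lambda>h. X (Suc i) j a b s w * fst h + X i (Suc j) a b s w * snd h)) (at (s, w)))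
   \<and> (\<forall>i j a b s w. s > 0 \<longrightarrow> i + j \<le> 2 \<longrightarrow> isCont (\<lambda>p. X i j a b (fst p) (snd p)) (s, w))"

lemma jets_X0: "jets (X0 \<tau>)"
  unfolding jets_def
proof (intro conjI allI impI)
  fix i j :: nat and a b and s w :: real assume s: "s > 0" and ij: "i + j < 2"
  have i: "i < 2" using ij by simp
  have f: "((\<lambda>p. fst p) has_derivative fst) (at (s, w))" "((\<lambda>p. snd p) has_derivative snd) (at (s, w))"
    by (auto intro!: derivative_eq_intros)
  have M: "((\<lambda>p. MM i n (fst p) (snd p)) has_derivative (\<lambda>h. MM (Suc i) n s w * fst h - 2 * MM i (n+1) s w * snd h)) (at (s, w))" for n
    using MM_has_derivative[OF f _ i, of n] s by simp
  have H: "((\<lambda>p. hU i n (fst p)) has_derivative (\<lambda>h. hU (Suc i) n s * fst h)) (at (s, w))" for n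
    using hU_has_derivative[OF f(1) _ i, of n] s by simp
  show "((\<lambda>p. X0 \<tau> i j a b (fst p) (snd p)) has_derivative (\<lambda>h. X0 \<tau> (Suc i) j a b s w * fst h + X0 \<tau> i (Suc j) a b s w * snd h)) (at (s, w))"
  proof (cases "j = 0")
    case True
    have "((\<lambda>p. sg a * sg b * ((if a then \<tau> else 1) * hU i (nb a b) (fst p) + MM i (nb a b) (fst p) (snd p))) has_derivative
      (\<lambda>h. sg a * sg b * ((if a then \<tau> else 1) * (hU (Suc i) (nb a b) s * fst h) + (MM (Suc i) (nb a b) s w * fst h - 2 * MM i (nb a b + 1) s w * snd h)))) (at (s, w))"
      by (intro has_derivative_mult_right has_derivative_add H M)
    thus ?thesis unfolding Xgen_def True
      by (rule has_derivative_eq_rhs[OF has_derivative_transform_within_open[where s=UNIV]]) (simp_all add: fun_eq_iff algebra_simps del: hU.simps MM.simps)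
  next
    case False
    have "((\<lambda>p. sg a * sg b * ((- 2) ^ j * MM i (nb a b + j) (fst p) (snd p))) has_derivative
      (\<lambda>h. sg a * sg b * ((- 2) ^ j * (MM (Suc i) (nb a b + j) s w * fst h - 2 * MM i (nb a b + j + 1) s w * snd h)))) (at (s, w))"
      by (intro has_derivative_mult_right M)
    thus ?thesis unfolding Xgen_def
      by (rule has_derivative_eq_rhs[OF has_derivative_transform_within_open[where s=UNIV]]) (use False in \<open>simp_all add: fun_eq_iff algebra_simps del: hU.simps MM.simps\<close>)
  qed
next
  fix i j :: nat and a b and s w :: real assume s: "s > 0" and ij: "i + j \<le> 2"
  have i: "i \<le> 2" using ij by simp
  have H: "isCont (\<lambda>p. hU i n (fst p)) (s, w)" for n
    by (rule isCont_o2[where f=fst and g="hU i n"]) (use hU_isCont[OF s i] in auto)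
  show "isCont (\<lambda>p. X0 \<tau> i j a b (fst p) (snd p)) (s, w)"
    unfolding Xgen_def by (cases "j = 0") (simp_all only: if_True if_False refl, (intro continuous_intros H MM_isCont s i)+)
qed

lemma Uj_deriv: "s > 0 \<Longrightarrow> i < 2 \<Longrightarrow> (Uj i n has_real_derivative Uj (Suc i) n s) (at s)"
  unfolding Uj_def[abs_def] by (intro DERIV_add hU_deriv MM_deriv) auto

lemma Uj_isCont: "s > 0 \<Longrightarrow> i \<le> 2 \<Longrightarrow> isCont (Uj i n) s"
  unfolding Uj_def[abs_def]
  using isCont_o2[of s "\<lambda>s. (s, 0)" "\<lambda>p. MM i n (fst p) (snd p)"] MM_isCont[where s=s and i=i and n=n and w=0]
  by (intro continuous_add hU_isCont) (auto intro!: continuous_intros)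

lemma jets_XC: "jets XC"
  unfolding jets_def
proof (intro conjI allI impI)
  fix i j :: nat and a b and s \<alpha> :: real assume s: "s > 0" and ij: "i + j < 2"
  have i: "i < 2" using ij by simp
  have f: "((\<lambda>p. fst p) has_derivative fst) (at (s, \<alpha>))" "((\<lambda>p. snd p) has_derivative snd) (at (s, \<alpha>))"
    by (auto intro!: derivative_eq_intros)
  have U: "((\<lambda>p. Uj i n (fst p)) has_derivative (\<lambda>h. Uj (Suc i) n s * fst h)) (at (s, \<alpha>))" for n
    using has_derivative_compose[OF f(1), of "Uj i n" "(*) (Uj (Suc i) n s)"] Uj_deriv[OF s i, of n] by (simp add: has_field_derivative_def)
  have C: "((\<lambda>p. if even j then cosh (snd p) else sinh (snd p)) has_derivative (\<lambda>h. (if even j then sinh \<alpha> else cosh \<alpha>) * snd h)) (at (s, \<alpha>))"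
    "((\<lambda>p. if even j then sinh (snd p) else cosh (snd p)) has_derivative (\<lambda>h. (if even j then cosh \<alpha> else sinh \<alpha>) * snd h)) (at (s, \<alpha>))"
    using cosh_has_derivative[OF f(2)] sinh_has_derivative[OF f(2)] by auto
  show "((\<lambda>p. XC i j a b (fst p) (snd p)) has_derivative (\<lambda>h. XC (Suc i) j a b s \<alpha> * fst h + XC i (Suc j) a b s \<alpha> * snd h)) (at (s, \<alpha>))"
    unfolding XC_def
    by (rule has_derivative_eq_rhs, rule has_derivative_mult_right, rule has_derivative_diff, (rule has_derivative_mult C U)+)
      (simp add: fun_eq_iff algebra_simps)
next
  fix i j :: nat and a b and s \<alpha> :: real assume s: "s > 0" and ij: "i + j \<le> 2"
  have U: "isCont (\<lambda>p. Uj i n (fst p)) (s, \<alpha>)" for n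
    by (rule isCont_o2[where f=fst and g="Uj i n"]) (use Uj_isCont[OF s] ij in auto)
  have C: "isCont (\<lambda>p. if even j then cosh (snd p) else sinh (snd p)) (s, \<alpha>)" "isCont (\<lambda>p. if even j then sinh (snd p) else cosh (snd p)) (s, \<alpha>)"
    by (cases "even j"; auto intro!: continuous_intros)+
  show "isCont (\<lambda>p. XC i j a b (fst p) (snd p)) (s, \<alpha>)"
    unfolding XC_def by (intro continuous_intros U C)
qed

section \<open>Chain rule for the charts\<close>

definition D1c :: "real \<times> real \<times> real \<times> real \<Rightarrow> (nat \<Rightarrow> nat \<Rightarrow> bool \<Rightarrow> bool \<Rightarrow> real \<Rightarrow> real \<Rightarrow> real) \<Rightarrow> bool \<Rightarrow> bool \<Rightarrow> real \<Rightarrow> real \<Rightarrow> real" where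
  "D1c e X a b s w = (case e of (ew, e0, e1, e2) \<Rightarrow>
     e2 * X 1 0 a b s w + ew * X 0 1 a b s w + e0 * X 0 0 (\<not> a) b s w + e1 * X 0 0 a (\<not> b) s w)"

definition D2c :: "real \<times> real \<times> real \<times> real \<Rightarrow> (nat \<Rightarrow> nat \<Rightarrow> bool \<Rightarrow> bool \<Rightarrow> real \<Rightarrow> real \<Rightarrow> real) \<Rightarrow> bool \<Rightarrow> bool \<Rightarrow> real \<Rightarrow> real \<Rightarrow> real" where
  "D2c e X a b s w = (case e of (ew, e0, e1, e2) \<Rightarrow>
     e2 * (e2 * X 2 0 a b s w + ew * X 1 1 a b s w + e0 * X 1 0 (\<not> a) b s w + e1 * X 1 0 a (\<not> b) s w)
   + ew * (e2 * X 1 1 a b s w + ew * X 0 2 a b s w + e0 * X 0 1 (\<not> a) b s w + e1 * X 0 1 a (\<not> b) s w)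
   + e0 * (e2 * X 1 0 (\<not> a) b s w + ew * X 0 1 (\<not> a) b s w + e0 * X 0 0 a b s w + e1 * X 0 0 (\<not> a) (\<not> b) s w)
   + e1 * (e2 * X 1 0 a (\<not> b) s w + ew * X 0 1 a (\<not> b) s w + e0 * X 0 0 (\<not> a) (\<not> b) s w + e1 * X 0 0 a b s w))"

lemma dfc_D2c: "dfc e X 0 a b s w = X 0 0 a b s w - D2c e X a b s w"
  by (cases e) (simp add: dfc_def D2c_def algebra_simps power2_eq_square numeral_2_eq_2)

lemma val_has_derivative:
  fixes Lw L0 L1 Ls :: "real^4 \<Rightarrow> real"
  assumes lin: "bounded_linear Lw" "bounded_linear L0" "bounded_linear L1" "bounded_linear Ls"
    and Y: "\<And>a b. ((\<lambda>p. Y a b (fst p) (snd p)) has_derivative (\<lambda>h. Ys a b * fst h + Yw a b * snd h)) (at (Ls q, Lw q))"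
  shows "((\<lambda>q. val (\<lambda>a b. Y a b (Ls q) (Lw q)) (L0 q) (L1 q)) has_derivative
    (\<lambda>d. val (\<lambda>a b. Ls d * Ys a b + Lw d * Yw a b + L0 d * Y (\<not> a) b (Ls q) (Lw q) + L1 d * Y a (\<not> b) (Ls q) (Lw q)) (L0 q) (L1 q))) (at q)"
proof -
  note dl = lin[THEN bounded_linear_imp_has_derivative, of "at q"]
  have dY: "((\<lambda>q. Y a b (Ls q) (Lw q)) has_derivative (\<lambda>d. Ys a b * Ls d + Yw a b * Lw d)) (at q)" for a b
    using has_derivative_compose[OF has_derivative_Pair[OF dl(4) dl(1)] Y[of a b]] by simp
  show ?thesis unfolding val_def
    by (rule has_derivative_eq_rhs, (rule has_derivative_add has_derivative_mult dY cosh_has_derivative sinh_has_derivative dl)+)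
      (simp add: fun_eq_iff algebra_simps)
qed

lemma val_D1: assumes "jets X" "bounded_linear Lw" "bounded_linear L0" "bounded_linear L1" "bounded_linear Ls" "Ls (q :: real^4) > 0"
  shows "((\<lambda>q. val (\<lambda>a b. X 0 0 a b (Ls q) (Lw q)) (L0 q) (L1 q)) has_derivative
    (\<lambda>d. val (\<lambda>a b. D1c (Lw d, L0 d, L1 d, Ls d) X a b (Ls q) (Lw q)) (L0 q) (L1 q))) (at q)"
proof -
  have "((\<lambda>p. X 0 0 a b (fst p) (snd p)) has_derivative (\<lambda>h. X 1 0 a b (Ls q) (Lw q) * fst h + X 0 1 a b (Ls q) (Lw q) * snd h)) (at (Ls q, Lw q))" for a b
    using assms(1,6) unfolding jets_def by simp
  from val_has_derivative[where Y="\<lambda>a b. X 0 0 a b", OF assms(2-5) this]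
  show ?thesis by (rule has_derivative_eq_rhs) (simp add: fun_eq_iff D1c_def)
qed

lemma val_D2: assumes "jets X" "bounded_linear Lw" "bounded_linear L0" "bounded_linear L1" "bounded_linear Ls" "Ls (q :: real^4) > 0"
  shows "\<exists>D. ((\<lambda>q. val (\<lambda>a b. D1c (Lw d, L0 d, L1 d, Ls d) X a b (Ls q) (Lw q)) (L0 q) (L1 q)) has_derivative D) (at q)
     \<and> D d = val (\<lambda>a b. D2c (Lw d, L0 d, L1 d, Ls d) X a b (Ls q) (Lw q)) (L0 q) (L1 q)"
proof -
  have X: "((\<lambda>p. X i j a b (fst p) (snd p)) has_derivative (\<lambda>h. X (Suc i) j a b (Ls q) (Lw q) * fst h + X i (Suc j) a b (Ls q) (Lw q) * snd h)) (at (Ls q, Lw q))"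
    if "i + j < 2" for i j a b
    using assms(1,6) that unfolding jets_def by simp
  have "((\<lambda>p. D1c (Lw d, L0 d, L1 d, Ls d) X a b (fst p) (snd p)) has_derivative
     (\<lambda>h. (Ls d * X 2 0 a b (Ls q) (Lw q) + Lw d * X 1 1 a b (Ls q) (Lw q) + L0 d * X 1 0 (\<not> a) b (Ls q) (Lw q) + L1 d * X 1 0 a (\<not> b) (Ls q) (Lw q)) * fst h
       + (Ls d * X 1 1 a b (Ls q) (Lw q) + Lw d * X 0 2 a b (Ls q) (Lw q) + L0 d * X 0 1 (\<not> a) b (Ls q) (Lw q) + L1 d * X 0 1 a (\<not> b) (Ls q) (Lw q)) * snd h)) (at (Ls q, Lw q))" for a b
    unfolding D1c_def prod.case
    by (rule has_derivative_eq_rhs, (rule has_derivative_add has_derivative_mult_right X[where i=1 and j=0] X[where i=0 and j=1] X[where i=0 and j=0] | simp only: add_0_right add_0_left one_less_numeral_iff semiring_norm(76) zero_less_numeral)+)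
      (simp add: fun_eq_iff algebra_simps numeral_2_eq_2)
  from val_has_derivative[OF assms(2-5) this] show ?thesis
    by (intro exI conjI, assumption) (simp add: D1c_def D2c_def)
qed

lemma val_cont: assumes "jets X" "bounded_linear Lw" "bounded_linear L0" "bounded_linear L1" "bounded_linear Ls" "Ls (q :: real^4) > 0"
  shows "isCont (\<lambda>q. val (\<lambda>a b. X 0 0 a b (Ls q) (Lw q)) (L0 q) (L1 q)) q"
    "isCont (\<lambda>q. val (\<lambda>a b. D2c e X a b (Ls q) (Lw q)) (L0 q) (L1 q)) q"
proof -
  note dl = assms(2-5)[THEN bounded_linear_imp_has_derivative, of "at q", THEN has_derivative_continuous]
  have X: "isCont (\<lambda>q. X i j a b (Ls q) (Lw q)) q" if "i + j \<le> 2" for i j a b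
  proof -
    have "isCont (\<lambda>p. X i j a b (fst p) (snd p)) (Ls q, Lw q)" using assms(1,6) that unfolding jets_def by simp
    moreover have "isCont (\<lambda>q. (Ls q, Lw q)) q" by (intro continuous_intros dl)
    ultimately show ?thesis using isCont_o2[where f="\<lambda>q. (Ls q, Lw q)" and g="\<lambda>p. X i j a b (fst p) (snd p)"] by simp
  qed
  show "isCont (\<lambda>q. val (\<lambda>a b. X 0 0 a b (Ls q) (Lw q)) (L0 q) (L1 q)) q"
    unfolding val_def by (intro continuous_intros X dl) auto
  show "isCont (\<lambda>q. val (\<lambda>a b. D2c e X a b (Ls q) (Lw q)) (L0 q) (L1 q)) q"
    unfolding val_def D2c_def by (cases e) (simp only: prod.case, intro continuous_intros X dl; simp)
qed

text \<open>The gradient is assembled from one-variable derivatives along the axes; total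
  differentiability of a local representative is what identifies it with \<open>D\<close>.\<close>

lemma dir_deriv_eqI:
  assumes "open O'" "q \<in> O'" "\<And>q. q \<in> O' \<Longrightarrow> f q = g q" "(g has_derivative D) (at q)"
  shows "dir_deriv d f q = D d"
proof -
  have fD: "(f has_derivative D) (at q)"
    by (rule has_derivative_transform_within_open[OF assms(4,1,2)]) (simp add: assms(3))
  interpret D: bounded_linear D using fD by (rule has_derivative_bounded_linear)
  have "deriv (\<lambda>t. f (q + t *\<^sub>R axis i 1)) 0 = D (axis i 1)" for i
  proof (rule DERIV_imp_deriv)
    have "((\<lambda>t. q + t *\<^sub>R axis i 1) has_derivative (\<lambda>t. t *\<^sub>R axis i 1)) (at 0)"
      by (auto intro!: derivative_eq_intros)
    from has_derivative_compose[OF this, of f D] fD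
    have "((\<lambda>t. f (q + t *\<^sub>R axis i 1)) has_derivative (\<lambda>t. D (t *\<^sub>R axis i 1))) (at 0)" by simp
    thus "((\<lambda>t. f (q + t *\<^sub>R axis i 1)) has_real_derivative D (axis i 1)) (at 0)"
      unfolding has_field_derivative_def by (rule has_derivative_eq_rhs) (simp add: fun_eq_iff D.scaleR)
  qed
  hence "dir_deriv d f q = (\<Sum>i\<in>UNIV. d $ i * D (axis i 1))"
    by (simp add: dir_deriv_def grad_def inner_vec_def)
  also have "\<dots> = D (\<Sum>i\<in>UNIV. d $ i *\<^sub>R axis i 1)" by (simp add: D.sum D.scaleR)
  also have "(\<Sum>i\<in>UNIV. d $ i *\<^sub>R axis i 1) = d" using basis_expansion[of d] by (simp add: scalar_mult_eq_scaleR)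
  finally show ?thesis .
qed

section \<open>Closed forms of the integral operators\<close>

lemma has_integral_at_top:
  fixes F f :: "real \<Rightarrow> real"
  assumes d: "\<And>r. r \<ge> t \<Longrightarrow> (F has_real_derivative f r) (at r)" and lim: "(F \<longlongrightarrow> 0) at_top"
  shows "(f has_integral (- F t)) {t..}"
proof -
  have I: "((\<lambda>x. if x \<in> {t..} then f x else 0) has_integral (if max a t \<le> b then F b - F (max a t) else 0)) {a..b}" for a b
  proof -
    have e: "{t..} \<inter> {a..b} = {max a t..b}" by auto
    have "(f has_integral (if max a t \<le> b then F b - F (max a t) else 0)) {max a t..b}"
    proof (cases "max a t \<le> b")
      case True
      have "(f has_integral F b - F (max a t)) {max a t..b}"
      proof (rule fundamental_theorem_of_calculus[OF True])
        fix x assume "x \<in> {max a t..b}"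
        hence "(F has_real_derivative f x) (at x)" by (intro d) simp
        thus "(F has_vector_derivative f x) (at x within {max a t..b})"
          unfolding has_real_derivative_iff_has_vector_derivative by (rule has_vector_derivative_at_within)
      qed
      thus ?thesis using True by simp
    next
      case False
      moreover from False have "{max a t..b} = {}" by auto
      ultimately show ?thesis by (simp only: if_False has_integral_empty)
    qed
    thus ?thesis unfolding has_integral_restrict_Int e .
  qed
  show ?thesis
  proof (subst has_integral_alt', intro conjI allI impI)
    fix a b :: real
    show "(\<lambda>x. if x \<in> {t..} then f x else 0) integrable_on cbox a b" using I by (auto intro: has_integral_integrable)
  next
    fix e :: real assume "e > 0"
    with lim have "eventually (\<lambda>b. \<bar>F b\<bar> < e) at_top" by (simp add: tendsto_iff dist_real_def)
    then obtain B where B: "\<And>b. b \<ge> B \<Longrightarrow> \<bar>F b\<bar> < e" by (auto simp: eventually_at_top_linorder)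
    define B' where "B' = \<bar>B\<bar> + \<bar>t\<bar> + 1"
    show "\<exists>B>0. \<forall>a b. ball 0 B \<subseteq> cbox a b \<longrightarrow> norm (integral (cbox a b) (\<lambda>x. if x \<in> {t..} then f x else 0) - - F t) < e"
    proof (intro exI[of _ B'] conjI allI impI)
      show "B' > 0" by (simp add: B'_def)
      fix a b :: real assume "ball 0 B' \<subseteq> cbox a b"
      hence "\<bar>B\<bar> + \<bar>t\<bar> \<in> {a..b}" "- (\<bar>B\<bar> + \<bar>t\<bar>) \<in> {a..b}" by (auto simp: B'_def subset_iff dist_real_def)
      hence ab: "a \<le> t" "t \<le> b" "B \<le> b" by auto
      have "integral (cbox a b) (\<lambda>x. if x \<in> {t..} then f x else 0) = F b - F t"
        using integral_unique[OF I[of a b]] ab by (simp add: max_def)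
      thus "norm (integral (cbox a b) (\<lambda>x. if x \<in> {t..} then f x else 0) - - F t) < e"
        using B[OF ab(3)] by simp
    qed
  qed
qed

text \<open>The relation \<open>Nrel a b\<close> says that \<open>b\<close> is the image of \<open>a\<close> under the operator
  multiplying the mode \<open>cosh s - r sinh s\<close> by \<open>r\<close>.\<close>

definition Nrel :: "(real \<Rightarrow> real) \<Rightarrow> (real \<Rightarrow> real) \<Rightarrow> bool" where
  "Nrel a b \<longleftrightarrow> (\<forall>y>0. \<exists>a' b'. (a has_real_derivative a') (at y) \<and> (b has_real_derivative b') (at y)
     \<and> sinh y * b' = cosh y * (a' + b y) - sinh y * a y) \<and> (\<exists>l. (a \<longlongrightarrow> l) at_top) \<and> (\<exists>l. (b \<longlongrightarrow> l) at_top)"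

lemma NrelE: assumes "Nrel a b" "y > 0"
  obtains a' b' where "(a has_real_derivative a') (at y)" "(b has_real_derivative b') (at y)"
    "sinh y * b' = cosh y * (a' + b y) - sinh y * a y" "b' = coth y * (a' + b y) - a y"
proof -
  obtain a' b' where *: "(a has_real_derivative a') (at y)" "(b has_real_derivative b') (at y)"
    "sinh y * b' = cosh y * (a' + b y) - sinh y * a y"
    using assms unfolding Nrel_def by blast
  moreover have "b' = coth y * (a' + b y) - a y" using *(3) assms(2) by (simp add: coth_def field_simps)
  ultimately show ?thesis using that by blast
qed

lemma inv_sinh_deriv: "t > 0 \<Longrightarrow> ((\<lambda>t. 1 / sinh t) has_real_derivative (- coth t / sinh t)) (at t)"
  by (auto intro!: derivative_eq_intros simp: coth_def power2_eq_square field_simps)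

lemma inv_sinh_lim: "((\<lambda>t::real. 1 / sinh t) \<longlongrightarrow> 0) at_top"
  unfolding sinh_field_def by real_asymp

lemma coth_sq: "t > 0 \<Longrightarrow> coth t ^ 2 = 1 + 1 / sinh t ^ 2"
  using coth_sq_minus_1[of t] by (simp add: coth_def)

text \<open>On a mode with parameter \<open>c\<close>, cut off at its zero,
  \<open>a / sinh = coth - c\<close> and \<open>b = c * a\<close>. With \<open>u = coth\<close> the
  integral is that of \<open>u - c\<close> from \<open>c\<close> to \<open>coth t\<close>, which is
  \<open>(coth t - c)^2 / 2\<close>. The formula through \<open>b\<close> is linear, so it holds for
  superpositions too.\<close>

lemma J_integral:
  assumes N: "Nrel a b" and t: "t > 0"
  shows "((\<lambda>r. a r / sinh r ^ 3) has_integral ((coth t * a t - b t) * (1 / sinh t) / 2)) {t..}"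
proof -
  let ?F = "\<lambda>r. - ((coth r * a r - b r) * (1 / sinh r) / 2)"
  have "(?F has_real_derivative a r / sinh r ^ 3) (at r)" if "r \<ge> t" for r
  proof -
    have r: "r > 0" using that t by simp
    from N r obtain a' b' where d: "(a has_real_derivative a') (at r)" "(b has_real_derivative b') (at r)"
      and e: "b' = coth r * (a' + b r) - a r" by (rule NrelE)
    have "(?F has_real_derivative - ((((- 1 / sinh r ^ 2) * a r + a' * coth r - b') * (1 / sinh r) + (- coth r / sinh r) * (coth r * a r - b r)) / 2)) (at r)"
      by (rule DERIV_minus DERIV_cdivide DERIV_mult DERIV_diff coth_deriv inv_sinh_deriv d r)+
    moreover have "- ((((- 1 / sinh r ^ 2) * a r + a' * coth r - b') * (1 / sinh r) + (- coth r / sinh r) * (coth r * a r - b r)) / 2)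
      = (1 / sinh r ^ 2 - 1 + coth r ^ 2) * a r / (2 * sinh r)"
      unfolding e using r by (simp add: field_simps power2_eq_square)
    moreover have "(1 / sinh r ^ 2 - 1 + coth r ^ 2) * a r / (2 * sinh r) = a r / sinh r ^ 3"
      unfolding coth_sq[OF r] by (simp add: power2_eq_square power3_eq_cube)
    ultimately show ?thesis by simp
  qed
  moreover have "(?F \<longlongrightarrow> 0) at_top"
  proof -
    from N obtain l l' where l: "(a \<longlongrightarrow> l) at_top" "(b \<longlongrightarrow> l') at_top" unfolding Nrel_def by blast
    have "(?F \<longlongrightarrow> - ((1 * l - l') * 0 / 2)) at_top" by (intro tendsto_intros coth_lim l inv_sinh_lim) simp
    thus ?thesis by simp
  qed
  ultimately show ?thesis using has_integral_at_top[of t ?F] by simp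
qed

text \<open>The constants come from integrating \<open>u * (u - c)\<close> from \<open>c\<close> to
  \<open>u = coth t\<close>: the result is \<open>(u - c) * (u^2 / 3 - c * u / 6 - c^2 / 6)\<close>.
  In \<open>Q_integral\<close> the integrand \<open>u^2 * (u - c)\<close> gives \<open>1/4\<close>
  and three times \<open>1/12\<close> in the same way.\<close>

lemma M_integral:
  assumes N: "Nrel a b" "Nrel b e" and t: "t > 0"
  shows "((\<lambda>r. cosh r * a r / sinh r ^ 4) has_integral ((coth t ^ 2 * a t / 3 - coth t * b t / 6 - e t / 6) * (1 / sinh t))) {t..}"
proof -
  let ?F = "\<lambda>r. - ((coth r * (coth r * (a r / 3)) - coth r * (b r / 6) - e r / 6) * (1 / sinh r))"
  have "(?F has_real_derivative cosh r * a r / sinh r ^ 4) (at r)" if "r \<ge> t" for r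
  proof -
    have r: "r > 0" using that t by simp
    from N(1) r obtain a' b' where d: "(a has_real_derivative a') (at r)" "(b has_real_derivative b') (at r)"
      and e1: "b' = coth r * (a' + b r) - a r" by (rule NrelE)
    from N(2) r obtain b'' e' where d': "(b has_real_derivative b'') (at r)" "(e has_real_derivative e') (at r)"
      and e2: "e' = coth r * (b'' + e r) - b r" by (rule NrelE)
    have b'': "b'' = b'" using d(2) d'(1) by (rule DERIV_unique[symmetric])
    let ?c = "coth r" let ?P = "1 / sinh r ^ 2"
    have "(?F has_real_derivative - (((- 1 / sinh r ^ 2) * (coth r * (a r / 3)) + ((- 1 / sinh r ^ 2) * (a r / 3) + a' / 3 * coth r) * coth r
       - ((- 1 / sinh r ^ 2) * (b r / 6) + b' / 6 * coth r) - e' / 6) * (1 / sinh r)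
       + (- coth r / sinh r) * (coth r * (coth r * (a r / 3)) - coth r * (b r / 6) - e r / 6))) (at r)"
      by (rule DERIV_minus DERIV_cdivide DERIV_mult DERIV_diff coth_deriv inv_sinh_deriv d d' r)+
    moreover have "- (((- 1 / sinh r ^ 2) * (coth r * (a r / 3)) + ((- 1 / sinh r ^ 2) * (a r / 3) + a' / 3 * coth r) * coth r
       - ((- 1 / sinh r ^ 2) * (b r / 6) + b' / 6 * coth r) - e' / 6) * (1 / sinh r)
       + (- coth r / sinh r) * (coth r * (coth r * (a r / 3)) - coth r * (b r / 6) - e r / 6))
      = ((2 * ?P - 1 + ?c ^ 2) / 3 * ?c * a r + (?c^2 - 1 - ?P) / 6 * b r) / sinh r"
      unfolding e1 e2 b'' using r by (simp add: field_simps power2_eq_square)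
    moreover have "\<dots> = cosh r * a r / sinh r ^ 4"
      unfolding coth_sq[OF r] using r by (simp add: coth_def eval_nat_numeral)
    ultimately show ?thesis by simp
  qed
  moreover have "(?F \<longlongrightarrow> 0) at_top"
  proof -
    from N obtain l l' l'' where l: "(a \<longlongrightarrow> l) at_top" "(b \<longlongrightarrow> l') at_top" "(e \<longlongrightarrow> l'') at_top" unfolding Nrel_def by blast
    have "(?F \<longlongrightarrow> - ((1 * (1 * (l / 3)) - 1 * (l' / 6) - l'' / 6) * 0)) at_top" by (intro tendsto_intros coth_lim l inv_sinh_lim) simp_all
    thus ?thesis by simp
  qed
  ultimately show ?thesis using has_integral_at_top[of t ?F] by (simp add: power2_eq_square mult_ac)
qed

lemma Q_integral:
  assumes N: "Nrel a b" "Nrel b e" "Nrel e g" and t: "t > 0"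
  shows "((\<lambda>r. cosh r ^ 2 * a r / sinh r ^ 5) has_integral ((coth t ^ 3 * a t / 4 - (coth t ^ 2 * b t + coth t * e t + g t) / 12) * (1 / sinh t))) {t..}"
proof -
  let ?F = "\<lambda>r. - ((coth r * (coth r * (coth r * (a r / 4))) - (coth r * (coth r * b r) + coth r * e r + g r) / 12) * (1 / sinh r))"
  have "(?F has_real_derivative cosh r ^ 2 * a r / sinh r ^ 5) (at r)" if "r \<ge> t" for r
  proof -
    have r: "r > 0" using that t by simp
    from N(1) r obtain a' b' where d: "(a has_real_derivative a') (at r)" "(b has_real_derivative b') (at r)"
      and e1: "b' = coth r * (a' + b r) - a r" by (rule NrelE)
    from N(2) r obtain b'' e' where d': "(b has_real_derivative b'') (at r)" "(e has_real_derivative e') (at r)"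
      and e2: "e' = coth r * (b'' + e r) - b r" by (rule NrelE)
    from N(3) r obtain e'' g' where d'': "(e has_real_derivative e'') (at r)" "(g has_real_derivative g') (at r)"
      and e3: "g' = coth r * (e'' + g r) - e r" by (rule NrelE)
    have b'': "b'' = b'" using d(2) d'(1) by (rule DERIV_unique[symmetric])
    have e'': "e'' = e'" using d'(2) d''(1) by (rule DERIV_unique[symmetric])
    let ?c = "coth r" let ?P = "1 / sinh r ^ 2"
    let ?D = "- (((- 1 / sinh r ^ 2) * (coth r * (coth r * (a r / 4))) + ((- 1 / sinh r ^ 2) * (coth r * (a r / 4)) + ((- 1 / sinh r ^ 2) * (a r / 4) + a' / 4 * coth r) * coth r) * coth r
       - ((- 1 / sinh r ^ 2) * (coth r * b r) + ((- 1 / sinh r ^ 2) * b r + b' * coth r) * coth r + ((- 1 / sinh r ^ 2) * e r + e' * coth r) + g') / 12) * (1 / sinh r)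
       + (- coth r / sinh r) * (coth r * (coth r * (coth r * (a r / 4))) - (coth r * (coth r * b r) + coth r * e r + g r) / 12))"
    have "(?F has_real_derivative ?D) (at r)"
      by (rule DERIV_minus DERIV_cdivide DERIV_mult DERIV_diff DERIV_add coth_deriv inv_sinh_deriv d d'(2) d''(2) r)+
    moreover have "?D = ((3 * ?P - 1 + ?c ^ 2) / 4 * ?c^2 * a r + (?c^2 - 1 - ?P) / 12 * (2 * ?c * b r + e r)) / sinh r"
      unfolding e1 e2 e3 b'' e'' using r by (simp add: field_simps power2_eq_square)
    moreover have "(3 * ?P - 1 + ?c ^ 2) / 4 = ?P" "(?c^2 - 1 - ?P) / 12 = 0" using coth_sq[OF r] by simp_all
    moreover have "(?P * ?c^2 * a r + 0 * (2 * ?c * b r + e r)) / sinh r = cosh r ^ 2 * a r / sinh r ^ 5"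
      by (simp add: coth_def eval_nat_numeral)
    ultimately show ?thesis by metis
  qed
  moreover have "(?F \<longlongrightarrow> 0) at_top"
  proof -
    from N obtain l l' l'' m where l: "(a \<longlongrightarrow> l) at_top" "(b \<longlongrightarrow> l') at_top" "(e \<longlongrightarrow> l'') at_top" "(g \<longlongrightarrow> m) at_top" unfolding Nrel_def by blast
    have "(?F \<longlongrightarrow> - ((1 * (1 * (1 * (l / 4))) - (1 * (1 * l') + 1 * l'' + m) / 12) * 0)) at_top" by (intro tendsto_intros coth_lim l inv_sinh_lim) simp_all
    thus ?thesis by simp
  qed
  ultimately show ?thesis using has_integral_at_top[of t ?F] by (simp add: power2_eq_square power3_eq_cube mult_ac)
qed

section \<open>The operators \<open>K\<close> and \<open>T\<close> in algebraic form\<close>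

lemma K_op_cong: assumes "\<And>r. r > 0 \<Longrightarrow> f r = g r" "y > 0" "p \<ge> 0" shows "K_op p f y = K_op p g y"
proof -
  have "J_int f (y + p / 2) = J_int g (y + p / 2)" "M_int f (y + p / 2) = M_int g (y + p / 2)"
    unfolding J_int_def M_int_def by (rule integral_cong; use assms in simp)+
  thus ?thesis using assms by (simp add: K_op_def Let_def)
qed

lemma T_op_cong: assumes "\<And>r. r > 0 \<Longrightarrow> f r = g r" "y > 0" shows "T_op f y = T_op g y"
proof -
  have "integral {y..} (\<lambda>r. f r / sinh r ^ 3) = integral {y..} (\<lambda>r. g r / sinh r ^ 3)"
    by (rule integral_cong) (use assms in simp)
  thus ?thesis by (simp add: T_op_def)
qed

lemma sinh_shift: "sinh (t::real) * cosh d - cosh t * sinh d = sinh (t - d)" "cosh (t::real) * cosh d - sinh t * sinh d = cosh (t - d)"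
  by (simp_all add: sinh_diff cosh_diff)

text \<open>On the mode with parameter \<open>r\<close> the operator shifts the argument by
  \<open>p / 2\<close> and multiplies by \<open>(C - r * S)^2\<close>; the three terms are the
  expansion of this square.\<close>

lemma K_op_chain:
  assumes N: "Nrel a b" "Nrel b e" and y: "y > 0" and p: "p \<ge> 0"
  defines "C \<equiv> cosh (p / 2)" and "S \<equiv> sinh (p / 2)"
  shows "K_op p a y = a (y + p/2) * C^2 - 2 * b (y + p/2) * C * S + e (y + p/2) * S^2"
proof -
  define t where "t = y + p / 2"
  have t: "t > 0" using y p by (simp add: t_def)
  have J: "J_int a t = (coth t * a t - b t) * (1 / sinh t) / 2" unfolding J_int_def by (rule integral_unique[OF J_integral[OF N(1) t]])
  have M: "M_int a t = (coth t ^ 2 * a t / 3 - coth t * b t / 6 - e t / 6) * (1 / sinh t)" unfolding M_int_def by (rule integral_unique[OF M_integral[OF N t]])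
  have yt: "y = t - p / 2" by (simp add: t_def)
  have Sy: "sinh y = sinh t * (C - coth t * S)" unfolding yt C_def S_def sinh_diff using t by (simp add: coth_def field_simps)
  have Ct: "cosh t = coth t * sinh t" using t by (simp add: coth_def)
  have "K_op p a y = (sinh t * (C - coth t * S)) ^ 2 / sinh t ^ 2 * a t + 4 * (sinh t * (C - coth t * S)) * S * ((coth t * a t - b t) * (1 / sinh t) / 2)
     + 6 * S^2 * (coth t * sinh t * ((coth t * a t - b t) * (1 / sinh t) / 2) - sinh t * ((coth t ^ 2 * a t / 3 - coth t * b t / 6 - e t / 6) * (1 / sinh t)))"
    unfolding K_op_def Let_def t_def[symmetric] J M Sy[symmetric] S_def[symmetric] Ct[symmetric] by simp
  also have "\<dots> = a t * C^2 - 2 * b t * C * S + e t * S^2"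
    using t by (simp add: field_simps power2_eq_square)
  finally show ?thesis unfolding t_def .
qed

text \<open>A shift by \<open>d\<close> changes the parameter \<open>r\<close> into
  \<open>(r * C - S) / (C - r * S)\<close>. On a mode the two functions therefore carry the factors
  \<open>(C - r * S)^2\<close> and \<open>(C - r * S) * (r * C - S)\<close>.\<close>

lemma Nrel_shift:
  assumes N: "Nrel a b" "Nrel b e" and d: "d \<ge> 0"
  defines "C \<equiv> cosh d" and "S \<equiv> sinh d"
  shows "Nrel (\<lambda>y. a (y + d) * C^2 - 2 * b (y + d) * C * S + e (y + d) * S^2) (\<lambda>y. b (y + d) * (C^2 + S^2) - (a (y + d) + e (y + d)) * C * S)"
proof -
  from N obtain l l' l'' where l: "(a \<longlongrightarrow> l) at_top" "(b \<longlongrightarrow> l') at_top" "(e \<longlongrightarrow> l'') at_top" unfolding Nrel_def by blast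
  have tr: "filterlim (\<lambda>y. y + d) at_top at_top" using filterlim_tendsto_add_at_top[OF tendsto_const[of d] filterlim_ident] by (simp add: add.commute)
  note l = l[THEN filterlim_compose, OF tr]
  show ?thesis unfolding Nrel_def
  proof (intro conjI allI impI)
    fix y :: real assume y: "y > 0"
    define t where "t = y + d"
    have t: "t > 0" using y d by (simp add: t_def)
    from N(1) t obtain a' b' where d1: "(a has_real_derivative a') (at t)" "(b has_real_derivative b') (at t)"
      and e1: "sinh t * b' = cosh t * (a' + b t) - sinh t * a t" by (rule NrelE)
    from N(2) t obtain b'' e' where d2: "(b has_real_derivative b'') (at t)" "(e has_real_derivative e') (at t)"
      and e2: "sinh t * e' = cosh t * (b'' + e t) - sinh t * b t" by (rule NrelE)
    have b'': "b'' = b'" using d1(2) d2(1) by (rule DERIV_unique[symmetric])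
    have dd: "((\<lambda>y. a (y + d)) has_real_derivative a') (at y)" "((\<lambda>y. b (y + d)) has_real_derivative b') (at y)" "((\<lambda>y. e (y + d)) has_real_derivative e') (at y)"
      using DERIV_shift[of a a' y d] DERIV_shift[of b b' y d] DERIV_shift[of e e' y d] d1 d2 by (simp_all add: t_def)
    have A: "((\<lambda>y. a (y + d) * C^2 - 2 * b (y + d) * C * S + e (y + d) * S^2) has_real_derivative (a' * C^2 - 2 * b' * C * S + e' * S^2)) (at y)"
      using dd by (auto intro!: derivative_eq_intros)
    have B: "((\<lambda>y. b (y + d) * (C^2 + S^2) - (a (y + d) + e (y + d)) * C * S) has_real_derivative (b' * (C^2 + S^2) - (a' + e') * C * S)) (at y)"
      using dd by (auto intro!: derivative_eq_intros)
    have y': "sinh y = sinh t * C - cosh t * S" "cosh y = cosh t * C - sinh t * S"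
      using sinh_shift[of t d] by (simp_all add: C_def S_def t_def)
    have "sinh y * (b' * (C^2 + S^2) - (a' + e') * C * S) - (cosh y * (a' * C^2 - 2 * b' * C * S + e' * S^2 + (b t * (C^2 + S^2) - (a t + e t) * C * S))
       - sinh y * (a t * C^2 - 2 * b t * C * S + e t * S^2))
       = (C^2 - S^2) * (C * (sinh t * b' - (cosh t * (a' + b t) - sinh t * a t)) - S * (sinh t * e' - (cosh t * (b' + e t) - sinh t * b t)))"
      unfolding y' by (simp add: algebra_simps power2_eq_square)
    also have "\<dots> = 0" using e1 e2 by (simp add: b'')
    finally have E: "sinh y * (b' * (C^2 + S^2) - (a' + e') * C * S) = cosh y * (a' * C^2 - 2 * b' * C * S + e' * S^2 + (b t * (C^2 + S^2) - (a t + e t) * C * S))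
       - sinh y * (a t * C^2 - 2 * b t * C * S + e t * S^2)" by simp
    show "\<exists>A B. ((\<lambda>y. a (y + d) * C^2 - 2 * b (y + d) * C * S + e (y + d) * S^2) has_real_derivative A) (at y) \<and>
      ((\<lambda>y. b (y + d) * (C^2 + S^2) - (a (y + d) + e (y + d)) * C * S) has_real_derivative B) (at y) \<and>
      sinh y * B = cosh y * (A + (b (y + d) * (C^2 + S^2) - (a (y + d) + e (y + d)) * C * S)) - sinh y * (a (y + d) * C^2 - 2 * b (y + d) * C * S + e (y + d) * S^2)"
      by (rule exI, rule exI, rule conjI[OF A conjI[OF B E[unfolded t_def]]])
  next
    show "\<exists>l. ((\<lambda>y. a (y + d) * C^2 - 2 * b (y + d) * C * S + e (y + d) * S^2) \<longlongrightarrow> l) at_top"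
      by (rule exI[of _ "l * C^2 - 2 * l' * C * S + l'' * S^2"], (rule tendsto_add tendsto_diff tendsto_mult tendsto_const l)+)
    show "\<exists>l. ((\<lambda>y. b (y + d) * (C^2 + S^2) - (a (y + d) + e (y + d)) * C * S) \<longlongrightarrow> l) at_top"
      by (rule exI[of _ "l' * (C^2 + S^2) - (l + l'') * C * S"], (rule tendsto_add tendsto_diff tendsto_mult tendsto_const l)+)
  qed
qed

text \<open>The origin of the coordinates. \<open>T F = cosh * F - sinh * G\<close>, where
  \<open>G\<close> is \<open>F\<close> with its mode multiplied by the parameter, so the
  interpolation collapses to \<open>F * cosh \<beta> - G * sinh \<beta>\<close>. On modes this
  leaves the factors at \<open>d\<close> and \<open>d + \<beta>\<close>: hence
  \<open>s0 = d\<close>, \<open>s1 = d + \<beta>\<close>, \<open>s = t\<close>.\<close>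

lemma op_chain:
  assumes N: "Nrel a b" "Nrel b e" and y: "y > 0" and p: "p \<ge> 0"
  defines "t \<equiv> y + p / 2" and "d \<equiv> p / 2"
  shows "K_op p a y * (sinh (y - \<beta>) / sinh y) + T_op (K_op p a) y * (sinh \<beta> / sinh y)
    = a t * cosh d * cosh (d + \<beta>) - b t * (cosh d * sinh (d + \<beta>) + sinh d * cosh (d + \<beta>)) + e t * sinh d * sinh (d + \<beta>)"
proof -
  define C where "C = cosh d" define S where "S = sinh d"
  define F where "F = (\<lambda>y. a (y + d) * C^2 - 2 * b (y + d) * C * S + e (y + d) * S^2)"
  define G where "G = (\<lambda>y. b (y + d) * (C^2 + S^2) - (a (y + d) + e (y + d)) * C * S)"
  have K: "K_op p a r = F r" if "r > 0" for r
    using K_op_chain[OF N that p] by (simp add: F_def C_def S_def d_def)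
  have NFG: "Nrel F G" unfolding F_def G_def C_def S_def by (rule Nrel_shift[OF N]) (use p in \<open>simp add: d_def\<close>)
  have "T_op (K_op p a) y = T_op F y" by (rule T_op_cong[OF K y])
  also have "\<dots> = 2 * sinh y ^ 2 * ((coth y * F y - G y) * (1 / sinh y) / 2)"
    unfolding T_op_def integral_unique[OF J_integral[OF NFG y]] ..
  also have "\<dots> = cosh y * F y - sinh y * G y" using y by (simp add: coth_def power2_eq_square field_simps)
  finally have T: "T_op (K_op p a) y = cosh y * F y - sinh y * G y" .
  have "K_op p a y * (sinh (y - \<beta>) / sinh y) + T_op (K_op p a) y * (sinh \<beta> / sinh y) = F y * cosh \<beta> - G y * sinh \<beta>"
    unfolding K[OF y] T sinh_diff using y by (simp add: field_simps)
  also have "\<dots> = a t * cosh d * cosh (d + \<beta>) - b t * (cosh d * sinh (d + \<beta>) + sinh d * cosh (d + \<beta>)) + e t * sinh d * sinh (d + \<beta>)"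
    unfolding F_def G_def cosh_add sinh_add C_def[symmetric] S_def[symmetric] t_def d_def[symmetric] by (simp add: algebra_simps power2_eq_square)
  finally show ?thesis .
qed

section \<open>Chains starting from \<open>L\<close>, \<open>U\<close> and \<open>b0\<close>\<close>

lemma h_lim: "((\<lambda>s. hU 0 n s) \<longlongrightarrow> kk) at_top" "((\<lambda>s. M0 n s w) \<longlongrightarrow> 0) at_top"
proof -
  have e: "((\<lambda>s::real. exp (- s)) \<longlongrightarrow> 0) at_top" by real_asymp
  from tendsto_add[OF tendsto_mult[OF e h_lims(1)[of n]] tendsto_const[of kk]] show "((\<lambda>s. hU 0 n s) \<longlongrightarrow> kk) at_top"
    by (simp add: mult.assoc[symmetric] mult_exp_exp del: hU.simps)
  from tendsto_mult[OF e M_lims(1)[of n w]] show "((\<lambda>s. M0 n s w) \<longlongrightarrow> 0) at_top"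
    by (simp add: mult.assoc[symmetric] mult_exp_exp)
qed

lemma Nrel_L: assumes n: "n < 3" shows "Nrel (\<lambda>s. hU 0 n s + M0 n s w) (\<lambda>s. hU 0 (Suc n) s + M0 (Suc n) s w)"
  unfolding Nrel_def
proof (intro conjI allI impI)
  fix y :: real assume y: "y > 0"
  have "sinh y * hU (Suc 0) (Suc n) y = cosh y * (hU (Suc 0) n y + hU 0 (Suc n) y) - sinh y * hU 0 n y"
    using n y by (auto simp: less_Suc_eq numeral_3_eq_3 coth_def field_simps)
  moreover have "sinh y * M1 (Suc n) y w = cosh y * (M1 n y w + M0 (Suc n) y w) - sinh y * M0 n y w"
    by (simp add: M0_def M1_def algebra_simps)
  ultimately have E: "sinh y * (hU (Suc 0) (Suc n) y + M1 (Suc n) y w) = cosh y * (hU (Suc 0) n y + M1 n y w + (hU 0 (Suc n) y + M0 (Suc n) y w)) - sinh y * (hU 0 n y + M0 n y w)"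
    by (simp add: algebra_simps del: hU.simps)
  have D: "((\<lambda>s. hU 0 n s + M0 n s w) has_real_derivative (hU (Suc 0) n y + M1 n y w)) (at y)" for n
    by (intro DERIV_add hU_deriv M0_deriv y) simp
  show "\<exists>a' b'. ((\<lambda>s. hU 0 n s + M0 n s w) has_real_derivative a') (at y) \<and> ((\<lambda>s. hU 0 (Suc n) s + M0 (Suc n) s w) has_real_derivative b') (at y)
     \<and> sinh y * b' = cosh y * (a' + (hU 0 (Suc n) y + M0 (Suc n) y w)) - sinh y * (hU 0 n y + M0 n y w)"
    by (rule exI, rule exI, rule conjI[OF D conjI[OF D E]])
next
  show "\<exists>l. ((\<lambda>s. hU 0 n s + M0 n s w) \<longlongrightarrow> l) at_top" "\<exists>l. ((\<lambda>s. hU 0 (Suc n) s + M0 (Suc n) s w) \<longlongrightarrow> l) at_top"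
    by (rule exI, rule tendsto_add[OF h_lim])+
qed

lemma L_fun_eq: "L_fun s w = hU 0 0 s + M0 0 s w"
proof -
  have "integral {1..cosh s / sinh s} (\<lambda>r. (r * sinh s - cosh s) * exp (- 2 * w * r) * g_fun r) = M0 0 s w"
  proof (rule integral_unique)
    have "(\<lambda>r. (cosh s + (- sinh s) * r) * wgt 0 w r) = (\<lambda>r. (r * sinh s - cosh s) * exp (- 2 * w * r) * g_fun r)"
      by (simp add: fun_eq_iff wgt_def dens_def algebra_simps)
    with mom_lin_has_integral[of "cosh s" "- sinh s" 0 w "coth s"]
    show "((\<lambda>r. (r * sinh s - cosh s) * exp (- 2 * w * r) * g_fun r) has_integral M0 0 s w) {1..cosh s / sinh s}"
      by (simp add: M0_def coth_def)
  qed
  moreover have "1 / sqrt 2 = 2 * kk" by (simp add: kk_def)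
  ultimately show ?thesis by (simp add: L_fun_def At_def)
qed

text \<open>Up to the factor \<open>cosh^2\<close>, the bracket in \<open>H_fun\<close> is the
  closed form of the first moment at \<open>w = 0\<close> plus \<open>kk * cosh\<close>: the
  difference has derivative zero and tends to 0 at infinity.\<close>

lemma mom1_closed: assumes t: "t > 0" shows "H_fun t = kk / cosh t + mom 1 (coth t) 0 / cosh t ^ 2"
proof -
  \<comment> \<open>\<open>6 * kk\<close> is the constant \<open>3 / sqrt 2\<close> of
    \<open>H_fun\<close>; \<open>?r\<close> replaces the multiple angles by powers of
    \<open>sinh\<close> and one factor \<open>cosh\<close>.\<close>
  let ?q = "\<lambda>t::real. 6 * kk / sinh t ^ 5 * (t / 16 - sinh (2 * t) / 64 - sinh (4 * t) / 64 + sinh (6 * t) / 192)"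
  let ?r = "\<lambda>t::real. 6 * kk * (t / 16 - sinh t * cosh t / 16 + sinh t ^ 3 * cosh t / 24 + sinh t ^ 5 * cosh t / 6) / sinh t ^ 5"
  have qr: "?q t = ?r t" for t
  proof -
    have 2: "sinh (2 * t) = 2 * sinh t * cosh t" by (rule sinh_double)
    have c2: "cosh (2 * t) = 2 * sinh t ^ 2 + 1" using cosh_double[of t] cosh_sq[of t] by simp
    have 4: "sinh (4 * t) = 4 * sinh t * cosh t * (2 * sinh t ^ 2 + 1)"
      using sinh_double[of "2 * t"] unfolding 2 c2 by simp
    have "cosh (4 * t) = 2 * (2 * sinh t * cosh t) ^ 2 + 1" using cosh_double[of "2 * t"] cosh_sq[of "2 * t"] unfolding 2 by simp
    hence c4: "cosh (4 * t) = 8 * sinh t ^ 2 * (sinh t ^ 2 + 1) + 1" by (simp add: power_mult_distrib cosh_sq)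
    have "sinh (6 * t) = sinh (4 * t + 2 * t)" by simp
    also have "\<dots> = 4 * sinh t * cosh t * (2 * sinh t ^ 2 + 1) * (2 * sinh t ^ 2 + 1) + (8 * sinh t ^ 2 * (sinh t ^ 2 + 1) + 1) * (2 * sinh t * cosh t)"
      unfolding sinh_add 4 2 c2 c4 ..
    finally have 6: "sinh (6 * t) = 4 * sinh t * cosh t * (2 * sinh t ^ 2 + 1) * (2 * sinh t ^ 2 + 1) + (8 * sinh t ^ 2 * (sinh t ^ 2 + 1) + 1) * (2 * sinh t * cosh t)" .
    have "t / 16 - sinh (2 * t) / 64 - sinh (4 * t) / 64 + sinh (6 * t) / 192
      = t / 16 - sinh t * cosh t / 16 + sinh t ^ 3 * cosh t / 24 + sinh t ^ 5 * cosh t / 6"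
      unfolding 2 4 6 by (simp add: field_simps eval_nat_numeral)
    thus ?thesis by simp
  qed
  let ?f = "\<lambda>t. ?r t - kk * cosh t - mom 1 (coth t) 0"
  have "?f t = 0"
  proof (rule zero_of_deriv_zero[where a=0 and f="?f"])
    fix s :: real assume s: "s > 0"
    have m: "((\<lambda>t. mom 1 (coth t) 0) has_real_derivative - coth s * Gam s * sinh s) (at s)"
      using mom_coth_has_derivative[of "\<lambda>t. t" "\<lambda>t. t" s "\<lambda>_. 0" "\<lambda>_. 0" 1] s
      by (simp add: has_field_derivative_def mult.commute[of "coth s * Gam s * sinh s"] cong: if_cong)
        (rule has_derivative_eq_rhs, assumption, simp add: fun_eq_iff)
    have r: "(?r has_real_derivative 6 * kk * ((1/16 - (cosh s * cosh s + sinh s * sinh s) / 16 + (3 * sinh s ^ 2 * cosh s * cosh s + sinh s ^ 4) / 24 + (5 * sinh s ^ 4 * cosh s * cosh s + sinh s ^ 6) / 6) * sinh s ^ 5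
       - (s / 16 - sinh s * cosh s / 16 + sinh s ^ 3 * cosh s / 24 + sinh s ^ 5 * cosh s / 6) * (5 * sinh s ^ 4 * cosh s)) / (sinh s ^ 5) ^ 2) (at s)"
      using s by (auto intro!: derivative_eq_intros simp: field_simps eval_nat_numeral)
    have e: "6 * kk * ((1/16 - (cosh s * cosh s + sinh s * sinh s) / 16 + (3 * sinh s ^ 2 * cosh s * cosh s + sinh s ^ 4) / 24 + (5 * sinh s ^ 4 * cosh s * cosh s + sinh s ^ 6) / 6) * sinh s ^ 5
       - (s / 16 - sinh s * cosh s / 16 + sinh s ^ 3 * cosh s / 24 + sinh s ^ 5 * cosh s / 6) * (5 * sinh s ^ 4 * cosh s)) / (sinh s ^ 5) ^ 2 - kk * sinh s - - coth s * Gam s * sinh s = 0"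
    proof -
      have "6 * kk * ((1/16 - (C * C + S * S) / 16 + (3 * S ^ 2 * C * C + S ^ 4) / 24 + (5 * S ^ 4 * C * C + S ^ 6) / 6) * S ^ 5
       - (s / 16 - S * C / 16 + S ^ 3 * C / 24 + S ^ 5 * C / 6) * (5 * S ^ 4 * C)) / (S ^ 5) ^ 2 - kk * S
       - - (C / S) * (kk * (15 * s * C / S - 15 - 5 * S ^ 2 + 2 * S ^ 4) / (8 * C * S ^ 5)) * S = 0"
        if "S \<noteq> 0" "C \<noteq> 0" "C * C = S * S + 1" for S C :: real
      proof -
        have h1: "6 * kk * ((1/16 - (C * C + S * S) / 16 + (3 * S ^ 2 * C * C + S ^ 4) / 24 + (5 * S ^ 4 * C * C + S ^ 6) / 6) * S ^ 5
          - (s / 16 - S * C / 16 + S ^ 3 * C / 24 + S ^ 5 * C / 6) * (5 * S ^ 4 * C)) / (S ^ 5) ^ 2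
          = 6 * kk * ((1/16 - (C * C + S * S) / 16 + (3 * S ^ 2 * (C * C) + S ^ 4) / 24 + (5 * S ^ 4 * (C * C) + S ^ 6) / 6) * S
          - (s * C / 16 - S * (C * C) / 16 + S ^ 3 * (C * C) / 24 + S ^ 5 * (C * C) / 6) * 5) / S ^ 6"
          using that(1) by (simp add: field_simps eval_nat_numeral)
        have h2: "- (C / S) * (kk * (15 * s * C / S - 15 - 5 * S ^ 2 + 2 * S ^ 4) / (8 * C * S ^ 5)) * S
          = - (kk * (15 * s * C - 15 * S - 5 * S ^ 3 + 2 * S ^ 5) / (8 * S ^ 6))"
          using that(1,2) by (simp add: field_simps eval_nat_numeral)
        show ?thesis unfolding h1 unfolding h2 unfolding that(3) using that(1) by (simp add: field_simps eval_nat_numeral)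
      qed
      from this[of "sinh s" "cosh s"] s show ?thesis
        using cosh_sq[of s] unfolding coth_def Gam_def by (simp add: power2_eq_square)
    qed
    show "(?f has_real_derivative 0) (at s)"
      by (rule DERIV_cong[OF DERIV_diff[OF DERIV_diff[OF r DERIV_cmult[OF dcosh]] m] e])
  next
    have "((\<lambda>t::real. 6 * (t / 16 - sinh t * cosh t / 16 + sinh t ^ 3 * cosh t / 24 + sinh t ^ 5 * cosh t / 6) / sinh t ^ 5 - cosh t) \<longlongrightarrow> 0) at_top"
      unfolding sinh_field_def cosh_field_def by real_asymp
    from tendsto_mult[OF tendsto_const[of kk] this] have "((\<lambda>t. ?r t - kk * cosh t) \<longlongrightarrow> 0) at_top" by (simp add: algebra_simps)
    from tendsto_diff[OF this mom_tendsto_0[of 1 0]] show "(?f \<longlongrightarrow> 0) at_top" by (simp add: coth_def)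
  qed (rule t)
  hence "?q t = kk * cosh t + mom 1 (coth t) 0" unfolding qr by simp
  moreover have "H_fun t = ?q t / cosh t ^ 2"
    by (simp add: H_fun_def kk_def)
  ultimately show ?thesis using t by (simp add: add_divide_distrib power2_eq_square)
qed

text \<open>\<open>U\<close> is \<open>L\<close> at \<open>w = 0\<close>. Division by
  \<open>cosh\<close> removes the zeroth moment from the derivative, and what is left is
  \<open>- H_fun\<close> by \<open>mom1_closed\<close>.\<close>

lemma U_fun_eq: assumes t: "t > 0" shows "U_fun t = Uj 0 0 t"
proof -
  let ?F = "\<lambda>t. - (Uj 0 0 t / cosh t)"
  have "(?F has_real_derivative H_fun r) (at r)" if "r \<ge> t" for r
  proof -
    have r: "r > 0" using that t by simp
    have "(?F has_real_derivative - ((Uj 1 0 r * cosh r - Uj 0 0 r * sinh r) / (cosh r * cosh r))) (at r)"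
      by (rule DERIV_minus DERIV_divide dcosh)+ (use Uj_deriv[OF r, of 0 0] dcosh in simp_all)
    moreover have "- ((Uj 1 0 r * cosh r - Uj 0 0 r * sinh r) / (cosh r * cosh r)) = H_fun r"
    proof -
      have "Uj 1 0 r * cosh r - Uj 0 0 r * sinh r = - (kk * cosh r) - (cosh r ^ 2 - sinh r ^ 2) * mom 1 (coth r) 0"
        unfolding Uj_def by (simp add: M0_def M1_def algebra_simps power2_eq_square)
      hence "Uj 1 0 r * cosh r - Uj 0 0 r * sinh r = - (kk * cosh r) - mom 1 (coth r) 0" by (simp add: cosh_sq)
      thus ?thesis unfolding mom1_closed[OF r] by (simp add: diff_divide_distrib power2_eq_square)
    qed
    ultimately show ?thesis by simp
  qed
  moreover have "(?F \<longlongrightarrow> 0) at_top"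
  proof -
    have c: "((\<lambda>t::real. 1 / cosh t) \<longlongrightarrow> 0) at_top" unfolding cosh_field_def by real_asymp
    from tendsto_mult[OF tendsto_minus[OF tendsto_add[OF h_lim[of 0] ]] c]
    show ?thesis by (simp add: Uj_def minus_divide_left del: hU.simps)
  qed
  ultimately have "integral {t..} H_fun = Uj 0 0 t / cosh t"
    using integral_unique[OF has_integral_at_top[of t ?F]] by simp
  thus ?thesis by (simp add: U_fun_def)
qed

lemma Nrel_L01: "Nrel (\<lambda>s. hU 0 0 s + M0 0 s w) (\<lambda>s. hU 0 1 s + M0 1 s w)" "Nrel (\<lambda>s. hU 0 1 s + M0 1 s w) (\<lambda>s. hU 0 2 s + M0 2 s w)"
    "Nrel (\<lambda>s. hU 0 2 s + M0 2 s w) (\<lambda>s. hU 0 3 s + M0 3 s w)"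
  using Nrel_L[of 0 w] Nrel_L[of 1 w] Nrel_L[of 2 w] by (simp_all add: eval_nat_numeral del: hU.simps)

lemma v_upper_A:
  assumes q: "q $ 4 \<ge> q $ 2" "2 * q $ 1 \<ge> q $ 4 - q $ 2" and y: "q $ 2 + q $ 3 > 0"
  shows "v_upper q = val (\<lambda>a b. X0 1 0 0 a b (sqrt 2 * (q $ 2 + q $ 3) + sqrt 2 * (q $ 4 - q $ 2) / 2) (sqrt 2 * q $ 1 - sqrt 2 * (q $ 4 - q $ 2) / 2))
     (sqrt 2 * (q $ 4 - q $ 2) / 2) (sqrt 2 * (q $ 4 - q $ 2) / 2 + sqrt 2 * q $ 2)"
proof -
  define y where "y = sqrt 2 * (q $ 2 + q $ 3)"
  define z where "z = sqrt 2 * (q $ 4 - q $ 2)"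
  define w where "w = sqrt 2 * q $ 1 - z / 2"
  have y0: "y > 0" and z0: "z \<ge> 0" using assms by (simp_all add: y_def z_def)
  have "sqrt 2 * (q $ 4 - q $ 2) \<le> sqrt 2 * (2 * q $ 1)" using q by (intro mult_left_mono) auto
  hence w0: "w \<ge> 0" "min z (2 * (sqrt 2 * q $ 1)) = z" by (simp_all add: w_def z_def)
  have phi: "phi_fun w = (\<lambda>s. hU 0 0 s + M0 0 s w)" using w0 by (simp add: phi_fun_def L_fun_eq fun_eq_iff)
  have q3: "sqrt 2 * q $ 3 = y - sqrt 2 * q $ 2" by (simp add: y_def algebra_simps)
  have "v_upper q = K_op z (phi_fun w) y * (sinh (y - sqrt 2 * q $ 2) / sinh y) + T_op (K_op z (phi_fun w)) y * (sinh (sqrt 2 * q $ 2) / sinh y)"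
    unfolding v_upper_def Let_def F_fun_def R_fun_def y_def[symmetric] z_def[symmetric] w_def[symmetric] w0 q3 ..
  also have "\<dots> = val (\<lambda>a b. X0 1 0 0 a b (y + z / 2) w) (z / 2) (z / 2 + sqrt 2 * q $ 2)"
    unfolding phi op_chain[OF Nrel_L01(1,2) y0 z0]
    by (simp add: val_def Xgen_def sg_def nb_def algebra_simps numeral_2_eq_2 del: hU.simps)
  finally show ?thesis unfolding y_def z_def w_def .
qed

text \<open>The first two images of \<open>b0\<close> under multiplication of the mode by
  \<open>r\<close>. They explain \<open>b1\<close>: it equals
  \<open>cosh * b0 - sinh * (kk * (1 - exp (- 2 * s) / 3))\<close>, that is,
  \<open>T b0\<close>.\<close>

lemma Nrel_b0: "Nrel b0 (\<lambda>s. kk * (1 - exp (- 2 * s) / 3))" "Nrel (\<lambda>s. kk * (1 - exp (- 2 * s) / 3)) (\<lambda>s. kk * (2 * (lam s * sinh s) - 1 + exp (- 2 * s) / 3))"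
proof -
  have b0: "b0 = (\<lambda>s. kk * (1 + exp (- 2 * s) / 3))" by (simp add: b0_def kk_def fun_eq_iff)
  have e: "((\<lambda>s::real. exp (- 2 * s)) \<longlongrightarrow> 0) at_top" by real_asymp
  have l: "((\<lambda>s::real. lam s * sinh s) \<longlongrightarrow> 1) at_top" unfolding lam_def sinh_field_def by real_asymp
  have d: "(b0 has_real_derivative kk * (- 2 * exp (- 2 * y) / 3)) (at y)" "((\<lambda>s. kk * (1 - exp (- 2 * s) / 3)) has_real_derivative kk * (2 * exp (- 2 * y) / 3)) (at y)" for y
    unfolding b0 by (auto intro!: derivative_eq_intros)
  have d2: "((\<lambda>s. kk * (2 * (lam s * sinh s) - 1 + exp (- 2 * s) / 3)) has_real_derivative kk * (2 * (lam y * cosh y - 1) - 2 * exp (- 2 * y) / 3)) (at y)" if "y > 0" for y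
    using lam_deriv[OF that] that by (auto intro!: derivative_eq_intros simp: field_simps)
  have c: "cosh y * exp (- 2 * y) + sinh y * exp (- 2 * y) = cosh y - sinh y" for y :: real
    unfolding cosh_field_def sinh_field_def by (simp add: field_simps exp_minus exp_double power2_eq_square exp_add[symmetric])
  show "Nrel b0 (\<lambda>s. kk * (1 - exp (- 2 * s) / 3))" unfolding Nrel_def
  proof (intro conjI allI impI)
    fix y :: real assume y: "y > 0"
    have "sinh y * (kk * (2 * exp (- 2 * y) / 3)) = cosh y * (kk * (- 2 * exp (- 2 * y) / 3) + kk * (1 - exp (- 2 * y) / 3)) - sinh y * b0 y
       \<longleftrightarrow> kk * (cosh y * exp (- 2 * y) + sinh y * exp (- 2 * y)) = kk * (cosh y - sinh y)" unfolding b0 by (simp add: algebra_simps; (rule eq_commute)?)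
    hence E: "sinh y * (kk * (2 * exp (- 2 * y) / 3)) = cosh y * (kk * (- 2 * exp (- 2 * y) / 3) + kk * (1 - exp (- 2 * y) / 3)) - sinh y * b0 y" unfolding c by simp
    show "\<exists>a' b'. (b0 has_real_derivative a') (at y) \<and> ((\<lambda>s. kk * (1 - exp (- 2 * s) / 3)) has_real_derivative b') (at y) \<and>
      sinh y * b' = cosh y * (a' + kk * (1 - exp (- 2 * y) / 3)) - sinh y * b0 y"
      by (rule exI, rule exI, rule conjI[OF d(1) conjI[OF d(2) E]])
  next
    show "\<exists>l. (b0 \<longlongrightarrow> l) at_top" unfolding b0 by (rule exI, (rule tendsto_mult tendsto_add tendsto_diff tendsto_divide tendsto_const e | simp)+)
    show "\<exists>l. ((\<lambda>s. kk * (1 - exp (- 2 * s) / 3)) \<longlongrightarrow> l) at_top" by (rule exI, (rule tendsto_mult tendsto_add tendsto_diff tendsto_divide tendsto_const e | simp)+)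
  qed
  show "Nrel (\<lambda>s. kk * (1 - exp (- 2 * s) / 3)) (\<lambda>s. kk * (2 * (lam s * sinh s) - 1 + exp (- 2 * s) / 3))" unfolding Nrel_def
  proof (intro conjI allI impI)
    fix y :: real assume y: "y > 0"
    have "sinh y * (kk * (2 * (lam y * cosh y - 1) - 2 * exp (- 2 * y) / 3)) = cosh y * (kk * (2 * exp (- 2 * y) / 3) + kk * (2 * (lam y * sinh y) - 1 + exp (- 2 * y) / 3)) - sinh y * (kk * (1 - exp (- 2 * y) / 3))
       \<longleftrightarrow> kk * (cosh y * exp (- 2 * y) + sinh y * exp (- 2 * y)) = kk * (cosh y - sinh y)" by (simp add: algebra_simps; (rule eq_commute)?)
    hence E: "sinh y * (kk * (2 * (lam y * cosh y - 1) - 2 * exp (- 2 * y) / 3)) = cosh y * (kk * (2 * exp (- 2 * y) / 3) + kk * (2 * (lam y * sinh y) - 1 + exp (- 2 * y) / 3)) - sinh y * (kk * (1 - exp (- 2 * y) / 3))" unfolding c by simp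
    show "\<exists>a' b'. ((\<lambda>s. kk * (1 - exp (- 2 * s) / 3)) has_real_derivative a') (at y) \<and> ((\<lambda>s. kk * (2 * (lam s * sinh s) - 1 + exp (- 2 * s) / 3)) has_real_derivative b') (at y) \<and>
      sinh y * b' = cosh y * (a' + kk * (2 * (lam y * sinh y) - 1 + exp (- 2 * y) / 3)) - sinh y * (kk * (1 - exp (- 2 * y) / 3))"
      by (rule exI, rule exI, rule conjI[OF d(2) conjI[OF d2[OF y] E]])
  next
    show "\<exists>l. ((\<lambda>s. kk * (1 - exp (- 2 * s) / 3)) \<longlongrightarrow> l) at_top" by (rule exI, (rule tendsto_mult tendsto_add tendsto_diff tendsto_divide tendsto_const e | simp)+)
    show "\<exists>l. ((\<lambda>s. kk * (2 * (lam s * sinh s) - 1 + exp (- 2 * s) / 3)) \<longlongrightarrow> l) at_top" by (rule exI, (rule tendsto_mult tendsto_add tendsto_diff tendsto_divide tendsto_const e l | simp)+)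
  qed
qed

lemma Nrel_diff: assumes "Nrel a b" "Nrel a' b'" shows "Nrel (\<lambda>s. a s - a' s) (\<lambda>s. b s - b' s)"
  unfolding Nrel_def
proof (intro conjI allI impI)
  fix y :: real assume y: "y > 0"
  from assms(1) y obtain d e where 1: "(a has_real_derivative d) (at y)" "(b has_real_derivative e) (at y)" "sinh y * e = cosh y * (d + b y) - sinh y * a y"
    by (rule NrelE)
  from assms(2) y obtain d' e' where 2: "(a' has_real_derivative d') (at y)" "(b' has_real_derivative e') (at y)" "sinh y * e' = cosh y * (d' + b' y) - sinh y * a' y"
    by (rule NrelE)
  have E: "sinh y * (e - e') = cosh y * (d - d' + (b y - b' y)) - sinh y * (a y - a' y)"
    using 1(3) 2(3) by (simp add: algebra_simps)
  show "\<exists>d e. ((\<lambda>s. a s - a' s) has_real_derivative d) (at y) \<and> ((\<lambda>s. b s - b' s) has_real_derivative e) (at y) \<and> sinh y * e = cosh y * (d + (b y - b' y)) - sinh y * (a y - a' y)"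
    by (rule exI, rule exI, rule conjI[OF DERIV_diff[OF 1(1) 2(1)] conjI[OF DERIV_diff[OF 1(2) 2(2)] E]])
next
  from assms obtain l m l' m' where l: "(a \<longlongrightarrow> l) at_top" "(b \<longlongrightarrow> m) at_top" "(a' \<longlongrightarrow> l') at_top" "(b' \<longlongrightarrow> m') at_top" unfolding Nrel_def by blast
  show "\<exists>l. ((\<lambda>s. a s - a' s) \<longlongrightarrow> l) at_top" by (rule exI, rule tendsto_diff[OF l(1,3)])
  show "\<exists>l. ((\<lambda>s. b s - b' s) \<longlongrightarrow> l) at_top" by (rule exI, rule tendsto_diff[OF l(2,4)])
qed

text \<open>Removing \<open>b0\<close> before \<open>K\<close> and restoring \<open>b0\<close>,
  \<open>b1\<close> afterwards affects only the elementary part: the terms with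
  \<open>exp (- 2 * t)\<close> cancel, and the elementary coefficients of \<open>sinh s0\<close>
  change sign. This is the meaning of \<open>\<tau> = - 1\<close>.\<close>

lemma v_lower_B:
  assumes q: "q $ 2 \<ge> q $ 4" and y: "q $ 3 + q $ 4 > 0"
  shows "v_lower q = val (\<lambda>a b. X0 (-1) 0 0 a b (sqrt 2 * (q $ 3 + q $ 4) + sqrt 2 * (q $ 2 - q $ 4) / 2) (sqrt 2 * q $ 1))
     (sqrt 2 * (q $ 2 - q $ 4) / 2) (sqrt 2 * (q $ 2 - q $ 4) / 2 + sqrt 2 * q $ 4)"
proof -
  define y where "y = sqrt 2 * (q $ 3 + q $ 4)"
  define z where "z = sqrt 2 * (q $ 2 - q $ 4)"
  define w where "w = sqrt 2 * q $ 1"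
  define \<beta> where "\<beta> = sqrt 2 * q $ 4"
  define d where "d = z / 2"
  define t where "t = y + d"
  have y0: "y > 0" and z0: "z \<ge> 0" using assms by (simp_all add: y_def z_def)
  have psi: "psi_fun w = (\<lambda>s. (hU 0 0 s + M0 0 s w) - b0 s)" by (simp add: psi_fun_def L_fun_eq fun_eq_iff)
  have q3: "sqrt 2 * q $ 3 = y - \<beta>" by (simp add: y_def \<beta>_def algebra_simps)
  have "v_lower q = (K_op z (psi_fun w) y * (sinh (y - \<beta>) / sinh y) + T_op (K_op z (psi_fun w)) y * (sinh \<beta> / sinh y))
     + (b0 y * sinh (y - \<beta>) + b1 y * sinh \<beta>) / sinh y"
    unfolding v_lower_def Let_def HB_fun_def RB_fun_def y_def[symmetric] z_def[symmetric] w_def[symmetric] \<beta>_def[symmetric] q3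
    by (simp add: algebra_simps add_divide_distrib)
  also have "K_op z (psi_fun w) y * (sinh (y - \<beta>) / sinh y) + T_op (K_op z (psi_fun w)) y * (sinh \<beta> / sinh y)
     = (hU 0 0 t + M0 0 t w - b0 t) * cosh d * cosh (d + \<beta>)
       - (hU 0 1 t + M0 1 t w - kk * (1 - exp (- 2 * t) / 3)) * (cosh d * sinh (d + \<beta>) + sinh d * cosh (d + \<beta>))
       + (hU 0 2 t + M0 2 t w - kk * (2 * (lam t * sinh t) - 1 + exp (- 2 * t) / 3)) * sinh d * sinh (d + \<beta>)"
    unfolding psi op_chain[OF Nrel_diff[OF Nrel_L01(1) Nrel_b0(1)] Nrel_diff[OF Nrel_L01(2) Nrel_b0(2)] y0 z0] t_def d_def ..
  also have "(b0 y * sinh (y - \<beta>) + b1 y * sinh \<beta>) / sinh y = kk * ((1 + exp (- 2 * y) / 3) * cosh \<beta> - (1 - exp (- 2 * y) / 3) * sinh \<beta>)"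
  proof -
    have b0y: "b0 y = kk * (1 + exp (- 2 * y) / 3)" and b1y': "b1 y = kk * (4 / 3 * exp (- y))"
      by (simp_all add: b0_def b1_def kk_def)
    have "4 / 3 * exp (- y) = (1 + exp (- 2 * y) / 3) * cosh y - (1 - exp (- 2 * y) / 3) * sinh y"
    proof -
      have "exp (- 2 * y) = 1 / (exp y * exp y)" by (simp add: exp_minus field_simps flip: exp_add)
      thus ?thesis unfolding cosh_field_def sinh_field_def exp_minus by (simp add: field_simps)
    qed
    hence b1y: "b1 y = kk * ((1 + exp (- 2 * y) / 3) * cosh y - (1 - exp (- 2 * y) / 3) * sinh y)" using b1y' by (simp only:)
    have g: "k * (1 + E) * (Sy * Cb - Cy * Sb) + k * ((1 + E) * Cy - (1 - E) * Sy) * Sb = Sy * (k * ((1 + E) * Cb - (1 - E) * Sb))" for k E Sy Cy Cb Sb :: real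
      by (simp add: algebra_simps)
    have "b0 y * sinh (y - \<beta>) + b1 y * sinh \<beta> = sinh y * (kk * ((1 + exp (- 2 * y) / 3) * cosh \<beta> - (1 - exp (- 2 * y) / 3) * sinh \<beta>))"
      unfolding b0y b1y sinh_diff by (rule g)
    thus ?thesis using y0 by simp
  qed
  also have "kk * ((1 + exp (- 2 * y) / 3) * cosh \<beta> - (1 - exp (- 2 * y) / 3) * sinh \<beta>)
     = kk * ((1 + exp (- 2 * t) / 3) * (cosh d * cosh (d + \<beta>)) - (1 - exp (- 2 * t) / 3) * (cosh d * sinh (d + \<beta>) + sinh d * cosh (d + \<beta>)) + (exp (- 2 * t) / 3 - 1) * (sinh d * sinh (d + \<beta>)))
       + 2 * kk * (sinh d * cosh (d + \<beta>))"
  proof -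
    \<comment> \<open>In terms of these three exponentials the claim is an identity of rational
      functions.\<close>
    define a where "a = exp d" define b where "b = exp \<beta>" define u where "u = exp (- y)"
    have nz: "a > 0" "b > 0" by (simp_all add: a_def b_def)
    have e: "exp (- 2 * y) = u * u" "exp (- 2 * t) = u * u / (a * a)" "cosh d = (a + 1 / a) / 2" "sinh d = (a - 1 / a) / 2"
      "cosh (d + \<beta>) = (a * b + 1 / (a * b)) / 2" "sinh (d + \<beta>) = (a * b - 1 / (a * b)) / 2" "cosh \<beta> = (b + 1 / b) / 2" "sinh \<beta> = (b - 1 / b) / 2"
      unfolding cosh_field_def sinh_field_def a_def b_def u_def t_def
      by (simp_all add: exp_add exp_minus exp_double power2_eq_square field_simps flip: exp_add)
    show ?thesis unfolding e using nz by (simp add: field_simps)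
  qed
  finally have v: "v_lower q = (hU 0 0 t + M0 0 t w - b0 t) * cosh d * cosh (d + \<beta>)
       - (hU 0 1 t + M0 1 t w - kk * (1 - exp (- 2 * t) / 3)) * (cosh d * sinh (d + \<beta>) + sinh d * cosh (d + \<beta>))
       + (hU 0 2 t + M0 2 t w - kk * (2 * (lam t * sinh t) - 1 + exp (- 2 * t) / 3)) * sinh d * sinh (d + \<beta>)
       + (kk * ((1 + exp (- 2 * t) / 3) * (cosh d * cosh (d + \<beta>)) - (1 - exp (- 2 * t) / 3) * (cosh d * sinh (d + \<beta>) + sinh d * cosh (d + \<beta>)) + (exp (- 2 * t) / 3 - 1) * (sinh d * sinh (d + \<beta>)))
       + 2 * kk * (sinh d * cosh (d + \<beta>)))" .
  have V: "val (\<lambda>a b. X0 (-1) 0 0 a b t w) d (d + \<beta>) = (hU 0 0 t + M0 0 t w) * cosh d * cosh (d + \<beta>)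
       - (hU 0 1 t + M0 1 t w) * cosh d * sinh (d + \<beta>) - (M0 1 t w - hU 0 1 t) * sinh d * cosh (d + \<beta>)
       + (M0 2 t w - hU 0 2 t) * sinh d * sinh (d + \<beta>)"
    by (simp add: val_def Xgen_def sg_def nb_def algebra_simps numeral_2_eq_2 del: hU.simps)
  have h: "hU 0 1 t = kk" "hU 0 2 t = kk * (lam t * sinh t)" "b0 t = kk * (1 + exp (- 2 * t) / 3)"
    by (simp_all add: b0_def kk_def)
  have "v_lower q = val (\<lambda>a b. X0 (-1) 0 0 a b t w) d (d + \<beta>)"
    unfolding v V h by (simp add: algebra_simps del: hU.simps)
  thus ?thesis unfolding t_def d_def y_def z_def w_def \<beta>_def .
qed

section \<open>The third region\<close>

lemma Nrel_U: "Nrel (Uj 0 0) (Uj 0 1)" "Nrel (Uj 0 1) (Uj 0 2)" "Nrel (Uj 0 2) (Uj 0 3)"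
  using Nrel_L01[of 0] unfolding Uj_def[abs_def] by simp_all

lemma P_fun_identity:
  fixes c :: real
  assumes CS: "C * C = S * S + 1" and E': "E = (C + S)^2"
  shows "(C - c * S) ^ 3 * u0
    + 12 * (C + S) * (c - 1) * S ^ 2 * (C^2 * ((c * u0 - u1) / 2) - 2 * C * S * (c^2 * u0 / 3 - c * u1 / 6 - u2 / 6) + S^2 * (c^3 * u0 / 4 - (c^2 * u1 + c * u2 + u3) / 12))
    + 6 * (C - c * S) * S * (C * E * ((c * u0 - u1) / 2) + (C * (1 - E) - S * E) * (c^2 * u0 / 3 - c * u1 / 6 - u2 / 6) - S * (1 - E) * (c^3 * u0 / 4 - (c^2 * u1 + c * u2 + u3) / 12))
    = u0 * C^3 - 3 * u1 * C^2 * S + 3 * u2 * C * S^2 - u3 * S^3"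
proof -
  define j where "j = c * u0 - u1"
  define m where "m = 2 * c * c * u0 - c * u1 - u2"
  define k where "k = 3 * c * c * c * u0 - c * c * u1 - c * u2 - u3"
  have jmk: "(c * u0 - u1) / 2 = j / 2" "c^2 * u0 / 3 - c * u1 / 6 - u2 / 6 = m / 6" "c^3 * u0 / 4 - (c^2 * u1 + c * u2 + u3) / 12 = k / 12"
    by (simp_all add: j_def m_def k_def power2_eq_square power3_eq_cube field_simps)
  have E: "E = C * C + 2 * C * S + S * S" "1 - E = - 2 * S * (C + S)"
    using E' CS by (simp_all add: power2_eq_square algebra_simps)
  have 1: "S * S = C * C - 1" using CS by simp
  have 2: "S * (S * x) = C * (C * x) - x" for x using 1 by (simp add: mult.assoc[symmetric] left_diff_distrib)
  have "(C - c * S) ^ 3 * u0 + 12 * (C + S) * (c - 1) * S ^ 2 * (C^2 * (j / 2) - 2 * C * S * (m / 6) + S^2 * (k / 12))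
    + 6 * (C - c * S) * S * (C * E * (j / 2) + (C * (1 - E) - S * E) * (m / 6) - S * (1 - E) * (k / 12))
    = (C - c * S) ^ 3 * u0 + (C + S) * (c - 1) * S ^ 2 * (6 * C^2 * j - 4 * C * S * m + S^2 * k)
    + (C - c * S) * S * (3 * C * E * j + (C * (1 - E) - S * E) * m - S * (1 - E) / 2 * k)"
    by (simp add: field_simps)
  also have "\<dots> = (C - c * S) ^ 3 * u0 + (C + S) * (c - 1) * S ^ 2 * (6 * C^2 * j - 4 * C * S * m + S^2 * k)
    + (C - c * S) * S * (3 * C * E * j + (C * (- 2 * S * (C + S)) - S * E) * m + S * S * (C + S) * k)"
    unfolding E(2) by (simp add: mult.assoc)
  also have "\<dots> = u0 * C^3 - 3 * u1 * C^2 * S + 3 * u2 * C * S^2 - u3 * S^3"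
    unfolding E(1) j_def m_def k_def by (simp add: algebra_simps power2_eq_square power3_eq_cube 1 2)
  finally show ?thesis unfolding jmk .
qed

text \<open>On a mode \<open>P\<close> shifts the argument by \<open>\<alpha>\<close> and multiplies
  by \<open>(C - r * S)^3\<close>. The integrands contain \<open>sinh (r - \<alpha>)\<close> up to
  exponentials in \<open>\<alpha>\<close>; expanding it reduces both integrals to the three
  evaluated above.\<close>

lemma P_fun_eq:
  assumes y: "y > 0" and \<alpha>: "\<alpha> \<ge> 0"
  defines "C \<equiv> cosh \<alpha>" and "S \<equiv> sinh \<alpha>" and "\<rho> \<equiv> y + \<alpha>"
  shows "P_fun y (3 * \<alpha>) = Uj 0 0 \<rho> * C^3 - 3 * Uj 0 1 \<rho> * C^2 * S + 3 * Uj 0 2 \<rho> * C * S^2 - Uj 0 3 \<rho> * S^3"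
proof -
  have r: "\<rho> > 0" using y \<alpha> by (simp add: \<rho>_def)
  define E where "E = exp (2 * \<alpha>)"
  have e\<alpha>: "exp \<alpha> = C + S" "exp (- \<alpha>) = C - S" by (simp_all add: C_def S_def cosh_plus_sinh cosh_minus_sinh)
  have E: "E = (C + S)^2" by (simp add: E_def exp_double e\<alpha>)
  have CS: "C * C = S * S + 1" using cosh_sq[of \<alpha>] by (simp add: C_def S_def power2_eq_square)
  note J = J_integral[OF Nrel_U(1) r] and M = M_integral[OF Nrel_U(1,2) r] and Q = Q_integral[OF Nrel_U(1,2,3) r]
  define j where "j = (coth \<rho> * Uj 0 0 \<rho> - Uj 0 1 \<rho>) / 2"
  define m where "m = coth \<rho> ^ 2 * Uj 0 0 \<rho> / 3 - coth \<rho> * Uj 0 1 \<rho> / 6 - Uj 0 2 \<rho> / 6"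
  define k where "k = coth \<rho> ^ 3 * Uj 0 0 \<rho> / 4 - (coth \<rho> ^ 2 * Uj 0 1 \<rho> + coth \<rho> * Uj 0 2 \<rho> + Uj 0 3 \<rho>) / 12"
  have J': "((\<lambda>r. Uj 0 0 r / sinh r ^ 3) has_integral j / sinh \<rho>) {\<rho>..}" using J by (simp add: j_def mult.commute)
  have M': "((\<lambda>r. cosh r * Uj 0 0 r / sinh r ^ 4) has_integral m / sinh \<rho>) {\<rho>..}" using M by (simp add: m_def)
  have Q': "((\<lambda>r. cosh r ^ 2 * Uj 0 0 r / sinh r ^ 5) has_integral k / sinh \<rho>) {\<rho>..}" using Q by (simp add: k_def)
  have ee: "exp (2 * x) = exp x * exp x" "exp (- 2 * x) = 1 / (exp x * exp x)" "exp (4 * x) = exp x * exp x * exp x * exp x" for x :: real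
    by (simp_all add: exp_minus field_simps flip: exp_add)
  have X: "exp (- 2 * r) * (E - exp (2 * r)) = - 2 * exp \<alpha> * exp (- r) * sinh (r - \<alpha>)" for r
    unfolding E_def sinh_field_def ee exp_minus exp_diff by (simp add: field_simps power2_eq_square)
  have X2: "exp (- 2 * r) * (E - exp (2 * r))^2 = 4 * E * sinh (r - \<alpha>) ^ 2" for r
    unfolding E_def sinh_field_def ee exp_minus exp_diff by (simp add: field_simps power2_eq_square)
  have X3: "exp (- 2 * r) * (E - exp (2 * r)) * (E - (exp (2 * r) + 1) / 2) = - 2 * exp \<alpha> * (sinh (r - \<alpha>) * (E * (cosh r - sinh r) - cosh r))" for r
  proof -
    have "exp (- r) * (E - (exp (2 * r) + 1) / 2) = E * (cosh r - sinh r) - cosh r"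
      unfolding sinh_field_def cosh_field_def ee exp_minus by (simp add: field_simps)
    thus ?thesis unfolding X by (metis mult.assoc mult.left_commute)
  qed
  have I2: "integral {\<rho>..} (\<lambda>r. exp (- 2 * r) * (E - exp (2 * r)) ^ 2 * U_fun r / sinh r ^ 5)
     = 4 * E * (C^2 * (j / sinh \<rho>) - 2 * C * S * (m / sinh \<rho>) + S^2 * (k / sinh \<rho>))"
  proof -
    have "integral {\<rho>..} (\<lambda>r. exp (- 2 * r) * (E - exp (2 * r)) ^ 2 * U_fun r / sinh r ^ 5)
      = integral {\<rho>..} (\<lambda>r. 4 * E * (C^2 * (Uj 0 0 r / sinh r ^ 3) - 2 * C * S * (cosh r * Uj 0 0 r / sinh r ^ 4) + S^2 * (cosh r ^ 2 * Uj 0 0 r / sinh r ^ 5)))"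
    proof (rule integral_cong)
      fix r assume "r \<in> {\<rho>..}"
      hence r0: "r > 0" using r by simp
      hence "sinh r \<noteq> 0" by simp
      thus "exp (- 2 * r) * (E - exp (2 * r)) ^ 2 * U_fun r / sinh r ^ 5 = 4 * E * (C^2 * (Uj 0 0 r / sinh r ^ 3) - 2 * C * S * (cosh r * Uj 0 0 r / sinh r ^ 4) + S^2 * (cosh r ^ 2 * Uj 0 0 r / sinh r ^ 5))"
        unfolding X2 U_fun_eq[OF r0] sinh_diff C_def[symmetric] S_def[symmetric] using r0 by (simp add: field_simps eval_nat_numeral)
    qed
    also have "\<dots> = 4 * E * (C^2 * (j / sinh \<rho>) - 2 * C * S * (m / sinh \<rho>) + S^2 * (k / sinh \<rho>))"
      by (rule integral_unique) (intro has_integral_mult_right has_integral_add has_integral_diff J' M' Q')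
    finally show ?thesis .
  qed
  have I3: "integral {\<rho>..} (\<lambda>r. exp (- 2 * r) * (E - exp (2 * r)) * (E - (exp (2 * r) + 1) / 2) * U_fun r / sinh r ^ 5)
     = 2 * exp \<alpha> * (C * E * (j / sinh \<rho>) + (C * (1 - E) - S * E) * (m / sinh \<rho>) - S * (1 - E) * (k / sinh \<rho>))"
  proof -
    have "integral {\<rho>..} (\<lambda>r. exp (- 2 * r) * (E - exp (2 * r)) * (E - (exp (2 * r) + 1) / 2) * U_fun r / sinh r ^ 5)
      = integral {\<rho>..} (\<lambda>r. 2 * exp \<alpha> * (C * E * (Uj 0 0 r / sinh r ^ 3) + (C * (1 - E) - S * E) * (cosh r * Uj 0 0 r / sinh r ^ 4) - S * (1 - E) * (cosh r ^ 2 * Uj 0 0 r / sinh r ^ 5)))"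
    proof (rule integral_cong)
      fix r assume "r \<in> {\<rho>..}"
      hence r0: "r > 0" using r by simp
      hence "sinh r \<noteq> 0" by simp
      thus "exp (- 2 * r) * (E - exp (2 * r)) * (E - (exp (2 * r) + 1) / 2) * U_fun r / sinh r ^ 5 = 2 * exp \<alpha> * (C * E * (Uj 0 0 r / sinh r ^ 3) + (C * (1 - E) - S * E) * (cosh r * Uj 0 0 r / sinh r ^ 4) - S * (1 - E) * (cosh r ^ 2 * Uj 0 0 r / sinh r ^ 5))"
        unfolding X3 U_fun_eq[OF r0] sinh_diff C_def[symmetric] S_def[symmetric] using r0 by (simp add: field_simps eval_nat_numeral)
    qed
    also have "\<dots> = 2 * exp \<alpha> * (C * E * (j / sinh \<rho>) + (C * (1 - E) - S * E) * (m / sinh \<rho>) - S * (1 - E) * (k / sinh \<rho>))"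
      by (rule integral_unique) (intro has_integral_mult_right has_integral_add has_integral_diff J' M' Q')
    finally show ?thesis .
  qed
  have Sy: "sinh y = sinh \<rho> * (C - coth \<rho> * S)"
    using sinh_shift(1)[of \<rho> \<alpha>] r by (simp add: \<rho>_def C_def S_def coth_def field_simps)
  have ey: "exp (- y - 4 * \<alpha>) * (E - 1) ^ 2 * (4 * E) = 16 * ((C + S) * (coth \<rho> - 1) * sinh \<rho>) * S^2"
  proof -
    have "exp (- y - 4 * \<alpha>) * (E - 1) ^ 2 * (4 * E) = 16 * (exp \<alpha> * exp (- \<rho>)) * S^2"
      unfolding E_def S_def \<rho>_def sinh_field_def ee exp_minus exp_diff exp_add by (simp add: field_simps power2_eq_square)
    also have "exp \<alpha> * exp (- \<rho>) = (C + S) * (coth \<rho> - 1) * sinh \<rho>"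
      unfolding e\<alpha> using r cosh_minus_sinh[of \<rho>] by (simp add: coth_def field_simps)
    finally show ?thesis .
  qed
  have e3: "exp (- 2 * \<alpha>) * (E - 1) * (2 * exp \<alpha>) = 4 * S"
    unfolding E_def S_def sinh_field_def ee exp_minus by (simp add: field_simps)
  have "P_fun y (3 * \<alpha>) = sinh y ^ 3 / sinh \<rho> ^ 3 * U_fun \<rho>
     + 3 / 4 * (exp (- y - 4 * \<alpha>) * (E - 1) ^ 2 * (4 * E)) * (C^2 * (j / sinh \<rho>) - 2 * C * S * (m / sinh \<rho>) + S^2 * (k / sinh \<rho>))
     + 3 / 2 * sinh y * (exp (- 2 * \<alpha>) * (E - 1) * (2 * exp \<alpha>)) * (C * E * (j / sinh \<rho>) + (C * (1 - E) - S * E) * (m / sinh \<rho>) - S * (1 - E) * (k / sinh \<rho>))"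
  proof -
    have "P_fun y (3 * \<alpha>) = sinh y ^ 3 / sinh \<rho> ^ 3 * U_fun \<rho>
     + 3 / 4 * exp (- y - 4 * \<alpha>) * (E - 1) ^ 2 * integral {\<rho>..} (\<lambda>r. exp (- 2 * r) * (E - exp (2 * r)) ^ 2 * U_fun r / sinh r ^ 5)
     + 3 / 2 * sinh y * exp (- 2 * \<alpha>) * (E - 1) * integral {\<rho>..} (\<lambda>r. exp (- 2 * r) * (E - exp (2 * r)) * (E - (exp (2 * r) + 1) / 2) * U_fun r / sinh r ^ 5)"
      by (simp add: P_fun_def Let_def E_def \<rho>_def)
    thus ?thesis unfolding I2 I3 by (simp only: mult.assoc)
  qed
  also have "\<dots> = (C - coth \<rho> * S) ^ 3 * Uj 0 0 \<rho> + 12 * (C + S) * (coth \<rho> - 1) * S ^ 2 * (C^2 * j - 2 * C * S * m + S^2 * k)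
    + 6 * (C - coth \<rho> * S) * S * (C * E * j + (C * (1 - E) - S * E) * m - S * (1 - E) * k)"
    unfolding ey e3 U_fun_eq[OF r] Sy power_mult_distrib using r
    by (simp add: add_divide_distrib[symmetric] diff_divide_distrib[symmetric]) (simp add: field_simps)
  also have "\<dots> = Uj 0 0 \<rho> * C^3 - 3 * Uj 0 1 \<rho> * C^2 * S + 3 * Uj 0 2 \<rho> * C * S^2 - Uj 0 3 \<rho> * S^3"
    unfolding j_def m_def k_def by (rule P_fun_identity[OF CS E])
  finally show ?thesis .
qed

text \<open>On the mode \<open>cosh s - r sinh s\<close> the three combinations carry the factors \<open>(C - r S)\<^sup>3\<close>, \<open>(C - r S)\<^sup>2 (r C - S)\<close> and
  \<open>(C - r S) (r C - S)\<^sup>2\<close>: a shift by \<open>d\<close> turns multiplication by \<open>r\<close> into multiplication by \<open>(r C - S) / (C - r S)\<close>.\<close>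

lemma Nrel_cubic_shift:
  assumes N: "Nrel a b" "Nrel b e" "Nrel e g" and d: "d \<ge> 0"
  defines "C \<equiv> cosh d" and "S \<equiv> sinh d"
  shows "Nrel (\<lambda>y. a (y + d) * C^3 - 3 * b (y + d) * C^2 * S + 3 * e (y + d) * C * S^2 - g (y + d) * S^3)
     (\<lambda>y. b (y + d) * C^3 - (2 * e (y + d) + a (y + d)) * C^2 * S + (g (y + d) + 2 * b (y + d)) * C * S^2 - e (y + d) * S^3)"
    and "Nrel (\<lambda>y. b (y + d) * C^3 - (2 * e (y + d) + a (y + d)) * C^2 * S + (g (y + d) + 2 * b (y + d)) * C * S^2 - e (y + d) * S^3)
     (\<lambda>y. e (y + d) * C^3 - (2 * b (y + d) + g (y + d)) * C^2 * S + (a (y + d) + 2 * e (y + d)) * C * S^2 - b (y + d) * S^3)"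
proof -
  from N obtain l l' l'' m where l: "(a \<longlongrightarrow> l) at_top" "(b \<longlongrightarrow> l') at_top" "(e \<longlongrightarrow> l'') at_top" "(g \<longlongrightarrow> m) at_top" unfolding Nrel_def by blast
  have tr: "filterlim (\<lambda>y. y + d) at_top at_top" using filterlim_tendsto_add_at_top[OF tendsto_const[of d] filterlim_ident] by (simp add: add.commute)
  note l = l[THEN filterlim_compose, OF tr]
  let ?A = "\<lambda>y. a (y + d) * C^3 - 3 * b (y + d) * C^2 * S + 3 * e (y + d) * C * S^2 - g (y + d) * S^3"
  let ?B = "\<lambda>y. b (y + d) * C^3 - (2 * e (y + d) + a (y + d)) * C^2 * S + (g (y + d) + 2 * b (y + d)) * C * S^2 - e (y + d) * S^3"
  let ?E = "\<lambda>y. e (y + d) * C^3 - (2 * b (y + d) + g (y + d)) * C^2 * S + (a (y + d) + 2 * e (y + d)) * C * S^2 - b (y + d) * S^3"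
  have lim: "\<exists>l. (?A \<longlongrightarrow> l) at_top" "\<exists>l. (?B \<longlongrightarrow> l) at_top" "\<exists>l. (?E \<longlongrightarrow> l) at_top"
    by (rule exI, (rule tendsto_add tendsto_diff tendsto_mult tendsto_const l)+)+
  have main: "\<exists>A B E. (?A has_real_derivative A) (at y) \<and> (?B has_real_derivative B) (at y) \<and> (?E has_real_derivative E) (at y)
      \<and> sinh y * B = cosh y * (A + ?B y) - sinh y * ?A y \<and> sinh y * E = cosh y * (B + ?E y) - sinh y * ?B y" if y: "y > 0" for y
  proof -
    define t where "t = y + d"
    have t: "t > 0" using y d by (simp add: t_def)
    from N(1) t obtain a' b' where d1: "(a has_real_derivative a') (at t)" "(b has_real_derivative b') (at t)"
      and e1: "sinh t * b' = cosh t * (a' + b t) - sinh t * a t" by (rule NrelE)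
    from N(2) t obtain b'' e' where d2: "(b has_real_derivative b'') (at t)" "(e has_real_derivative e') (at t)"
      and e2: "sinh t * e' = cosh t * (b'' + e t) - sinh t * b t" by (rule NrelE)
    from N(3) t obtain e'' g' where d3: "(e has_real_derivative e'') (at t)" "(g has_real_derivative g') (at t)"
      and e3: "sinh t * g' = cosh t * (e'' + g t) - sinh t * e t" by (rule NrelE)
    have b'': "b'' = b'" using d1(2) d2(1) by (rule DERIV_unique[symmetric])
    have e'': "e'' = e'" using d2(2) d3(1) by (rule DERIV_unique[symmetric])
    have dd: "((\<lambda>y. a (y + d)) has_real_derivative a') (at y)" "((\<lambda>y. b (y + d)) has_real_derivative b') (at y)" "((\<lambda>y. e (y + d)) has_real_derivative e') (at y)"
        "((\<lambda>y. g (y + d)) has_real_derivative g') (at y)"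
      using DERIV_shift[of a a' y d] DERIV_shift[of b b' y d] DERIV_shift[of e e' y d] DERIV_shift[of g g' y d] d1 d2 d3 by (simp_all add: t_def)
    let ?A' = "a' * C^3 - 3 * b' * C^2 * S + 3 * e' * C * S^2 - g' * S^3"
    let ?B' = "b' * C^3 - (2 * e' + a') * C^2 * S + (g' + 2 * b') * C * S^2 - e' * S^3"
    let ?E' = "e' * C^3 - (2 * b' + g') * C^2 * S + (a' + 2 * e') * C * S^2 - b' * S^3"
    have D: "(?A has_real_derivative ?A') (at y)" "(?B has_real_derivative ?B') (at y)" "(?E has_real_derivative ?E') (at y)"
      using dd by (auto intro!: derivative_eq_intros simp: algebra_simps)
    have y': "sinh y = sinh t * C - cosh t * S" "cosh y = cosh t * C - sinh t * S"
      using sinh_shift[of t d] by (simp_all add: C_def S_def t_def)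
    \<comment> \<open>Residuals of the three given relations at \<open>t\<close>; each new relation
      has as its residual a combination of these with coefficients in \<open>C\<close> and
      \<open>S\<close>.\<close>
    define r0 where "r0 = sinh t * b' - (cosh t * (a' + b t) - sinh t * a t)"
    define r1 where "r1 = sinh t * e' - (cosh t * (b' + e t) - sinh t * b t)"
    define r2 where "r2 = sinh t * g' - (cosh t * (e' + g t) - sinh t * e t)"
    have r: "r0 = 0" "r1 = 0" "r2 = 0" using e1 e2 e3 unfolding r0_def r1_def r2_def b'' e'' by simp_all
    have "sinh y * ?B' - (cosh y * (?A' + ?B y) - sinh y * ?A y) = (C^2 - S^2) * (C^2 * r0 - 2 * C * S * r1 + S^2 * r2)"
      unfolding y' t_def[symmetric] r0_def r1_def r2_def by (simp add: algebra_simps power2_eq_square power3_eq_cube)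
    hence E1: "sinh y * ?B' = cosh y * (?A' + ?B y) - sinh y * ?A y" by (simp add: r)
    have "sinh y * ?E' - (cosh y * (?B' + ?E y) - sinh y * ?B y) = (C^2 - S^2) * ((C^2 + S^2) * r1 - C * S * (r0 + r2))"
      unfolding y' t_def[symmetric] r0_def r1_def r2_def by (simp add: algebra_simps power2_eq_square power3_eq_cube)
    hence E2: "sinh y * ?E' = cosh y * (?B' + ?E y) - sinh y * ?B y" by (simp add: r)
    show ?thesis
      by (rule exI, rule exI, rule exI, rule conjI[OF D(1) conjI[OF D(2) conjI[OF D(3) conjI[OF E1 E2]]]])
  qed
  show "Nrel ?A ?B" unfolding Nrel_def using main lim by blast
  show "Nrel ?B ?E" unfolding Nrel_def using main lim by blast
qed

text \<open>By the addition theorem, two of the three factors \<open>C - r * S\<close> from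
  \<open>P\<close> merge with the factors at \<open>x\<close> and \<open>x + \<beta>\<close> from
  the operators into modes at \<open>x + \<alpha>\<close> and \<open>x + \<beta> + \<alpha>\<close>.
  The third factor is left over as the fourth mode.\<close>

lemma v_upper_C:
  assumes q: "q $ 1 > 0" "q $ 2 > 0" "q $ 3 > 0" "2 * q $ 1 < q $ 4 - q $ 2"
  defines "\<alpha> \<equiv> (sqrt 2 * (q $ 4 - q $ 2) - 2 * (sqrt 2 * q $ 1)) / 3"
  shows "v_upper q = val (\<lambda>a b. XC 0 0 a b (sqrt 2 * (q $ 2 + q $ 3) + sqrt 2 * q $ 1 + \<alpha>) \<alpha>)
     (sqrt 2 * q $ 1 + \<alpha>) (sqrt 2 * q $ 1 + sqrt 2 * q $ 2 + \<alpha>)"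
proof -
  define y where "y = sqrt 2 * (q $ 2 + q $ 3)"
  define z where "z = sqrt 2 * (q $ 4 - q $ 2)"
  define x where "x = sqrt 2 * q $ 1"
  define \<beta> where "\<beta> = sqrt 2 * q $ 2"
  have y0: "y > 0" and x0: "x > 0" using q by (simp_all add: y_def x_def)
  have "sqrt 2 * (q $ 4 - q $ 2) > sqrt 2 * (2 * q $ 1)" using q by (intro mult_strict_left_mono) auto
  hence zx: "z > 2 * x" by (simp add: x_def z_def)
  have a0: "\<alpha> > 0" "- 2 * (x - z / 2) = 3 * \<alpha>" "\<alpha> \<ge> 0" using zx unfolding \<alpha>_def x_def[symmetric] z_def[symmetric] by (simp_all add: field_simps)
  define C where "C = cosh \<alpha>" define S where "S = sinh \<alpha>"
  note N = Nrel_cubic_shift[OF Nrel_U(1,2,3) a0(3), folded C_def S_def]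
  let ?A = "\<lambda>y. Uj 0 0 (y + \<alpha>) * C^3 - 3 * Uj 0 1 (y + \<alpha>) * C^2 * S + 3 * Uj 0 2 (y + \<alpha>) * C * S^2 - Uj 0 3 (y + \<alpha>) * S^3"
  have phi: "phi_fun (x - z / 2) s = ?A s" if "s > 0" for s
    using P_fun_eq[OF that a0(3)] zx unfolding phi_fun_def a0(2) C_def S_def by simp
  have K: "K_op (2 * x) (phi_fun (x - z / 2)) r = K_op (2 * x) ?A r" if "r > 0" for r
    by (rule K_op_cong[OF phi that]) (use x0 in simp_all)
  have T: "T_op (K_op (2 * x) (phi_fun (x - z / 2))) y = T_op (K_op (2 * x) ?A) y"
    by (rule T_op_cong[OF K y0])
  have q3: "sqrt 2 * q $ 3 = y - \<beta>" by (simp add: y_def \<beta>_def algebra_simps)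
  have mn: "min z (2 * x) = 2 * x" "2 * x / 2 = x" "2 * x \<ge> 0" using zx x0 by simp_all
  have "v_upper q = K_op (2 * x) ?A y * (sinh (y - \<beta>) / sinh y) + T_op (K_op (2 * x) ?A) y * (sinh \<beta> / sinh y)"
    unfolding v_upper_def Let_def F_fun_def R_fun_def y_def[symmetric] z_def[symmetric] x_def[symmetric] \<beta>_def[symmetric] mn(1) q3 K[OF y0] T ..
  also have "\<dots> = val (\<lambda>a b. XC 0 0 a b (y + x + \<alpha>) \<alpha>) (x + \<alpha>) (x + \<beta> + \<alpha>)"
  proof -
    define t where "t = y + x + \<alpha>"
    define u0 where "u0 = Uj 0 0 t" define u1 where "u1 = Uj 0 1 t" define u2 where "u2 = Uj 0 2 t" define u3 where "u3 = Uj 0 3 t"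
    have v: "val (\<lambda>a b. XC 0 0 a b t \<alpha>) (x + \<alpha>) (x + \<beta> + \<alpha>) =
      (C * u0 - S * u1) * cosh (x + \<alpha>) * cosh (x + \<beta> + \<alpha>) - (C * u1 - S * u2) * (cosh (x + \<alpha>) * sinh (x + \<beta> + \<alpha>) + sinh (x + \<alpha>) * cosh (x + \<beta> + \<alpha>))
        + (C * u2 - S * u3) * sinh (x + \<alpha>) * sinh (x + \<beta> + \<alpha>)"
      by (simp add: val_def XC_def sg_def nb_def C_def S_def u0_def u1_def u2_def u3_def algebra_simps eval_nat_numeral)
    show ?thesis unfolding op_chain[OF N y0 mn(3)] mn(2) t_def[symmetric] v u0_def[symmetric] u1_def[symmetric] u2_def[symmetric] u3_def[symmetric]
      unfolding cosh_add[of x \<alpha>] sinh_add[of x \<alpha>] cosh_add[of "x + \<beta>" \<alpha>] sinh_add[of "x + \<beta>" \<alpha>] C_def[symmetric] S_def[symmetric]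
      by (simp add: algebra_simps power2_eq_square power3_eq_cube)
  qed
  finally show ?thesis unfolding y_def x_def \<beta>_def .
qed

section \<open>The regional formulas and their agreement\<close>

text \<open>First order agreement on the interface: at \<open>w = 0\<close> the derivative along the
  reference direction raises the power of \<open>r\<close> by one, just as minus the
  \<open>\<alpha>\<close>-derivative does in the third region at
  \<open>\<alpha> = 0\<close>.\<close>

lemma Eh_eq:
  fixes a b :: bool
  assumes s: "s > 0" and i: "i \<le> 1"
  shows "3/2 * X0 1 i 1 a b s 0 - 1/2 * X0 1 (Suc i) 0 a b s 0 - 1/2 * X0 1 i 0 (\<not> a) b s 0 - 1/2 * X0 1 i 0 a (\<not> b) s 0
    = sg a * sg b * Uj i (Suc (nb a b)) s"
proof -
  have 0: "3/2 * X0 1 0 1 a b s 0 - 1/2 * X0 1 (Suc 0) 0 a b s 0 - 1/2 * X0 1 0 0 (\<not> a) b s 0 - 1/2 * X0 1 0 0 a (\<not> b) s 0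
    = sg a * sg b * Uj 0 (Suc (nb a b)) s" if s: "s > 0" for s
  proof -
    have h: "hU 1 2 s = kk - hU 0 3 s + (kk - kk)" "hU 0 1 s = kk" "hU 1 1 s = 0"
      by (simp_all add: algebra_simps)
    have 1: "hU (Suc 0) 0 s + M1 0 s 0 + 6 * M0 (Suc 0) s 0 = 0" using w0_identity_1[OF s] by (simp del: hU.simps)
    have 2: "7 * M0 2 s 0 + hU 0 2 s - hU 0 0 s - M0 0 s 0 + M1 (Suc 0) s 0 = 0" using w0_identity_2[OF s] by (simp del: hU.simps)
    have 3: "- 8 * M0 3 s 0 + hU (Suc 0) 2 s + 2 * M0 (Suc 0) s 0 - M1 2 s 0 = 0" using w0_identity_3[OF s] by (simp del: hU.simps)
    have h3: "hU (Suc 0) 2 s = kk - hU 0 3 s" "hU 0 (Suc 0) s = kk" "hU (Suc 0) (Suc 0) s = 0" using h by (simp_all del: hU.simps)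
    show ?thesis
      using 1 2 3 h3 by (cases a; cases b) (simp_all add: Xgen_def sg_def nb_def Uj_def numeral_2_eq_2 numeral_3_eq_3 algebra_simps del: hU.simps)
  qed
  show ?thesis
  proof (cases "i = 0")
    case True thus ?thesis using 0[OF s] by simp
  next
    case False
    hence i1: "i = Suc 0" using i by simp
    \<comment> \<open>The case \<open>i = 0\<close> holds on the whole half-line, so it may be
      differentiated to give \<open>i = 1\<close>.\<close>
    have d1: "((\<lambda>s. 3/2 * X0 1 0 1 a b s 0 - 1/2 * X0 1 (Suc 0) 0 a b s 0 - 1/2 * X0 1 0 0 (\<not> a) b s 0 - 1/2 * X0 1 0 0 a (\<not> b) s 0) has_real_derivative
       (3/2 * X0 1 (Suc 0) 1 a b s 0 - 1/2 * X0 1 (Suc (Suc 0)) 0 a b s 0 - 1/2 * X0 1 (Suc 0) 0 (\<not> a) b s 0 - 1/2 * X0 1 (Suc 0) 0 a (\<not> b) s 0)) (at s)"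
      by (intro DERIV_diff DERIV_cmult X0_deriv s) simp_all
    have d2: "((\<lambda>s. sg a * sg b * Uj 0 (Suc (nb a b)) s) has_real_derivative sg a * sg b * Uj (Suc 0) (Suc (nb a b)) s) (at s)"
      by (intro DERIV_cmult Uj_deriv s) simp
    have "((\<lambda>s. 3/2 * X0 1 0 1 a b s 0 - 1/2 * X0 1 (Suc 0) 0 a b s 0 - 1/2 * X0 1 0 0 (\<not> a) b s 0 - 1/2 * X0 1 0 0 a (\<not> b) s 0) has_real_derivative
        sg a * sg b * Uj (Suc 0) (Suc (nb a b)) s) (at s)"
      by (rule has_field_derivative_transform_within_open[OF d2, of "{0<..}"]) (use s 0 in simp_all)
    from DERIV_unique[OF d1 this] show ?thesis unfolding i1 .
  qed
qed

lemma D2c_split: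
  "D2c (- a * (3/2), f0 + a / 2, f1 + a / 2, f2 + a / 2) X p q s w =
    a^2 * D2c (3/2, -1/2, -1/2, -1/2) X p q s w
    - 2 * a * (f2 * (3/2 * X 1 1 p q s w - 1/2 * X 2 0 p q s w - 1/2 * X 1 0 (\<not> p) q s w - 1/2 * X 1 0 p (\<not> q) s w)
       + f0 * (3/2 * X 0 1 (\<not> p) q s w - 1/2 * X 1 0 (\<not> p) q s w - 1/2 * X 0 0 p q s w - 1/2 * X 0 0 (\<not> p) (\<not> q) s w)
       + f1 * (3/2 * X 0 1 p (\<not> q) s w - 1/2 * X 1 0 p (\<not> q) s w - 1/2 * X 0 0 (\<not> p) (\<not> q) s w - 1/2 * X 0 0 p q s w))
    + D2c (0, f0, f1, f2) X p q s w"
  by (simp add: D2c_def power2_eq_square field_simps)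

text \<open>The direction is split into a multiple of the reference direction and a part tangential
  to the interface. The pure second derivative agrees by \<open>dfc_h_zero\<close>, the mixed ones
  by \<open>Eh_eq\<close>, and the tangential one because the coefficients coincide at
  \<open>w = 0\<close>.\<close>

lemma D2c_AC: assumes s: "s > 0"
  shows "D2c (- a * (3/2), f0 + a / 2, f1 + a / 2, f2 + a / 2) (X0 1) p q s 0 = D2c (a, f0, f1, f2) XC p q s 0"
proof -
  have h: "D2c (3/2, -1/2, -1/2, -1/2) (X0 1) p q s 0 = X0 1 0 0 p q s 0"
    using dfc_h_zero[OF s, of p q] unfolding dfc_D2c by simp
  have XX: "X0 1 i 0 p q s 0 = XC i 0 p q s 0" for i p q by (simp add: Xgen_def XC_def Uj_def algebra_simps)
  have e1: "3/2 * X0 1 1 1 p q s 0 - 1/2 * X0 1 2 0 p q s 0 - 1/2 * X0 1 1 0 (\<not> p) q s 0 - 1/2 * X0 1 1 0 p (\<not> q) s 0 = - XC 1 1 p q s 0"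
    using Eh_eq[OF s, of 1 p q] by (simp add: XC_def numeral_2_eq_2)
  have e0: "3/2 * X0 1 0 1 p q s 0 - 1/2 * X0 1 1 0 p q s 0 - 1/2 * X0 1 0 0 (\<not> p) q s 0 - 1/2 * X0 1 0 0 p (\<not> q) s 0 = - XC 0 1 p q s 0" for p q
    using Eh_eq[OF s, of 0 p q] by (simp add: XC_def)
  have c2: "XC 0 2 p q s 0 = XC 0 0 p q s 0" by (simp add: XC_def)
  have "D2c (- a * (3/2), f0 + a / 2, f1 + a / 2, f2 + a / 2) (X0 1) p q s 0 =
    a^2 * XC 0 0 p q s 0 - 2 * a * (f2 * (- XC 1 1 p q s 0) + f0 * (- XC 0 1 (\<not> p) q s 0) + f1 * (- XC 0 1 p (\<not> q) s 0)) + D2c (0, f0, f1, f2) (X0 1) p q s 0"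
    unfolding D2c_split h e1 using e0[of "\<not> p" q] e0[of p "\<not> q"] by (simp add: XX)
  also have "D2c (0, f0, f1, f2) (X0 1) p q s 0 = D2c (0, f0, f1, f2) XC p q s 0"
    by (simp add: D2c_def XX)
  also have "a^2 * XC 0 0 p q s 0 - 2 * a * (f2 * (- XC 1 1 p q s 0) + f0 * (- XC 0 1 (\<not> p) q s 0) + f1 * (- XC 0 1 p (\<not> q) s 0)) + D2c (0, f0, f1, f2) XC p q s 0
     = D2c (a, f0, f1, f2) XC p q s 0"
    by (simp add: D2c_def c2 algebra_simps power2_eq_square)
  finally show ?thesis .
qed

text \<open>On \<open>q2 = q4\<close> both versions of \<open>s0\<close> vanish, so only
  coefficients of \<open>cosh s0\<close> count, hence \<open>False\<close>. Passing to the other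
  chart reverses \<open>e0\<close> and changes the \<open>w\<close>-component by \<open>e0\<close>;
  the elementary sign \<open>\<tau>\<close> compensates the reversal.\<close>

lemma D2c_AB: "D2c (ew - e0, e0, e1, e2) (X0 1) False b s w = D2c (ew, - e0, e1, e2) (X0 (-1)) False b s w"
  by (cases b) (simp_all add: D2c_def Xgen_def sg_def nb_def algebra_simps power2_eq_square eval_nat_numeral del: hU.simps MM.simps)

section \<open>Linear coordinates and the three charts\<close>

definition cval where
  "cval X lw l0 l1 ls q = val (\<lambda>a b. X 0 0 a b (ls q) (lw q)) (l0 q) (l1 q)"

definition cval2 where
  "cval2 X lw l0 l1 ls d q = val (\<lambda>a b. D2c (lw d, l0 d, l1 d, ls d) X a b (ls q) (lw q)) (l0 q) (l1 q)"

definition wA :: "real^4 \<Rightarrow> real" where "wA q = sqrt 2 * q $ 1 - sqrt 2 * (q $ 4 - q $ 2) / 2"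
definition wB :: "real^4 \<Rightarrow> real" where "wB q = sqrt 2 * q $ 1"
definition t0A :: "real^4 \<Rightarrow> real" where "t0A q = sqrt 2 * (q $ 4 - q $ 2) / 2"
definition t0B :: "real^4 \<Rightarrow> real" where "t0B q = sqrt 2 * (q $ 2 - q $ 4) / 2"
text \<open>\<open>t1\<close> and \<open>t2\<close> are symmetric in \<open>q2\<close> and
  \<open>q4\<close> and therefore serve both charts; \<open>t2\<close> is \<open>y + z / 2\<close>
  in either branch.\<close>

definition t1 :: "real^4 \<Rightarrow> real" where "t1 q = sqrt 2 * (q $ 2 + q $ 4) / 2"
definition t2 :: "real^4 \<Rightarrow> real" where "t2 q = sqrt 2 * (q $ 2 + q $ 4) / 2 + sqrt 2 * q $ 3"
definition al :: "real^4 \<Rightarrow> real" where "al q = (sqrt 2 * (q $ 4 - q $ 2) - 2 * (sqrt 2 * q $ 1)) / 3"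
definition r0 :: "real^4 \<Rightarrow> real" where "r0 q = sqrt 2 * q $ 1 + al q"
definition r1 :: "real^4 \<Rightarrow> real" where "r1 q = sqrt 2 * q $ 1 + sqrt 2 * q $ 2 + al q"
definition r2 :: "real^4 \<Rightarrow> real" where "r2 q = sqrt 2 * (q $ 2 + q $ 3) + sqrt 2 * q $ 1 + al q"

lemmas forms_def = wA_def wB_def t0A_def t0B_def t1_def t2_def al_def r0_def r1_def r2_def

lemma forms_linear: "bounded_linear wA" "bounded_linear wB" "bounded_linear t0A" "bounded_linear t0B" "bounded_linear t1" "bounded_linear t2"
  "bounded_linear al" "bounded_linear r0" "bounded_linear r1" "bounded_linear r2"
  unfolding linear_conv_bounded_linear[symmetric]
  by (rule linearI; simp add: forms_def field_simps)+

abbreviation "VA \<equiv> cval (X0 1) wA t0A t1 t2"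
abbreviation "VB \<equiv> cval (X0 (-1)) wB t0B t1 t2"
abbreviation "VC \<equiv> cval XC al r0 r1 r2"
abbreviation "EA \<equiv> cval2 (X0 1) wA t0A t1 t2"
abbreviation "EB \<equiv> cval2 (X0 (-1)) wB t0B t1 t2"
abbreviation "EC \<equiv> cval2 XC al r0 r1 r2"

lemma V_cont: "t2 q > 0 \<Longrightarrow> isCont VA q" "t2 q > 0 \<Longrightarrow> isCont VB q" "r2 q > 0 \<Longrightarrow> isCont VC q"
  "t2 q > 0 \<Longrightarrow> isCont (EA d) q" "t2 q > 0 \<Longrightarrow> isCont (EB d) q" "r2 q > 0 \<Longrightarrow> isCont (EC d) q"
  unfolding cval_def[abs_def] cval2_def[abs_def]
  by (intro val_cont jets_X0 jets_XC forms_linear; assumption)+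

lemma AB_agree: assumes "q $ 2 = q $ 4" shows "VA q = VB q" "EA d q = EB d q"
proof -
  have l: "wA q = wB q" "t0A q = 0" "t0B q = 0" using assms by (simp_all add: forms_def)
  show "VA q = VB q" by (simp add: cval_def val_def l Xgen_def sg_def nb_def)
  have e: "wA d = wB d - t0A d" "t0B d = - t0A d" by (simp_all add: forms_def field_simps)
  show "EA d q = EB d q" by (simp add: cval2_def val_def l e D2c_AB)
qed

lemma AC_agree: assumes "2 * q $ 1 = q $ 4 - q $ 2" "t2 q > 0" shows "VA q = VC q" "EA d q = EC d q"
proof -
  have "q $ 4 = q $ 2 + 2 * q $ 1" using assms(1) by simp
  hence l: "al q = 0" "wA q = 0" "r0 q = t0A q" "r1 q = t1 q" "r2 q = t2 q" by (simp_all add: forms_def field_simps)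
  show "VA q = VC q" by (simp add: cval_def val_def l XC_def Xgen_def Uj_def)
  have e: "wA d = - al d * (3/2)" "t0A d = r0 d + al d / 2" "t1 d = r1 d + al d / 2" "t2 d = r2 d + al d / 2"
    by (simp_all add: forms_def field_simps)
  show "EA d q = EC d q" unfolding cval2_def l e D2c_AC[OF assms(2)] ..
qed

section \<open>The candidate and its second derivatives on the open regions\<close>

definition OA :: "(real^4) set" where "OA = {q \<in> open_orthant. q $ 4 > q $ 2 \<and> 2 * q $ 1 > q $ 4 - q $ 2}"
definition OB :: "(real^4) set" where "OB = {q \<in> open_orthant. q $ 4 < q $ 2}"
definition OC :: "(real^4) set" where "OC = {q \<in> open_orthant. q $ 4 - q $ 2 > 2 * q $ 1}"

lemma orthant_pos: "q \<in> open_orthant \<longleftrightarrow> q $ 1 > 0 \<and> q $ 2 > 0 \<and> q $ 3 > 0 \<and> q $ 4 > 0"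
  by (simp add: open_orthant_def forall_4)

lemma closed_orthant_iff: "q \<in> closed_orthant \<longleftrightarrow> q $ 1 \<ge> 0 \<and> q $ 2 \<ge> 0 \<and> q $ 3 \<ge> 0 \<and> q $ 4 \<ge> 0"
  by (simp add: closed_orthant_def forall_4)

lemma regular_split: "regular_points = OA \<union> OB \<union> OC"
  unfolding regular_points_def OA_def OB_def OC_def by (auto simp: orthant_pos)

lemma open_O: "open OA" "open OB" "open OC"
  unfolding OA_def OB_def OC_def orthant_pos mem_Collect_eq Collect_conj_eq[symmetric]
  by (auto intro!: open_Collect_conj open_Collect_less continuous_intros)

lemma v_formula_A: assumes "q \<in> closed_orthant" "q $ 4 \<ge> q $ 2" "2 * q $ 1 \<ge> q $ 4 - q $ 2" "q $ 2 + q $ 3 > 0"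
  shows "v_formula q = VA q"
  using v_upper_A[OF assms(2-4)] assms(2) by (simp add: v_formula_def cval_def forms_def field_simps)

lemma v_formula_B: assumes "q \<in> closed_orthant" "q $ 4 \<le> q $ 2" "q $ 3 + q $ 4 > 0"
  shows "v_formula q = VB q"
proof (cases "q $ 4 = q $ 2")
  case True
  have "v_formula q = VA q" by (rule v_formula_A) (use assms True in \<open>auto simp: closed_orthant_iff\<close>)
  thus ?thesis using AB_agree(1)[of q] True by simp
next
  case False
  thus ?thesis using v_lower_B[OF assms(2,3)] assms(2) by (simp add: v_formula_def cval_def forms_def field_simps)
qed

lemma v_formula_C: assumes "q \<in> OC" shows "v_formula q = VC q"
  using v_upper_C[of q] assms by (simp add: v_formula_def cval_def forms_def OC_def orthant_pos)

lemma v_cand_orthant: "q \<in> open_orthant \<Longrightarrow> v_cand q = v_formula q"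
  by (auto simp: v_cand_def orthant_pos min_def)

lemma v_cand_regions: "q \<in> OA \<Longrightarrow> v_cand q = VA q" "q \<in> OB \<Longrightarrow> v_cand q = VB q" "q \<in> OC \<Longrightarrow> v_cand q = VC q"
proof -
  assume "q \<in> OA" thus "v_cand q = VA q" using v_formula_A[of q] v_cand_orthant[of q] by (auto simp: OA_def orthant_pos closed_orthant_iff)
next
  assume "q \<in> OB" thus "v_cand q = VB q" using v_formula_B[of q] v_cand_orthant[of q] by (auto simp: OB_def orthant_pos closed_orthant_iff)
next
  assume "q \<in> OC" thus "v_cand q = VC q" using v_formula_C[of q] v_cand_orthant[of q] by (auto simp: OC_def)
qed

lemma second_deriv_chart:
  assumes "open R" "q \<in> R" "\<And>q. q \<in> R \<Longrightarrow> f q = cval X lw l0 l1 ls q" "\<And>q. q \<in> R \<Longrightarrow> ls q > 0"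
    and j: "jets X" "bounded_linear lw" "bounded_linear l0" "bounded_linear l1" "bounded_linear ls"
  shows "dir_deriv d (dir_deriv d f) q = cval2 X lw l0 l1 ls d q"
proof -
  have 1: "dir_deriv d f p = val (\<lambda>a b. D1c (lw d, l0 d, l1 d, ls d) X a b (ls p) (lw p)) (l0 p) (l1 p)" if p: "p \<in> R" for p
    by (rule dir_deriv_eqI[OF assms(1) p assms(3)[unfolded cval_def] val_D1[OF j assms(4)[OF p]]])
  obtain D where D: "((\<lambda>q. val (\<lambda>a b. D1c (lw d, l0 d, l1 d, ls d) X a b (ls q) (lw q)) (l0 q) (l1 q)) has_derivative D) (at q)"
    "D d = val (\<lambda>a b. D2c (lw d, l0 d, l1 d, ls d) X a b (ls q) (lw q)) (l0 q) (l1 q)"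
    using val_D2[OF j assms(4)[OF assms(2)], of d] by blast
  show ?thesis unfolding cval2_def D(2)[symmetric] by (rule dir_deriv_eqI[OF assms(1,2) 1 D(1)])
qed

lemma forms_pos: "q \<in> open_orthant \<Longrightarrow> t2 q > 0" "q \<in> OC \<Longrightarrow> r2 q > 0"
proof -
  assume "q \<in> open_orthant" thus "t2 q > 0" by (simp add: t2_def orthant_pos add_pos_pos)
next
  assume q: "q \<in> OC"
  hence "sqrt 2 * (q $ 4 - q $ 2) > sqrt 2 * (2 * q $ 1)" by (intro mult_strict_left_mono) (auto simp: OC_def)
  hence "al q > 0" by (simp add: al_def)
  thus "r2 q > 0" using q by (auto simp: r2_def OC_def orthant_pos intro!: add_pos_pos)
qed

lemma dd_regions: "q \<in> OA \<Longrightarrow> dir_deriv d (dir_deriv d v_cand) q = EA d q" "q \<in> OB \<Longrightarrow> dir_deriv d (dir_deriv d v_cand) q = EB d q"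
  "q \<in> OC \<Longrightarrow> dir_deriv d (dir_deriv d v_cand) q = EC d q"
proof -
  assume "q \<in> OA" thus "dir_deriv d (dir_deriv d v_cand) q = EA d q"
    by (intro second_deriv_chart[OF open_O(1)] v_cand_regions forms_linear jets_X0 forms_pos) (simp_all add: OA_def)
next
  assume "q \<in> OB" thus "dir_deriv d (dir_deriv d v_cand) q = EB d q"
    by (intro second_deriv_chart[OF open_O(2)] v_cand_regions forms_linear jets_X0 forms_pos) (simp_all add: OB_def)
next
  assume "q \<in> OC" thus "dir_deriv d (dir_deriv d v_cand) q = EC d q"
    by (intro second_deriv_chart[OF open_O(3)] v_cand_regions forms_linear jets_XC forms_pos)
qed

section \<open>Limits at the vertex\<close>

lemma mom_diff: assumes "1 \<le> x" "x \<le> X" shows "mom n X w - mom n x w = integral {x..X} (wgt n w)" "wgt n w integrable_on {x..X}"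
proof -
  show i: "wgt n w integrable_on {x..X}" by (rule integrable_on_subinterval[OF wgt_integrable[of n w X]]) (use assms in auto)
  show "mom n X w - mom n x w = integral {x..X} (wgt n w)"
    using Henstock_Kurzweil_Integration.integral_combine[OF assms wgt_integrable, of n w] unfolding mom_def by linarith
qed

lemma wgt_nonneg: "r \<ge> 1 \<Longrightarrow> wgt n w r \<ge> 0" by (simp add: wgt_def dens_nonneg)

text \<open>The tail is bounded independently of \<open>w \<ge> 0\<close> and of
  \<open>n \<le> 2\<close>. This uniformity allows \<open>s\<close> and \<open>w\<close> to move
  simultaneously in the limit.\<close>

lemma mom_tail: assumes "1 \<le> x" "x \<le> X" "w \<ge> 0" "n \<le> 2"
  shows "0 \<le> mom n X w - mom n x w" "mom n X w - mom n x w \<le> mom 2 X 0 - mom 2 x 0"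
proof -
  show "0 \<le> mom n X w - mom n x w" unfolding mom_diff(1)[OF assms(1,2)]
    by (rule integral_nonneg[OF mom_diff(2)[OF assms(1,2)]]) (use assms wgt_nonneg in auto)
  show "mom n X w - mom n x w \<le> mom 2 X 0 - mom 2 x 0" unfolding mom_diff(1)[OF assms(1,2)]
  proof (rule integral_le[OF mom_diff(2)[OF assms(1,2)] mom_diff(2)[OF assms(1,2)]])
    fix r assume "r \<in> {x..X}"
    hence r: "r \<ge> 1" using assms by simp
    have "r ^ n \<le> r ^ 2" using r assms(4) by (intro power_increasing)
    moreover have "exp (- 2 * w * r) \<le> 1" using r assms(3) by simp
    ultimately have "r ^ n * (exp (- 2 * w * r) * dens r) \<le> r ^ 2 * (1 * dens r)"
      using r dens_nonneg[OF r] by (intro mult_mono mult_right_mono) auto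
    thus "wgt n w r \<le> wgt 2 0 r" by (simp add: wgt_def)
  qed
qed

lemma mom_power: assumes "1 \<le> X" shows "mom (n + j) X w \<le> X ^ j * mom n X w"
proof -
  have 1: "((\<lambda>r. X ^ j * wgt n w r) has_integral X ^ j * mom n X w) {1..X}"
    unfolding mom_def by (intro has_integral_mult_right integrable_integral wgt_integrable)
  have 2: "(wgt (n + j) w has_integral mom (n + j) X w) {1..X}"
    unfolding mom_def by (intro integrable_integral wgt_integrable)
  show ?thesis
    by (rule has_integral_le[OF 2 1]) (auto simp: wgt_shift intro!: mult_right_mono power_mono wgt_nonneg)
qed

text \<open>The third moment is unbounded, but after multiplication by \<open>sinh s\<close> with
  \<open>X = coth s\<close> the first term tends to 0 for fixed \<open>x\<close> and the second is a
  small tail times \<open>cosh s\<close>.\<close>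

lemma mom3_split: assumes "1 \<le> x" "x \<le> X" shows "mom 3 X 0 \<le> x * mom 2 x 0 + X * (mom 2 X 0 - mom 2 x 0)"
proof -
  have "mom 3 X 0 - mom 3 x 0 \<le> X * (mom 2 X 0 - mom 2 x 0)"
    unfolding mom_diff(1)[OF assms]
  proof (rule has_integral_le[OF integrable_integral[OF mom_diff(2)[OF assms]] has_integral_mult_right[OF integrable_integral[OF mom_diff(2)[OF assms]]]])
    fix r assume "r \<in> {x..X}"
    thus "wgt 3 0 r \<le> X * wgt 2 0 r" using wgt_shift[of 2 1 0 r] wgt_nonneg[of r 2 0] assms by (auto intro!: mult_right_mono)
  qed
  moreover have "mom 3 x 0 \<le> x * mom 2 x 0" using mom_power[OF assms(1), of 2 1 0] by simp
  ultimately show ?thesis by simp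
qed

lemma mom2_bounded: "mom 2 x 0 \<le> (LINT r:{1<..}|lborel. kk / 4 * dmaj r)"
proof -
  have i: "set_integrable lborel {1<..} (\<lambda>r. kk / 4 * dmaj r)" using dmaj_integrable by (rule set_integrable_mult_right)
  have "mom 2 x 0 = (LINT r|lborel. indicator {1..x} r *\<^sub>R wgt 2 0 r)" by (simp add: mom_eq_LINT set_lebesgue_integral_def)
  also have "\<dots> \<le> (LINT r|lborel. indicator {1<..} r *\<^sub>R (kk / 4 * dmaj r))"
  proof (rule integral_mono)
    show "integrable lborel (\<lambda>r. indicator {1..x} r *\<^sub>R wgt 2 0 r)" using wgt_set_integrable[of x 2 0] by (simp add: set_integrable_def)
    show "integrable lborel (\<lambda>r. indicator {1<..} r *\<^sub>R (kk / 4 * dmaj r))" using i by (simp add: set_integrable_def)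
    fix r :: real
    show "indicator {1..x} r *\<^sub>R wgt 2 0 r \<le> indicator {1<..} r *\<^sub>R (kk / 4 * dmaj r)"
      using dens_bounds(2)[of r] dmaj_nonneg[of r] kk_pos dens_1
      by (cases "r = 1") (auto simp: indicator_def wgt_def)
  qed
  finally show ?thesis unfolding set_lebesgue_integral_def .
qed

lemma mom_tail_small: assumes "e > 0"
  shows "\<exists>x\<ge>2. \<forall>X\<ge>x. mom 2 X 0 - mom 2 x 0 < e"
proof -
  let ?f = "\<lambda>x. mom 2 x 0"
  have bdd: "bdd_above (range ?f)" by (rule bdd_aboveI2[OF mom2_bounded])
  obtain y where y: "(SUP x. ?f x) - e < ?f y"
    using less_cSUP_iff[OF _ bdd, of "(SUP x. ?f x) - e"] assms by auto
  define x where "x = max 2 y"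
  have "?f y \<le> ?f x"
  proof (cases "y \<ge> 1")
    case True thus ?thesis using mom_tail(1)[of y x 0 2] by (simp add: x_def)
  next
    case False hence "{1..y} = {}" by simp
    hence "?f y = 0" by (simp add: mom_def)
    thus ?thesis using mom_nonneg[of 2 x 0] by simp
  qed
  hence "?f X - ?f x < e" for X using y cSUP_upper[OF UNIV_I bdd, of X] by simp
  thus ?thesis by (intro exI[of _ x]) (simp add: x_def)
qed

text \<open>The moment over all of \<open>[1, \<infinity>)\<close>, meaningful for
  \<open>n \<le> 2\<close> and \<open>w \<ge> 0\<close>.\<close>

definition minf :: "nat \<Rightarrow> real \<Rightarrow> real" where "minf n w = lim (\<lambda>k. mom n (real k) w)"

lemma minf_bounds: assumes x: "x \<ge> 2" "\<And>X. X \<ge> x \<Longrightarrow> mom 2 X 0 - mom 2 x 0 < e" and n: "n \<le> 2" and w: "w \<ge> 0"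
  shows "\<bar>mom n x w - minf n w\<bar> \<le> e"
proof -
  have b: "0 \<le> mom n X w - mom n x w" "mom n X w - mom n x w \<le> mom 2 X 0 - mom 2 x 0" if "x \<ge> 2" "X \<ge> x" for x X
    using mom_tail[of x X w n] that n w by auto
  have "Cauchy (\<lambda>k. mom n (real k) w)"
  proof (rule metric_CauchyI)
    fix \<epsilon> :: real assume "\<epsilon> > 0"
    from mom_tail_small[OF this] obtain y where y: "y \<ge> 2" "\<And>X. X \<ge> y \<Longrightarrow> mom 2 X 0 - mom 2 y 0 < \<epsilon>" by blast
    show "\<exists>M. \<forall>m\<ge>M. \<forall>n'\<ge>M. dist (mom n (real m) w) (mom n (real n') w) < \<epsilon>"
    proof (intro exI[of _ "nat \<lceil>y\<rceil>"] allI impI)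
      fix m k assume "m \<ge> nat \<lceil>y\<rceil>" "k \<ge> nat \<lceil>y\<rceil>"
      hence "y \<le> real m" "y \<le> real k" by linarith+
      from b[OF y(1) this(1)] b[OF y(1) this(2)] y(2)[OF this(1)] y(2)[OF this(2)]
      show "dist (mom n (real m) w) (mom n (real k) w) < \<epsilon>" by (simp add: dist_real_def)
    qed
  qed
  hence l: "(\<lambda>k. mom n (real k) w) \<longlonglongrightarrow> minf n w"
    unfolding minf_def by (simp add: Cauchy_convergent convergent_LIMSEQ_iff[symmetric])
  have k: "x \<le> real k" if "k \<ge> nat \<lceil>x\<rceil>" for k using that by linarith
  have "minf n w \<le> mom n x w + e"
    by (rule LIMSEQ_le_const2[OF l], rule exI[of _ "nat \<lceil>x\<rceil>"]) (use b[OF x(1)] x(2) k in fastforce)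
  moreover have "mom n x w \<le> minf n w"
    by (rule LIMSEQ_le_const[OF l], rule exI[of _ "nat \<lceil>x\<rceil>"]) (use b[OF x(1)] k in fastforce)
  ultimately show ?thesis by simp
qed

text \<open>The filter is arbitrary: the locale serves the approach within each region separately
  and also the one-dimensional limit \<open>s \<longlonglongrightarrow> 0\<close> that yields
  \<open>minf_relation\<close>.\<close>

locale vertex =
  fixes F :: "'a filter" and s w :: "'a \<Rightarrow> real" and w0 :: real
  assumes s_lim: "(s \<longlongrightarrow> 0) F" and s_pos: "eventually (\<lambda>q. s q > 0) F"
    and w_lim: "(w \<longlongrightarrow> w0) F" and w_nonneg: "eventually (\<lambda>q. w q \<ge> 0) F" and w0: "w0 \<ge> 0"
begin

lemma sh: "((\<lambda>q. sinh (s q)) \<longlongrightarrow> 0) F" "((\<lambda>q. cosh (s q)) \<longlongrightarrow> 1) F"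
  using isCont_tendsto_compose[OF DERIV_isCont[OF dsinh] s_lim] isCont_tendsto_compose[OF DERIV_isCont[OF dcosh] s_lim] by simp_all

lemma s_right: "filterlim s (at_right 0) F"
  using s_lim s_pos by (simp add: tendsto_imp_filterlim_at_right)

lemma shpow: "((\<lambda>q. sinh (s q) ^ m) \<longlongrightarrow> (if m = 0 then 1 else 0)) F"
  using tendsto_power[OF sh(1), of m] by (simp only: power_0_left)

lemma coth_large: "eventually (\<lambda>q. coth (s q) \<ge> x) F"
proof -
  have "eventually (\<lambda>q. sinh (s q) < 1 / (\<bar>x\<bar> + 1)) F" by (rule order_tendstoD(2)[OF sh(1)]) simp
  thus ?thesis using s_pos
  proof eventually_elim
    case (elim q)
    have "sinh (s q) * (\<bar>x\<bar> + 1) < 1" using elim by (simp add: field_simps)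
    hence "(\<bar>x\<bar> + 1) * sinh (s q) \<le> cosh (s q)" using cosh_real_ge_1[of "s q"] by (simp add: mult.commute)
    hence "\<bar>x\<bar> + 1 \<le> coth (s q)" using elim by (simp add: coth_def pos_le_divide_eq)
    thus ?case by simp
  qed
qed

lemma mom_conv: assumes n: "n \<le> 2" shows "((\<lambda>q. mom n (coth (s q)) (w q)) \<longlongrightarrow> minf n w0) F"
proof (rule tendstoI)
  fix e :: real assume e: "e > 0"
  hence "e / 4 > 0" by simp
  from mom_tail_small[OF this] obtain x where x: "x \<ge> 2" "\<And>X. X \<ge> x \<Longrightarrow> mom 2 X 0 - mom 2 x 0 < e / 4" by blast
  have "isCont (\<lambda>w. mom n x w) w0" by (rule DERIV_isCont[OF mom_deriv_w]) (use x in simp)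
  from isCont_tendsto_compose[OF this w_lim] have "((\<lambda>q. mom n x (w q)) \<longlongrightarrow> mom n x w0) F" .
  hence "eventually (\<lambda>q. dist (mom n x (w q)) (mom n x w0) < e / 4) F" by (rule tendstoD) (use e in simp)
  thus "eventually (\<lambda>q. dist (mom n (coth (s q)) (w q)) (minf n w0) < e) F"
    using coth_large[of x] w_nonneg
  proof eventually_elim
    case (elim q)
    have "\<bar>mom n x w0 - minf n w0\<bar> \<le> e / 4" by (rule minf_bounds[OF x n w0])
    moreover have "0 \<le> mom n (coth (s q)) (w q) - mom n x (w q)" "mom n (coth (s q)) (w q) - mom n x (w q) \<le> mom 2 (coth (s q)) 0 - mom 2 x 0"
      using mom_tail[of x "coth (s q)" "w q" n] elim n x(1) by auto
    ultimately show ?case using x(2)[OF elim(2)] elim(1) unfolding dist_real_def by linarith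
  qed
qed

lemma mom3_zero: "((\<lambda>q. sinh (s q) * mom 3 (coth (s q)) 0) \<longlongrightarrow> 0) F"
proof (rule tendstoI)
  fix e :: real assume e: "e > 0"
  hence "e / 4 > 0" by simp
  from mom_tail_small[OF this] obtain x where x: "x \<ge> 2" "\<And>X. X \<ge> x \<Longrightarrow> mom 2 X 0 - mom 2 x 0 < e / 4" by blast
  have "((\<lambda>q. sinh (s q) * (x * mom 2 x 0)) \<longlongrightarrow> 0 * (x * mom 2 x 0)) F" by (intro tendsto_intros sh)
  hence "eventually (\<lambda>q. sinh (s q) * (x * mom 2 x 0) < e / 2) F" using order_tendstoD(2)[of _ 0 F "e / 2"] e by simp
  moreover have "eventually (\<lambda>q. cosh (s q) < 2) F" by (rule order_tendstoD(2)[OF sh(2)]) simp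
  ultimately show "eventually (\<lambda>q. dist (sinh (s q) * mom 3 (coth (s q)) 0) 0 < e) F"
    using coth_large[of x] s_pos
  proof eventually_elim
    case (elim q)
    let ?X = "coth (s q)"
    have S: "sinh (s q) > 0" using elim by simp
    have SX: "sinh (s q) * ?X = cosh (s q)" using S by (simp add: coth_def)
    have m: "0 \<le> mom 2 ?X 0 - mom 2 x 0" using mom_tail(1)[of x ?X 0 2] elim x by simp
    have "sinh (s q) * mom 3 ?X 0 \<le> sinh (s q) * (x * mom 2 x 0 + ?X * (mom 2 ?X 0 - mom 2 x 0))"
      using mom3_split[of x ?X] elim x(1) S by (intro mult_left_mono) auto
    also have "\<dots> = sinh (s q) * (x * mom 2 x 0) + cosh (s q) * (mom 2 ?X 0 - mom 2 x 0)"
      unfolding SX[symmetric] by (simp add: algebra_simps)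
    also have "\<dots> < e / 2 + 2 * (e / 4)"
      using elim(1,2) x(2)[OF elim(3)] m by (intro add_less_le_mono mult_mono) auto
    finally have "sinh (s q) * mom 3 ?X 0 < e" by simp
    moreover have "sinh (s q) * mom 3 ?X 0 \<ge> 0" using S mom_nonneg[of 3 ?X 0] by simp
    ultimately show ?case by (simp add: dist_real_def)
  qed
qed

text \<open>For \<open>n \<ge> 3\<close> the moment is at most
  \<open>coth s ^ (n - 3) * mom 3\<close>. The powers of \<open>coth\<close> use up
  \<open>n - 3\<close> factors \<open>sinh s\<close>, and one further factor absorbs the growth of
  the third moment.\<close>

lemma mom_zero: assumes m: "m \<ge> 1" "n \<le> m + 2" shows "((\<lambda>q. sinh (s q) ^ m * mom n (coth (s q)) (w q)) \<longlongrightarrow> 0) F"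
proof (cases "n \<le> 2")
  case True
  from tendsto_mult[OF shpow[of m] mom_conv[OF True]] show ?thesis using m by simp
next
  case False
  define j where "j = n - 3"
  have n: "n = 3 + j" "m = (m - 1 - j) + j + 1" using False m by (auto simp: j_def)
  have b: "eventually (\<lambda>q. norm (sinh (s q) ^ m * mom n (coth (s q)) (w q)) \<le> sinh (s q) ^ (m - 1 - j) * cosh (s q) ^ j * (sinh (s q) * mom 3 (coth (s q)) 0)) F"
    using s_pos w_nonneg
  proof eventually_elim
    case (elim q)
    let ?X = "coth (s q)"
    have S: "sinh (s q) > 0" using elim by simp
    have SX: "sinh (s q) ^ j * ?X ^ j = cosh (s q) ^ j" using S by (simp add: coth_def power_divide)
    have "mom n ?X (w q) \<le> ?X ^ j * mom 3 ?X (w q)" unfolding n(1) using coth_gt1[OF elim(1)] by (intro mom_power) simp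
    also have "\<dots> \<le> ?X ^ j * mom 3 ?X 0" using mom_mono_w[OF elim(2)] coth_gt1[OF elim(1)] by (intro mult_left_mono) auto
    finally have "sinh (s q) ^ m * mom n ?X (w q) \<le> sinh (s q) ^ m * (?X ^ j * mom 3 ?X 0)" using S by (intro mult_left_mono) auto
    also have "\<dots> = sinh (s q) ^ (m - 1 - j) * (sinh (s q) ^ j * ?X ^ j) * (sinh (s q) * mom 3 ?X 0)"
    proof -
      have "sinh (s q) ^ m = sinh (s q) ^ (m - 1 - j) * sinh (s q) ^ j * sinh (s q)" by (subst n(2)) (simp add: power_add)
      thus ?thesis by simp
    qed
    finally have "sinh (s q) ^ m * mom n ?X (w q) \<le> sinh (s q) ^ (m - 1 - j) * (sinh (s q) ^ j * ?X ^ j) * (sinh (s q) * mom 3 ?X 0)" by simp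
    thus ?case unfolding SX using S mom_nonneg[of n ?X "w q"] by (simp add: abs_mult)
  qed
  have "((\<lambda>q. sinh (s q) ^ (m - 1 - j) * cosh (s q) ^ j * (sinh (s q) * mom 3 (coth (s q)) 0)) \<longlongrightarrow> (if m - 1 - j = 0 then 1 else 0) * 1 ^ j * 0) F"
    by (intro tendsto_mult shpow tendsto_power sh mom3_zero)
  hence "((\<lambda>q. sinh (s q) ^ (m - 1 - j) * cosh (s q) ^ j * (sinh (s q) * mom 3 (coth (s q)) 0)) \<longlongrightarrow> 0) F" by simp
  thus ?thesis by (rule Lim_null_comparison[OF b])
qed

lemma M0_conv: assumes "n \<le> 2" shows "((\<lambda>q. M0 n (s q) (w q)) \<longlongrightarrow> minf n w0) F"
proof -
  have "((\<lambda>q. cosh (s q) * mom n (coth (s q)) (w q) - sinh (s q) ^ 1 * mom (n + 1) (coth (s q)) (w q)) \<longlongrightarrow> 1 * minf n w0 - 0) F"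
    using assms by (intro tendsto_diff tendsto_mult sh mom_conv mom_zero) auto
  thus ?thesis by (simp add: M0_def)
qed

lemma M1_conv: assumes "n \<le> 1" shows "((\<lambda>q. M1 n (s q) (w q)) \<longlongrightarrow> - minf (n + 1) w0) F"
proof -
  have "((\<lambda>q. sinh (s q) ^ 1 * mom n (coth (s q)) (w q) - cosh (s q) * mom (n + 1) (coth (s q)) (w q)) \<longlongrightarrow> 0 - 1 * minf (n + 1) w0) F"
    using assms by (intro tendsto_diff tendsto_mult sh mom_conv mom_zero) auto
  thus ?thesis by (simp add: M1_def)
qed

lemma M0_zero: assumes m: "m \<ge> 1" "n \<le> m + 2" shows "((\<lambda>q. sinh (s q) ^ m * M0 n (s q) (w q)) \<longlongrightarrow> 0) F"
proof -
  have "((\<lambda>q. cosh (s q) * (sinh (s q) ^ m * mom n (coth (s q)) (w q)) - sinh (s q) ^ (m + 1) * mom (n + 1) (coth (s q)) (w q)) \<longlongrightarrow> 1 * 0 - 0) F"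
    using assms by (intro tendsto_diff tendsto_mult sh mom_zero) auto
  thus ?thesis by (simp add: M0_def algebra_simps)
qed

lemma M1_zero: assumes m: "m \<ge> 1" "n \<le> m + 1" shows "((\<lambda>q. sinh (s q) ^ m * M1 n (s q) (w q)) \<longlongrightarrow> 0) F"
proof -
  have "((\<lambda>q. sinh (s q) ^ (m + 1) * mom n (coth (s q)) (w q) - cosh (s q) * (sinh (s q) ^ m * mom (n + 1) (coth (s q)) (w q))) \<longlongrightarrow> 0 - 1 * 0) F"
    using assms by (intro tendsto_diff tendsto_mult sh mom_zero) auto
  thus ?thesis by (simp add: M1_def algebra_simps)
qed

lemma KG_zero: assumes "n \<le> m" shows "((\<lambda>q. sinh (s q) ^ m * KG 0 n (s q) (w q)) \<longlongrightarrow> 0) F"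
proof (rule Lim_null_comparison)
  show "eventually (\<lambda>q. norm (sinh (s q) ^ m * KG 0 n (s q) (w q)) \<le> sinh (s q) ^ (m - n) * cosh (s q) ^ n * sinh (s q)) F"
    using s_pos w_nonneg
  proof eventually_elim
    case (elim q)
    have S: "sinh (s q) > 0" using elim by simp
    have c: "coth (s q) > 1" using elim coth_gt1 by simp
    have SX: "sinh (s q) ^ m * coth (s q) ^ n = sinh (s q) ^ (m - n) * cosh (s q) ^ n" using S assms
      by (simp add: coth_def power_divide power_diff)
    have "kk * sinh (s q) / (cosh (s q) * (4 * sinh (s q) ^ 2 + 5)) \<le> sinh (s q)"
    proof -
      have "1 \<le> sqrt 2" by simp
      hence "kk \<le> 1" unfolding kk_def by (subst divide_le_eq_1) linarith
      moreover have "1 * 1 \<le> cosh (s q) * (4 * sinh (s q) ^ 2 + 5)" by (intro mult_mono) (auto simp: cosh_real_ge_1)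
      ultimately have "kk * sinh (s q) \<le> (cosh (s q) * (4 * sinh (s q) ^ 2 + 5)) * sinh (s q)"
        using S by (intro mult_right_mono) auto
      thus ?thesis by (simp add: pos_divide_le_eq add_nonneg_pos mult.commute)
    qed
    with Gam_bounds[OF elim(1)] have G: "0 \<le> Gam (s q)" "Gam (s q) \<le> sinh (s q)" by simp_all
    have E: "exp (- 2 * w q * coth (s q)) \<le> 1" using elim c by simp
    have "norm (sinh (s q) ^ m * KG 0 n (s q) (w q)) = sinh (s q) ^ m * coth (s q) ^ n * (exp (- 2 * w q * coth (s q)) * Gam (s q))"
      using S c G by (simp add: KG_def abs_mult)
    also have "\<dots> \<le> sinh (s q) ^ m * coth (s q) ^ n * (1 * sinh (s q))"
      using S c G E by (intro mult_left_mono mult_mono) auto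
    finally show ?case unfolding SX by simp
  qed
  have "((\<lambda>q. sinh (s q) ^ (m - n) * cosh (s q) ^ n * sinh (s q)) \<longlongrightarrow> (if m - n = 0 then 1 else 0) * 1 ^ n * 0) F"
    by (intro tendsto_mult shpow tendsto_power sh)
  thus "((\<lambda>q. sinh (s q) ^ (m - n) * cosh (s q) ^ n * sinh (s q)) \<longlongrightarrow> 0) F" by simp
qed

lemma nat_le_2_cases: "(i::nat) \<le> 2 \<Longrightarrow> i = 0 \<or> i = Suc 0 \<or> i = Suc (Suc 0)" by auto

lemma MM_conv: assumes "i + n \<le> 2" shows "((\<lambda>q. MM i n (s q) (w q)) \<longlongrightarrow> (if i = 1 then - minf (n + 1) w0 else minf n w0)) F"
proof -
  have "i \<le> 2" using assms by simp
  from nat_le_2_cases[OF this] show ?thesis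
  proof (elim disjE)
    assume "i = Suc (Suc 0)"
    with assms have n: "n = 0" "i = Suc (Suc 0)" by auto
    from tendsto_add[OF M0_conv[of 0] KG_zero[of 0 0]] show ?thesis using n by simp
  qed (use assms M0_conv[of n] M1_conv[of n] in auto)
qed

lemma MM_zero: assumes "i \<le> 2" "i + n \<le> m + 2" "m \<ge> 1" shows "((\<lambda>q. sinh (s q) ^ m * MM i n (s q) (w q)) \<longlongrightarrow> 0) F"
  using nat_le_2_cases[OF assms(1)]
proof (elim disjE)
  assume i: "i = Suc (Suc 0)"
  from tendsto_add[OF M0_zero[of m n] KG_zero[of n m]] show ?thesis using assms i by (simp add: algebra_simps)
qed (use assms M0_zero[of m n] M1_zero[of m n] in auto)

text \<open>Limits of the elementary parts at \<open>s = 0\<close> for \<open>i + n \<le> 2\<close>;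
  the value \<open>kk * pi / 2\<close> stems from \<open>arctan 1\<close>.\<close>

definition hl :: "nat \<Rightarrow> nat \<Rightarrow> real" where
  "hl i n = (if n = 0 then (if i = 1 then - kk else kk * pi / 2) else if n = 1 \<and> i = 0 then kk else 0)"

lemma hU_conv: assumes "i + n \<le> 2" shows "((\<lambda>q. hU i n (s q)) \<longlongrightarrow> hl i n) F"
proof -
  have At: "((\<lambda>q. At (s q)) \<longlongrightarrow> pi / 4) F"
    using isCont_tendsto_compose[OF DERIV_isCont[OF At_deriv] s_lim] by (simp add: At_def arctan_one)
  have lamS: "((\<lambda>s. lam s * sinh s) \<longlongrightarrow> 0) (at_right 0)" unfolding lam_def sinh_field_def by real_asymp
  have l2: "((\<lambda>q. kk * (lam (s q) * sinh (s q))) \<longlongrightarrow> kk * 0) F" by (intro tendsto_mult tendsto_const filterlim_compose[OF lamS s_right])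
  have th: "((\<lambda>q. - kk * (sinh (s q) / cosh (s q))) \<longlongrightarrow> - kk * (0 / 1)) F" by (intro tendsto_intros sh) simp
  have a0: "((\<lambda>q. kk * (2 * At (s q) * cosh (s q))) \<longlongrightarrow> kk * (2 * (pi / 4) * 1)) F" by (intro tendsto_intros At sh)
  have a1: "((\<lambda>q. kk * (2 * At (s q) * sinh (s q) - 1)) \<longlongrightarrow> kk * (2 * (pi / 4) * 0 - 1)) F" by (intro tendsto_intros At sh)
  have "i = 0 \<and> n = 0 \<or> i = 0 \<and> n = 1 \<or> i = 0 \<and> n = 2 \<or> i = 1 \<and> n = 0 \<or> i = 1 \<and> n = 1 \<or> i = Suc (Suc 0) \<and> n = 0" using assms by auto
  thus ?thesis using a0 a1 l2 tendsto_add[OF a0 th] by (elim disjE) (simp_all add: hl_def hW_def)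
qed

lemma hU_zero: assumes "i \<le> 2" "n \<le> 3" "i + n \<le> m + 2" "m \<ge> 1" shows "((\<lambda>q. sinh (s q) ^ m * hU i n (s q)) \<longlongrightarrow> 0) F"
proof (cases "i + n \<le> 2")
  case True
  from tendsto_mult[OF shpow[of m] hU_conv[OF True]] show ?thesis using assms by (simp del: hU.simps)
next
  case False
  define k where "k = i + n - 2"
  have k: "k \<ge> 1" "k \<le> m" using False assms by (auto simp: k_def)
  have r: "((\<lambda>s. sinh s * (2 - lam s * cosh s)) \<longlongrightarrow> 0) (at_right 0)" "((\<lambda>s. sinh s * (lam s * cosh s - 1)) \<longlongrightarrow> 0) (at_right 0)"
    "((\<lambda>s. sinh s ^ 2 * (coth s - lam s * sinh s)) \<longlongrightarrow> 0) (at_right 0)" "((\<lambda>s. sinh s ^ 2 * (lam s * sinh s - coth s)) \<longlongrightarrow> 0) (at_right 0)"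
    "((\<lambda>s. sinh s ^ 3 * (2 - lam s * cosh s - coth s ^ 2)) \<longlongrightarrow> 0) (at_right 0)"
    unfolding lam_def coth_def sinh_field_def cosh_field_def by real_asymp+
  note R = r[THEN filterlim_compose, OF s_right, THEN tendsto_mult[OF tendsto_const[of kk]]]
  have "i = 0 \<and> n = 3 \<or> i = 1 \<and> n = 2 \<or> i = 1 \<and> n = 3 \<or> i = 2 \<and> n = 1 \<or> i = 2 \<and> n = 2 \<or> i = 2 \<and> n = 3" using assms False by auto
  hence base: "((\<lambda>q. sinh (s q) ^ k * hU i n (s q)) \<longlongrightarrow> 0) F"
    using R by (elim disjE) (simp_all add: k_def hW_def algebra_simps numeral_2_eq_2)
  have "((\<lambda>q. sinh (s q) ^ (m - k) * (sinh (s q) ^ k * hU i n (s q))) \<longlongrightarrow> (if m - k = 0 then 1 else 0) * 0) F"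
    by (intro tendsto_mult shpow base)
  moreover have "sinh (s q) ^ (m - k) * (sinh (s q) ^ k * hU i n (s q)) = sinh (s q) ^ m * hU i n (s q)" for q
    using k by (simp add: mult.assoc[symmetric] power_add[symmetric])
  ultimately show ?thesis by simp
qed

end

context vertex
begin

definition ml :: "nat \<Rightarrow> nat \<Rightarrow> real" where
  "ml i n = (if i = 1 then - minf (n + 1) w0 else minf n w0)"

lemma X0_conv: assumes "i + j + nb a b \<le> 2"
  shows "((\<lambda>q. X0 \<tau> i j a b (s q) (w q)) \<longlongrightarrow> Xgen \<tau> (\<lambda>i n s. hl i n) (\<lambda>i n s w. ml i n) i j a b 0 0) F"
proof -
  have M: "((\<lambda>q. MM i (nb a b + j) (s q) (w q)) \<longlongrightarrow> ml i (nb a b + j)) F"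
    unfolding ml_def by (rule MM_conv) (use assms in simp)
  show ?thesis
  proof (cases "j = 0")
    case True
    have H: "((\<lambda>q. hU i (nb a b) (s q)) \<longlongrightarrow> hl i (nb a b)) F" using hU_conv[of i "nb a b"] assms by simp
    show ?thesis unfolding Xgen_def using True by (simp only: if_True refl) (intro tendsto_mult tendsto_add tendsto_const M[unfolded True] H)
  next
    case False
    thus ?thesis unfolding Xgen_def by (simp only: if_False) (intro tendsto_mult tendsto_add tendsto_const M)
  qed
qed

lemma X0_zero: assumes "i \<le> 2" "i + j + nb a b \<le> m + 2" "m \<ge> 1"
  shows "((\<lambda>q. sinh (s q) ^ m * X0 \<tau> i j a b (s q) (w q)) \<longlongrightarrow> 0) F"
proof -
  have nb: "nb a b \<le> 3" using nb_less[of a b] by simp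
  have H: "((\<lambda>q. sinh (s q) ^ m * hU i (nb a b) (s q)) \<longlongrightarrow> 0) F" by (rule hU_zero) (use assms nb in auto)
  have M: "((\<lambda>q. sinh (s q) ^ m * MM i (nb a b + j) (s q) (w q)) \<longlongrightarrow> 0) F" by (rule MM_zero) (use assms in auto)
  have "((\<lambda>q. sg a * sg b * ((if j = 0 then (if a then \<tau> else 1) else 0) * (sinh (s q) ^ m * hU i (nb a b) (s q)) + (- 2) ^ j * (sinh (s q) ^ m * MM i (nb a b + j) (s q) (w q))))
     \<longlongrightarrow> sg a * sg b * ((if j = 0 then (if a then \<tau> else 1) else 0) * 0 + (- 2) ^ j * 0)) F"
    by (intro tendsto_add tendsto_mult tendsto_const H M)
  thus ?thesis unfolding Xgen_def by (cases "j = 0") (simp_all add: algebra_simps del: hU.simps MM.simps)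
qed

text \<open>Both \<open>v0\<close> and \<open>v1\<close> lie between 0 and \<open>s\<close>, so
  every \<open>sinh\<close> in the form supplies one factor bounded by \<open>sinh s\<close> against
  the growth of its coefficient. Only the product of the two \<open>cosh\<close> survives.\<close>

lemma val_lim:
  assumes Y: "((\<lambda>q. Y q False False) \<longlongrightarrow> l) F" "((\<lambda>q. sinh (s q) * Y q False True) \<longlongrightarrow> 0) F"
     "((\<lambda>q. sinh (s q) * Y q True False) \<longlongrightarrow> 0) F" "((\<lambda>q. sinh (s q) ^ 2 * Y q True True) \<longlongrightarrow> 0) F"
    and t: "eventually (\<lambda>q. 0 \<le> v0 q \<and> v0 q \<le> v1 q \<and> v1 q \<le> s q) F"
  shows "((\<lambda>q. val (Y q) (v0 q) (v1 q)) \<longlongrightarrow> l) F"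
proof -
  have tl: "(v0 \<longlongrightarrow> 0) F" "(v1 \<longlongrightarrow> 0) F"
    by (rule tendsto_sandwich[OF _ _ tendsto_const s_lim]; use t in \<open>auto elim: eventually_mono\<close>)+
  have c: "((\<lambda>q. cosh (v0 q)) \<longlongrightarrow> 1) F" "((\<lambda>q. cosh (v1 q)) \<longlongrightarrow> 1) F"
    using isCont_tendsto_compose[OF DERIV_isCont[OF dcosh] tl(1)] isCont_tendsto_compose[OF DERIV_isCont[OF dcosh] tl(2)] by simp_all
  have 1: "((\<lambda>q. Y q False True * sinh (v1 q)) \<longlongrightarrow> 0) F"
    by (rule Lim_null_comparison[OF _ tendsto_norm_zero[OF Y(2)]])
      (use t in \<open>auto simp: abs_mult mult.commute elim!: eventually_mono intro!: mult_right_mono\<close>)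
  have 2: "((\<lambda>q. Y q True False * sinh (v0 q)) \<longlongrightarrow> 0) F"
    by (rule Lim_null_comparison[OF _ tendsto_norm_zero[OF Y(3)]])
      (use t in \<open>auto simp: abs_mult mult.commute elim!: eventually_mono intro!: mult_right_mono\<close>)
  have 3: "((\<lambda>q. Y q True True * sinh (v1 q) * sinh (v0 q)) \<longlongrightarrow> 0) F"
  proof (rule Lim_null_comparison[OF _ tendsto_norm_zero[OF Y(4)]])
    show "eventually (\<lambda>q. norm (Y q True True * sinh (v1 q) * sinh (v0 q)) \<le> norm (sinh (s q) ^ 2 * Y q True True)) F"
      using t
    proof eventually_elim
      case (elim q)
      have "sinh (v1 q) * sinh (v0 q) \<le> sinh (s q) * sinh (s q)" using elim by (intro mult_mono) auto
      hence "\<bar>Y q True True\<bar> * (sinh (v1 q) * sinh (v0 q)) \<le> \<bar>Y q True True\<bar> * (sinh (s q) * sinh (s q))" by (intro mult_left_mono) auto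
      thus ?case using elim by (simp add: abs_mult power2_eq_square mult_ac)
    qed
  qed
  have "((\<lambda>q. (Y q False False * cosh (v1 q) + Y q False True * sinh (v1 q)) * cosh (v0 q) + (Y q True False * sinh (v0 q) * cosh (v1 q) + Y q True True * sinh (v1 q) * sinh (v0 q)))
     \<longlongrightarrow> (l * 1 + 0) * 1 + (0 * 1 + 0)) F" by (intro tendsto_add tendsto_mult Y(1) c 1 2 3)
  thus ?thesis by (simp add: val_def algebra_simps)
qed

lemma chart_lim:
  assumes conv: "\<And>i j a b. i + j + nb a b \<le> 2 \<Longrightarrow> ((\<lambda>q. X i j a b (s q) (u q)) \<longlongrightarrow> xl i j a b) F"
    and zero: "\<And>i j a b m. i + j \<le> 2 \<Longrightarrow> i + j + nb a b \<le> m + 2 \<Longrightarrow> m \<ge> 1 \<Longrightarrow> ((\<lambda>q. sinh (s q) ^ m * X i j a b (s q) (u q)) \<longlongrightarrow> 0) F"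
    and t: "eventually (\<lambda>q. 0 \<le> v0 q \<and> v0 q \<le> v1 q \<and> v1 q \<le> s q) F"
  shows "((\<lambda>q. val (\<lambda>a b. X 0 0 a b (s q) (u q)) (v0 q) (v1 q)) \<longlongrightarrow> xl 0 0 False False) F"
    "((\<lambda>q. val (\<lambda>a b. D2c e X a b (s q) (u q)) (v0 q) (v1 q)) \<longlongrightarrow> D2c e (\<lambda>i j a b s w. xl i j a b) False False 0 0) F"
proof -
  show "((\<lambda>q. val (\<lambda>a b. X 0 0 a b (s q) (u q)) (v0 q) (v1 q)) \<longlongrightarrow> xl 0 0 False False) F"
    using conv[of 0 0 False False] zero[of 0 0 False True 1] zero[of 0 0 True False 1] zero[of 0 0 True True 2]
    by (intro val_lim t) (simp_all add: nb_def)
  obtain ew e0 e1 e2 where e: "e = (ew, e0, e1, e2)" by (cases e)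
  have dist: "c * D2c e X a b s w = D2c e (\<lambda>i j a b s w. c * X i j a b s w) a b s w" for c :: real and a b s w
    unfolding e D2c_def prod.case by (simp add: algebra_simps)
  have zero': "((\<lambda>q. sinh (s q) ^ m * D2c e X a b (s q) (u q)) \<longlongrightarrow> 0) F" if m: "nb a b \<le> m" "m \<ge> 1" for a b m
  proof -
    have n: "nb (\<not> a) b \<le> nb a b + 1" "nb a (\<not> b) \<le> nb a b + 1" "nb (\<not> a) (\<not> b) \<le> nb a b + 2" by (simp_all add: nb_def of_bool_def)
    have "((\<lambda>q. D2c e (\<lambda>i j a b s' w. sinh (s q) ^ m * X i j a b (s q) (u q)) a b (s q) (u q)) \<longlongrightarrow> D2c e (\<lambda>i j a b s w. 0) a b (0::real) (0::real)) F"
      unfolding e D2c_def prod.case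
      by (intro tendsto_add tendsto_mult tendsto_const zero) (use m n in auto)
    moreover have "sinh (s q) ^ m * D2c e X a b (s q) (u q) = D2c e (\<lambda>i j a b s' w. sinh (s q) ^ m * X i j a b (s q) (u q)) a b (s q) (u q)" for q
      unfolding e D2c_def prod.case by (simp add: algebra_simps)
    ultimately show ?thesis by (simp add: e D2c_def)
  qed
  have "((\<lambda>q. D2c e X False False (s q) (u q)) \<longlongrightarrow> D2c e (\<lambda>i j a b s w. xl i j a b) False False 0 0) F"
    unfolding e D2c_def prod.case by (intro tendsto_add tendsto_mult tendsto_const conv) (simp_all add: nb_def)
  thus "((\<lambda>q. val (\<lambda>a b. D2c e X a b (s q) (u q)) (v0 q) (v1 q)) \<longlongrightarrow> D2c e (\<lambda>i j a b s w. xl i j a b) False False 0 0) F"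
    using zero'[of False True 1] zero'[of True False 1] zero'[of True True 2]
    by (intro val_lim t) (simp_all add: nb_def)
qed

text \<open>The limit does not depend on \<open>\<tau>\<close>, because the elementary limits
  \<open>hl 1 1\<close> and \<open>hl 0 2\<close> it would multiply are zero. Hence both charts have
  the same limit after the change of coordinates.\<close>

lemma chart0_lim:
  assumes t: "eventually (\<lambda>q. 0 \<le> v0 q \<and> v0 q \<le> v1 q \<and> v1 q \<le> s q) F"
  shows "((\<lambda>q. val (\<lambda>a b. X0 \<tau> 0 0 a b (s q) (w q)) (v0 q) (v1 q)) \<longlongrightarrow> kk * pi / 2 + minf 0 w0) F"
    "((\<lambda>q. val (\<lambda>a b. D2c (ew, e0, e1, e2) (X0 \<tau>) a b (s q) (w q)) (v0 q) (v1 q)) \<longlongrightarrow>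
      (e0^2 + e1^2 + e2^2) * (kk * pi / 2 + minf 0 w0)
       + (4 * e2 * ew + 2 * e2 * (e0 + e1) + 4 * ew^2 + 4 * ew * (e0 + e1) + 2 * e0 * e1) * minf 2 w0) F"
proof -
  let ?x = "\<lambda>i j a b. Xgen \<tau> (\<lambda>i n s. hl i n) (\<lambda>i n s w. ml i n) i j a b (0::real) (0::real)"
  have x0: "?x 0 0 False False = kk * pi / 2 + minf 0 w0" by (simp add: Xgen_def sg_def nb_def hl_def ml_def)
  note L = chart_lim[where X="X0 \<tau>" and u=w and xl="?x", OF X0_conv X0_zero t]
  show "((\<lambda>q. val (\<lambda>a b. X0 \<tau> 0 0 a b (s q) (w q)) (v0 q) (v1 q)) \<longlongrightarrow> kk * pi / 2 + minf 0 w0) F"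
    unfolding x0[symmetric] by (rule L(1)) simp_all
  have "D2c (ew, e0, e1, e2) (\<lambda>i j a b s w. ?x i j a b) False False 0 0 = (e0^2 + e1^2 + e2^2) * (kk * pi / 2 + minf 0 w0)
       + (4 * e2 * ew + 2 * e2 * (e0 + e1) + 4 * ew^2 + 4 * ew * (e0 + e1) + 2 * e0 * e1) * minf 2 w0"
    by (simp add: D2c_def Xgen_def sg_def nb_def hl_def ml_def eval_nat_numeral algebra_simps)
  moreover have "((\<lambda>q. val (\<lambda>a b. D2c (ew, e0, e1, e2) (X0 \<tau>) a b (s q) (w q)) (v0 q) (v1 q)) \<longlongrightarrow>
      D2c (ew, e0, e1, e2) (\<lambda>i j a b s w. ?x i j a b) False False 0 0) F" by (rule L(2)) simp_all
  ultimately show "((\<lambda>q. val (\<lambda>a b. D2c (ew, e0, e1, e2) (X0 \<tau>) a b (s q) (w q)) (v0 q) (v1 q)) \<longlongrightarrow>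
      (e0^2 + e1^2 + e2^2) * (kk * pi / 2 + minf 0 w0)
       + (4 * e2 * ew + 2 * e2 * (e0 + e1) + 4 * ew^2 + 4 * ew * (e0 + e1) + 2 * e0 * e1) * minf 2 w0) F" by simp
qed

end

text \<open>The second identity at \<open>w = 0\<close>, read off at \<open>s = 0\<close>. It
  reconciles the limits at the origin: with four modes the limit from the third region is symmetric
  in its four components, and only this ratio of moments makes it agree with the other two
  charts.\<close>

lemma minf_relation: "kk * pi / 2 + minf 0 0 = 6 * minf 2 0"
proof -
  interpret vertex "at_right (0::real)" "\<lambda>s. s" "\<lambda>_. 0" 0
    by unfold_locales (auto simp: eventually_at_right_less intro: tendsto_ident_at)
  have "((\<lambda>s. 7 * M0 2 s 0 + hU 0 2 s - hU 0 0 s - M0 0 s 0 + M1 1 s 0) \<longlongrightarrow> 7 * minf 2 0 + hl 0 2 - hl 0 0 - minf 0 0 + - minf (1 + 1) 0) (at_right 0)"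
    by (intro tendsto_intros M0_conv M1_conv hU_conv) simp_all
  moreover have "eventually (\<lambda>s. 7 * M0 2 s 0 + hU 0 2 s - hU 0 0 s - M0 0 s 0 + M1 1 s 0 = 0) (at_right (0::real))"
    using eventually_at_right_less[of "0::real"] by (rule eventually_mono) (rule w0_identity_2)
  hence "((\<lambda>s. 7 * M0 2 s 0 + hU 0 2 s - hU 0 0 s - M0 0 s 0 + M1 1 s 0) \<longlongrightarrow> 0) (at_right 0)"
    by (rule tendsto_eventually)
  ultimately have "7 * minf 2 0 + hl 0 2 - hl 0 0 - minf 0 0 + - minf (1 + 1) 0 = 0"
    by (rule tendsto_unique[rotated]) simp
  thus ?thesis by (simp add: hl_def numeral_2_eq_2)
qed

text \<open>The argument of the fourth mode is not constant but lies between 0 and \<open>s\<close>,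
  so \<open>sinh \<alpha>\<close> gains one power of \<open>sinh s\<close>; this pays for the
  additional power of \<open>r\<close> in \<open>XC\<close>.\<close>

locale vertex_C = vertex F s "\<lambda>_. 0" 0 for F :: "'a filter" and s :: "'a \<Rightarrow> real" +
  fixes \<alpha> :: "'a \<Rightarrow> real"
  assumes al: "eventually (\<lambda>q. 0 \<le> \<alpha> q \<and> \<alpha> q \<le> s q) F"
begin

lemma al_lim: "((\<lambda>q. cosh (\<alpha> q)) \<longlongrightarrow> 1) F"
proof -
  have "(\<alpha> \<longlongrightarrow> 0) F"
    by (rule tendsto_sandwich[OF _ _ tendsto_const s_lim]; use al in \<open>auto elim: eventually_mono\<close>)+
  from isCont_tendsto_compose[OF DERIV_isCont[OF dcosh] this] show ?thesis by simp
qed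

lemma Uj_conv: assumes "i + n \<le> 2" shows "((\<lambda>q. Uj i n (s q)) \<longlongrightarrow> hl i n + ml i n) F"
  unfolding Uj_def using MM_conv[OF assms] by (intro tendsto_add hU_conv assms) (simp add: ml_def)

lemma Uj_zero: assumes "i \<le> 2" "n \<le> 3" "i + n \<le> m + 2" "m \<ge> 1" shows "((\<lambda>q. sinh (s q) ^ m * Uj i n (s q)) \<longlongrightarrow> 0) F"
  using tendsto_add[OF hU_zero[OF assms] MM_zero[OF assms(1,3,4)]] by (simp add: Uj_def algebra_simps)

lemma al_Uj_zero: assumes "i \<le> 2" "n \<le> 3" "i + n \<le> m + 3" shows "((\<lambda>q. sinh (s q) ^ m * (sinh (\<alpha> q) * Uj i n (s q))) \<longlongrightarrow> 0) F"
proof (rule Lim_null_comparison)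
  show "((\<lambda>q. norm (sinh (s q) ^ (m + 1) * Uj i n (s q))) \<longlongrightarrow> 0) F"
    by (rule tendsto_norm_zero[OF Uj_zero]) (use assms in auto)
  show "eventually (\<lambda>q. norm (sinh (s q) ^ m * (sinh (\<alpha> q) * Uj i n (s q))) \<le> norm (sinh (s q) ^ (m + 1) * Uj i n (s q))) F"
    using al s_pos
  proof eventually_elim
    case (elim q)
    have "\<bar>Uj i n (s q)\<bar> * sinh (s q) ^ m * sinh (\<alpha> q) \<le> \<bar>Uj i n (s q)\<bar> * sinh (s q) ^ m * sinh (s q)"
      using elim by (intro mult_left_mono) auto
    thus ?case using elim by (simp add: abs_mult mult_ac)
  qed
qed

definition xC :: "nat \<Rightarrow> nat \<Rightarrow> bool \<Rightarrow> bool \<Rightarrow> real" where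
  "xC i j a b = sg a * sg b * (if even j then hl i (nb a b) + ml i (nb a b) else - (hl i (Suc (nb a b)) + ml i (Suc (nb a b))))"

lemma XC_conv: assumes "i + j + nb a b \<le> 2" shows "((\<lambda>q. XC i j a b (s q) (\<alpha> q)) \<longlongrightarrow> xC i j a b) F"
proof (cases "even j")
  case True
  have "((\<lambda>q. sg a * sg b * (cosh (\<alpha> q) * Uj i (nb a b) (s q) - sinh (s q) ^ 0 * (sinh (\<alpha> q) * Uj i (Suc (nb a b)) (s q)))) \<longlongrightarrow> sg a * sg b * (1 * (hl i (nb a b) + ml i (nb a b)) - 0)) F"
    by (intro tendsto_mult tendsto_const tendsto_diff al_lim Uj_conv al_Uj_zero) (use assms in auto)
  thus ?thesis using True by (simp add: XC_def xC_def)
next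
  case False
  hence j: "j \<ge> 1" by (cases j) auto
  have "((\<lambda>q. sg a * sg b * (sinh (s q) ^ 0 * (sinh (\<alpha> q) * Uj i (nb a b) (s q)) - cosh (\<alpha> q) * Uj i (Suc (nb a b)) (s q))) \<longlongrightarrow> sg a * sg b * (0 - 1 * (hl i (Suc (nb a b)) + ml i (Suc (nb a b))))) F"
    by (intro tendsto_mult tendsto_const tendsto_diff al_lim Uj_conv al_Uj_zero) (use assms j in auto)
  thus ?thesis using False by (simp add: XC_def xC_def)
qed

lemma XC_zero: assumes "i + j \<le> 2" "i + j + nb a b \<le> m + 2" "m \<ge> 1"
  shows "((\<lambda>q. sinh (s q) ^ m * XC i j a b (s q) (\<alpha> q)) \<longlongrightarrow> 0) F"
proof (cases "even j")
  case True
  have "((\<lambda>q. sg a * sg b * (cosh (\<alpha> q) * (sinh (s q) ^ m * Uj i (nb a b) (s q)) - sinh (s q) ^ m * (sinh (\<alpha> q) * Uj i (Suc (nb a b)) (s q)))) \<longlongrightarrow> sg a * sg b * (1 * 0 - 0)) F"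
    by (intro tendsto_mult tendsto_const tendsto_diff al_lim Uj_zero al_Uj_zero) (use assms nb_less[of a b] in auto)
  thus ?thesis using True by (simp add: XC_def algebra_simps)
next
  case False
  hence j: "j \<ge> 1" by (cases j) auto
  have "((\<lambda>q. sg a * sg b * (sinh (s q) ^ m * (sinh (\<alpha> q) * Uj i (nb a b) (s q)) - cosh (\<alpha> q) * (sinh (s q) ^ m * Uj i (Suc (nb a b)) (s q)))) \<longlongrightarrow> sg a * sg b * (0 - 1 * 0)) F"
    by (intro tendsto_mult tendsto_const tendsto_diff al_lim Uj_zero al_Uj_zero) (use assms j nb_less[of a b] in auto)
  thus ?thesis using False by (simp add: XC_def algebra_simps)
qed

lemma chartC_lim:
  assumes t: "eventually (\<lambda>q. 0 \<le> v0 q \<and> v0 q \<le> v1 q \<and> v1 q \<le> s q) F"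
  shows "((\<lambda>q. val (\<lambda>a b. XC 0 0 a b (s q) (\<alpha> q)) (v0 q) (v1 q)) \<longlongrightarrow> kk * pi / 2 + minf 0 0) F"
    "((\<lambda>q. val (\<lambda>a b. D2c (ew, e0, e1, e2) XC a b (s q) (\<alpha> q)) (v0 q) (v1 q)) \<longlongrightarrow>
      (5 * (ew^2 + e0^2 + e1^2 + e2^2) + (ew + e0 + e1 + e2)^2) * minf 2 0) F"
proof -
  have x0: "xC 0 0 False False = kk * pi / 2 + minf 0 0" by (simp add: xC_def sg_def nb_def hl_def ml_def)
  note L = chart_lim[where X=XC and u=\<alpha> and xl=xC, OF XC_conv XC_zero t]
  show "((\<lambda>q. val (\<lambda>a b. XC 0 0 a b (s q) (\<alpha> q)) (v0 q) (v1 q)) \<longlongrightarrow> kk * pi / 2 + minf 0 0) F"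
    unfolding x0[symmetric] by (rule L(1))
  have "D2c (ew, e0, e1, e2) (\<lambda>i j a b s w. xC i j a b) False False 0 0 = (ew^2 + e0^2 + e1^2 + e2^2) * (kk * pi / 2 + minf 0 0)
     + 2 * (e2 * ew + e2 * e0 + e2 * e1 + ew * e0 + ew * e1 + e0 * e1) * minf 2 0"
    by (simp add: D2c_def xC_def sg_def nb_def hl_def ml_def eval_nat_numeral algebra_simps)
  also have "\<dots> = (5 * (ew^2 + e0^2 + e1^2 + e2^2) + (ew + e0 + e1 + e2)^2) * minf 2 0"
    unfolding minf_relation by (simp add: algebra_simps power2_eq_square)
  finally have v: "D2c (ew, e0, e1, e2) (\<lambda>i j a b s w. xC i j a b) False False 0 0 = (5 * (ew^2 + e0^2 + e1^2 + e2^2) + (ew + e0 + e1 + e2)^2) * minf 2 0" .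
  show "((\<lambda>q. val (\<lambda>a b. D2c (ew, e0, e1, e2) XC a b (s q) (\<alpha> q)) (v0 q) (v1 q)) \<longlongrightarrow>
      (5 * (ew^2 + e0^2 + e1^2 + e2^2) + (ew + e0 + e1 + e2)^2) * minf 2 0) F"
    unfolding v[symmetric] by (rule L(2))
qed

end

section \<open>The defect on the closed regions\<close>

text \<open>The regions with their interfaces included, so that together with \<open>OC\<close> they
  cover the open orthant. The limit defining \<open>v_cand\<close> at degenerate points also runs
  through the interfaces.\<close>

definition PA :: "(real^4) set" where "PA = {q \<in> open_orthant. q $ 4 \<ge> q $ 2 \<and> 2 * q $ 1 \<ge> q $ 4 - q $ 2}"
definition PB :: "(real^4) set" where "PB = {q \<in> open_orthant. q $ 4 \<le> q $ 2}"

lemma pieces: "open_orthant = PA \<union> PB \<union> OC" "OA \<subseteq> PA" "OB \<subseteq> PB" "OC \<subseteq> open_orthant"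
  unfolding PA_def PB_def OA_def OB_def OC_def by auto

lemma eventually_in: "eventually (\<lambda>x. x \<in> S) (at q within S)" by (simp add: eventually_at_filter)

text \<open>A region that does not accumulate at \<open>q\<close> has a trivial filter there, and
  every limit statement holds along it.\<close>

lemma tendsto_away: assumes "open U" "q \<in> U" "U \<inter> S = {}" shows "(f \<longlongrightarrow> l) (at q within S)"
proof -
  have "eventually (\<lambda>x. False) (at q within S)"
    unfolding eventually_at_topological using assms by blast
  hence "at q within S = bot" by (simp add: eventually_False)
  thus ?thesis by simp
qed

lemma cont_within: "isCont (f :: real^4 \<Rightarrow> real) q \<Longrightarrow> (f \<longlongrightarrow> f q) (at q within S)"
  unfolding isCont_def by (rule tendsto_within_subset[OF _ subset_UNIV])

lemma form_lim: assumes "bounded_linear (f :: real^4 \<Rightarrow> real)" shows "(f \<longlongrightarrow> f q) (at q within S)"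
  using bounded_linear.tendsto[OF assms tendsto_ident_at] .

lemma forms_PA: assumes "x \<in> PA" shows "0 \<le> t0A x" "t0A x \<le> t1 x" "t1 x < t2 x" "wA x \<ge> 0"
proof -
  have p: "x $ 1 > 0" "x $ 2 > 0" "x $ 3 > 0" "x $ 4 > 0" "x $ 4 \<ge> x $ 2" "2 * x $ 1 \<ge> x $ 4 - x $ 2" using assms by (auto simp: PA_def orthant_pos)
  show "0 \<le> t0A x" "t1 x < t2 x" using p by (simp_all add: forms_def)
  have "sqrt 2 * (x $ 4 - x $ 2) \<le> sqrt 2 * (x $ 2 + x $ 4)" using p by (intro mult_left_mono) auto
  thus "t0A x \<le> t1 x" by (simp add: forms_def)
  have "sqrt 2 * (x $ 4 - x $ 2) \<le> sqrt 2 * (2 * x $ 1)" using p by (intro mult_left_mono) auto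
  thus "wA x \<ge> 0" by (simp add: forms_def)
qed

lemma forms_PB: assumes "x \<in> PB" shows "0 \<le> t0B x" "t0B x \<le> t1 x" "t1 x < t2 x" "wB x \<ge> 0"
proof -
  have p: "x $ 1 > 0" "x $ 2 > 0" "x $ 3 > 0" "x $ 4 > 0" "x $ 4 \<le> x $ 2" using assms by (auto simp: PB_def orthant_pos)
  show "0 \<le> t0B x" "t1 x < t2 x" "wB x \<ge> 0" using p by (simp_all add: forms_def)
  have "sqrt 2 * (x $ 2 - x $ 4) \<le> sqrt 2 * (x $ 2 + x $ 4)" using p by (intro mult_left_mono) auto
  thus "t0B x \<le> t1 x" by (simp add: forms_def)
qed

lemma forms_OC: assumes "x \<in> OC" shows "0 \<le> r0 x" "r0 x \<le> r1 x" "r1 x \<le> r2 x" "0 \<le> al x" "al x \<le> r2 x"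
proof -
  have p: "x $ 1 > 0" "x $ 2 > 0" "x $ 3 > 0" "x $ 4 - x $ 2 > 2 * x $ 1" using assms by (auto simp: OC_def orthant_pos)
  have "sqrt 2 * (x $ 4 - x $ 2) > sqrt 2 * (2 * x $ 1)" using p by (intro mult_strict_left_mono) auto
  thus a: "0 \<le> al x" by (simp add: al_def)
  thus "0 \<le> r0 x" "al x \<le> r2 x" "r0 x \<le> r1 x" "r1 x \<le> r2 x" using p by (simp_all add: r0_def r1_def r2_def distrib_left)
qed

text \<open>One value and one second derivative serve all three regional approaches. If
  \<open>t2 q > 0\<close> the charts are continuous and agree on interfaces; if
  \<open>t2 q = 0\<close> then \<open>q = (x,0,0,0)\<close> and the vertex limits apply.\<close>

lemma region_limits:
  assumes q: "q \<in> region_A \<union> region_B"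
  shows "\<exists>\<mu> \<nu>. (VA \<longlongrightarrow> \<mu>) (at q within PA) \<and> (VB \<longlongrightarrow> \<mu>) (at q within PB) \<and> (VC \<longlongrightarrow> \<mu>) (at q within OC)
    \<and> (EA d \<longlongrightarrow> \<nu>) (at q within PA) \<and> (EB d \<longlongrightarrow> \<nu>) (at q within PB) \<and> (EC d \<longlongrightarrow> \<nu>) (at q within OC)
    \<and> (q $ 3 + min (q $ 2) (q $ 4) \<noteq> 0 \<longrightarrow> v_formula q = \<mu>)"
proof -
  have q0: "q \<in> closed_orthant" and p: "q $ 1 \<ge> 0" "q $ 2 \<ge> 0" "q $ 3 \<ge> 0" "q $ 4 \<ge> 0"
    using q by (auto simp: region_A_def region_B_def closed_orthant_iff)
  have opens: "open {x::real^4. x $ 4 > x $ 2}" "open {x::real^4. x $ 4 < x $ 2}" "open {x::real^4. 2 * x $ 1 > x $ 4 - x $ 2}"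
    by (intro open_Collect_less continuous_intros)+
  show ?thesis
  proof (cases "t2 q > 0")
    case True
    show ?thesis
    proof (cases "q \<in> region_A")
      case A: True
      hence a: "q $ 4 \<ge> q $ 2" "2 * q $ 1 \<ge> q $ 4 - q $ 2" by (auto simp: region_A_def)
      have B: "(VB \<longlongrightarrow> VA q) (at q within PB)" "(EB d \<longlongrightarrow> EA d q) (at q within PB)"
      proof -
        have "(VB \<longlongrightarrow> VA q) (at q within PB) \<and> (EB d \<longlongrightarrow> EA d q) (at q within PB)"
        proof (cases "q $ 2 = q $ 4")
          case e: True
          show ?thesis unfolding AB_agree[OF e]
            by (intro conjI cont_within V_cont True)
        next
          case False
          hence "q $ 4 > q $ 2" using a by simp
          thus ?thesis by (intro conjI tendsto_away[OF opens(1)]) (auto simp: PB_def)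
        qed
        thus "(VB \<longlongrightarrow> VA q) (at q within PB)" "(EB d \<longlongrightarrow> EA d q) (at q within PB)" by auto
      qed
      have C: "(VC \<longlongrightarrow> VA q) (at q within OC) \<and> (EC d \<longlongrightarrow> EA d q) (at q within OC)"
      proof (cases "2 * q $ 1 = q $ 4 - q $ 2")
        case e: True
        have "q $ 4 = q $ 2 + 2 * q $ 1" using e by simp
        hence "r2 q = t2 q" by (simp add: forms_def field_simps)
        hence r: "r2 q > 0" using True by simp
        show ?thesis unfolding AC_agree[OF e True]
          by (intro conjI cont_within V_cont r)
      next
        case False
        hence "2 * q $ 1 > q $ 4 - q $ 2" using a by simp
        thus ?thesis by (intro conjI tendsto_away[OF opens(3)]) (auto simp: OC_def)
      qed
      have V: "(VA \<longlongrightarrow> VA q) (at q within PA) \<and> (EA d \<longlongrightarrow> EA d q) (at q within PA)"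
        by (intro conjI cont_within V_cont True)
      have F: "q $ 3 + min (q $ 2) (q $ 4) \<noteq> 0 \<longrightarrow> v_formula q = VA q"
        using v_formula_A[OF q0 a] a p by (auto simp: min_def)
      show ?thesis using B C V F by blast
    next
      case False
      hence b: "q $ 4 < q $ 2" "q $ 4 \<le> q $ 2" using q p by (auto simp: region_A_def region_B_def closed_orthant_iff)
      have A: "(VA \<longlongrightarrow> VB q) (at q within PA) \<and> (EA d \<longlongrightarrow> EB d q) (at q within PA)"
        using b by (intro conjI tendsto_away[OF opens(2)]) (auto simp: PA_def)
      have C: "(VC \<longlongrightarrow> VB q) (at q within OC) \<and> (EC d \<longlongrightarrow> EB d q) (at q within OC)"
        using b by (intro conjI tendsto_away[OF opens(2)]) (auto simp: OC_def orthant_pos)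
      have V: "(VB \<longlongrightarrow> VB q) (at q within PB) \<and> (EB d \<longlongrightarrow> EB d q) (at q within PB)"
        by (intro conjI cont_within V_cont True)
      have F: "q $ 3 + min (q $ 2) (q $ 4) \<noteq> 0 \<longrightarrow> v_formula q = VB q"
        using v_formula_B[OF q0 b(2)] b p by (auto simp: min_def)
      show ?thesis using A C V F by blast
    qed
  next
    case False
    hence z: "q $ 2 = 0" "q $ 3 = 0" "q $ 4 = 0"
    proof -
      have "sqrt 2 * ((q $ 2 + q $ 4) / 2 + q $ 3) \<le> 0" using False by (simp add: t2_def distrib_left)
      hence "(q $ 2 + q $ 4) / 2 + q $ 3 \<le> 0" by (simp add: mult_le_0_iff)
      thus "q $ 2 = 0" "q $ 3 = 0" "q $ 4 = 0" using p by argo+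
    qed
    have fz: "t2 q = 0" "wA q = wB q" "r2 q = sqrt 2 * q $ 1 / 3" using z by (simp_all add: forms_def)
    let ?\<mu> = "kk * pi / 2 + minf 0 (wB q)"
    let ?\<nu> = "((t0A d)^2 + (t1 d)^2 + (t2 d)^2) * (kk * pi / 2 + minf 0 (wB q))
       + (4 * t2 d * wA d + 2 * t2 d * (t0A d + t1 d) + 4 * (wA d)^2 + 4 * wA d * (t0A d + t1 d) + 2 * t0A d * t1 d) * minf 2 (wB q)"
    interpret A: vertex "at q within PA" t2 wA "wB q"
    proof
      show "(t2 \<longlongrightarrow> 0) (at q within PA)" "(wA \<longlongrightarrow> wB q) (at q within PA)"
        using form_lim[OF forms_linear(6), of q PA] form_lim[OF forms_linear(1), of q PA] by (simp_all add: fz)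
      show "eventually (\<lambda>x. t2 x > 0) (at q within PA)" "eventually (\<lambda>x. wA x \<ge> 0) (at q within PA)"
        using eventually_in[of PA q] by (auto elim!: eventually_mono simp: forms_PA intro: forms_pos simp: PA_def[THEN eqset_imp_iff])
      show "wB q \<ge> 0" using p by (simp add: wB_def)
    qed
    interpret B: vertex "at q within PB" t2 wB "wB q"
    proof
      show "(t2 \<longlongrightarrow> 0) (at q within PB)" "(wB \<longlongrightarrow> wB q) (at q within PB)"
        using form_lim[OF forms_linear(6), of q PB] form_lim[OF forms_linear(2), of q PB] by (simp_all add: fz)
      show "eventually (\<lambda>x. t2 x > 0) (at q within PB)" "eventually (\<lambda>x. wB x \<ge> 0) (at q within PB)"
        using eventually_in[of PB q] by (auto elim!: eventually_mono simp: forms_PB intro: forms_pos simp: PB_def[THEN eqset_imp_iff])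
      show "wB q \<ge> 0" using p by (simp add: wB_def)
    qed
    have tA: "eventually (\<lambda>x. 0 \<le> t0A x \<and> t0A x \<le> t1 x \<and> t1 x \<le> t2 x) (at q within PA)"
      using eventually_in[of PA q] by (rule eventually_mono) (use forms_PA in \<open>auto intro: less_imp_le\<close>)
    have tB: "eventually (\<lambda>x. 0 \<le> t0B x \<and> t0B x \<le> t1 x \<and> t1 x \<le> t2 x) (at q within PB)"
      using eventually_in[of PB q] by (rule eventually_mono) (use forms_PB in \<open>auto intro: less_imp_le\<close>)
    have LA: "(VA \<longlongrightarrow> ?\<mu>) (at q within PA)" "(EA d \<longlongrightarrow> ?\<nu>) (at q within PA)"
      unfolding cval_def[abs_def] cval2_def[abs_def] by (rule A.chart0_lim[OF tA])+
    have LB: "(VB \<longlongrightarrow> ?\<mu>) (at q within PB)"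
      unfolding cval_def[abs_def] by (rule B.chart0_lim[OF tB])
    have "(EB d \<longlongrightarrow> ((t0B d)^2 + (t1 d)^2 + (t2 d)^2) * (kk * pi / 2 + minf 0 (wB q))
       + (4 * t2 d * wB d + 2 * t2 d * (t0B d + t1 d) + 4 * (wB d)^2 + 4 * wB d * (t0B d + t1 d) + 2 * t0B d * t1 d) * minf 2 (wB q)) (at q within PB)"
      unfolding cval2_def[abs_def] by (rule B.chart0_lim[OF tB])
    moreover have "((t0B d)^2 + (t1 d)^2 + (t2 d)^2) * (kk * pi / 2 + minf 0 (wB q))
       + (4 * t2 d * wB d + 2 * t2 d * (t0B d + t1 d) + 4 * (wB d)^2 + 4 * wB d * (t0B d + t1 d) + 2 * t0B d * t1 d) * minf 2 (wB q) = ?\<nu>"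
    proof -
      have e: "wA d = wB d - t0A d" "t0B d = - t0A d" by (simp_all add: forms_def field_simps)
      show ?thesis unfolding e by (simp add: algebra_simps power2_eq_square)
    qed
    ultimately have LB': "(EB d \<longlongrightarrow> ?\<nu>) (at q within PB)" by simp
    \<comment> \<open>The third region accumulates at \<open>(x,0,0,0)\<close> only for
      \<open>x = 0\<close>; there \<open>w = 0\<close> and \<open>minf_relation\<close> is
      available.\<close>
    have LC: "(VC \<longlongrightarrow> ?\<mu>) (at q within OC) \<and> (EC d \<longlongrightarrow> ?\<nu>) (at q within OC)"
    proof (cases "q $ 1 = 0")
      case False
      thus ?thesis using z p by (intro conjI tendsto_away[OF opens(3)]) (auto simp: OC_def)
    next
      case True
      have w0: "wB q = 0" using True by (simp add: wB_def)
      interpret C: vertex_C "at q within OC" r2 al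
      proof
        show "(r2 \<longlongrightarrow> 0) (at q within OC)" using form_lim[OF forms_linear(10), of q OC] by (simp add: fz True)
        show "eventually (\<lambda>x. r2 x > 0) (at q within OC)" "eventually (\<lambda>x. 0 \<le> al x \<and> al x \<le> r2 x) (at q within OC)"
          using eventually_in[of OC q] by (auto elim!: eventually_mono simp: forms_OC forms_pos)
      qed simp_all
      have tC: "eventually (\<lambda>x. 0 \<le> r0 x \<and> r0 x \<le> r1 x \<and> r1 x \<le> r2 x) (at q within OC)"
        using eventually_in[of OC q] by (rule eventually_mono) (use forms_OC in auto)
      have 1: "(VC \<longlongrightarrow> ?\<mu>) (at q within OC)" unfolding w0 cval_def[abs_def] by (rule C.chartC_lim[OF tC])
      have "(EC d \<longlongrightarrow> (5 * ((al d)^2 + (r0 d)^2 + (r1 d)^2 + (r2 d)^2) + (al d + r0 d + r1 d + r2 d)^2) * minf 2 0) (at q within OC)"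
        unfolding cval2_def[abs_def] by (rule C.chartC_lim[OF tC])
      moreover have "(5 * ((al d)^2 + (r0 d)^2 + (r1 d)^2 + (r2 d)^2) + (al d + r0 d + r1 d + r2 d)^2) * minf 2 0 = ?\<nu>"
      proof -
        have e: "wA d = - al d * (3/2)" "t0A d = r0 d + al d / 2" "t1 d = r1 d + al d / 2" "t2 d = r2 d + al d / 2"
          by (simp_all add: forms_def field_simps)
        show ?thesis unfolding w0 minf_relation e by (simp add: field_simps power2_eq_square)
      qed
      ultimately show ?thesis using 1 by simp
    qed
    show ?thesis using LA LB LB' LC z by (intro exI[of _ ?\<mu>] exI[of _ ?\<nu>]) simp
  qed
qed

section \<open>From the open regions to the closed ones\<close>

lemma region_islimpt: "q \<in> region_A \<Longrightarrow> q islimpt OA" "q \<in> region_B \<Longrightarrow> q islimpt OB"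
proof -
  have L: "(\<lambda>k. q + (1 / real (Suc k)) *\<^sub>R u) \<longlonglongrightarrow> q" for u :: "real^4"
  proof -
    have "(\<lambda>k. q + (1 / real (Suc k)) *\<^sub>R u) \<longlonglongrightarrow> q + 0 *\<^sub>R u" by (intro tendsto_intros LIMSEQ_Suc lim_1_over_n)
    thus ?thesis by simp
  qed
  have ne: "q + (1 / real (Suc k)) *\<^sub>R u \<noteq> q" if "u $ 1 > 0" for u :: "real^4" and k
    using that by (auto simp: vec_eq_iff forall_4)
  show "q islimpt OA" if "q \<in> region_A"
  proof -
    \<comment> \<open>Along \<open>(2,1,1,2)\<close> the difference \<open>q4 - q2\<close> gains one
      unit and \<open>2 * q1\<close> gains four, so both inequalities become strict.\<close>
    let ?u = "(\<chi> i. if i = 1 \<or> i = 4 then 2 else 1) :: real^4"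
    have "q + (1 / real (Suc k)) *\<^sub>R ?u \<in> OA" for k
    proof -
      define e where "e = 1 / real (Suc k)"
      have "e > 0" by (simp add: e_def)
      thus ?thesis using that unfolding e_def[symmetric] by (auto simp: OA_def region_A_def orthant_pos closed_orthant_iff intro: add_nonneg_pos)
    qed
    thus ?thesis using L[of ?u] ne[of ?u] unfolding islimpt_sequential by (intro exI[of _ "\<lambda>k. q + (1 / real (Suc k)) *\<^sub>R ?u"]) auto
  qed
  show "q islimpt OB" if "q \<in> region_B"
  proof -
    \<comment> \<open>Along \<open>(1,2,1,1)\<close> the difference \<open>q2 - q4\<close> gains one
      unit.\<close>
    let ?u = "(\<chi> i. if i = 2 then 2 else 1) :: real^4"
    have "q + (1 / real (Suc k)) *\<^sub>R ?u \<in> OB" for k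
    proof -
      define e where "e = 1 / real (Suc k)"
      have "e > 0" by (simp add: e_def)
      thus ?thesis using that unfolding e_def[symmetric] by (auto simp: OB_def region_B_def orthant_pos closed_orthant_iff intro: add_nonneg_pos)
    qed
    thus ?thesis using L[of ?u] ne[of ?u] unfolding islimpt_sequential by (intro exI[of _ "\<lambda>k. q + (1 / real (Suc k)) *\<^sub>R ?u"]) auto
  qed
qed

text \<open>Limits along the pieces are glued to the filters of the definitions: the open orthant
  for \<open>v_cand\<close> and the regular points for \<open>cont_ext\<close>. The defect at a
  closed point is then the limit of chart defects from within a single open region.\<close>

lemma defect_limit:
  assumes q: "q \<in> region_A \<union> region_B"
  shows "((\<lambda>x. VA x - 1/2 * EA d x) \<longlongrightarrow> v_cand q - 1/2 * dir_deriv2 d v_cand q) (at q within OA)"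
    "((\<lambda>x. VB x - 1/2 * EB d x) \<longlongrightarrow> v_cand q - 1/2 * dir_deriv2 d v_cand q) (at q within OB)"
proof -
  let ?f = "dir_deriv d (dir_deriv d v_cand)"
  obtain \<mu> \<nu> where L: "(VA \<longlongrightarrow> \<mu>) (at q within PA)" "(VB \<longlongrightarrow> \<mu>) (at q within PB)" "(VC \<longlongrightarrow> \<mu>) (at q within OC)"
    "(EA d \<longlongrightarrow> \<nu>) (at q within PA)" "(EB d \<longlongrightarrow> \<nu>) (at q within PB)" "(EC d \<longlongrightarrow> \<nu>) (at q within OC)"
    "q $ 3 + min (q $ 2) (q $ 4) \<noteq> 0 \<longrightarrow> v_formula q = \<mu>"
    using region_limits[OF q, of d] by blast
  have lp: "q islimpt regular_points" "q islimpt open_orthant"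
  proof -
    have s: "OA \<subseteq> regular_points" "OB \<subseteq> regular_points" unfolding regular_split by auto
    have "q islimpt OA \<or> q islimpt OB" using q region_islimpt by auto
    thus r: "q islimpt regular_points" using islimpt_subset[OF _ s(1)] islimpt_subset[OF _ s(2)] by auto
    show "q islimpt open_orthant" by (rule islimpt_subset[OF r]) (simp add: regular_points_def)
  qed
  have nb: "at q within regular_points \<noteq> bot" "at q within open_orthant \<noteq> bot" using lp by (simp_all add: trivial_limit_within)
  have tr: "(f \<longlongrightarrow> l) (at q within S)" if "(g \<longlongrightarrow> l) (at q within S)" "\<And>x. x \<in> S \<Longrightarrow> f x = g x" for f g :: "real^4 \<Rightarrow> real" and l S
    using that(1) by (rule Lim_transform_eventually) (use eventually_in[of S q] that(2) in \<open>auto elim!: eventually_mono\<close>)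
  have "(v_formula \<longlongrightarrow> \<mu>) (at q within PA)"
    by (rule tr[OF L(1)]) (auto simp: PA_def orthant_pos closed_orthant_iff intro!: v_formula_A)
  moreover have "(v_formula \<longlongrightarrow> \<mu>) (at q within PB)"
    by (rule tr[OF L(2)]) (auto simp: PB_def orthant_pos closed_orthant_iff intro!: v_formula_B)
  moreover have "(v_formula \<longlongrightarrow> \<mu>) (at q within OC)" by (rule tr[OF L(3) v_formula_C])
  ultimately have "(v_formula \<longlongrightarrow> \<mu>) (at q within open_orthant)" unfolding pieces(1) by (intro Lim_Un)
  hence "Lim (at q within open_orthant) v_formula = \<mu>" using nb(2) by (intro tendsto_Lim)
  hence v: "v_cand q = \<mu>" using L(7) by (simp add: v_cand_def)
  have EO: "(EA d \<longlongrightarrow> \<nu>) (at q within OA)" "(EB d \<longlongrightarrow> \<nu>) (at q within OB)" "(VA \<longlongrightarrow> \<mu>) (at q within OA)" "(VB \<longlongrightarrow> \<mu>) (at q within OB)"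
    using L pieces(2,3) tendsto_within_subset by blast+
  have F: "(?f \<longlongrightarrow> \<nu>) (at q within regular_points)"
    unfolding regular_split by (intro Lim_Un tr[OF EO(1) dd_regions(1)] tr[OF EO(2) dd_regions(2)] tr[OF L(6) dd_regions(3)])
  have "dir_deriv2 d v_cand q = \<nu>"
  \<comment> \<open>At a regular point \<open>cont_ext\<close> returns the value itself, and
    continuity of the chart identifies it with \<open>\<nu>\<close>.\<close>
  proof (cases "q \<in> regular_points")
    case True
    hence "q \<in> OA \<or> q \<in> OB" using q by (auto simp: regular_split OC_def region_A_def region_B_def orthant_pos)
    hence "(?f \<longlongrightarrow> ?f q) (at q within regular_points)"
    proof
      assume a: "q \<in> OA"
      have c: "isCont (EA d) q" by (rule V_cont(4)) (use a in \<open>auto simp: OA_def intro: forms_pos\<close>)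
      have "eventually (\<lambda>x. ?f x = EA d x) (nhds q)"
        using eventually_nhds_in_open[OF open_O(1) a] by (rule eventually_mono) (rule dd_regions(1))
      hence "isCont ?f q" using isCont_cong c by blast
      thus ?thesis by (rule cont_within)
    next
      assume a: "q \<in> OB"
      have c: "isCont (EB d) q" by (rule V_cont(5)) (use a in \<open>auto simp: OB_def intro: forms_pos\<close>)
      have "eventually (\<lambda>x. ?f x = EB d x) (nhds q)"
        using eventually_nhds_in_open[OF open_O(2) a] by (rule eventually_mono) (rule dd_regions(2))
      hence "isCont ?f q" using isCont_cong c by blast
      thus ?thesis by (rule cont_within)
    qed
    from tendsto_unique[OF nb(1) this F] show ?thesis using True by (simp add: dir_deriv2_def cont_ext_def)
  next
    case False
    thus ?thesis using tendsto_Lim[OF nb(1) F] by (simp add: dir_deriv2_def cont_ext_def)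
  qed
  thus "((\<lambda>x. VA x - 1/2 * EA d x) \<longlongrightarrow> v_cand q - 1/2 * dir_deriv2 d v_cand q) (at q within OA)"
    "((\<lambda>x. VB x - 1/2 * EB d x) \<longlongrightarrow> v_cand q - 1/2 * dir_deriv2 d v_cand q) (at q within OB)"
    unfolding v by (intro tendsto_intros EO; simp)+
qed

text \<open>The components of \<open>d\<close> in chart coordinates, divided by
  \<open>sqrt 2\<close>. The square of this factor cancels the \<open>1/2\<close> in the
  defect.\<close>

definition eA :: "real^4 \<Rightarrow> real \<times> real \<times> real \<times> real" where
  "eA d = (d $ 1 - (d $ 4 - d $ 2) / 2, (d $ 4 - d $ 2) / 2, (d $ 2 + d $ 4) / 2, (d $ 2 + d $ 4) / 2 + d $ 3)"
definition eB :: "real^4 \<Rightarrow> real \<times> real \<times> real \<times> real" where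
  "eB d = (d $ 1, (d $ 2 - d $ 4) / 2, (d $ 2 + d $ 4) / 2, (d $ 2 + d $ 4) / 2 + d $ 3)"

lemma D2c_scale: "D2c (sqrt 2 * ew, sqrt 2 * e0, sqrt 2 * e1, sqrt 2 * e2) X a b s w = 2 * D2c (ew, e0, e1, e2) X a b s w"
proof -
  have "D2c (r * ew, r * e0, r * e1, r * e2) X a b s w = (r * r) * D2c (ew, e0, e1, e2) X a b s w" for r
    by (simp add: D2c_def algebra_simps)
  from this[of "sqrt 2"] show ?thesis by simp
qed

lemma dfv_chart:
  "VA q - 1/2 * EA d q = dfv (eA d) 1 0 (t0A q) (t1 q) (t2 q) (wA q)"
  "VB q - 1/2 * EB d q = dfv (eB d) (-1) 0 (t0B q) (t1 q) (t2 q) (wB q)"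
proof -
  have A: "(wA d, t0A d, t1 d, t2 d) = (sqrt 2 * (d $ 1 - (d $ 4 - d $ 2) / 2), sqrt 2 * ((d $ 4 - d $ 2) / 2), sqrt 2 * ((d $ 2 + d $ 4) / 2), sqrt 2 * ((d $ 2 + d $ 4) / 2 + d $ 3))"
    by (simp add: forms_def algebra_simps)
  have B: "(wB d, t0B d, t1 d, t2 d) = (sqrt 2 * d $ 1, sqrt 2 * ((d $ 2 - d $ 4) / 2), sqrt 2 * ((d $ 2 + d $ 4) / 2), sqrt 2 * ((d $ 2 + d $ 4) / 2 + d $ 3))"
    by (simp add: forms_def algebra_simps)
  show "VA q - 1/2 * EA d q = dfv (eA d) 1 0 (t0A q) (t1 q) (t2 q) (wA q)"
    unfolding cval_def cval2_def dfv_def dfc_D2c A D2c_scale eA_def[symmetric] by (simp add: val_def algebra_simps)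
  show "VB q - 1/2 * EB d q = dfv (eB d) (-1) 0 (t0B q) (t1 q) (t2 q) (wB q)"
    unfolding cval_def cval2_def dfv_def dfc_D2c B D2c_scale eB_def[symmetric] by (simp add: val_def algebra_simps)
qed

lemma dfv_even: "dfv (- ew, - e0, - e1, - e2) \<tau> i s0 s1 s w = dfv (ew, e0, e1, e2) \<tau> i s0 s1 s w"
  by (simp add: dfv_def dfc_def algebra_simps)

section \<open>Controls as directions in the charts\<close>

lemma controls_directions:
  assumes "w \<in> controls"
  shows "eA (d_vec w) \<in> dsetA \<or> - eA (d_vec w) \<in> dsetA" "eB (d_vec w) \<in> dsetB \<or> - eB (d_vec w) \<in> dsetB"
proof -
  have v: "d_vec w $ 1 = w $ 2 - w $ 1" "d_vec w $ 2 = w $ 3 - w $ 2" "d_vec w $ 3 = w $ 4 - w $ 3" "d_vec w $ 4 = w $ 5 - w $ 4"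
    by (simp_all add: d_vec_def vector_def)
  have "w $ i = 0 \<or> w $ i = 1" for i using assms by (simp add: controls_def)
  from this[of 1] this[of 2] this[of 3] this[of 4] this[of 5]
  have "(eA (d_vec w) \<in> dsetA \<or> - eA (d_vec w) \<in> dsetA) \<and> (eB (d_vec w) \<in> dsetB \<or> - eB (d_vec w) \<in> dsetB)"
    unfolding eA_def eB_def v by (elim disjE) (simp_all add: dsetA_def dsetB_def)
  thus "eA (d_vec w) \<in> dsetA \<or> - eA (d_vec w) \<in> dsetA" "eB (d_vec w) \<in> dsetB \<or> - eB (d_vec w) \<in> dsetB" by auto
qed

lemma dfv_controls:
  assumes "w \<in> controls"
  shows "x \<in> OA \<Longrightarrow> dfv (eA (d_vec w)) 1 0 (t0A x) (t1 x) (t2 x) (wA x) \<ge> 0"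
    "x \<in> OB \<Longrightarrow> dfv (eB (d_vec w)) (-1) 0 (t0B x) (t1 x) (t2 x) (wB x) \<ge> 0"
proof -
  have ev: "dfv (- e) \<tau> i s0 s1 s w = dfv e \<tau> i s0 s1 s w" for e \<tau> i s0 s1 s w
    by (cases e) (simp add: dfv_even)
  show "dfv (eA (d_vec w)) 1 0 (t0A x) (t1 x) (t2 x) (wA x) \<ge> 0" if x: "x \<in> OA"
  proof -
    have "x \<in> PA" using x pieces(2) by auto
    note f = dfv_nonneg(1)[OF forms_PA[OF this]]
    show ?thesis using controls_directions(1)[OF assms] f[of "eA (d_vec w)"] f[of "- eA (d_vec w)"] unfolding ev by blast
  qed
  show "dfv (eB (d_vec w)) (-1) 0 (t0B x) (t1 x) (t2 x) (wB x) \<ge> 0" if x: "x \<in> OB"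
  proof -
    have "x \<in> PB" using x pieces(3) by auto
    note f = dfv_nonneg(2)[OF forms_PB[OF this]]
    show ?thesis using controls_directions(2)[OF assms] f[of "eB (d_vec w)"] f[of "- eB (d_vec w)"] unfolding ev by blast
  qed
qed

lemma region_nontrivial: "q \<in> region_A \<Longrightarrow> at q within OA \<noteq> bot" "q \<in> region_B \<Longrightarrow> at q within OB \<noteq> bot"
  using region_islimpt[of q] by (simp_all add: trivial_limit_within)

lemma defect_nonneg: assumes w: "w \<in> controls" and q: "q \<in> region_A \<union> region_B" shows "defect w q \<ge> 0"
proof (cases "q \<in> region_A")
  case True
  show ?thesis unfolding defect_def
    by (rule tendsto_lowerbound[OF defect_limit(1)[OF q] _ region_nontrivial(1)[OF True]])
      (rule eventually_mono[OF eventually_in[of OA q]], unfold dfv_chart, rule dfv_controls(1)[OF w])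
next
  case False
  hence B: "q \<in> region_B" using q by simp
  show ?thesis unfolding defect_def
    by (rule tendsto_lowerbound[OF defect_limit(2)[OF q] _ region_nontrivial(2)[OF B]])
      (rule eventually_mono[OF eventually_in[of OB q]], unfold dfv_chart, rule dfv_controls(2)[OF w])
qed

lemma defect_zero_A: assumes e: "\<And>s0 s1 s w. dfv (eA (d_vec c)) 1 0 s0 s1 s w = 0" and q: "q \<in> region_A" shows "defect c q = 0"
proof -
  have "((\<lambda>x. 0) \<longlongrightarrow> v_cand q - 1/2 * dir_deriv2 (d_vec c) v_cand q) (at q within OA)"
    using defect_limit(1)[of q "d_vec c"] q unfolding dfv_chart e by simp
  from tendsto_unique[OF region_nontrivial(1)[OF q] this tendsto_const] show ?thesis by (simp add: defect_def)
qed

lemma defect_zero_B: assumes e: "\<And>s0 s1 s w. dfv (eB (d_vec c)) (-1) 0 s0 s1 s w = 0" and q: "q \<in> region_B" shows "defect c q = 0"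
proof -
  have "((\<lambda>x. 0) \<longlongrightarrow> v_cand q - 1/2 * dir_deriv2 (d_vec c) v_cand q) (at q within OB)"
    using defect_limit(2)[of q "d_vec c"] q unfolding dfv_chart e by simp
  from tendsto_unique[OF region_nontrivial(2)[OF q] this tendsto_const] show ?thesis by (simp add: defect_def)
qed

text \<open>The equality controls are those that move \<open>s0\<close> alone or \<open>s1\<close>
  alone, where the second derivative reproduces \<open>v\<close>.\<close>

lemma equality_directions:
  "eA (d_vec (vector [0, 1, 0, 0, 1])) = (0, 1, 0, 0) \<or> eA (d_vec (vector [0, 1, 0, 0, 1])) = (0, - 1, 0, 0)"
  "eA (d_vec (vector [0, 0, 1, 0, 1])) = (0, 0, 1, 0)"
  "eB (d_vec (vector [0, 0, 1, 1, 0])) = (0, 1, 0, 0)"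
  "eB (d_vec (vector [0, 0, 1, 0, 1])) = (0, 0, 1, 0)"
  by (simp_all add: eA_def eB_def d_vec_def vector_def)

theorem theorem5p19:
  shows "(\<forall>w \<in> controls. \<forall>q \<in> region_A \<union> region_B. defect w q \<ge> 0)
    \<and> (\<forall>q \<in> region_A. defect (vector [0, 1, 0, 0, 1]) q = 0)
    \<and> (\<forall>q \<in> region_A. defect (vector [0, 0, 1, 0, 1]) q = 0)
    \<and> (\<forall>q \<in> region_B. defect (vector [0, 0, 1, 1, 0]) q = 0)
    \<and> (\<forall>q \<in> region_B. defect (vector [0, 0, 1, 0, 1]) q = 0)"
proof -
  have "dfv (eA (d_vec (vector [0, 1, 0, 0, 1]))) 1 0 s0 s1 s w = 0" for s0 s1 s w
    using equality_directions(1) dfv_even[of 0 1 0 0] by (auto simp: dirs_A)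
  moreover have "dfv (eA (d_vec (vector [0, 0, 1, 0, 1]))) 1 0 s0 s1 s w = 0" for s0 s1 s w
    unfolding equality_directions(2) dirs_A ..
  moreover have "dfv (eB (d_vec (vector [0, 0, 1, 1, 0]))) (-1) 0 s0 s1 s w = 0" for s0 s1 s w
    unfolding equality_directions(3) dirs_B ..
  moreover have "dfv (eB (d_vec (vector [0, 0, 1, 0, 1]))) (-1) 0 s0 s1 s w = 0" for s0 s1 s w
    unfolding equality_directions(4) dirs_B ..
  ultimately show ?thesis by (intro conjI ballI defect_nonneg defect_zero_A defect_zero_B) auto
qed

end
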